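(* Let $(\kappa,\mathbf{u})$ and $(\kappa_h,\mathbf{u}_h)$ be the eigenpairs of the continuous and of the discrete linear elasticity eigenvalue problem, respectively, with $\kappa>0$. Then $$|||Res_h|||_{-1}\le \sqrt{3}\,\eta,\qquad |||Res_h|||_{*}\le \sqrt{3}\,C_{\mathrm{Kornelast}}\,\eta,$$ and the error $\mathbf{e}=\mathbf{u}-\mathbf{u}_h$ satisfies $$|||\mathbf{e}|||\le \sqrt{3}\,C_{\mathrm{Kornelast}}\,\eta+\frac{\kappa+\kappa_h}{2\sqrt{\kappa}}\,\|\mathbf{e}\|_0 .$$
   Context: Setting. $\Omega\subset\mathbb{R}^2$ is a Lipschitz domain with polygonal boundary, split into a closed Dirichlet part $\Gamma_D$, a closed gliding part $\Gamma_g$ and the open Neumann part $\Gamma_N=\partial\Omega\setminus(\Gamma_D\cup\Gamma_g)$; each part is connected, they do not overlap in more than a vertex, and up to two of them may be empty. $\mathbf{n}$ is the outer unit normal. $\mathbb{C}$ is the stiffness (elasticity) tensor of linear elasticity (symmetric positive definite on symmetric $2\times2$ matrices, with square root $\mathbb{C}^{1/2}$), $\varepsilon(\mathbf{v})=\frac12(\nabla\mathbf{v}+\nabla\mathbf{v}^T)$, $D\mathbf{v}$ is the Jacobian. $\|\cdot\|_0$ and $(\cdot,\cdot)_0$ are the $L^2(\Omega)$ norm and inner product. Spaces and eigenproblems. $\mathbf{H}=\{\mathbf{v}\in H^1(\Omega,\mathbb{R}^2): \mathbf{v}=\mathbf{0}\text{ on }\Gamma_D,\ \mathbf{v}\cdot\mathbf{n}=0\text{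 on }\Gamma_g\}$; $a(\mathbf{u},\mathbf{v})=\int_\Omega \mathbb{C}\varepsilon(\mathbf{u}):\varepsilon(\mathbf{v})\,dx$; $|||\mathbf{v}|||=a(\mathbf{v},\mathbf{v})^{1/2}=\|\mathbb{C}^{1/2}\varepsilon(\mathbf{v})\|_0$. $\mathcal{T}$ is a regular, quasi-uniform triangulation of $\Omega$ (resolving the boundary parts) with vertex set $\mathcal{N}$. $\mathbf{H}_h\subset\mathbf{H}$ consists of the functions in $\mathbf{H}$ whose components are polynomials of total degree at most $k$ ($k\ge1$) on each $T\in\mathcal{T}$. Continuous eigenpair: $\kappa\ge0$, $\mathbf{u}\in\mathbf{H}$, $\|\mathbf{u}\|_0=1$, $a(\mathbf{u},\mathbf{v})=\kappa(\mathbf{u},\mathbf{v})_0$ for all $\mathbf{v}\in\mathbf{H}$. Discrete eigenpair: $\kappa_h\ge0$, $\mathbf{u}_h\in\mathbf{H}_h$, $\|\mathbf{u}_h\|_0=1$, $a(\mathbf{u}_h,\mathbf{v}_h)=\kappa_h(\mathbf{u}_h,\mathbf{v}_h)_0$ for all $\mathbf{v}_h\in\mathbf{H}_h$. Eigenvalues are ordered increasingly, the two eigenpairs have the same index (so $\kappa_h\ge\kappa$), and $\kappa$ is assumed simple. Residual. $Res_h(\mathbf{v})=\kappa_h(\mathbf{u}_h,\mathbf{v})_0-a(\mathbf{u}_h,\mathbf{v})$ for $\mathbf{v}\in\mathbf{H}$. Dual norms: $|||Res_h|||_*=\sup\{Res_h(\mathbf{v})/|||\mathbf{v}|||:\mathbf{v}\in\mathbf{H},|||\mathbf{v}|||\ne0\}$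 and $|||Res_h|||_{-1}=\sup\{Res_h(\mathbf{v})/\|D\mathbf{v}\|_0:\mathbf{v}\in\mathbf{H},\|D\mathbf{v}\|_0\ne0\}$. Partition of unity. For $z\in\mathcal{N}$, $\varphi_z$ is the continuous piecewise affine hat function with $\varphi_z(z)=1$ and $\varphi_z=0$ at all other vertices; $\omega_z=\{x\in\Omega:\varphi_z(x)\ne0\}$; $\|\cdot\|_z$ is the $L^2(\omega_z)$ norm; $Res_z(\mathbf{v})=Res_h(\varphi_z\mathbf{v})$. Estimator. $\eta_z=\sup\{Res_z(\mathbf{v})/\|\varphi_z^{1/2}D\mathbf{v}\|_z:\mathbf{v}\in\mathbf{H},\ \|\varphi_z^{1/2}D\mathbf{v}\|_z\ne0\}$ and $\eta^2=\sum_{z\in\mathcal{N}}\eta_z^2$. Korn constant. $C_{\mathrm{Kornelast}}>0$ is a constant depending only on $\Omega$ for which Korn's inequality $\|D\mathbf{v}\|_0\le C_{\mathrm{Kornelast}}|||\mathbf{v}|||$ holds for all $\mathbf{v}\in\mathbf{H}$ with $|||\mathbf{v}|||\neq0$. *)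

theory Defs
  imports "HOL-Analysis.Analysis"
begin

section \<open>Lebesgue and Sobolev spaces\<close>

text \<open>Elements of $L^2$ and $H^1$ are represented by functions on the whole space; only their
  values almost everywhere on the given set matter.\<close>

definition l2_space :: "'a::euclidean_space set \<Rightarrow> ('a \<Rightarrow> real) \<Rightarrow> bool" where
  "l2_space \<Omega> f \<longleftrightarrow> set_borel_measurable lborel \<Omega> f \<and> set_integrable lborel \<Omega> (\<lambda>x. (f x)\<^sup>2)"

definition l2_norm :: "'a::euclidean_space set \<Rightarrow> ('a \<Rightarrow> 'b::real_normed_vector) \<Rightarrow> real" where
  "l2_norm \<Omega> f = sqrt (LINT x:\<Omega>|lborel. (norm (f x))\<^sup>2)"

definition l2_inner :: "'a::euclidean_space set \<Rightarrow> ('a \<Rightarrow> 'b::real_inner) \<Rightarrow> ('a \<Rightarrow> 'b) \<Rightarrow> real" where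
  "l2_inner \<Omega> f g = (LINT x:\<Omega>|lborel. f x \<bullet> g x)"

definition partial_deriv :: "2 \<Rightarrow> (real^2 \<Rightarrow> real) \<Rightarrow> real^2 \<Rightarrow> real" where
  "partial_deriv i f x = frechet_derivative f (at x) (axis i 1)"

text \<open>Test functions are the compactly supported $C^1$ functions. For first-order weak
  derivatives these are equivalent to compactly supported $C^\infty$ functions.\<close>

definition test_function :: "(real^2) set \<Rightarrow> (real^2 \<Rightarrow> real) \<Rightarrow> bool" where
  "test_function \<Omega> \<psi> \<longleftrightarrow>
     (\<forall>x. \<psi> differentiable (at x)) \<and> (\<forall>i. continuous_on UNIV (partial_deriv i \<psi>)) \<and>
     (\<exists>K. compact K \<and> K \<subseteq> \<Omega> \<and> (\<forall>x. x \<notin> K \<longrightarrow> \<psi> x = 0))"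

definition has_weak_partial :: "(real^2) set \<Rightarrow> 2 \<Rightarrow> (real^2 \<Rightarrow> real) \<Rightarrow> (real^2 \<Rightarrow> real) \<Rightarrow> bool" where
  "has_weak_partial \<Omega> i f g \<longleftrightarrow> l2_space \<Omega> f \<and> l2_space \<Omega> g \<and>
     (\<forall>\<psi>. test_function \<Omega> \<psi> \<longrightarrow>
        (LINT x:\<Omega>|lborel. f x * partial_deriv i \<psi> x) = - (LINT x:\<Omega>|lborel. g x * \<psi> x))"

definition h1_space :: "(real^2) set \<Rightarrow> (real^2 \<Rightarrow> real) \<Rightarrow> bool" where
  "h1_space \<Omega> f \<longleftrightarrow> l2_space \<Omega> f \<and> (\<forall>i. \<exists>g. has_weak_partial \<Omega> i f g)"

text \<open>A representative of the weak partial derivative, which is unique almost everywhere on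
  an open \<open>\<Omega>\<close>.\<close>

definition weak_partial :: "(real^2) set \<Rightarrow> 2 \<Rightarrow> (real^2 \<Rightarrow> real) \<Rightarrow> real^2 \<Rightarrow> real" where
  "weak_partial \<Omega> i f = (SOME g. has_weak_partial \<Omega> i f g)"

definition h1_norm :: "(real^2) set \<Rightarrow> (real^2 \<Rightarrow> real) \<Rightarrow> real" where
  "h1_norm \<Omega> f = sqrt ((l2_norm \<Omega> f)\<^sup>2 + (\<Sum>i\<in>UNIV. (l2_norm \<Omega> (weak_partial \<Omega> i f))\<^sup>2))"

definition weak_jacobian :: "(real^2) set \<Rightarrow> (real^2 \<Rightarrow> real^2) \<Rightarrow> real^2 \<Rightarrow> real^2^2" where
  "weak_jacobian \<Omega> v x = (\<chi> i j. weak_partial \<Omega> j (\<lambda>y. v y $ i) x)"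

text \<open>The trace operator is the continuous extension of the restriction map on
  $H^1(\Omega)\cap C(\overline\Omega)$. On a polygonal boundary, $L^2(\partial\Omega)$ (with respect
  to arc length) is described through the parametrised straight segments that the boundary
  contains; the constant arc length factor of a segment is irrelevant here.\<close>

definition has_trace ::
  "(real^2) set \<Rightarrow> real^2 \<Rightarrow> real^2 \<Rightarrow> (real^2 \<Rightarrow> real) \<Rightarrow> (real^2 \<Rightarrow> real) \<Rightarrow> bool" where
  "has_trace \<Omega> a b f g \<longleftrightarrow> l2_space {0..1} (\<lambda>t. g (linepath a b t)) \<and>
     (\<exists>w :: nat \<Rightarrow> real^2 \<Rightarrow> real.
        (\<forall>n. h1_space \<Omega> (w n) \<and> continuous_on (closure \<Omega>) (w n)) \<and>
        (\<lambda>n. h1_norm \<Omega> (\<lambda>x. w n x - f x)) \<longlonglongrightarrow> 0 \<and>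
        (\<lambda>n. l2_norm {0..1} (\<lambda>t. w n (linepath a b t) - g (linepath a b t))) \<longlonglongrightarrow> 0)"

section \<open>Domain and boundary\<close>

definition lipschitz_boundary :: "(real^2) set \<Rightarrow> bool" where
  "lipschitz_boundary \<Omega> \<longleftrightarrow>
     (\<forall>x\<in>frontier \<Omega>. \<exists>r e\<^sub>1 e\<^sub>2 L \<gamma>.
        r > 0 \<and> norm e\<^sub>1 = 1 \<and> norm e\<^sub>2 = 1 \<and> e\<^sub>1 \<bullet> e\<^sub>2 = 0 \<and> L-lipschitz_on UNIV (\<gamma> :: real \<Rightarrow> real) \<and>
        \<Omega> \<inter> ball x r = {y \<in> ball x r. y \<bullet> e\<^sub>2 > \<gamma> (y \<bullet> e\<^sub>1)})"

definition polygonal_boundary :: "(real^2) set \<Rightarrow> bool" where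
  "polygonal_boundary \<Omega> \<longleftrightarrow>
     (\<exists>E. finite E \<and> frontier \<Omega> = (\<Union>(a, b)\<in>E. closed_segment a b))"

definition polygonal_lipschitz_domain :: "(real^2) set \<Rightarrow> bool" where
  "polygonal_lipschitz_domain \<Omega> \<longleftrightarrow>
     open \<Omega> \<and> connected \<Omega> \<and> bounded \<Omega> \<and> \<Omega> \<noteq> {} \<and> lipschitz_boundary \<Omega> \<and> polygonal_boundary \<Omega>"

definition neumann_part :: "(real^2) set \<Rightarrow> (real^2) set \<Rightarrow> (real^2) set \<Rightarrow> (real^2) set" where
  "neumann_part \<Omega> \<Gamma>D \<Gamma>g = frontier \<Omega> - (\<Gamma>D \<union> \<Gamma>g)"

text \<open>The empty set is connected in the library, so parts may be empty. That the parts meet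
  only in vertices is expressed together with the triangulation, see \<open>resolves_boundary\<close>.\<close>

definition boundary_parts :: "(real^2) set \<Rightarrow> (real^2) set \<Rightarrow> (real^2) set \<Rightarrow> bool" where
  "boundary_parts \<Omega> \<Gamma>D \<Gamma>g \<longleftrightarrow>
     closed \<Gamma>D \<and> closed \<Gamma>g \<and> \<Gamma>D \<subseteq> frontier \<Omega> \<and> \<Gamma>g \<subseteq> frontier \<Omega> \<and>
     connected \<Gamma>D \<and> connected \<Gamma>g \<and> connected (neumann_part \<Omega> \<Gamma>D \<Gamma>g)"

text \<open>Outer unit normal at a boundary point that is not a corner: near the point, the domain
  is a half disc.\<close>

definition outer_unit_normal :: "(real^2) set \<Rightarrow> real^2 \<Rightarrow> real^2 \<Rightarrow> bool" where
  "outer_unit_normal \<Omega> x \<nu> \<longleftrightarrow> norm \<nu> = 1 \<and>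
     (\<exists>r>0. \<Omega> \<inter> ball x r = {y \<in> ball x r. (y - x) \<bullet> \<nu> < 0})"

text \<open>The boundary conditions are required on every nondegenerate segment of the respective
  part. The normal is constant on a segment of the boundary, so the trace of \<open>v \<bullet> \<nu>\<close> is the
  normal component of the trace of \<open>v\<close>.\<close>

definition H_space ::
  "(real^2) set \<Rightarrow> (real^2) set \<Rightarrow> (real^2) set \<Rightarrow> (real^2 \<Rightarrow> real^2) set" where
  "H_space \<Omega> \<Gamma>D \<Gamma>g = {v.
     (\<forall>i. h1_space \<Omega> (\<lambda>x. v x $ i)) \<and>
     (\<forall>a b. a \<noteq> b \<and> closed_segment a b \<subseteq> \<Gamma>D \<longrightarrow>
        (\<forall>i. has_trace \<Omega> a b (\<lambda>x. v x $ i) (\<lambda>_. 0))) \<and>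
     (\<forall>a b \<nu>. a \<noteq> b \<and> closed_segment a b \<subseteq> \<Gamma>g \<and>
          (\<forall>x\<in>open_segment a b. outer_unit_normal \<Omega> x \<nu>) \<longrightarrow>
        has_trace \<Omega> a b (\<lambda>x. v x \<bullet> \<nu>) (\<lambda>_. 0))}"

section \<open>Linear elasticity\<close>

definition strain :: "(real^2) set \<Rightarrow> (real^2 \<Rightarrow> real^2) \<Rightarrow> real^2 \<Rightarrow> real^2^2" where
  "strain \<Omega> v x = (1/2) *\<^sub>R (weak_jacobian \<Omega> v x + transpose (weak_jacobian \<Omega> v x))"

text \<open>The inner product and the norm of the type of matrices are those of Frobenius.\<close>

definition elasticity_tensor :: "(real^2^2 \<Rightarrow> real^2^2) \<Rightarrow> bool" where
  "elasticity_tensor \<CC> \<longleftrightarrow> linear \<CC> \<and>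
     (\<forall>A. transpose A = A \<longrightarrow> transpose (\<CC> A) = \<CC> A) \<and>
     (\<forall>A B. transpose A = A \<and> transpose B = B \<longrightarrow> \<CC> A \<bullet> B = A \<bullet> \<CC> B) \<and>
     (\<forall>A. transpose A = A \<and> A \<noteq> 0 \<longrightarrow> \<CC> A \<bullet> A > 0)"

definition a_form ::
  "(real^2) set \<Rightarrow> (real^2^2 \<Rightarrow> real^2^2) \<Rightarrow> (real^2 \<Rightarrow> real^2) \<Rightarrow> (real^2 \<Rightarrow> real^2) \<Rightarrow> real" where
  "a_form \<Omega> \<CC> u v = (LINT x:\<Omega>|lborel. \<CC> (strain \<Omega> u x) \<bullet> strain \<Omega> v x)"

definition energy_norm ::
  "(real^2) set \<Rightarrow> (real^2^2 \<Rightarrow> real^2^2) \<Rightarrow> (real^2 \<Rightarrow> real^2) \<Rightarrow> real" where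
  "energy_norm \<Omega> \<CC> v = sqrt (a_form \<Omega> \<CC> v v)"

text \<open>Eigenpairs in a subspace \<open>V\<close> (the full or the discrete space).\<close>

definition eigenpair ::
  "(real^2) set \<Rightarrow> (real^2^2 \<Rightarrow> real^2^2) \<Rightarrow> (real^2 \<Rightarrow> real^2) set \<Rightarrow> real \<Rightarrow> (real^2 \<Rightarrow> real^2) \<Rightarrow> bool"
where
  "eigenpair \<Omega> \<CC> V \<kappa> u \<longleftrightarrow> \<kappa> \<ge> 0 \<and> u \<in> V \<and> l2_norm \<Omega> u = 1 \<and>
     (\<forall>v\<in>V. a_form \<Omega> \<CC> u v = \<kappa> * l2_inner \<Omega> u v)"

text \<open>\<open>\<kappa>\<close> is number \<open>j\<close> in the increasing enumeration, with multiplicities, of the eigenvalues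
  in \<open>V\<close>: \<open>\<mu> 1 \<le> \<dots> \<le> \<mu> j = \<kappa>\<close> have orthonormal eigenfunctions, and no eigenfunction for an
  eigenvalue below \<open>\<kappa>\<close> is left out.\<close>

definition eigenvalue_number ::
  "(real^2) set \<Rightarrow> (real^2^2 \<Rightarrow> real^2^2) \<Rightarrow> (real^2 \<Rightarrow> real^2) set \<Rightarrow> nat \<Rightarrow> real \<Rightarrow> bool" where
  "eigenvalue_number \<Omega> \<CC> V j \<kappa> \<longleftrightarrow> j \<ge> 1 \<and>
     (\<exists>\<mu> w. \<mu> j = \<kappa> \<and>
        (\<forall>i\<in>{1..j}. eigenpair \<Omega> \<CC> V (\<mu> i) (w i)) \<and>
        (\<forall>i\<in>{1..j}. \<forall>l\<in>{1..j}. i < l \<longrightarrow> \<mu> i \<le> \<mu> l \<and> l2_inner \<Omega> (w i) (w l) = 0) \<and>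
        (\<forall>\<theta> v. eigenpair \<Omega> \<CC> V \<theta> v \<and> \<theta> < \<kappa> \<longrightarrow>
           (\<exists>c. AE x in lborel. x \<in> \<Omega> \<longrightarrow>
              v x = (\<Sum>i | i \<in> {1..j} \<and> \<mu> i = \<theta>. c i *\<^sub>R w i x))))"

definition simple_eigenvalue ::
  "(real^2) set \<Rightarrow> (real^2^2 \<Rightarrow> real^2^2) \<Rightarrow> (real^2 \<Rightarrow> real^2) set \<Rightarrow> real \<Rightarrow> bool" where
  "simple_eigenvalue \<Omega> \<CC> V \<kappa> \<longleftrightarrow>
     (\<exists>u. eigenpair \<Omega> \<CC> V \<kappa> u \<and>
        (\<forall>v. eigenpair \<Omega> \<CC> V \<kappa> v \<longrightarrow> (\<exists>c. AE x in lborel. x \<in> \<Omega> \<longrightarrow> v x = c *\<^sub>R u x)))"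

section \<open>Triangulations and finite elements\<close>

text \<open>A triangulation is given by the vertex sets of its (closed) triangles. Triangles meet
  in the convex hull of their common vertices: not at all, in a vertex or in a common edge.\<close>

definition conforming_triangulation :: "(real^2) set \<Rightarrow> (real^2) set set \<Rightarrow> bool" where
  "conforming_triangulation \<Omega> \<T> \<longleftrightarrow> finite \<T> \<and>
     (\<forall>S\<in>\<T>. card S = 3 \<and> \<not> affine_dependent S) \<and>
     (\<forall>S\<in>\<T>. \<forall>S'\<in>\<T>. convex hull S \<inter> convex hull S' = convex hull (S \<inter> S')) \<and>
     (\<Union>S\<in>\<T>. convex hull S) = closure \<Omega>"

abbreviation nodes :: "(real^2) set set \<Rightarrow> (real^2) set" where
  "nodes \<T> \<equiv> \<Union>\<T>"

text \<open>No boundary edge changes its type in its relative interior, and the two closed parts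
  overlap at most in vertices.\<close>

definition resolves_boundary ::
  "(real^2) set \<Rightarrow> (real^2) set \<Rightarrow> (real^2) set \<Rightarrow> (real^2) set set \<Rightarrow> bool" where
  "resolves_boundary \<Omega> \<Gamma>D \<Gamma>g \<T> \<longleftrightarrow>
     (\<forall>S\<in>\<T>. \<forall>a\<in>S. \<forall>b\<in>S. a \<noteq> b \<and> closed_segment a b \<subseteq> frontier \<Omega> \<longrightarrow>
        open_segment a b \<subseteq> \<Gamma>D \<or> open_segment a b \<subseteq> \<Gamma>g \<or>
        open_segment a b \<subseteq> neumann_part \<Omega> \<Gamma>D \<Gamma>g) \<and>
     \<Gamma>D \<inter> \<Gamma>g \<subseteq> nodes \<T>"

definition shape_regular :: "real \<Rightarrow> (real^2) set set \<Rightarrow> bool" where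
  "shape_regular \<sigma> \<T> \<longleftrightarrow>
     (\<forall>S\<in>\<T>. (diameter (convex hull S))\<^sup>2 \<le> \<sigma> * measure lborel (convex hull S))"

definition quasi_uniform :: "real \<Rightarrow> (real^2) set set \<Rightarrow> bool" where
  "quasi_uniform \<rho> \<T> \<longleftrightarrow>
     (\<forall>S\<in>\<T>. \<forall>S'\<in>\<T>. diameter (convex hull S) \<le> \<rho> * diameter (convex hull S'))"

definition polynomial_degree_le :: "nat \<Rightarrow> (real^2 \<Rightarrow> real) \<Rightarrow> bool" where
  "polynomial_degree_le k p \<longleftrightarrow>
     (\<exists>c. \<forall>x. p x = (\<Sum>m\<le>k. \<Sum>n\<le>k - m. c m n * (x $ 1) ^ m * (x $ 2) ^ n))"

definition H_discrete ::
  "(real^2) set \<Rightarrow> (real^2) set \<Rightarrow> (real^2) set \<Rightarrow> (real^2) set set \<Rightarrow> nat \<Rightarrow> (real^2 \<Rightarrow> real^2) set" where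
  "H_discrete \<Omega> \<Gamma>D \<Gamma>g \<T> k = {v \<in> H_space \<Omega> \<Gamma>D \<Gamma>g.
     \<forall>S\<in>\<T>. \<forall>i. \<exists>p. polynomial_degree_le k p \<and>
       (AE x in lborel. x \<in> convex hull S \<longrightarrow> v x $ i = p x)}"

definition hat :: "(real^2) set set \<Rightarrow> real^2 \<Rightarrow> real^2 \<Rightarrow> real" where
  "hat \<T> z = (THE \<phi>.
     (\<forall>x. x \<notin> (\<Union>S\<in>\<T>. convex hull S) \<longrightarrow> \<phi> x = 0) \<and>
     continuous_on (\<Union>S\<in>\<T>. convex hull S) \<phi> \<and>
     (\<forall>S\<in>\<T>. \<exists>l c. \<forall>x\<in>convex hull S. \<phi> x = l \<bullet> x + c) \<and>
     (\<forall>y\<in>nodes \<T>. \<phi> y = (if y = z then 1 else 0)))"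

definition patch :: "(real^2) set \<Rightarrow> (real^2) set set \<Rightarrow> real^2 \<Rightarrow> (real^2) set" where
  "patch \<Omega> \<T> z = {x \<in> \<Omega>. hat \<T> z x \<noteq> 0}"

section \<open>Residual and estimator\<close>

text \<open>Suprema are taken in the extended reals, so that they are meaningful without a
  boundedness proof.\<close>

definition residual ::
  "(real^2) set \<Rightarrow> (real^2^2 \<Rightarrow> real^2^2) \<Rightarrow> real \<Rightarrow> (real^2 \<Rightarrow> real^2) \<Rightarrow> (real^2 \<Rightarrow> real^2) \<Rightarrow> real" where
  "residual \<Omega> \<CC> \<kappa>\<^sub>h u\<^sub>h v = \<kappa>\<^sub>h * l2_inner \<Omega> u\<^sub>h v - a_form \<Omega> \<CC> u\<^sub>h v"

definition dual_energy_norm ::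
  "(real^2) set \<Rightarrow> (real^2^2 \<Rightarrow> real^2^2) \<Rightarrow> (real^2 \<Rightarrow> real^2) set \<Rightarrow> ((real^2 \<Rightarrow> real^2) \<Rightarrow> real) \<Rightarrow> ereal"
where
  "dual_energy_norm \<Omega> \<CC> V R =
     (SUP v\<in>{v \<in> V. energy_norm \<Omega> \<CC> v \<noteq> 0}. ereal (R v / energy_norm \<Omega> \<CC> v))"

definition dual_gradient_norm ::
  "(real^2) set \<Rightarrow> (real^2 \<Rightarrow> real^2) set \<Rightarrow> ((real^2 \<Rightarrow> real^2) \<Rightarrow> real) \<Rightarrow> ereal" where
  "dual_gradient_norm \<Omega> V R =
     (SUP v\<in>{v \<in> V. l2_norm \<Omega> (weak_jacobian \<Omega> v) \<noteq> 0}.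
        ereal (R v / l2_norm \<Omega> (weak_jacobian \<Omega> v)))"

definition weighted_patch_norm ::
  "(real^2) set \<Rightarrow> (real^2) set set \<Rightarrow> real^2 \<Rightarrow> (real^2 \<Rightarrow> real^2) \<Rightarrow> real" where
  "weighted_patch_norm \<Omega> \<T> z v =
     l2_norm (patch \<Omega> \<T> z) (\<lambda>x. sqrt (hat \<T> z x) *\<^sub>R weak_jacobian \<Omega> v x)"

definition local_estimator ::
  "(real^2) set \<Rightarrow> (real^2 \<Rightarrow> real^2) set \<Rightarrow> (real^2) set set \<Rightarrow> ((real^2 \<Rightarrow> real^2) \<Rightarrow> real) \<Rightarrow>
     real^2 \<Rightarrow> ereal" where
  "local_estimator \<Omega> V \<T> R z =
     (SUP v\<in>{v \<in> V. weighted_patch_norm \<Omega> \<T> z v \<noteq> 0}.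
        ereal (R (\<lambda>x. hat \<T> z x *\<^sub>R v x) / weighted_patch_norm \<Omega> \<T> z v))"

definition ereal_sqrt :: "ereal \<Rightarrow> ereal" where
  "ereal_sqrt x = (case x of ereal r \<Rightarrow> ereal (sqrt r) | PInfty \<Rightarrow> \<infinity> | MInfty \<Rightarrow> -\<infinity>)"

definition estimator ::
  "(real^2) set \<Rightarrow> (real^2 \<Rightarrow> real^2) set \<Rightarrow> (real^2) set set \<Rightarrow> ((real^2 \<Rightarrow> real^2) \<Rightarrow> real) \<Rightarrow> ereal"
where
  "estimator \<Omega> V \<T> R = ereal_sqrt (\<Sum>z\<in>nodes \<T>. (local_estimator \<Omega> V \<T> R z)\<^sup>2)"

definition korn_constant ::
  "(real^2) set \<Rightarrow> (real^2^2 \<Rightarrow> real^2^2) \<Rightarrow> (real^2 \<Rightarrow> real^2) set \<Rightarrow> real \<Rightarrow> bool" where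
  "korn_constant \<Omega> \<CC> V K \<longleftrightarrow> K > 0 \<and>
     (\<forall>v\<in>V. energy_norm \<Omega> \<CC> v \<noteq> 0 \<longrightarrow>
        l2_norm \<Omega> (weak_jacobian \<Omega> v) \<le> K * energy_norm \<Omega> \<CC> v)"

end

theory Submission
  imports Defs "HOL-Real_Asymp.Real_Asymp"
begin

text \<open>The hat functions form a partition of unity, so \<open>Res v\<close> is the sum of
  \<open>Res (\<phi>\<^sub>z v) \<le> \<eta>\<^sub>z \<cdot> \<parallel>\<phi>\<^sub>z\<^sup>1\<^sup>/\<^sup>2 D v\<parallel>\<close>, and the Cauchy-Schwarz inequality bounds it by \<open>\<eta>\<close> times
  the norm of \<open>D v\<close>; this even gives the constant \<open>1\<close> instead of \<open>\<surd>3\<close>. Korn's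
  inequality turns it into the bound in the energy norm.

  The eigenvalue equations give
  \<open>|||e|||\<^sup>2 = Res e + (\<kappa> + \<kappa>\<^sub>h)/2 \<cdot> \<parallel>e\<parallel>\<^sup>2\<close> and \<open>|||e|||\<^sup>2 = \<kappa>\<^sub>h - \<kappa> + \<kappa> \<cdot> \<parallel>e\<parallel>\<^sup>2\<close>. The
  second identity and \<open>\<kappa> \<le> \<kappa>\<^sub>h\<close> show \<open>\<surd>\<kappa> \<cdot> \<parallel>e\<parallel> \<le> |||e|||\<close>, after which the first one can be
  divided by \<open>|||e|||\<close>.

  The inequality \<open>\<kappa> \<le> \<kappa>\<^sub>h\<close> is the min-max principle. It needs that the embedding of the
  energy space into \<open>L\<^sup>2\<close> is compact, which follows from Poincare's inequality on small convex
  pieces of the triangles. All properties of weak derivatives that are needed, Poincare's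
  inequality and the product rule with hat functions, are consequences of the identity
  \<open>f(x + h) - f(x) = \<integral>\<^sub>0\<^sup>1 h \<cdot> \<nabla>f(x + t h) dt\<close> for almost every \<open>x\<close>.\<close>

section \<open>The min-max principle\<close>

text \<open>The constant 1 comes from the weights: the hats sum to 1, so the squared weighted norms
  add up to exactly the squared norm of Dv. Replacing every weight by 1 would count a point once for
  each of the three vertices of its triangle, which is the origin of sqrt 3. The localized function
  \<open>hat \<T> z x *\<^sub>R v x\<close> is treated as a member of \<open>H1_vec\<close>, where
  the residual is already linear; the boundary conditions enter through v alone.

  Korn's inequality and the local suprema speak only about vectors with nonvanishing seminorm. Both
  are extended by a perturbation t y with t tending to 0; for Korn's inequality y is the
  eigenfunction u, whose energy \<kappa> is positive.

  The min-max principle works in the energy space, so Korn's inequality also has to convert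
  compactness and completeness of H^1 into statements about the energy. Since
  \<open>weak_partial\<close> chooses a representative for each function separately, derivatives are
  linear only almost everywhere, and linearity is recovered under the integral.\<close>

lemma underdetermined_system:
  fixes A :: "'i \<Rightarrow> 'j \<Rightarrow> real"
  assumes "finite I" "finite J" "card I < card J"
  shows "\<exists>c. (\<exists>l\<in>J. c l \<noteq> 0) \<and> (\<forall>i\<in>I. (\<Sum>l\<in>J. c l * A i l) = 0)"
  using assms
proof (induction I arbitrary: J A rule: finite_induct)
  case empty
  then obtain l where "l \<in> J" by fastforce
  then show ?case by (intro exI[of _ "\<lambda>_. 1"]) auto
next
  case (insert i I)
  show ?case
  proof (cases "\<forall>l\<in>J. A i l = 0")
    case True
    obtain c where c: "\<exists>l\<in>J. c l \<noteq> 0" "\<forall>i\<in>I. (\<Sum>l\<in>J. c l * A i l) = 0"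
      using insert.IH[of J A] insert.prems insert.hyps by auto
    then show ?thesis using True by (intro exI[of _ c]) auto
  next
    case False
    then obtain p where p: "p \<in> J" "A i p \<noteq> 0" by blast
    define J' where "J' = J - {p}"
    \<comment> \<open>Gaussian elimination with the pivot \<open>A i p\<close>: \<open>B\<close>
      holds the remaining rows after column \<open>p\<close> has been cleared. A solution for
      \<open>B\<close> is completed below by solving row \<open>i\<close> for the unknown
      \<open>p\<close>.\<close>
    define B where "B k l = A k l - A k p * A i l / A i p" for k l
    have J': "finite J'" "card I < card J'" "p \<notin> J'" "J = insert p J'"
      using insert.prems insert.hyps p by (auto simp: J'_def)
    obtain c where c: "\<exists>l\<in>J'. c l \<noteq> 0" "\<forall>i\<in>I. (\<Sum>l\<in>J'. c l * B i l) = 0"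
      using insert.IH[of J' B] J' by auto
    define d where "d l = (if l = p then - (\<Sum>l\<in>J'. c l * A i l) / A i p else c l)" for l
    have sumd: "(\<Sum>l\<in>J. d l * A k l) = d p * A k p + (\<Sum>l\<in>J'. c l * A k l)" for k
      using J' by (auto simp: d_def intro!: sum.cong)
    have "(\<Sum>l\<in>J. d l * A k l) = 0" if "k \<in> insert i I" for k
    proof (cases "k = i")
      case True then show ?thesis using p unfolding sumd by (simp add: d_def)
    next
      case False
      then have "0 = (\<Sum>l\<in>J'. c l * B k l)" using c that by simp
      also have "\<dots> = (\<Sum>l\<in>J'. c l * A k l - (A k p / A i p) * (c l * A i l))"
        by (intro sum.cong) (auto simp: B_def algebra_simps)
      also have "\<dots> = (\<Sum>l\<in>J'. c l * A k l) - (A k p / A i p) * (\<Sum>l\<in>J'. c l * A i l)"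
        by (simp add: sum_subtractf sum_distrib_left)
      also have "\<dots> = (\<Sum>l\<in>J. d l * A k l)" unfolding sumd by (simp add: d_def)
      finally show ?thesis by simp
    qed
    moreover have "\<exists>l\<in>J. d l \<noteq> 0" using c(1) J' by (auto simp: d_def)
    ultimately show ?thesis by blast
  qed
qed

text \<open>Source of the Cauchy-Schwarz inequalities for semi-inner products and integrals, and of
  the eigenvalue equation in \<open>constrained_minimizer\<close>. The polynomial is evaluated at
  its vertex -B/C; if C = 0 it is affine and bounded below, hence constant.\<close>

lemma quadratic_nonneg_discriminant:
  fixes A B C :: real
  assumes "\<And>t. 0 \<le> A + 2 * t * B + t\<^sup>2 * C" "C \<ge> 0"
  shows "B\<^sup>2 \<le> A * C"
proof (cases "C = 0")
  case True
  have "B = 0"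
  proof (rule ccontr)
    assume "B \<noteq> 0"
    \<comment> \<open>The argument is chosen so that the affine polynomial takes the value -1
      there.\<close>
    have "0 \<le> A + 2 * (-(A + 1) / (2 * B)) * B" using assms(1)[of "-(A + 1) / (2 * B)"] True by simp
    then show False using \<open>B \<noteq> 0\<close> by (simp add: field_simps)
  qed
  then show ?thesis using True by simp
next
  case False
  then have "C > 0" using assms(2) by simp
  have "0 \<le> A + 2 * (- B / C) * B + (- B / C)\<^sup>2 * C" by (rule assms(1))
  also have "\<dots> = A - B\<^sup>2 / C" using \<open>C > 0\<close> by (simp add: field_simps power2_eq_square)
  finally show ?thesis using \<open>C > 0\<close> by (simp add: field_simps)
qed

text \<open>Function types are no instance of \<^class>\<open>real_vector\<close>, so subspaces of
  functions and semi-inner products on them are described explicitly.\<close>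

definition linear_subspace :: "('x \<Rightarrow> 'b::real_vector) set \<Rightarrow> bool" where
  "linear_subspace V \<longleftrightarrow> V \<noteq> {} \<and> (\<forall>u\<in>V. \<forall>v\<in>V. \<forall>c. (\<lambda>x. u x + c *\<^sub>R v x) \<in> V)"

text \<open>Definiteness is not asked for: functions that agree almost everywhere on the domain are
  not identified, and the energy form vanishes on rigid motions.\<close>

definition semi_inner ::
  "('x \<Rightarrow> 'b::real_vector) set \<Rightarrow> (('x \<Rightarrow> 'b) \<Rightarrow> ('x \<Rightarrow> 'b) \<Rightarrow> real) \<Rightarrow> bool" where
  "semi_inner V B \<longleftrightarrow>
     (\<forall>u\<in>V. \<forall>v\<in>V. B u v = B v u) \<and> (\<forall>u\<in>V. B u u \<ge> 0) \<and>
     (\<forall>u\<in>V. \<forall>v\<in>V. \<forall>w\<in>V. \<forall>c. B (\<lambda>x. u x + c *\<^sub>R v x) w = B u w + c * B v w)"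

lemma subspace_comb: "linear_subspace V \<Longrightarrow> u \<in> V \<Longrightarrow> v \<in> V \<Longrightarrow> (\<lambda>x. u x + c *\<^sub>R v x) \<in> V"
  by (auto simp: linear_subspace_def)

lemma subspace_zero: "linear_subspace V \<Longrightarrow> (\<lambda>x. 0) \<in> V"
  unfolding linear_subspace_def by (metis (no_types, lifting) all_not_in_conv add.right_inverse ext scaleR_minus1_left)

lemma subspace_scale: "linear_subspace V \<Longrightarrow> v \<in> V \<Longrightarrow> (\<lambda>x. c *\<^sub>R v x) \<in> V"
  using subspace_comb[of V "\<lambda>x. 0" v c] subspace_zero[of V] by simp

lemma subspace_diff: "linear_subspace V \<Longrightarrow> u \<in> V \<Longrightarrow> v \<in> V \<Longrightarrow> (\<lambda>x. u x - v x) \<in> V"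
  using subspace_comb[of V u v "-1"] by simp

lemma subspace_sum:
  assumes "linear_subspace V" "\<And>l. l \<in> J \<Longrightarrow> z l \<in> V"
  shows "(\<lambda>x. \<Sum>l\<in>J. c l *\<^sub>R z l x) \<in> V"
  using assms(2)
proof (induction J rule: infinite_finite_induct)
  case (insert j J)
  then show ?case using subspace_comb[OF assms(1), of "\<lambda>x. \<Sum>l\<in>J. c l *\<^sub>R z l x" "z j" "c j"]
    by (simp add: add.commute)
qed (use subspace_zero[OF assms(1)] in auto)

section \<open>Calculus of semi-inner products\<close>

context
  fixes V :: "('x \<Rightarrow> 'b::real_vector) set" and B :: "('x \<Rightarrow> 'b) \<Rightarrow> ('x \<Rightarrow> 'b) \<Rightarrow> real"
  assumes V: "linear_subspace V" and B: "semi_inner V B"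
begin

lemma form_sym: "u \<in> V \<Longrightarrow> v \<in> V \<Longrightarrow> B u v = B v u"
  using B by (auto simp: semi_inner_def)

lemma form_nonneg: "u \<in> V \<Longrightarrow> B u u \<ge> 0"
  using B by (auto simp: semi_inner_def)

lemma form_comb_left:
  "u \<in> V \<Longrightarrow> v \<in> V \<Longrightarrow> w \<in> V \<Longrightarrow> B (\<lambda>x. u x + c *\<^sub>R v x) w = B u w + c * B v w"
  using B by (auto simp: semi_inner_def)

lemma form_comb_right:
  "u \<in> V \<Longrightarrow> v \<in> V \<Longrightarrow> w \<in> V \<Longrightarrow> B w (\<lambda>x. u x + c *\<^sub>R v x) = B w u + c * B w v"
  using form_comb_left[of u v w c] form_sym subspace_comb[OF V] by metis

lemma form_zero_left: "w \<in> V \<Longrightarrow> B (\<lambda>x. 0) w = 0"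
  using form_comb_left[of "\<lambda>x. 0" "\<lambda>x. 0" w 1] subspace_zero[OF V] by simp

lemma form_scale_left: "v \<in> V \<Longrightarrow> w \<in> V \<Longrightarrow> B (\<lambda>x. c *\<^sub>R v x) w = c * B v w"
  using form_comb_left[of "\<lambda>x. 0" v w c] form_zero_left subspace_zero[OF V] by simp

lemma form_sum_left:
  assumes "\<And>l. l \<in> J \<Longrightarrow> z l \<in> V" "w \<in> V"
  shows "B (\<lambda>x. \<Sum>l\<in>J. c l *\<^sub>R z l x) w = (\<Sum>l\<in>J. c l * B (z l) w)"
  using assms(1)
proof (induction J rule: infinite_finite_induct)
  case (insert j J)
  then show ?case
    using form_comb_left[of "\<lambda>x. \<Sum>l\<in>J. c l *\<^sub>R z l x" "z j" w "c j"] subspace_sum[OF V, of J z c] assms(2)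
    by (simp add: add.commute)
qed (use form_zero_left assms(2) in auto)

lemma form_expand:
  assumes "u \<in> V" "v \<in> V"
  shows "B (\<lambda>x. u x + c *\<^sub>R v x) (\<lambda>x. u x + c *\<^sub>R v x) = B u u + 2 * c * B u v + c\<^sup>2 * B v v"
  using assms form_sym[of u v] subspace_comb[OF V, of u v c]
  by (simp add: form_comb_left form_comb_right algebra_simps power2_eq_square)

lemma form_diff:
  assumes "u \<in> V" "v \<in> V"
  shows "B (\<lambda>x. u x - v x) (\<lambda>x. u x - v x) = B u u - 2 * B u v + B v v"
  using form_expand[OF assms, of "-1"] by simp

lemma form_add:
  assumes "u \<in> V" "v \<in> V"
  shows "B (\<lambda>x. u x + v x) (\<lambda>x. u x + v x) = B u u + 2 * B u v + B v v"
  using form_expand[OF assms, of 1] by simp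

lemma form_Cauchy_Schwarz:
  assumes "u \<in> V" "v \<in> V"
  shows "(B u v)\<^sup>2 \<le> B u u * B v v"
  using form_nonneg[OF subspace_comb[OF V assms]] form_nonneg[OF assms(2)] form_expand[OF assms]
  by (intro quadratic_nonneg_discriminant) auto

lemma form_tendsto:
  assumes v: "\<And>n. v n \<in> V" "u \<in> V" "w \<in> V" and lim: "(\<lambda>n. B (\<lambda>x. v n x - u x) (\<lambda>x. v n x - u x)) \<longlonglongrightarrow> 0"
  shows "(\<lambda>n. B (v n) w) \<longlonglongrightarrow> B u w"
proof -
  have "(\<lambda>n. \<bar>B (v n) w - B u w\<bar>) \<longlonglongrightarrow> 0"
  proof (rule tendsto_sandwich[OF _ _ tendsto_const])
    let ?d = "\<lambda>n. (\<lambda>x. v n x - u x)"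
    have "\<bar>B (v n) w - B u w\<bar> \<le> sqrt (B (?d n) (?d n) * B w w)" for n
    proof -
      have "B (?d n) w = B (v n) w - B u w"
        using form_comb_left[of "v n" u w "-1"] v by simp
      then show ?thesis
        using form_Cauchy_Schwarz[of "?d n" w] subspace_diff[OF V, of "v n" u] v
        by (metis real_le_rsqrt real_sqrt_abs real_sqrt_le_iff)
    qed
    then show "\<forall>\<^sub>F n in sequentially. \<bar>B (v n) w - B u w\<bar> \<le> sqrt (B (?d n) (?d n) * B w w)" by simp
    show "(\<lambda>n. sqrt (B (?d n) (?d n) * B w w)) \<longlonglongrightarrow> 0"
      using tendsto_real_sqrt[OF tendsto_mult[OF lim tendsto_const, of "B w w"]] by simp
  qed simp
  then show ?thesis by (simp add: tendsto_rabs_zero_iff LIM_zero_iff)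
qed

lemma form_tendsto_diag:
  assumes v: "\<And>n. v n \<in> V" "u \<in> V" and lim: "(\<lambda>n. B (\<lambda>x. v n x - u x) (\<lambda>x. v n x - u x)) \<longlonglongrightarrow> 0"
  shows "(\<lambda>n. B (v n) (v n)) \<longlonglongrightarrow> B u u"
proof -
  have "(\<lambda>n. B (\<lambda>x. v n x - u x) (\<lambda>x. v n x - u x) + 2 * B (v n) u - B u u) \<longlonglongrightarrow> 0 + 2 * B u u - B u u"
    using form_tendsto[OF v v(2) lim] lim by (intro tendsto_intros)
  then show ?thesis using form_diff[OF v(1) v(2)] by simp
qed

end

section \<open>Minimization of the Rayleigh quotient under a compact embedding\<close>

definition form_Cauchy ::
  "(('x \<Rightarrow> 'b::real_vector) \<Rightarrow> ('x \<Rightarrow> 'b) \<Rightarrow> real) \<Rightarrow> (nat \<Rightarrow> 'x \<Rightarrow> 'b) \<Rightarrow> bool" where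
  "form_Cauchy B v \<longleftrightarrow>
     (\<forall>\<epsilon>>0. \<exists>N. \<forall>i\<ge>N. \<forall>k\<ge>N. B (\<lambda>x. v i x - v k x) (\<lambda>x. v i x - v k x) < \<epsilon>)"

definition form_converges ::
  "(('x \<Rightarrow> 'b::real_vector) \<Rightarrow> ('x \<Rightarrow> 'b) \<Rightarrow> real) \<Rightarrow> (nat \<Rightarrow> 'x \<Rightarrow> 'b) \<Rightarrow> ('x \<Rightarrow> 'b) \<Rightarrow> bool" where
  "form_converges B v u \<longleftrightarrow> (\<lambda>n. B (\<lambda>x. v n x - u x) (\<lambda>x. v n x - u x)) \<longlonglongrightarrow> 0"

text \<open>Compactness of the embedding of \<open>V\<close> with the seminorm of a + m into
  \<open>V\<close> with the seminorm of m. Only a Cauchy subsequence is requested; its limit comes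
  from \<open>complete_in_forms\<close> once the sequence is Cauchy in both forms.\<close>

definition compactly_embedded ::
  "('x \<Rightarrow> 'b::real_vector) set \<Rightarrow> (('x \<Rightarrow> 'b) \<Rightarrow> ('x \<Rightarrow> 'b) \<Rightarrow> real) \<Rightarrow>
     (('x \<Rightarrow> 'b) \<Rightarrow> ('x \<Rightarrow> 'b) \<Rightarrow> real) \<Rightarrow> bool" where
  "compactly_embedded V a m \<longleftrightarrow>
     (\<forall>v C. (\<forall>n::nat. v n \<in> V \<and> a (v n) (v n) \<le> C \<and> m (v n) (v n) \<le> C) \<longrightarrow>
        (\<exists>r. strict_mono r \<and> form_Cauchy m (\<lambda>n. v (r n))))"

text \<open>Completeness in the seminorm of a + m: one limit has to serve both forms.\<close>

definition complete_in_forms ::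
  "('x \<Rightarrow> 'b::real_vector) set \<Rightarrow> (('x \<Rightarrow> 'b) \<Rightarrow> ('x \<Rightarrow> 'b) \<Rightarrow> real) \<Rightarrow>
     (('x \<Rightarrow> 'b) \<Rightarrow> ('x \<Rightarrow> 'b) \<Rightarrow> real) \<Rightarrow> bool" where
  "complete_in_forms V a m \<longleftrightarrow>
     (\<forall>v. (\<forall>n. v n \<in> V) \<and> form_Cauchy a v \<and> form_Cauchy m v \<longrightarrow>
        (\<exists>u\<in>V. form_converges a v u \<and> form_converges m v u))"

text \<open>The direct method for the quotient a/m on the vectors m-orthogonal to the given
  \<open>w i\<close>. Compactness makes a minimizing sequence Cauchy for m, the parallelogram
  identity then makes it Cauchy for a, and completeness yields a minimizer. Minimality says that a -
  \<theta> m is positive semidefinite on \<open>M\<close> and vanishes at the minimizer, which is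
  therefore orthogonal to \<open>M\<close> in this form.\<close>

lemma constrained_minimizer:
  fixes V :: "('x \<Rightarrow> 'b::real_vector) set"
  assumes V: "linear_subspace V" and a: "semi_inner V a" and m: "semi_inner V m"
    and compact: "compactly_embedded V a m" and complete: "complete_in_forms V a m"
    and M_def: "M = {v \<in> V. \<forall>i\<in>I. m v (w i) = 0}" and w: "\<And>i. i \<in> I \<Longrightarrow> w i \<in> V"
    and v0: "v0 \<in> M" "m v0 v0 = 1" "a v0 v0 \<le> s"
  shows "\<exists>\<theta> v. 0 \<le> \<theta> \<and> \<theta> \<le> s \<and> v \<in> M \<and> m v v = 1 \<and> (\<forall>x\<in>M. a v x = \<theta> * m v x)"
proof -
  have MV: "v \<in> V" if "v \<in> M" for v using that by (simp add: M_def)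
  have M_comb: "(\<lambda>x. u x + c *\<^sub>R v x) \<in> M" if "u \<in> M" "v \<in> M" for u v c
    using that w subspace_comb[OF V] by (auto simp: M_def form_comb_left[OF V m])
  have "(\<lambda>x. u x + v x) \<in> M" if "u \<in> M" "v \<in> M" for u v
    using M_comb[OF that, of 1] by simp
  note M_add = this
  have M_scale: "(\<lambda>x. c *\<^sub>R v x) \<in> M" if "v \<in> M" for v c
    using M_comb[OF that that, of "c - 1"] by (simp add: algebra_simps)
  define \<Lambda> where "\<Lambda> = {a v v |v. v \<in> M \<and> m v v = 1}"
  define \<theta> where "\<theta> = Inf \<Lambda>"
  have bdd: "bdd_below \<Lambda>" using form_nonneg[OF V a] MV by (auto simp: \<Lambda>_def intro!: bdd_belowI[of _ 0])
  have ne: "\<Lambda> \<noteq> {}" using v0 by (auto simp: \<Lambda>_def)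
  have \<theta>0: "0 \<le> \<theta>" unfolding \<theta>_def
    by (rule cInf_greatest[OF ne]) (use form_nonneg[OF V a] MV in \<open>auto simp: \<Lambda>_def\<close>)
  have "\<theta> \<le> a v0 v0" unfolding \<theta>_def
    by (rule cInf_lower[OF _ bdd]) (use v0 in \<open>auto simp: \<Lambda>_def\<close>)
  then have \<theta>s: "\<theta> \<le> s" using v0 by simp
  have Rayleigh: "\<theta> * m x x \<le> a x x" if x: "x \<in> M" for x
  proof (cases "m x x = 0")
    case True then show ?thesis using form_nonneg[OF V a] MV[OF x] by simp
  next
    case False
    then have pos: "m x x > 0" using form_nonneg[OF V m MV[OF x]] by linarith
    let ?c = "1 / sqrt (m x x)"
    have c2: "?c * ?c = 1 / m x x" using pos by (simp add: field_simps)
    have sc: "B (\<lambda>y. ?c *\<^sub>R x y) (\<lambda>y. ?c *\<^sub>R x y) = B x x / m x x" if B: "semi_inner V B" for B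
    proof -
      have "B (\<lambda>y. ?c *\<^sub>R x y) (\<lambda>y. ?c *\<^sub>R x y) = ?c * B x (\<lambda>y. ?c *\<^sub>R x y)"
        by (rule form_scale_left[OF V B MV[OF x] MV[OF M_scale[OF x]]])
      also have "B x (\<lambda>y. ?c *\<^sub>R x y) = B (\<lambda>y. ?c *\<^sub>R x y) x"
        by (rule form_sym[OF V B MV[OF x] MV[OF M_scale[OF x]]])
      also have "\<dots> = ?c * B x x"
        by (rule form_scale_left[OF V B MV[OF x] MV[OF x]])
      finally show ?thesis using c2 by (simp add: mult.assoc[symmetric])
    qed
    have "a x x / m x x \<in> \<Lambda>"
      using M_scale[OF x, of ?c] sc[OF a] sc[OF m] pos unfolding \<Lambda>_def
      by (intro CollectI exI[of _ "\<lambda>y. ?c *\<^sub>R x y"]) auto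
    then have "\<theta> \<le> a x x / m x x" unfolding \<theta>_def by (rule cInf_lower[OF _ bdd])
    then show ?thesis using pos by (simp add: field_simps)
  qed
  have "\<exists>v. v \<in> M \<and> m v v = 1 \<and> a v v < \<theta> + 1 / real (Suc n)" for n
  proof -
    have "\<theta> < \<theta> + 1 / real (Suc n)" by simp
    then obtain y where "y \<in> \<Lambda>" "y < \<theta> + 1 / real (Suc n)"
      using cInf_lessD[OF ne] unfolding \<theta>_def by blast
    then show ?thesis by (auto simp: \<Lambda>_def)
  qed
  then obtain v where v: "\<And>n. v n \<in> M" "\<And>n. m (v n) (v n) = 1" "\<And>n. a (v n) (v n) < \<theta> + 1 / real (Suc n)"
    by metis
  \<comment> \<open>Both forms share the bound \<theta> + 1, because m is normalized to 1 and
    \<theta> is nonnegative.\<close>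
  have bnd: "v n \<in> V \<and> a (v n) (v n) \<le> \<theta> + 1 \<and> m (v n) (v n) \<le> \<theta> + 1" for n
  proof -
    have "1 / real (Suc n) \<le> 1" by simp
    then have "a (v n) (v n) \<le> \<theta> + 1" using v(3)[of n] by linarith
    then show ?thesis using v(1,2)[of n] MV \<theta>0 by simp
  qed
  obtain r where r: "strict_mono r" "form_Cauchy m (\<lambda>n. v (r n))"
    using compact bnd unfolding compactly_embedded_def by blast
  define y where "y n = v (r n)" for n
  have y: "y n \<in> M" "y n \<in> V" "m (y n) (y n) = 1" "a (y n) (y n) \<le> \<theta> + 1 / real (Suc n)" for n
  proof -
    \<comment> \<open>A strictly increasing r satisfies r n >= n, so the subsequence inherits the
      rate 1/(n + 1).\<close>
    have "1 / real (Suc (r n)) \<le> 1 / real (Suc n)"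
      using seq_suble[OF r(1), of n] by (intro divide_left_mono) auto
    then show "a (y n) (y n) \<le> \<theta> + 1 / real (Suc n)" using v(3)[of "r n"] unfolding y_def by simp
  qed (use v MV in \<open>auto simp: y_def\<close>)
  \<comment> \<open>The sum of \<open>y i\<close> and \<open>y k\<close> lies in \<open>M\<close>,
    so its energy is at least \<theta> times its squared m-norm. The parallelogram law turns this
    lower bound into an upper bound for the energy of the difference.\<close>
  have parallelogram: "a (\<lambda>x. y i x - y k x) (\<lambda>x. y i x - y k x) \<le>
      2 / real (Suc i) + 2 / real (Suc k) + \<theta> * m (\<lambda>x. y i x - y k x) (\<lambda>x. y i x - y k x)" for i k
  proof -
    have "\<theta> * m (\<lambda>x. y i x + y k x) (\<lambda>x. y i x + y k x) \<le> a (\<lambda>x. y i x + y k x) (\<lambda>x. y i x + y k x)"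
      by (rule Rayleigh[OF M_add]) (use y in auto)
    moreover have "B (\<lambda>x. y i x + y k x) (\<lambda>x. y i x + y k x) =
        2 * B (y i) (y i) + 2 * B (y k) (y k) - B (\<lambda>x. y i x - y k x) (\<lambda>x. y i x - y k x)"
      if "semi_inner V B" for B using form_add[OF V that y(2) y(2)] form_diff[OF V that y(2) y(2)] by simp
    note this[OF a] this[OF m]
    ultimately show ?thesis using y(3)[of i] y(3)[of k] y(4)[of i] y(4)[of k]
      by (simp add: algebra_simps)
  qed
  have Cauchy_m: "form_Cauchy m y" using r(2) unfolding y_def .
  have "form_Cauchy a y" unfolding form_Cauchy_def
  proof (intro allI impI)
    fix \<epsilon> :: real assume \<epsilon>: "\<epsilon> > 0"
    \<comment> \<open>Each of the three summands of \<open>parallelogram\<close> gets \<epsilon>/3;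
      the + 1 in the denominator covers \<theta> = 0.\<close>
    define \<delta> where "\<delta> = \<epsilon> / (3 * (\<theta> + 1))"
    have \<delta>: "\<delta> > 0" "\<delta> \<le> \<epsilon> / 3" "\<theta> * \<delta> \<le> \<epsilon> / 3"
      using \<epsilon> \<theta>0 by (auto simp: \<delta>_def field_simps)
    obtain N where N: "\<And>i k. i \<ge> N \<Longrightarrow> k \<ge> N \<Longrightarrow> m (\<lambda>x. y i x - y k x) (\<lambda>x. y i x - y k x) < \<delta>"
      using Cauchy_m \<delta>(1) unfolding form_Cauchy_def by meson
    obtain N' :: nat where N': "6 / \<epsilon> < real N'" using reals_Archimedean2 by blast
    have small: "2 / real (Suc i) < \<epsilon> / 3" if "i \<ge> N'" for i
    proof -
      have "6 / \<epsilon> < real (Suc i)" using N' that by simp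
      then show ?thesis using \<epsilon> by (simp add: field_simps)
    qed
    show "\<exists>N. \<forall>i\<ge>N. \<forall>k\<ge>N. a (\<lambda>x. y i x - y k x) (\<lambda>x. y i x - y k x) < \<epsilon>"
    proof (intro exI[of _ "max N N'"] allI impI)
      fix i k assume ik: "max N N' \<le> i" "max N N' \<le> k"
      have mm: "m (\<lambda>x. y i x - y k x) (\<lambda>x. y i x - y k x) < \<delta>" using N ik by simp
      have "\<theta> * m (\<lambda>x. y i x - y k x) (\<lambda>x. y i x - y k x) \<le> \<theta> * \<delta>"
        by (rule mult_left_mono) (use mm \<theta>0 in auto)
      then show "a (\<lambda>x. y i x - y k x) (\<lambda>x. y i x - y k x) < \<epsilon>"
        using parallelogram[of i k] small[of i] small[of k] ik \<delta>(3) by simp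
    qed
  qed
  then obtain u where u: "u \<in> V" "(\<lambda>n. a (\<lambda>x. y n x - u x) (\<lambda>x. y n x - u x)) \<longlonglongrightarrow> 0"
      "(\<lambda>n. m (\<lambda>x. y n x - u x) (\<lambda>x. y n x - u x)) \<longlonglongrightarrow> 0"
    using complete Cauchy_m y(2) unfolding complete_in_forms_def form_converges_def by blast
  have "m u (w i) = 0" if "i \<in> I" for i
  proof -
    have "(\<lambda>n. m (y n) (w i)) \<longlonglongrightarrow> m u (w i)"
      by (rule form_tendsto[OF V m y(2) u(1) w[OF that] u(3)])
    moreover have "(\<lambda>n. m (y n) (w i)) = (\<lambda>n. 0)" using y(1) that by (auto simp: M_def)
    ultimately show ?thesis by (simp add: LIMSEQ_const_iff)
  qed
  then have uM: "u \<in> M" using u(1) by (simp add: M_def)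
  have "(\<lambda>n. m (y n) (y n)) \<longlonglongrightarrow> m u u" by (rule form_tendsto_diag[OF V m y(2) u(1) u(3)])
  then have mu: "m u u = 1" using y(3) by (simp add: LIMSEQ_const_iff)
  have "(\<lambda>n. a (y n) (y n)) \<longlonglongrightarrow> a u u" by (rule form_tendsto_diag[OF V a y(2) u(1) u(2)])
  moreover have "(\<lambda>n. \<theta> + 1 / real (Suc n)) \<longlonglongrightarrow> \<theta> + 0"
    using LIMSEQ_inverse_real_of_nat by (intro tendsto_intros) (simp add: inverse_eq_divide)
  ultimately have "a u u \<le> \<theta>" using y(4) by (auto intro: LIMSEQ_le)
  then have au: "a u u = \<theta>" using Rayleigh[OF uM] mu by simp
  have "a u x = \<theta> * m u x" if x: "x \<in> M" for x
  proof -
    \<comment> \<open>Cauchy-Schwarz for the form a - \<theta> m, which is semidefinite on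
      \<open>M\<close> by \<open>Rayleigh\<close> and zero at u. This takes the place of
      differentiating the quotient.\<close>
    have "(a u x - \<theta> * m u x)\<^sup>2 \<le> (a u u - \<theta> * m u u) * (a x x - \<theta> * m x x)"
    proof (rule quadratic_nonneg_discriminant)
      show "0 \<le> a u u - \<theta> * m u u + 2 * t * (a u x - \<theta> * m u x) + t\<^sup>2 * (a x x - \<theta> * m x x)" for t
        using Rayleigh[OF M_comb[OF uM x, of t]] form_expand[OF V a u(1) MV[OF x], of t]
          form_expand[OF V m u(1) MV[OF x], of t] by (simp add: algebra_simps)
      show "0 \<le> a x x - \<theta> * m x x" using Rayleigh[OF x] by simp
    qed
    then show ?thesis using au mu by simp
  qed
  then show ?thesis using \<theta>0 \<theta>s uM mu by blast
qed

text \<open>The min-max principle for eigenvalue number \<open>j\<close>: some vector in the span of the \<open>j\<close>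
  trial vectors is orthogonal to the fewer than \<open>j\<close> eigenvectors below \<open>\<kappa>\<close>; if its Rayleigh
  quotient were below \<open>\<kappa>\<close>, minimization would produce a further eigenvector below \<open>\<kappa>\<close>.\<close>

lemma minmax_principle:
  fixes V :: "('x \<Rightarrow> 'b::real_vector) set" and j :: nat
  assumes V: "linear_subspace V" and a: "semi_inner V a" and m: "semi_inner V m"
    and compact: "compactly_embedded V a m" and complete: "complete_in_forms V a m"
    and w: "\<And>i. i \<in> {1..j} \<Longrightarrow> w i \<in> V \<and> m (w i) (w i) = 1 \<and> (\<forall>x\<in>V. a (w i) x = \<mu> i * m (w i) x)"
    and w_orth: "\<And>i l. i \<in> {1..j} \<Longrightarrow> l \<in> {1..j} \<Longrightarrow> i \<noteq> l \<Longrightarrow> m (w i) (w l) = 0"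
    and j: "j \<ge> 1" "\<mu> j = \<kappa>"
    and exhaust: "\<And>\<theta> v. 0 \<le> \<theta> \<Longrightarrow> \<theta> < \<kappa> \<Longrightarrow> v \<in> V \<Longrightarrow> m v v = 1 \<Longrightarrow> (\<forall>x\<in>V. a v x = \<theta> * m v x) \<Longrightarrow>
      \<exists>c. \<forall>x\<in>V. m v x = (\<Sum>i | i \<in> {1..j} \<and> \<mu> i = \<theta>. c i * m (w i) x)"
    and z: "\<And>i. i \<in> {1..j} \<Longrightarrow> z i \<in> V \<and> m (z i) (z i) = 1 \<and> a (z i) (z i) \<le> \<kappa>'"
    and z_orth: "\<And>i l. i \<in> {1..j} \<Longrightarrow> l \<in> {1..j} \<Longrightarrow> i \<noteq> l \<Longrightarrow> m (z i) (z l) = 0 \<and> a (z i) (z l) = 0"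
  shows "\<kappa> \<le> \<kappa>'"
proof (rule ccontr)
  assume "\<not> \<kappa> \<le> \<kappa>'"
  then have less: "\<kappa>' < \<kappa>" by simp
  \<comment> \<open>Since \<open>\<mu> j = \<kappa>\<close>, the index j is left out of
    \<open>I\<close>. So there are fewer orthogonality conditions than trial vectors, and a
    nontrivial combination satisfies all of them.\<close>
  define I where "I = {i \<in> {1..j}. \<mu> i < \<kappa>}"
  have I: "finite I" "I \<subseteq> {1..j}" "I \<subseteq> {1..j} - {j}" using j by (auto simp: I_def)
  have "card I \<le> card ({1..j} - {j})" by (rule card_mono) (use I in auto)
  then have "card I < card {1..j}" using j by (simp add: card_Diff_singleton)
  then obtain c where c: "\<exists>l\<in>{1..j}. c l \<noteq> 0" "\<And>i. i \<in> I \<Longrightarrow> (\<Sum>l\<in>{1..j}. c l * m (z l) (w i)) = 0"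
    using underdetermined_system[of I "{1..j}" "\<lambda>i l. m (z l) (w i)"] I by auto
  define S where "S = (\<Sum>l\<in>{1..j}. (c l)\<^sup>2)"
  have S: "S > 0" using c(1) by (auto simp: S_def intro!: sum_pos2)
  define v0 where "v0 = (\<lambda>x. \<Sum>l\<in>{1..j}. c l *\<^sub>R z l x)"
  have zV: "\<And>l. l \<in> {1..j} \<Longrightarrow> z l \<in> V" and wV: "\<And>l. l \<in> {1..j} \<Longrightarrow> w l \<in> V" using z w by auto
  have v0V: "v0 \<in> V" unfolding v0_def by (rule subspace_sum[OF V zV])
  have v0_left: "B v0 x = (\<Sum>l\<in>{1..j}. c l * B (z l) x)" if "semi_inner V B" "x \<in> V" for B x
    unfolding v0_def by (rule form_sum_left[OF V that(1) zV that(2)])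
  have v0_sq: "B v0 v0 = (\<Sum>l\<in>{1..j}. (c l)\<^sup>2 * B (z l) (z l))"
    if B: "semi_inner V B" and orth: "\<And>i l. i \<in> {1..j} \<Longrightarrow> l \<in> {1..j} \<Longrightarrow> i \<noteq> l \<Longrightarrow> B (z i) (z l) = 0" for B
  proof -
    have "B v0 v0 = (\<Sum>l\<in>{1..j}. c l * B (z l) v0)" by (rule v0_left[OF B v0V])
    also have "\<dots> = (\<Sum>l\<in>{1..j}. c l * (c l * B (z l) (z l)))"
    proof (rule sum.cong[OF refl])
      fix l assume l: "l \<in> {1..j}"
      have "B (z l) v0 = (\<Sum>i\<in>{1..j}. c i * B (z i) (z l))"
        using v0_left[OF B zV[OF l]] form_sym[OF V B v0V zV[OF l]] by simp
      also have "\<dots> = (\<Sum>i\<in>{1..j}. if i = l then c l * B (z l) (z l) else 0)"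
        by (rule sum.cong) (use orth l in auto)
      also have "\<dots> = c l * B (z l) (z l)" using l by simp
      finally show "c l * B (z l) v0 = c l * (c l * B (z l) (z l))" by simp
    qed
    finally show ?thesis by (simp add: power2_eq_square mult.assoc)
  qed
  have mv0: "m v0 v0 = S"
    using v0_sq[OF m] z z_orth unfolding S_def by (auto intro!: sum.cong)
  have "a v0 v0 \<le> (\<Sum>l\<in>{1..j}. (c l)\<^sup>2 * \<kappa>')"
    using v0_sq[OF a] z z_orth by (auto intro!: sum_mono mult_left_mono)
  then have av0: "a v0 v0 \<le> \<kappa>' * S" by (simp add: S_def sum_distrib_left mult.commute)
  define v1 where "v1 = (\<lambda>x. (1 / sqrt S) *\<^sub>R v0 x)"
  have v1V: "v1 \<in> V" unfolding v1_def by (rule subspace_scale[OF V v0V])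
  have v1_left: "B v1 x = (1 / sqrt S) * B v0 x" if "semi_inner V B" "x \<in> V" for B x
    unfolding v1_def by (rule form_scale_left[OF V that(1) v0V that(2)])
  have v1_sq: "B v1 v1 = B v0 v0 / S" if B: "semi_inner V B" for B
  proof -
    have "B v1 v1 = (1 / sqrt S) * ((1 / sqrt S) * B v0 v0)"
      using v1_left[OF B v1V] v1_left[OF B v0V] form_sym[OF V B v0V v1V] by simp
    then show ?thesis using S by (simp add: field_simps)
  qed
  define M where "M = {v \<in> V. \<forall>i\<in>I. m v (w i) = 0}"
  have "m v1 (w i) = 0" if "i \<in> I" for i
    using v1_left[OF m, of "w i"] v0_left[OF m, of "w i"] c(2)[OF that] wV I that by auto
  then have v1M: "v1 \<in> M" using v1V by (simp add: M_def)
  have v1n: "m v1 v1 = 1" "a v1 v1 \<le> \<kappa>'"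
    unfolding v1_sq[OF m] v1_sq[OF a] using mv0 av0 S by (simp_all add: pos_divide_le_eq)
  have wI: "\<And>i. i \<in> I \<Longrightarrow> w i \<in> V" using wV I by auto
  obtain \<theta> v where v: "0 \<le> \<theta>" "\<theta> \<le> \<kappa>'" "v \<in> M" "m v v = 1" "\<And>x. x \<in> M \<Longrightarrow> a v x = \<theta> * m v x"
    using constrained_minimizer[where w = w and I = I, OF V a m compact complete M_def wI v1M v1n] by blast
  have vV: "v \<in> V" and vw: "\<And>i. i \<in> I \<Longrightarrow> m v (w i) = 0" using v(3) by (auto simp: M_def)
  have eig: "a v x = \<theta> * m v x" if x: "x \<in> V" for x
  proof -
    \<comment> \<open>To pass from test vectors in \<open>M\<close> to all of \<open>V\<close>, the
      m-orthogonal projection onto the span of the \<open>w i\<close> with i in \<open>I\<close> is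
      subtracted. It is orthogonal to v in m by the constraints, and then also in a by the equations
      for the \<open>w i\<close>.\<close>
    define p where "p = (\<lambda>y. \<Sum>i\<in>I. m x (w i) *\<^sub>R w i y)"
    have pV: "p \<in> V" unfolding p_def by (rule subspace_sum[OF V wI])
    have p_left: "B p y = (\<Sum>i\<in>I. m x (w i) * B (w i) y)" if "semi_inner V B" "y \<in> V" for B y
      unfolding p_def by (rule form_sum_left[OF V that(1) wI that(2)])
    have mp: "m p v = 0" unfolding p_left[OF m vV]
      using vw form_sym[OF V m vV] wI by (intro sum.neutral) auto
    have ap: "a p v = 0" unfolding p_left[OF a vV]
      using vw form_sym[OF V m vV] wI w vV I by (intro sum.neutral) auto
    have qM: "(\<lambda>y. x y - p y) \<in> M"
    proof -
      have "m (\<lambda>y. x y - p y) (w i) = 0" if i: "i \<in> I" for i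
      proof -
        have "m p (w i) = (\<Sum>l\<in>I. m x (w l) * m (w l) (w i))" by (rule p_left[OF m wI[OF i]])
        also have "\<dots> = (\<Sum>l\<in>I. if l = i then m x (w i) else 0)"
        proof (rule sum.cong[OF refl])
          fix l assume "l \<in> I"
          then have "l \<in> {1..j}" "i \<in> {1..j}" using i I by auto
          then show "m x (w l) * m (w l) (w i) = (if l = i then m x (w i) else 0)"
            using w[of i] w_orth[of l i] by auto
        qed
        also have "\<dots> = m x (w i)" using i I by simp
        finally show ?thesis using form_comb_left[OF V m x pV wI[OF i], of "-1"] by simp
      qed
      then show ?thesis using subspace_diff[OF V x pV] by (simp add: M_def)
    qed
    have diff: "B v (\<lambda>y. x y - p y) = B v x - B p v" if B: "semi_inner V B" for B
      using form_comb_right[OF V B x pV vV, of "-1"] form_sym[OF V B pV vV] by simp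
    show ?thesis using v(5)[OF qM] diff[OF a] diff[OF m] mp ap by simp
  qed
  \<comment> \<open>Here \<theta> <= \<kappa>' < \<kappa>, so every \<open>w i\<close> in this
    expansion has its index in \<open>I\<close> and is orthogonal to v. The expansion forces m v v =
    0, against the normalization.\<close>
  obtain d where d: "\<And>x. x \<in> V \<Longrightarrow> m v x = (\<Sum>i | i \<in> {1..j} \<and> \<mu> i = \<theta>. d i * m (w i) x)"
    using exhaust[of \<theta> v] v eig vV less by auto
  have "m v v = (\<Sum>i | i \<in> {1..j} \<and> \<mu> i = \<theta>. d i * m (w i) v)" by (rule d[OF vV])
  also have "\<dots> = 0"
  proof (rule sum.neutral, safe)
    fix i assume i: "i \<in> {1..j}" "\<theta> = \<mu> i"
    then have "i \<in> I" using v(2) less by (auto simp: I_def)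
    then show "d i * m (w i) v = 0" using vw form_sym[OF V m vV wV[OF i(1)]] by simp
  qed
  finally show False using v(4) by simp
qed

section \<open>Square-integrable functions\<close>

text \<open>Stated for an arbitrary measure and Euclidean values, so that it serves functions on the
  domain, on a piece of it and on the unit interval as well as matrix-valued gradients.
  \<open>l2_space_iff\<close> is the link to \<open>l2_space\<close>.\<close>

definition square_integrable :: "'a measure \<Rightarrow> ('a \<Rightarrow> 'b::euclidean_space) \<Rightarrow> bool" where
  "square_integrable M f \<longleftrightarrow> f \<in> borel_measurable M \<and> integrable M (\<lambda>x. (norm (f x))\<^sup>2)"

lemma square_integrable_measurable: "square_integrable M f \<Longrightarrow> f \<in> borel_measurable M"
  by (simp add: square_integrable_def)

lemma square_integrable_integrable: "square_integrable M f \<Longrightarrow> integrable M (\<lambda>x. (norm (f x))\<^sup>2)"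
  by (simp add: square_integrable_def)

lemma norm_add_sq_le: "(norm (a + b))\<^sup>2 \<le> 2 * (norm a)\<^sup>2 + 2 * (norm (b :: 'a::real_normed_vector))\<^sup>2"
proof -
  have "(norm (a + b))\<^sup>2 \<le> (norm a + norm b)\<^sup>2" by (intro power_mono norm_triangle_ineq) auto
  also have "\<dots> \<le> 2 * (norm a)\<^sup>2 + 2 * (norm b)\<^sup>2"
    using sum_squares_bound[of "norm a" "norm b"] by (simp add: power2_sum)
  finally show ?thesis .
qed

lemma square_integrable_bound:
  assumes "square_integrable M f" "g \<in> borel_measurable M" "\<And>x. x \<in> space M \<Longrightarrow> norm (g x) \<le> C * norm (f x)"
  shows "square_integrable M g"
proof -
  have "integrable M (\<lambda>x. (norm (g x))\<^sup>2)"
  proof (rule Bochner_Integration.integrable_bound[of M "\<lambda>x. C\<^sup>2 * (norm (f x))\<^sup>2"])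
    show "AE x in M. norm ((norm (g x))\<^sup>2) \<le> norm (C\<^sup>2 * (norm (f x))\<^sup>2)"
    proof (rule AE_I2)
      fix x assume "x \<in> space M"
      then have "(norm (g x))\<^sup>2 \<le> (C * norm (f x))\<^sup>2" using assms(3) by (intro power_mono) auto
      then show "norm ((norm (g x))\<^sup>2) \<le> norm (C\<^sup>2 * (norm (f x))\<^sup>2)" by (simp add: power_mult_distrib)
    qed
  qed (use assms square_integrable_integrable in auto)
  then show ?thesis using assms by (simp add: square_integrable_def)
qed

lemma square_integrable_zero: "square_integrable M (\<lambda>x. 0)"
  by (simp add: square_integrable_def)

lemma square_integrable_add:
  assumes "square_integrable M f" "square_integrable M g"
  shows "square_integrable M (\<lambda>x. f x + g x)"
proof -
  have [measurable]: "f \<in> borel_measurable M" "g \<in> borel_measurable M"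
    using assms square_integrable_measurable by auto
  have "integrable M (\<lambda>x. (norm (f x + g x))\<^sup>2)"
  proof (rule Bochner_Integration.integrable_bound[of M "\<lambda>x. 2 * (norm (f x))\<^sup>2 + 2 * (norm (g x))\<^sup>2"])
    show "AE x in M. norm ((norm (f x + g x))\<^sup>2) \<le> norm (2 * (norm (f x))\<^sup>2 + 2 * (norm (g x))\<^sup>2)"
      using norm_add_sq_le by auto
  qed (use square_integrable_integrable[OF assms(1)] square_integrable_integrable[OF assms(2)] in auto)
  then show ?thesis by (simp add: square_integrable_def)
qed

lemma square_integrable_scaleR: "square_integrable M f \<Longrightarrow> square_integrable M (\<lambda>x. c *\<^sub>R f x)"
  by (rule square_integrable_bound[of M f _ "\<bar>c\<bar>"])
     (auto intro!: borel_measurable_scaleR dest: square_integrable_measurable)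

lemma square_integrable_comb:
  "square_integrable M f \<Longrightarrow> square_integrable M g \<Longrightarrow> square_integrable M (\<lambda>x. f x + c *\<^sub>R g x)"
  by (intro square_integrable_add square_integrable_scaleR)

lemma square_integrable_diff:
  "square_integrable M f \<Longrightarrow> square_integrable M g \<Longrightarrow> square_integrable M (\<lambda>x. f x - g x)"
  using square_integrable_comb[of M f g "-1"] by simp

lemma square_integrable_sum:
  "(\<And>i. i \<in> I \<Longrightarrow> square_integrable M (f i)) \<Longrightarrow> square_integrable M (\<lambda>x. \<Sum>i\<in>I. f i x)"
  by (induction I rule: infinite_finite_induct) (auto intro: square_integrable_zero square_integrable_add)

lemma square_integrable_bounded_mult:
  assumes "square_integrable M f" "\<phi> \<in> borel_measurable M" "\<And>x. x \<in> space M \<Longrightarrow> \<bar>\<phi> x\<bar> \<le> C"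
  shows "square_integrable M (\<lambda>x. \<phi> x *\<^sub>R f x)"
  by (rule square_integrable_bound[OF assms(1), of _ C])
     (use assms square_integrable_measurable in \<open>auto intro!: mult_right_mono borel_measurable_scaleR\<close>)

lemma square_integrable_linear:
  assumes "square_integrable M f" "linear A"
  shows "square_integrable M (\<lambda>x. A (f x))"
proof -
  obtain C where C: "\<And>x. norm (A x) \<le> C * norm x"
    using linear_bounded[OF assms(2)] by blast
  have "A \<in> borel_measurable borel"
    using assms(2) by (intro borel_measurable_continuous_onI linear_continuous_on) (simp add: linear_linear)
  then show ?thesis
    by (intro square_integrable_bound[OF assms(1), of _ C])
       (use assms square_integrable_measurable C in \<open>auto intro: measurable_compose\<close>)
qed

lemma square_integrable_inner:
  assumes "square_integrable M f" "square_integrable M g"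
  shows "integrable M (\<lambda>x. f x \<bullet> g x)"
proof (rule Bochner_Integration.integrable_bound[of M "\<lambda>x. (norm (f x))\<^sup>2 + (norm (g x))\<^sup>2"])
  show "AE x in M. norm (f x \<bullet> g x) \<le> norm ((norm (f x))\<^sup>2 + (norm (g x))\<^sup>2)"
  proof (rule AE_I2)
    fix x
    have "\<bar>f x \<bullet> g x\<bar> \<le> norm (f x) * norm (g x)" by (rule Cauchy_Schwarz_ineq2)
    moreover have "0 \<le> norm (f x) * norm (g x)" by simp
    ultimately have "\<bar>f x \<bullet> g x\<bar> \<le> (norm (f x))\<^sup>2 + (norm (g x))\<^sup>2"
      using sum_squares_bound[of "norm (f x)" "norm (g x)"] by linarith
    then show "norm (f x \<bullet> g x) \<le> norm ((norm (f x))\<^sup>2 + (norm (g x))\<^sup>2)" by simp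
  qed
qed (use square_integrable_integrable[OF assms(1)] square_integrable_integrable[OF assms(2)]
    square_integrable_measurable[OF assms(1)] square_integrable_measurable[OF assms(2)] in auto)

lemma square_integrable_mult:
  fixes f g :: "'a \<Rightarrow> real"
  shows "square_integrable M f \<Longrightarrow> square_integrable M g \<Longrightarrow> integrable M (\<lambda>x. f x * g x)"
  using square_integrable_inner[of M f g] by simp

lemma (in finite_measure) square_integrable_const: "square_integrable M (\<lambda>x. c)"
  by (simp add: square_integrable_def)

lemma (in finite_measure) square_integrable_integrable_L1:
  fixes f :: "'a \<Rightarrow> real"
  assumes "square_integrable M f"
  shows "integrable M f"
  by (rule square_integrable_imp_integrable)
     (use square_integrable_measurable[OF assms] square_integrable_integrable[OF assms] in auto)

lemma integral_norm_sq_add_le: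
  assumes "square_integrable M f" "square_integrable M g"
  shows "(\<integral>x. (norm (f x + g x))\<^sup>2 \<partial>M) \<le> 2 * (\<integral>x. (norm (f x))\<^sup>2 \<partial>M) + 2 * (\<integral>x. (norm (g x))\<^sup>2 \<partial>M)"
proof -
  have "(\<integral>x. (norm (f x + g x))\<^sup>2 \<partial>M) \<le> (\<integral>x. 2 * (norm (f x))\<^sup>2 + 2 * (norm (g x))\<^sup>2 \<partial>M)"
    using square_integrable_add[OF assms] assms norm_add_sq_le
    by (intro integral_mono) (auto simp: square_integrable_def)
  then show ?thesis using assms by (simp add: square_integrable_def)
qed

lemma integral_Cauchy_Schwarz:
  assumes "square_integrable M f" "square_integrable M g"
  shows "(\<integral>x. f x \<bullet> g x \<partial>M)\<^sup>2 \<le> (\<integral>x. (norm (f x))\<^sup>2 \<partial>M) * (\<integral>x. (norm (g x))\<^sup>2 \<partial>M)"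
proof (rule quadratic_nonneg_discriminant)
  fix t :: real
  have "0 \<le> (\<integral>x. (norm (f x + t *\<^sub>R g x))\<^sup>2 \<partial>M)" by simp
  also have "\<dots> = (\<integral>x. (norm (f x))\<^sup>2 + (2 * t) * (f x \<bullet> g x) + t\<^sup>2 * (norm (g x))\<^sup>2 \<partial>M)"
    by (intro Bochner_Integration.integral_cong refl, unfold power2_norm_eq_inner)
       (simp add: inner_simps inner_commute power2_eq_square algebra_simps)
  also have "\<dots> = (\<integral>x. (norm (f x))\<^sup>2 \<partial>M) + 2 * t * (\<integral>x. f x \<bullet> g x \<partial>M) + t\<^sup>2 * (\<integral>x. (norm (g x))\<^sup>2 \<partial>M)"
    using square_integrable_inner[OF assms] assms by (simp add: square_integrable_def)
  finally show "0 \<le> \<dots>" .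
qed simp

lemma integral_tendsto_inner:
  assumes f: "\<And>n. square_integrable M (f n)" "square_integrable M f0" and g: "square_integrable M g"
    and lim: "(\<lambda>n. \<integral>x. (norm (f n x - f0 x))\<^sup>2 \<partial>M) \<longlonglongrightarrow> 0"
  shows "(\<lambda>n. \<integral>x. f n x \<bullet> g x \<partial>M) \<longlonglongrightarrow> (\<integral>x. f0 x \<bullet> g x \<partial>M)"
proof -
  have "(\<lambda>n. \<bar>(\<integral>x. f n x \<bullet> g x \<partial>M) - (\<integral>x. f0 x \<bullet> g x \<partial>M)\<bar>) \<longlonglongrightarrow> 0"
  proof (rule tendsto_sandwich[OF _ _ tendsto_const])
    have "\<bar>(\<integral>x. f n x \<bullet> g x \<partial>M) - (\<integral>x. f0 x \<bullet> g x \<partial>M)\<bar> \<le>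
        sqrt ((\<integral>x. (norm (f n x - f0 x))\<^sup>2 \<partial>M) * (\<integral>x. (norm (g x))\<^sup>2 \<partial>M))" for n
    proof -
      have "(\<integral>x. f n x \<bullet> g x \<partial>M) - (\<integral>x. f0 x \<bullet> g x \<partial>M) = (\<integral>x. (f n x - f0 x) \<bullet> g x \<partial>M)"
        using f g by (simp add: inner_diff_left square_integrable_inner)
      then show ?thesis
        using integral_Cauchy_Schwarz[OF square_integrable_diff[OF f(1)[of n] f(2)] g]
        by (intro real_le_rsqrt) (simp only: power2_abs)
    qed
    then show "\<forall>\<^sub>F n in sequentially. \<bar>(\<integral>x. f n x \<bullet> g x \<partial>M) - (\<integral>x. f0 x \<bullet> g x \<partial>M)\<bar> \<le>
        sqrt ((\<integral>x. (norm (f n x - f0 x))\<^sup>2 \<partial>M) * (\<integral>x. (norm (g x))\<^sup>2 \<partial>M))" by simp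
    show "(\<lambda>n. sqrt ((\<integral>x. (norm (f n x - f0 x))\<^sup>2 \<partial>M) * (\<integral>x. (norm (g x))\<^sup>2 \<partial>M))) \<longlonglongrightarrow> 0"
      using tendsto_real_sqrt[OF tendsto_mult[OF lim tendsto_const, of "\<integral>x. (norm (g x))\<^sup>2 \<partial>M"]] by simp
  qed simp
  then show ?thesis by (simp add: tendsto_rabs_zero_iff LIM_zero_iff)
qed

text \<open>The Riesz-Fischer theorem. On a finite measure an L^2 Cauchy sequence is Cauchy in L^1,
  hence a subsequence converges almost everywhere; Fatou's lemma along this subsequence carries the
  Cauchy estimate over to the pointwise limit.\<close>

lemma (in finite_measure) L2_complete:
  fixes f :: "nat \<Rightarrow> 'a \<Rightarrow> real"
  assumes f: "\<And>n. square_integrable M (f n)"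
    and Cauchy: "\<And>\<epsilon>. \<epsilon> > 0 \<Longrightarrow> \<exists>N. \<forall>i\<ge>N. \<forall>k\<ge>N. (\<integral>x. (f i x - f k x)\<^sup>2 \<partial>M) < \<epsilon>"
  shows "\<exists>g. square_integrable M g \<and> (\<lambda>n. \<integral>x. (f n x - g x)\<^sup>2 \<partial>M) \<longlonglongrightarrow> 0"
proof -
  have [measurable]: "f n \<in> borel_measurable M" for n using f square_integrable_measurable by auto
  have diff: "square_integrable M (\<lambda>x. f i x - f k x)" for i k by (rule square_integrable_diff[OF f f])
  have int: "integrable M (\<lambda>x. (f i x - f k x)\<^sup>2)" for i k
    using square_integrable_integrable[OF diff[of i k]] by simp
  define D where "D = measure M (space M)"
  have L1: "(\<integral>x. norm (f i x - f k x) \<partial>M)\<^sup>2 \<le> (\<integral>x. (f i x - f k x)\<^sup>2 \<partial>M) * D" for i k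
  proof -
    have "square_integrable M (\<lambda>x. norm (f i x - f k x))"
      by (rule square_integrable_bound[OF diff[of i k], of _ 1]) auto
    from integral_Cauchy_Schwarz[OF this square_integrable_const[of 1]] show ?thesis
      by (simp add: D_def)
  qed
  have "\<exists>N. \<forall>i\<ge>N. \<forall>k\<ge>N. (\<integral>x. norm (f i x - f k x) \<partial>M) < e" if "e > 0" for e
  proof -
    have D: "D \<ge> 0" by (simp add: D_def)
    \<comment> \<open>The bound is chosen against the total mass \<open>D\<close>, which is the
      factor in the Cauchy-Schwarz inequality \<open>L1\<close>; the + 1 covers the zero
      measure.\<close>
    then have "e\<^sup>2 / (D + 1) > 0" using that by simp
    then obtain N where N: "\<And>i k. i \<ge> N \<Longrightarrow> k \<ge> N \<Longrightarrow> (\<integral>x. (f i x - f k x)\<^sup>2 \<partial>M) < e\<^sup>2 / (D + 1)"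
      using Cauchy by meson
    have "(\<integral>x. norm (f i x - f k x) \<partial>M) < e" if "i \<ge> N" "k \<ge> N" for i k
    proof -
      have "(\<integral>x. norm (f i x - f k x) \<partial>M)\<^sup>2 \<le> (\<integral>x. (f i x - f k x)\<^sup>2 \<partial>M) * D" by (rule L1)
      also have "\<dots> \<le> (\<integral>x. (f i x - f k x)\<^sup>2 \<partial>M) * (D + 1)" by (intro mult_left_mono) auto
      also have "\<dots> < e\<^sup>2 / (D + 1) * (D + 1)" using N[OF that] D by (intro mult_strict_right_mono) auto
      also have "\<dots> = e\<^sup>2" using D by simp
      finally show ?thesis using \<open>e > 0\<close> by (simp add: power_less_imp_less_base)
    qed
    then show ?thesis by blast
  qed
  then obtain r where r: "strict_mono r" "AE x in M. Cauchy (\<lambda>i. f (r i) x)"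
    using cauchy_L1_AE_cauchy_subseq[of M f] square_integrable_integrable_L1[OF f] by blast
  define g where "g x = lim (\<lambda>i. f (r i) x)" for x
  have [measurable]: "g \<in> borel_measurable M" unfolding g_def by measurable
  have lim: "AE x in M. (\<lambda>i. f (r i) x) \<longlonglongrightarrow> g x"
    using r(2) by eventually_elim (simp add: g_def Cauchy_convergent_iff convergent_LIMSEQ_iff)
  have bound: "(\<integral>\<^sup>+x. ennreal ((f n x - g x)\<^sup>2) \<partial>M) \<le> ennreal \<epsilon>"
    if N: "\<And>i k. i \<ge> N \<Longrightarrow> k \<ge> N \<Longrightarrow> (\<integral>x. (f i x - f k x)\<^sup>2 \<partial>M) < \<epsilon>" and n: "n \<ge> N" for N n \<epsilon>
  proof -
    have "(\<integral>\<^sup>+x. ennreal ((f n x - g x)\<^sup>2) \<partial>M) = (\<integral>\<^sup>+x. liminf (\<lambda>i. ennreal ((f n x - f (r i) x)\<^sup>2)) \<partial>M)"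
    proof (rule nn_integral_cong_AE)
      show "AE x in M. ennreal ((f n x - g x)\<^sup>2) = liminf (\<lambda>i. ennreal ((f n x - f (r i) x)\<^sup>2))"
        using lim
      proof eventually_elim
        case (elim x)
        have "(\<lambda>i. ennreal ((f n x - f (r i) x)\<^sup>2)) \<longlonglongrightarrow> ennreal ((f n x - g x)\<^sup>2)"
          by (intro tendsto_ennrealI tendsto_intros elim)
        then show ?case by (rule lim_imp_Liminf[symmetric, rotated]) simp
      qed
    qed
    also have "\<dots> \<le> liminf (\<lambda>i. \<integral>\<^sup>+x. ennreal ((f n x - f (r i) x)\<^sup>2) \<partial>M)"
      by (rule nn_integral_liminf) measurable
    also have "\<dots> = liminf (\<lambda>i. ennreal (\<integral>x. (f n x - f (r i) x)\<^sup>2 \<partial>M))"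
      using int by (simp add: nn_integral_eq_integral)
    also have "\<dots> \<le> liminf (\<lambda>i. ennreal \<epsilon>)"
    proof (rule Liminf_mono)
      show "\<forall>\<^sub>F i in sequentially. ennreal (\<integral>x. (f n x - f (r i) x)\<^sup>2 \<partial>M) \<le> ennreal \<epsilon>"
        unfolding eventually_sequentially
      proof (intro exI[of _ N] allI impI ennreal_leI)
        fix i assume "N \<le> i"
        then have "N \<le> r i" using seq_suble[OF r(1), of i] by simp
        then show "(\<integral>x. (f n x - f (r i) x)\<^sup>2 \<partial>M) \<le> \<epsilon>" using N[OF n] by (simp add: less_imp_le)
      qed
    qed
    also have "\<dots> = ennreal \<epsilon>" by (simp add: Liminf_const)
    finally show ?thesis .
  qed
  obtain N1 where N1: "\<And>i k. i \<ge> N1 \<Longrightarrow> k \<ge> N1 \<Longrightarrow> (\<integral>x. (f i x - f k x)\<^sup>2 \<partial>M) < 1"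
    using Cauchy[of 1] by auto
  \<comment> \<open>The Fatou bound with \<epsilon> = 1 makes one difference f N1 - g square
    integrable, and with it g.\<close>
  have "integrable M (\<lambda>x. (f N1 x - g x)\<^sup>2)"
  proof (rule integrableI_bounded)
    have "(\<integral>\<^sup>+x. ennreal (norm ((f N1 x - g x)\<^sup>2)) \<partial>M) \<le> ennreal 1" using bound[OF N1, of N1] by simp
    then show "(\<integral>\<^sup>+x. ennreal (norm ((f N1 x - g x)\<^sup>2)) \<partial>M) < \<infinity>" by (auto intro: le_less_trans)
  qed measurable
  then have "square_integrable M (\<lambda>x. f N1 x - g x)" by (simp add: square_integrable_def)
  from square_integrable_diff[OF f[of N1] this] have g: "square_integrable M g" by simp
  have "(\<lambda>n. \<integral>x. (f n x - g x)\<^sup>2 \<partial>M) \<longlonglongrightarrow> 0"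
  proof (rule LIMSEQ_I)
    fix \<epsilon> :: real assume "\<epsilon> > 0"
    then obtain N where N: "\<And>i k. i \<ge> N \<Longrightarrow> k \<ge> N \<Longrightarrow> (\<integral>x. (f i x - f k x)\<^sup>2 \<partial>M) < \<epsilon> / 2"
      using Cauchy[of "\<epsilon> / 2"] by auto
    show "\<exists>no. \<forall>n\<ge>no. norm ((\<integral>x. (f n x - g x)\<^sup>2 \<partial>M) - 0) < \<epsilon>"
    proof (intro exI[of _ N] allI impI)
      fix n assume n: "N \<le> n"
      have "integrable M (\<lambda>x. (f n x - g x)\<^sup>2)"
        using square_integrable_integrable[OF square_integrable_diff[OF f[of n] g]] by simp
      then have "ennreal (\<integral>x. (f n x - g x)\<^sup>2 \<partial>M) \<le> ennreal (\<epsilon> / 2)"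
        using bound[OF N n] by (simp add: nn_integral_eq_integral)
      then have "(\<integral>x. (f n x - g x)\<^sup>2 \<partial>M) \<le> \<epsilon> / 2" using \<open>\<epsilon> > 0\<close> by simp
      then show "norm ((\<integral>x. (f n x - g x)\<^sup>2 \<partial>M) - 0) < \<epsilon>" using \<open>\<epsilon> > 0\<close> by simp
    qed
  qed
  then show ?thesis using g by blast
qed

section \<open>Weak derivatives\<close>

lemma pos_part_sq_deriv: "((\<lambda>t. (max 0 t)\<^sup>2) has_real_derivative 2 * max 0 t) (at (t::real))"
proof -
  consider "t > 0" | "t < 0" | "t = 0" by linarith
  then show ?thesis
  proof cases
    case 1
    have "((\<lambda>t. t\<^sup>2) has_real_derivative 2 * t) (at t)" by (auto intro!: derivative_eq_intros)
    then have "((\<lambda>t. (max 0 t)\<^sup>2) has_real_derivative 2 * t) (at t)"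
      by (rule has_field_derivative_transform_within_open[of _ _ _ "{0<..}"]) (use 1 in auto)
    then show ?thesis using 1 by simp
  next
    case 2
    have "((\<lambda>t. 0) has_real_derivative 0) (at t)" by simp
    then have "((\<lambda>t. (max 0 t)\<^sup>2) has_real_derivative 0) (at t)"
      by (rule has_field_derivative_transform_within_open[of _ _ _ "{..<0}"]) (use 2 in auto)
    then show ?thesis using 2 by simp
  next
    case 3
    have "isCont (\<lambda>h::real. max 0 h) 0" by (intro continuous_intros)
    then have "((\<lambda>h::real. max 0 h) \<longlongrightarrow> 0) (at 0)" by (simp add: isCont_def)
    \<comment> \<open>At 0 the difference quotient of the squared positive part is the positive part
      itself, which tends to 0.\<close>
    moreover have "((max 0 (0 + h))\<^sup>2 - (max 0 0)\<^sup>2) / h = max 0 h" for h :: real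
      by (cases "h > 0") (simp_all add: power2_eq_square)
    ultimately show ?thesis unfolding 3 DERIV_def by simp
  qed
qed

lemma test_functionI:
  assumes "\<And>x. (\<psi> has_derivative D x) (at x)" "\<And>i. continuous_on UNIV (\<lambda>x. D x (axis i 1))"
    "compact K" "K \<subseteq> U" "\<And>x. x \<notin> K \<Longrightarrow> \<psi> x = 0"
  shows "test_function U \<psi>"
proof -
  have "partial_deriv i \<psi> = (\<lambda>x. D x (axis i 1))" for i
    unfolding partial_deriv_def using frechet_derivative_at[OF assms(1)] by auto
  then show ?thesis unfolding test_function_def using assms
    by (auto simp: differentiable_def)
qed

text \<open>A test function that approximates the indicator of \<open>box a b\<close> as N grows.
  Squared positive parts are continuously differentiable and vanish outside the box; p/(1 + p) stays
  in [0, 1) and tends to 1 wherever p = N c with c > 0.\<close>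

definition box_bump :: "real \<Rightarrow> real^2 \<Rightarrow> real^2 \<Rightarrow> real^2 \<Rightarrow> real" where
  "box_bump N a b x =
     (let p = N * ((max 0 ((x$1 - a$1) * (b$1 - x$1)))\<^sup>2 * (max 0 ((x$2 - a$2) * (b$2 - x$2)))\<^sup>2)
      in p / (1 + p))"

lemma test_function_box_bump:
  assumes "N \<ge> 0" and le: "\<And>i. a$i \<le> b$i" and "cbox a b \<subseteq> U"
  shows "test_function U (box_bump N a b)"
proof -
  define f where "f i x = (x$i - a$i) * (b$i - x$i)" for i and x :: "real^2"
  define p where "p x = N * ((max 0 (f 1 x))\<^sup>2 * (max 0 (f 2 x))\<^sup>2)" for x
  define f' where "f' i x h = h$i * (b$i - x$i) - (x$i - a$i) * h$i" for i and x h :: "real^2"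
  define p' where "p' x h = N * ((max 0 (f 1 x))\<^sup>2 * (2 * max 0 (f 2 x) * f' 2 x h) +
      (2 * max 0 (f 1 x) * f' 1 x h) * (max 0 (f 2 x))\<^sup>2)" for x h
  have p: "p x \<ge> 0" for x using assms by (simp add: p_def)
  have f: "(f i has_derivative f' i x) (at x)" for i x
    unfolding f_def f'_def
    by (auto intro!: derivative_eq_intros bounded_linear_imp_has_derivative bounded_linear_vec_nth)
  have fq: "((\<lambda>x. (max 0 (f i x))\<^sup>2) has_derivative (\<lambda>h. 2 * max 0 (f i x) * f' i x h)) (at x)" for i x
    using has_derivative_compose[OF f, of "\<lambda>t. (max 0 t)\<^sup>2" "\<lambda>h. 2 * max 0 (f i x) * h" i x]
      pos_part_sq_deriv[of "f i x"] by (simp add: has_field_derivative_def)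
  have pd: "(p has_derivative p' x) (at x)" for x
    unfolding p_def p'_def by (rule has_derivative_mult_right[OF has_derivative_mult[OF fq fq]])
  have bump: "box_bump N a b = (\<lambda>x. p x / (1 + p x))"
    by (simp add: box_bump_def p_def f_def Let_def fun_eq_iff)
  \<comment> \<open>The derivative of s/(1 + s) is 1/(1 + s)^2, and p >= 0 keeps the denominator
    away from 0.\<close>
  have D: "((\<lambda>x. p x / (1 + p x)) has_derivative (\<lambda>h. p' x h / (1 + p x)\<^sup>2)) (at x)" for x
  proof -
    have "1 + p x \<noteq> 0" using p[of x] by linarith
    then show ?thesis
      by (auto intro!: derivative_eq_intros pd simp: field_simps power2_eq_square)
  qed
  have fc: "continuous_on UNIV (f i)" for i unfolding f_def by (intro continuous_intros)
  have pc: "continuous_on UNIV p" unfolding p_def by (intro continuous_intros fc)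
  show ?thesis unfolding bump
  proof (rule test_functionI[OF D])
    fix i
    have "continuous_on UNIV (\<lambda>x. p' x (axis i 1))"
      unfolding p'_def f'_def by (intro continuous_intros fc)
    moreover have "1 + p x \<noteq> 0" for x using p[of x] by linarith
    ultimately show "continuous_on UNIV (\<lambda>x. p' x (axis i 1) / (1 + p x)\<^sup>2)"
      by (intro continuous_intros pc) auto
  next
    fix x assume "x \<notin> cbox a b"
    then obtain i where "x$i < a$i \<or> b$i < x$i" by (auto simp: mem_box_cart not_le)
    \<comment> \<open>Ordered end points exclude that both factors of \<open>f i x\<close> are
      negative.\<close>
    then have "f i x \<le> 0" using le[of i] by (auto simp: f_def mult_le_0_iff)
    then have "max 0 (f 1 x) = 0 \<or> max 0 (f 2 x) = 0" using exhaust_2[of i] by auto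
    then show "p x / (1 + p x) = 0" by (auto simp: p_def)
  qed (use assms in auto)
qed

lemma box_bump_tendsto:
  assumes "\<And>i. a$i \<le> b$i"
  shows "(\<lambda>n. box_bump (real n) a b x) \<longlonglongrightarrow> indicator (box a b) x"
proof -
  define c where "c = (max 0 ((x$1 - a$1) * (b$1 - x$1)))\<^sup>2 * (max 0 ((x$2 - a$2) * (b$2 - x$2)))\<^sup>2"
  have bump: "box_bump (real n) a b x = real n * c / (1 + real n * c)" for n
    by (simp add: box_bump_def c_def Let_def)
  show ?thesis
  proof (cases "x \<in> box a b")
    case True
    then have "(x$i - a$i) * (b$i - x$i) > 0" for i by (simp add: mem_box_cart)
    then have "max 0 ((x$i - a$i) * (b$i - x$i)) > 0" for i by (simp add: less_max_iff_disj)
    then have "c > 0" unfolding c_def by (intro mult_pos_pos zero_less_power)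
    then have "(\<lambda>n. real n * c / (1 + real n * c)) \<longlonglongrightarrow> 1" by real_asymp
    then show ?thesis using True by (simp add: bump)
  next
    case False
    then obtain i where "x$i \<le> a$i \<or> b$i \<le> x$i" by (auto simp: mem_box_cart not_less)
    then have "(x$i - a$i) * (b$i - x$i) \<le> 0" using assms[of i] by (auto simp: mult_le_0_iff)
    then have "c = 0" using exhaust_2[of i] by (auto simp: c_def)
    then show ?thesis using False by (simp add: bump)
  qed
qed

lemma box_bump_abs_le_1: "N \<ge> 0 \<Longrightarrow> \<bar>box_bump N a b x\<bar> \<le> 1"
proof -
  assume "N \<ge> 0"
  then have "0 \<le> N * ((max 0 ((x$1 - a$1) * (b$1 - x$1)))\<^sup>2 * (max 0 ((x$2 - a$2) * (b$2 - x$2)))\<^sup>2)"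
    by simp
  then show ?thesis unfolding box_bump_def Let_def by (auto simp: abs_le_iff divide_le_eq)
qed

lemma test_function_continuous: "test_function U \<psi> \<Longrightarrow> continuous_on UNIV \<psi>"
  unfolding test_function_def
  by (meson continuous_at_imp_continuous_on differentiable_imp_continuous_within)

lemma test_function_measurable: "test_function U \<psi> \<Longrightarrow> \<psi> \<in> borel_measurable borel"
  by (intro borel_measurable_continuous_onI test_function_continuous)

text \<open>Dominated convergence along \<open>box_bump\<close>, with |q| as the dominating
  function.\<close>

lemma orthogonal_to_tests_imp_box_integral_0:
  assumes q: "integrable lborel q" and U: "cbox a b \<subseteq> U" "\<And>i. a$i \<le> b$i"
    and tests: "\<And>\<psi>. test_function U \<psi> \<Longrightarrow> (\<integral>x. q x * \<psi> x \<partial>lborel) = 0"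
  shows "(\<integral>x. q x * indicator (box a b) x \<partial>lborel) = 0"
proof -
  have [measurable]: "q \<in> borel_measurable borel" using borel_measurable_integrable[OF q] by simp
  have test: "test_function U (box_bump (real n) a b)" for n
    by (rule test_function_box_bump) (use U in auto)
  have [measurable]: "box_bump (real n) a b \<in> borel_measurable borel" for n
    by (rule test_function_measurable[OF test])
  have "(\<lambda>n. \<integral>x. q x * box_bump (real n) a b x \<partial>lborel) \<longlonglongrightarrow> (\<integral>x. q x * indicator (box a b) x \<partial>lborel)"
  proof (rule integral_dominated_convergence[where w = "\<lambda>x. norm (q x)"])
    show "AE x in lborel. (\<lambda>n. q x * box_bump (real n) a b x) \<longlonglongrightarrow> q x * indicator (box a b) x"
      by (intro AE_I2 tendsto_intros box_bump_tendsto U)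
    show "AE x in lborel. norm (q x * box_bump (real n) a b x) \<le> norm (q x)" for n
      using box_bump_abs_le_1[of "real n" a b] by (auto simp: abs_mult intro!: mult_left_le)
  qed (use q in auto)
  then show ?thesis using tests[OF test] by (simp add: LIMSEQ_const_iff)
qed

text \<open>The positive and the negative part of q are densities of two measures that agree on open
  boxes. Boxes are stable under intersection and generate the Borel sets, so the measures agree, and
  hence the densities almost everywhere. A real number whose positive and negative parts agree is
  0.\<close>

lemma AE_zero_of_box_integrals:
  fixes q :: "'a::euclidean_space \<Rightarrow> real"
  assumes q: "integrable lborel q" and zero: "\<And>a b. (\<integral>x. q x * indicator (box a b) x \<partial>lborel) = 0"
  shows "AE x in lborel. q x = 0"
proof -
  have [measurable]: "q \<in> borel_measurable borel" using borel_measurable_integrable[OF q] by simp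
  let ?p = "\<lambda>x. ennreal (q x)" and ?n = "\<lambda>x. ennreal (- q x)"
  have fin: "(\<integral>\<^sup>+x. ?p x \<partial>lborel) \<noteq> \<infinity>"
    using q unfolding real_integrable_def by simp
  have boxes: "(\<integral>\<^sup>+x. ?p x * indicator (box a b) x \<partial>lborel) = (\<integral>\<^sup>+x. ?n x * indicator (box a b) x \<partial>lborel)" for a b
  proof -
    let ?f = "\<lambda>x. q x * indicator (box a b) x"
    have f: "integrable lborel ?f"
      using integrable_real_mult_indicator[OF _ q, of "box a b"] by simp
    have conv: "(\<integral>\<^sup>+x. ?p x * indicator (box a b) x \<partial>lborel) = (\<integral>\<^sup>+x. ennreal (?f x) \<partial>lborel)"
      "(\<integral>\<^sup>+x. ?n x * indicator (box a b) x \<partial>lborel) = (\<integral>\<^sup>+x. ennreal (- ?f x) \<partial>lborel)"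
      by (auto intro!: nn_integral_cong split: split_indicator)
    have "(\<integral>\<^sup>+x. ennreal (?f x) \<partial>lborel) \<noteq> \<infinity>" "(\<integral>\<^sup>+x. ennreal (- ?f x) \<partial>lborel) \<noteq> \<infinity>"
      using f unfolding real_integrable_def by auto
    moreover have "enn2real (\<integral>\<^sup>+x. ennreal (?f x) \<partial>lborel) = enn2real (\<integral>\<^sup>+x. ennreal (- ?f x) \<partial>lborel)"
      using real_lebesgue_integral_def[OF f] zero[of a b] by simp
    moreover have "A = B" if "A \<noteq> \<infinity>" "B \<noteq> \<infinity>" "enn2real A = enn2real B" for A B
      using that by (cases A; cases B) auto
    ultimately show ?thesis unfolding conv by blast
  qed
  have "density lborel ?p = density lborel ?n"
  proof (rule measure_eqI_generator_eq)
    let ?E = "range (\<lambda>(a, b). box a b::'a set)"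
    show "Int_stable ?E" by (auto simp: Int_stable_def box_Int_box)
    show "?E \<subseteq> Pow UNIV" "sets (density lborel ?p) = sigma_sets UNIV ?E" "sets (density lborel ?n) = sigma_sets UNIV ?E"
      by (simp_all add: borel_eq_box)
    let ?A = "\<lambda>n::nat. box (- (real n *\<^sub>R One)) (real n *\<^sub>R One) :: 'a set"
    show "range ?A \<subseteq> ?E" "(\<Union>i. ?A i) = UNIV" unfolding UN_box_eq_UNIV by auto
    \<comment> \<open>Uniqueness of measures asks for finiteness on an exhausting sequence of
      generators; it comes from the integrability of q.\<close>
    show "emeasure (density lborel ?p) (?A i) \<noteq> \<infinity>" for i
    proof -
      have "emeasure (density lborel ?p) (?A i) \<le> (\<integral>\<^sup>+x. ?p x \<partial>lborel)"
        by (subst emeasure_density) (auto intro!: nn_integral_mono split: split_indicator)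
      then show ?thesis using fin by (auto simp: top_unique)
    qed
    show "emeasure (density lborel ?p) X = emeasure (density lborel ?n) X" if "X \<in> ?E" for X
      using that boxes by (auto simp: emeasure_density)
  qed
  then have "AE x in lborel. ?p x = ?n x"
    using finite_density_unique[of ?p lborel ?n] fin by simp
  then show ?thesis
  proof eventually_elim
    case (elim x)
    show ?case
    proof (cases "q x \<ge> 0")
      case True
      then have "ennreal (q x) = 0" using elim by (simp add: ennreal_neg)
      then show ?thesis using True by simp
    next
      case False
      then have "ennreal (- q x) = 0" using elim by (simp add: ennreal_neg)
      then show ?thesis using False by (simp add: ennreal_eq_0_iff)
    qed
  qed
qed

text \<open>The fundamental lemma of the calculus of variations. U is covered by countably many
  closed boxes, and on each of them q is cut off to the open box. The cut-off function has vanishing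
  integral over every box, because the intersection of two open boxes is an open box, and bumps on
  it are tests for U.\<close>

lemma orthogonal_to_tests_imp_AE_0:
  assumes q: "integrable lborel q" and U: "open U"
    and tests: "\<And>\<psi>. test_function U \<psi> \<Longrightarrow> (\<integral>x. q x * \<psi> x \<partial>lborel) = 0"
  shows "AE x in lborel. x \<in> U \<longrightarrow> q x = 0"
proof -
  have [measurable]: "q \<in> borel_measurable borel" using borel_measurable_integrable[OF q] by simp
  obtain D where D: "countable D" "D \<subseteq> Pow U" "\<And>X. X \<in> D \<Longrightarrow> \<exists>a b. X = cbox a b" "\<Union>D = U"
    using open_countable_Union_open_cbox[OF U] by metis
  have "AE x in lborel. x \<in> X \<longrightarrow> q x = 0" if X: "X \<in> D" for X
  proof -
    obtain a b where ab: "X = cbox a b" using D(3)[OF X] by blast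
    have sub: "cbox a b \<subseteq> U" using D X ab by auto
    have "AE x in lborel. q x * indicator (box a b) x = 0"
    proof (rule AE_zero_of_box_integrals)
      show "integrable lborel (\<lambda>x. q x * indicator (box a b) x)"
        using integrable_real_mult_indicator[OF _ q, of "box a b"] by simp
      fix c d
      obtain a' b' where eq: "box a b \<inter> box c d = box a' b'" by (simp add: box_Int_box) 
      have "(\<integral>x. q x * indicator (box a' b') x \<partial>lborel) = 0"
      proof (cases "box a' b' = {}")
        case False
        then have ne: "\<And>i. a'$i < b'$i" by (simp add: interval_ne_empty_cart)
        \<comment> \<open>A nonempty open box has the closed box as its closure, so the inclusion of
          open boxes passes to the closed ones.\<close>
        have "cbox a' b' \<subseteq> cbox a b"
          using eq ne False by (metis Int_lower1 box_subset_cbox closure_box closure_minimal closed_cbox order_trans)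
        then show ?thesis
          using sub ne by (intro orthogonal_to_tests_imp_box_integral_0[OF q _ _ tests]) (auto simp: less_imp_le)
      qed simp
      moreover have "q x * indicator (box a b) x * indicator (box c d) x = q x * indicator (box a' b') x" for x
        unfolding eq[symmetric] by (simp add: indicator_inter_arith)
      ultimately show "(\<integral>x. q x * indicator (box a b) x * indicator (box c d) x \<partial>lborel) = 0"
        by (simp only:)
    qed
    \<comment> \<open>The cover consists of closed boxes while the cut-off sees only open ones; the
      faces in between form a null set.\<close>
    moreover have "AE x in lborel. x \<notin> cbox a b - box a b"
    proof -
      have "negligible (cbox a b - box a b)" using negligible_frontier_interval[of a b] .
      then show ?thesis
        by (intro AE_not_in) (auto simp: negligible_iff_null_sets null_sets_completion_iff)
    qed
    ultimately show ?thesis unfolding ab by eventually_elim (auto split: split_indicator)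
  qed
  then have "AE x in lborel. \<forall>X\<in>D. x \<in> X \<longrightarrow> q x = 0"
    unfolding AE_ball_countable[OF D(1)] by blast
  then show ?thesis by eventually_elim (use D(4) in blast)
qed

section \<open>Lebesgue measure restricted to a domain\<close>

abbreviation lborel_on :: "'a::euclidean_space set \<Rightarrow> 'a measure" where
  "lborel_on \<Omega> \<equiv> restrict_space lborel \<Omega>"

lemma l2_space_iff: "\<Omega> \<in> sets borel \<Longrightarrow> l2_space \<Omega> f \<longleftrightarrow> square_integrable (lborel_on \<Omega>) f"
  unfolding l2_space_def square_integrable_def set_borel_measurable_def set_integrable_def
  by (simp add: borel_measurable_restrict_space_iff integrable_restrict_space)

lemma set_integral_lborel_on:
  fixes f :: "'a::euclidean_space \<Rightarrow> 'b::{banach, second_countable_topology}"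
  shows "\<Omega> \<in> sets borel \<Longrightarrow> (LINT x:\<Omega>|lborel. f x) = integral\<^sup>L (lborel_on \<Omega>) f"
  unfolding set_lebesgue_integral_def by (simp add: integral_restrict_space)

lemma l2_norm_eq: "\<Omega> \<in> sets borel \<Longrightarrow> l2_norm \<Omega> f = sqrt (\<integral>x. (norm (f x))\<^sup>2 \<partial>lborel_on \<Omega>)"
  by (simp add: l2_norm_def set_integral_lborel_on)

lemma l2_norm_sq: "\<Omega> \<in> sets borel \<Longrightarrow> (l2_norm \<Omega> f)\<^sup>2 = (\<integral>x. (norm (f x))\<^sup>2 \<partial>lborel_on \<Omega>)"
  by (simp add: l2_norm_eq)

lemma AE_lborel_on:
  "\<Omega> \<in> sets borel \<Longrightarrow> (AE x in lborel_on \<Omega>. P x) \<longleftrightarrow> (AE x in lborel. x \<in> \<Omega> \<longrightarrow> P x)"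
  by (simp add: AE_restrict_space_iff)

lemma finite_measure_lborel_on:
  assumes "\<Omega> \<in> sets borel" "bounded \<Omega>"
  shows "finite_measure (lborel_on \<Omega>)"
proof
  have "emeasure lborel \<Omega> < \<infinity>" using assms(2) by (rule emeasure_bounded_finite)
  then show "emeasure (lborel_on \<Omega>) (space (lborel_on \<Omega>)) \<noteq> \<infinity>"
    using assms by (simp add: emeasure_restrict_space space_restrict_space)
qed

lemma test_function_props:
  assumes "test_function U \<psi>"
  obtains K B where "compact K" "K \<subseteq> U" "B \<ge> 0" "\<And>x. x \<notin> K \<Longrightarrow> \<psi> x = 0"
    "\<And>i x. x \<notin> K \<Longrightarrow> partial_deriv i \<psi> x = 0" "\<And>x. \<bar>\<psi> x\<bar> \<le> B" "\<And>i x. \<bar>partial_deriv i \<psi> x\<bar> \<le> B"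
proof -
  obtain K where K: "compact K" "K \<subseteq> U" "\<And>x. x \<notin> K \<Longrightarrow> \<psi> x = 0"
    using assms unfolding test_function_def by blast
  have out: "partial_deriv i \<psi> x = 0" if "x \<notin> K" for i x
  proof -
    have "((\<lambda>x. 0) has_derivative (\<lambda>h. 0)) (at x)" by simp
    then have "(\<psi> has_derivative (\<lambda>h. 0)) (at x)"
      by (rule has_derivative_transform_within_open[of _ _ _ _ "- K"])
         (use that K compact_imp_closed in auto)
    then show ?thesis unfolding partial_deriv_def using frechet_derivative_at by metis
  qed
  have bdd: "\<exists>C\<ge>0. \<forall>x. \<bar>f x\<bar> \<le> C" if f: "continuous_on UNIV f" "\<And>x. x \<notin> K \<Longrightarrow> f x = 0" for f :: "real^2 \<Rightarrow> real"
  proof -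
    have "compact (f ` K)" using K(1) f(1) compact_continuous_image continuous_on_subset by blast
    then obtain C where "\<forall>x\<in>K. \<bar>f x\<bar> \<le> C"
      using compact_imp_bounded bounded_iff by (metis image_eqI real_norm_def)
    then have "\<bar>f x\<bar> \<le> max C 0" for x using f(2)[of x] by (cases "x \<in> K") (auto simp: le_max_iff_disj)
    then show ?thesis by (intro exI[of _ "max C 0"]) auto
  qed
  have pc: "continuous_on UNIV (partial_deriv i \<psi>)" for i using assms by (simp add: test_function_def)
  obtain C C1 C2 where C: "C \<ge> 0" "\<And>x. \<bar>\<psi> x\<bar> \<le> C" "C1 \<ge> 0" "\<And>x. \<bar>partial_deriv 1 \<psi> x\<bar> \<le> C1"
      "C2 \<ge> 0" "\<And>x. \<bar>partial_deriv 2 \<psi> x\<bar> \<le> C2"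
    using bdd[OF test_function_continuous[OF assms] K(3)] bdd[OF pc out] by metis
  have "\<bar>\<psi> x\<bar> \<le> C + C1 + C2" "\<bar>partial_deriv i \<psi> x\<bar> \<le> C + C1 + C2" for i x
    using C(2,4,6)[of x] C(1,3,5) exhaust_2[of i] by auto
  with K out C that[of K "C + C1 + C2"] show ?thesis by auto
qed

lemma test_function_partial_measurable: "test_function U \<psi> \<Longrightarrow> partial_deriv i \<psi> \<in> borel_measurable borel"
  by (intro borel_measurable_continuous_onI) (simp add: test_function_def)

lemma borel_measurable_lborel_on: "f \<in> borel_measurable borel \<Longrightarrow> f \<in> borel_measurable (lborel_on \<Omega>)"
  by (rule measurable_restrict_space1) simp

section \<open>Weak derivatives on a bounded open set\<close>

context
  fixes \<Omega> :: "(real^2) set"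
  assumes open_\<Omega>: "open \<Omega>" and bounded_\<Omega>: "bounded \<Omega>"
begin

lemma domain_measurable: "\<Omega> \<in> sets borel"
  using open_\<Omega> by simp

lemma domain_finite: "finite_measure (lborel_on \<Omega>)"
  by (rule finite_measure_lborel_on[OF domain_measurable bounded_\<Omega>])

lemma square_integrable_test:
  assumes "test_function \<Omega> \<psi>"
  shows "square_integrable (lborel_on \<Omega>) \<psi>" "square_integrable (lborel_on \<Omega>) (partial_deriv i \<psi>)"
proof -
  interpret finite_measure "lborel_on \<Omega>" by (rule domain_finite)
  obtain K B where B: "\<And>x. \<bar>\<psi> x\<bar> \<le> B" "\<And>i x. \<bar>partial_deriv i \<psi> x\<bar> \<le> B"
    using test_function_props[OF assms] by metis
  show "square_integrable (lborel_on \<Omega>) \<psi>" "square_integrable (lborel_on \<Omega>) (partial_deriv i \<psi>)"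
    using B test_function_measurable[OF assms] test_function_partial_measurable[OF assms]
    by (auto intro!: borel_measurable_lborel_on square_integrable_bound[OF square_integrable_const[of "1::real"], of _ B])
qed

lemma has_weak_partial_iff:
  "has_weak_partial \<Omega> i f g \<longleftrightarrow> square_integrable (lborel_on \<Omega>) f \<and> square_integrable (lborel_on \<Omega>) g \<and>
     (\<forall>\<psi>. test_function \<Omega> \<psi> \<longrightarrow>
        (\<integral>x. f x * partial_deriv i \<psi> x \<partial>lborel_on \<Omega>) = - (\<integral>x. g x * \<psi> x \<partial>lborel_on \<Omega>))"
  unfolding has_weak_partial_def
  by (simp add: l2_space_iff[OF domain_measurable] set_integral_lborel_on[OF domain_measurable])

lemma has_weak_partial_comb:
  assumes "has_weak_partial \<Omega> i f g" "has_weak_partial \<Omega> i f' g'"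
  shows "has_weak_partial \<Omega> i (\<lambda>x. f x + c * f' x) (\<lambda>x. g x + c * g' x)"
  unfolding has_weak_partial_iff
proof (intro conjI allI impI)
  have si: "square_integrable (lborel_on \<Omega>) f" "square_integrable (lborel_on \<Omega>) g"
    "square_integrable (lborel_on \<Omega>) f'" "square_integrable (lborel_on \<Omega>) g'"
    using assms by (auto simp: has_weak_partial_iff)
  show "square_integrable (lborel_on \<Omega>) (\<lambda>x. f x + c * f' x)"
    "square_integrable (lborel_on \<Omega>) (\<lambda>x. g x + c * g' x)"
    using square_integrable_comb[OF si(1,3), of c] square_integrable_comb[OF si(2,4), of c] by simp_all
  fix \<psi> assume \<psi>: "test_function \<Omega> \<psi>"
  note int = square_integrable_mult[OF _ square_integrable_test(2)[OF \<psi>, of i]]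
    square_integrable_mult[OF _ square_integrable_test(1)[OF \<psi>]]
  have "(\<integral>x. (f x + c * f' x) * partial_deriv i \<psi> x \<partial>lborel_on \<Omega>) =
      (\<integral>x. f x * partial_deriv i \<psi> x + c * (f' x * partial_deriv i \<psi> x) \<partial>lborel_on \<Omega>)"
    by (simp add: algebra_simps)
  also have "\<dots> = (\<integral>x. f x * partial_deriv i \<psi> x \<partial>lborel_on \<Omega>) + c * (\<integral>x. f' x * partial_deriv i \<psi> x \<partial>lborel_on \<Omega>)"
    using int si by (subst Bochner_Integration.integral_add) auto
  also have "\<dots> = - ((\<integral>x. g x * \<psi> x \<partial>lborel_on \<Omega>) + c * (\<integral>x. g' x * \<psi> x \<partial>lborel_on \<Omega>))"
    using assms \<psi> by (simp add: has_weak_partial_iff)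
  also have "\<dots> = - (\<integral>x. g x * \<psi> x + c * (g' x * \<psi> x) \<partial>lborel_on \<Omega>)"
    using int si by (subst Bochner_Integration.integral_add) auto
  also have "\<dots> = - (\<integral>x. (g x + c * g' x) * \<psi> x \<partial>lborel_on \<Omega>)" by (simp add: algebra_simps)
  finally show "(\<integral>x. (f x + c * f' x) * partial_deriv i \<psi> x \<partial>lborel_on \<Omega>) =
      - (\<integral>x. (g x + c * g' x) * \<psi> x \<partial>lborel_on \<Omega>)" .
qed

text \<open>The difference of two candidates, extended by zero, is orthogonal to all test
  functions.\<close>

lemma has_weak_partial_unique:
  assumes "has_weak_partial \<Omega> i f g" "has_weak_partial \<Omega> i f g'"
  shows "AE x in lborel_on \<Omega>. g x = g' x"
proof -
  interpret finite_measure "lborel_on \<Omega>" by (rule domain_finite)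
  have si: "square_integrable (lborel_on \<Omega>) g" "square_integrable (lborel_on \<Omega>) g'"
    using assms by (auto simp: has_weak_partial_iff)
  define q where "q x = indicator \<Omega> x *\<^sub>R (g x - g' x)" for x
  have "integrable (lborel_on \<Omega>) (\<lambda>x. g x - g' x)"
    by (rule square_integrable_integrable_L1[OF square_integrable_diff[OF si]])
  then have q: "integrable lborel q" unfolding q_def by (simp add: integrable_restrict_space domain_measurable)
  have "AE x in lborel. x \<in> \<Omega> \<longrightarrow> q x = 0"
  proof (rule orthogonal_to_tests_imp_AE_0[OF q open_\<Omega>])
    fix \<psi> assume \<psi>: "test_function \<Omega> \<psi>"
    note int = square_integrable_mult[OF si(1) square_integrable_test(1)[OF \<psi>]]
      square_integrable_mult[OF si(2) square_integrable_test(1)[OF \<psi>]]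
    have "(\<integral>x. g x * \<psi> x \<partial>lborel_on \<Omega>) = (\<integral>x. g' x * \<psi> x \<partial>lborel_on \<Omega>)"
      using assms \<psi> unfolding has_weak_partial_iff by fastforce
    then have "0 = (\<integral>x. (g x - g' x) * \<psi> x \<partial>lborel_on \<Omega>)"
      using int by (simp add: left_diff_distrib)
    also have "\<dots> = (\<integral>x. q x * \<psi> x \<partial>lborel)"
      by (simp add: integral_restrict_space domain_measurable q_def mult.assoc)
    finally show "(\<integral>x. q x * \<psi> x \<partial>lborel) = 0" by simp
  qed
  then show ?thesis unfolding AE_lborel_on[OF domain_measurable]
    by eventually_elim (auto simp: q_def)
qed

lemma has_weak_partial_weak_partial: "h1_space \<Omega> f \<Longrightarrow> has_weak_partial \<Omega> i f (weak_partial \<Omega> i f)"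
  unfolding weak_partial_def h1_space_def by (metis someI_ex)

text \<open>Carries any computed weak derivative over to the representative that
  \<open>weak_partial\<close> chooses.\<close>

lemma weak_partial_AE_eq:
  assumes "has_weak_partial \<Omega> i f g"
  shows "AE x in lborel_on \<Omega>. weak_partial \<Omega> i f x = g x"
proof (rule has_weak_partial_unique[OF _ assms])
  show "has_weak_partial \<Omega> i f (weak_partial \<Omega> i f)"
    unfolding weak_partial_def using someI[of "has_weak_partial \<Omega> i f", OF assms] .
qed

lemma h1_space_comb:
  assumes "h1_space \<Omega> f" "h1_space \<Omega> f'"
  shows "h1_space \<Omega> (\<lambda>x. f x + c * f' x)"
proof -
  have "has_weak_partial \<Omega> i (\<lambda>x. f x + c * f' x)
      (\<lambda>x. weak_partial \<Omega> i f x + c * weak_partial \<Omega> i f' x)" for i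
    by (intro has_weak_partial_comb has_weak_partial_weak_partial assms)
  then show ?thesis unfolding h1_space_def has_weak_partial_def by blast
qed

lemma weak_partial_comb:
  assumes "h1_space \<Omega> f" "h1_space \<Omega> f'"
  shows "AE x in lborel_on \<Omega>. weak_partial \<Omega> i (\<lambda>x. f x + c * f' x) x =
    weak_partial \<Omega> i f x + c * weak_partial \<Omega> i f' x"
  by (intro weak_partial_AE_eq has_weak_partial_comb has_weak_partial_weak_partial assms)

lemma h1_square_integrable:
  assumes "h1_space \<Omega> f"
  shows "square_integrable (lborel_on \<Omega>) f" "square_integrable (lborel_on \<Omega>) (weak_partial \<Omega> i f)"
  using has_weak_partial_weak_partial[OF assms, of i] by (auto simp: has_weak_partial_iff)

lemma h1_spaceI: "(\<And>i. has_weak_partial \<Omega> i f (g i)) \<Longrightarrow> h1_space \<Omega> f"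
  unfolding h1_space_def has_weak_partial_def by blast

lemma h1_norm_sq:
  "(h1_norm \<Omega> f)\<^sup>2 = (\<integral>x. (f x)\<^sup>2 \<partial>lborel_on \<Omega>) + (\<Sum>i\<in>UNIV. \<integral>x. (weak_partial \<Omega> i f x)\<^sup>2 \<partial>lborel_on \<Omega>)"
  unfolding h1_norm_def by (simp add: l2_norm_sq[OF domain_measurable] sum_nonneg)

lemma h1_norm_nonneg: "h1_norm \<Omega> f \<ge> 0"
  unfolding h1_norm_def by (simp add: sum_nonneg)

text \<open>For squares the factor 2 plays the part of the triangle inequality; it serves to prove
  convergence to 0.\<close>

lemma h1_norm_add_le:
  assumes "h1_space \<Omega> f" "h1_space \<Omega> g"
  shows "(h1_norm \<Omega> (\<lambda>x. f x + g x))\<^sup>2 \<le> 2 * (h1_norm \<Omega> f)\<^sup>2 + 2 * (h1_norm \<Omega> g)\<^sup>2"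
proof -
  let ?M = "lborel_on \<Omega>"
  have "(\<integral>x. (weak_partial \<Omega> i (\<lambda>x. f x + g x) x)\<^sup>2 \<partial>?M) \<le>
      2 * (\<integral>x. (weak_partial \<Omega> i f x)\<^sup>2 \<partial>?M) + 2 * (\<integral>x. (weak_partial \<Omega> i g x)\<^sup>2 \<partial>?M)" for i
  proof -
    have "(\<integral>x. (weak_partial \<Omega> i (\<lambda>x. f x + g x) x)\<^sup>2 \<partial>?M) =
        (\<integral>x. (weak_partial \<Omega> i f x + weak_partial \<Omega> i g x)\<^sup>2 \<partial>?M)"
    proof (rule integral_cong_AE)
      show "AE x in ?M. (weak_partial \<Omega> i (\<lambda>x. f x + g x) x)\<^sup>2 = (weak_partial \<Omega> i f x + weak_partial \<Omega> i g x)\<^sup>2"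
        using weak_partial_comb[OF assms, of i 1] by eventually_elim simp
      have "h1_space \<Omega> (\<lambda>x. f x + g x)" using h1_space_comb[OF assms, of 1] by simp
      from h1_square_integrable(2)[OF this, of i] h1_square_integrable(2)[OF assms(1), of i]
        h1_square_integrable(2)[OF assms(2), of i]
      show "(\<lambda>x. (weak_partial \<Omega> i (\<lambda>x. f x + g x) x)\<^sup>2) \<in> borel_measurable ?M"
        "(\<lambda>x. (weak_partial \<Omega> i f x + weak_partial \<Omega> i g x)\<^sup>2) \<in> borel_measurable ?M"
        by (auto dest!: square_integrable_measurable)
    qed
    then show ?thesis
      using integral_norm_sq_add_le[OF h1_square_integrable(2)[OF assms(1), of i] h1_square_integrable(2)[OF assms(2), of i]]
      by simp
  qed
  then have "(\<Sum>i\<in>UNIV. \<integral>x. (weak_partial \<Omega> i (\<lambda>x. f x + g x) x)\<^sup>2 \<partial>?M) \<le>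
      (\<Sum>i\<in>UNIV. 2 * (\<integral>x. (weak_partial \<Omega> i f x)\<^sup>2 \<partial>?M) + 2 * (\<integral>x. (weak_partial \<Omega> i g x)\<^sup>2 \<partial>?M))"
    by (intro sum_mono)
  moreover have "(\<integral>x. (f x + g x)\<^sup>2 \<partial>?M) \<le> 2 * (\<integral>x. (f x)\<^sup>2 \<partial>?M) + 2 * (\<integral>x. (g x)\<^sup>2 \<partial>?M)"
    using integral_norm_sq_add_le[OF h1_square_integrable(1)[OF assms(1)] h1_square_integrable(1)[OF assms(2)]] by simp
  ultimately show ?thesis unfolding h1_norm_sq
    by (simp add: sum.distrib sum_distrib_left[symmetric] algebra_simps)
qed

text \<open>Differentiation is a closed operator: both sides of the defining identity are L^2
  pairings with a fixed test function and pass to the limit.\<close>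

lemma has_weak_partial_limit:
  assumes "\<And>n. has_weak_partial \<Omega> i (f n) (g n)"
    and "square_integrable (lborel_on \<Omega>) f0" "square_integrable (lborel_on \<Omega>) g0"
    and f: "(\<lambda>n. \<integral>x. (f n x - f0 x)\<^sup>2 \<partial>lborel_on \<Omega>) \<longlonglongrightarrow> 0"
    and g: "(\<lambda>n. \<integral>x. (g n x - g0 x)\<^sup>2 \<partial>lborel_on \<Omega>) \<longlonglongrightarrow> 0"
  shows "has_weak_partial \<Omega> i f0 g0"
  unfolding has_weak_partial_iff
proof (intro conjI allI impI assms)
  fix \<psi> assume \<psi>: "test_function \<Omega> \<psi>"
  have si: "square_integrable (lborel_on \<Omega>) (f n)" "square_integrable (lborel_on \<Omega>) (g n)" for n
    using assms(1)[of n] by (auto simp: has_weak_partial_iff)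
  have "(\<lambda>n. \<integral>x. f n x \<bullet> partial_deriv i \<psi> x \<partial>lborel_on \<Omega>) \<longlonglongrightarrow> (\<integral>x. f0 x \<bullet> partial_deriv i \<psi> x \<partial>lborel_on \<Omega>)"
    by (rule integral_tendsto_inner[OF si(1) assms(2) square_integrable_test(2)[OF \<psi>]]) (use f in simp)
  moreover have "(\<lambda>n. - (\<integral>x. g n x \<bullet> \<psi> x \<partial>lborel_on \<Omega>)) \<longlonglongrightarrow> - (\<integral>x. g0 x \<bullet> \<psi> x \<partial>lborel_on \<Omega>)"
    by (intro tendsto_minus integral_tendsto_inner[OF si(2) assms(3) square_integrable_test(1)[OF \<psi>]]) (use g in simp)
  moreover have "(\<integral>x. f n x \<bullet> partial_deriv i \<psi> x \<partial>lborel_on \<Omega>) = - (\<integral>x. g n x \<bullet> \<psi> x \<partial>lborel_on \<Omega>)" for n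
    using assms(1)[of n] \<psi> by (simp add: has_weak_partial_iff)
  ultimately show "(\<integral>x. f0 x * partial_deriv i \<psi> x \<partial>lborel_on \<Omega>) = - (\<integral>x. g0 x * \<psi> x \<partial>lborel_on \<Omega>)"
    using LIMSEQ_unique by fastforce
qed

end

section \<open>Translations and Lipschitz multipliers\<close>

lemma lborel_integral_shift:
  fixes f :: "'a::euclidean_space \<Rightarrow> 'b::{banach, second_countable_topology}"
  shows "f \<in> borel_measurable borel \<Longrightarrow> (\<integral>x. f (x + c) \<partial>lborel) = (\<integral>x. f x \<partial>lborel)"
  by (subst (2) lborel_distr_plus[of c, symmetric], subst integral_distr) (auto simp: add.commute)

lemma lborel_integrable_shift:
  fixes f :: "'a::euclidean_space \<Rightarrow> 'b::{banach, second_countable_topology}"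
  assumes "integrable lborel f"
  shows "integrable lborel (\<lambda>x. f (x + c))"
proof -
  have "f \<in> borel_measurable borel" using borel_measurable_integrable[OF assms] by simp
  moreover have "integrable (distr lborel borel ((+) c)) f" using assms by (simp add: lborel_distr_plus)
  ultimately show ?thesis by (subst (asm) integrable_distr_eq) (auto simp: add.commute)
qed

lemma lborel_nn_integral_shift:
  fixes f :: "'a::euclidean_space \<Rightarrow> ennreal"
  shows "f \<in> borel_measurable borel \<Longrightarrow> (\<integral>\<^sup>+x. f (x + c) \<partial>lborel) = (\<integral>\<^sup>+x. f x \<partial>lborel)"
  by (subst (2) lborel_distr_plus[of c, symmetric], subst nn_integral_distr) (auto simp: add.commute)

lemma integrable_mult_bounded:
  fixes u w :: "'a::euclidean_space \<Rightarrow> real"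
  assumes u: "integrable lborel u" and w: "w \<in> borel_measurable borel" "\<And>x. \<bar>w x\<bar> \<le> C"
  shows "integrable lborel (\<lambda>x. u x * w x)"
proof (rule Bochner_Integration.integrable_bound)
  show "integrable lborel (\<lambda>x. C * u x)" using u by simp
  show "(\<lambda>x. u x * w x) \<in> borel_measurable lborel"
    using w borel_measurable_integrable[OF u] by simp
  have "C \<ge> 0" using w(2)[of 0] by linarith
  moreover have "\<bar>u x\<bar> * \<bar>w x\<bar> \<le> \<bar>u x\<bar> * C" for x by (rule mult_left_mono[OF w(2)]) simp
  ultimately show "AE x in lborel. norm (u x * w x) \<le> norm (C * u x)"
    by (intro AE_I2) (auto simp: abs_mult mult.commute)
qed

abbreviation unit_interval :: "real measure" where
  "unit_interval \<equiv> lborel_on {0..1}"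

lemma finite_measure_unit_interval: "finite_measure unit_interval"
  by (rule finite_measure_lborel_on) auto

lemma pair_sigma_finite_unit_interval:
  "pair_sigma_finite unit_interval (lborel :: 'a::euclidean_space measure)"
  using finite_measure.axioms(1)[OF finite_measure_unit_interval] sigma_finite_lborel
  by (simp add: pair_sigma_finite_def)

text \<open>The function is composed with the identity, which is measurable from the product with
  the restricted interval into the Borel product space.\<close>

lemma measurable_unit_interval_pair:
  fixes f :: "real \<times> 'a::euclidean_space \<Rightarrow> 'b::topological_space"
  assumes "f \<in> borel_measurable borel"
  shows "f \<in> borel_measurable (unit_interval \<Otimes>\<^sub>M (lborel :: 'a measure))"
proof -
  have "f \<in> borel_measurable (borel \<Otimes>\<^sub>M borel)" using assms by (simp add: borel_prod)
  moreover have "(\<lambda>p. p) \<in> measurable (unit_interval \<Otimes>\<^sub>M (lborel :: 'a measure)) (borel \<Otimes>\<^sub>M borel)"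
  proof (rule measurable_pair)
    have "fst \<in> measurable (unit_interval \<Otimes>\<^sub>M (lborel :: 'a measure)) unit_interval" by simp
    then have "fst \<in> measurable (unit_interval \<Otimes>\<^sub>M (lborel :: 'a measure)) borel"
      by (rule measurable_compose[of _ _ _ "\<lambda>x. x"]) (intro measurable_restrict_space1, simp)
    then show "fst \<circ> (\<lambda>p. p) \<in> measurable (unit_interval \<Otimes>\<^sub>M (lborel :: 'a measure)) borel" by (simp add: comp_def)
    have "snd \<in> measurable (unit_interval \<Otimes>\<^sub>M (lborel :: 'a measure)) (lborel :: 'a measure)" by simp
    then show "snd \<circ> (\<lambda>p. p) \<in> measurable (unit_interval \<Otimes>\<^sub>M (lborel :: 'a measure)) borel" by (simp add: comp_def)
  qed
  ultimately show ?thesis using measurable_compose by blast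
qed

text \<open>Prepares the exchanges of integration order below. By translation invariance the L^1
  norm in x is the same for every t, hence integrable over the unit interval; the bounded factor
  \<psi> costs a constant.\<close>

lemma integrable_along_translations:
  fixes f :: "'a::euclidean_space \<Rightarrow> real"
  assumes f: "integrable lborel f" and \<psi>: "\<psi> \<in> borel_measurable borel" "\<And>x. \<bar>\<psi> x\<bar> \<le> B"
  shows "integrable (unit_interval \<Otimes>\<^sub>M lborel) (\<lambda>(t, x). f (x + t *\<^sub>R h) * \<psi> x)"
proof -
  interpret pair_sigma_finite unit_interval "lborel :: 'a measure" by (rule pair_sigma_finite_unit_interval)
  interpret U: finite_measure unit_interval by (rule finite_measure_unit_interval)
  have [measurable]: "f \<in> borel_measurable borel" using borel_measurable_integrable[OF f] by simp
  note [measurable] = \<psi>(1)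
  have B: "B \<ge> 0" using \<psi>(2)[of 0] by linarith
  have "(\<lambda>(t, x). f (x + t *\<^sub>R h)) \<in> borel_measurable borel"
    unfolding borel_prod[symmetric] by measurable
  then have "integrable (unit_interval \<Otimes>\<^sub>M lborel) (\<lambda>(t, x). f (x + t *\<^sub>R h))"
  proof (intro Fubini_integrable measurable_unit_interval_pair)
    have "(\<integral>x. norm (f (x + t *\<^sub>R h)) \<partial>lborel) = (\<integral>x. norm (f x) \<partial>lborel)" for t
      by (rule lborel_integral_shift) measurable
    then show "integrable unit_interval (\<lambda>t. \<integral>x. norm (case (t, x) of (t, x) \<Rightarrow> f (x + t *\<^sub>R h)) \<partial>lborel)"
      by simp
    show "AE t in unit_interval. integrable lborel (\<lambda>x. case (t, x) of (t, x) \<Rightarrow> f (x + t *\<^sub>R h))"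
      using lborel_integrable_shift[OF f] by simp
  qed
  then have "integrable (unit_interval \<Otimes>\<^sub>M lborel) (\<lambda>p. B * (case p of (t, x) \<Rightarrow> f (x + t *\<^sub>R h)))" by simp
  then show ?thesis
  proof (rule Bochner_Integration.integrable_bound)
    have "(\<lambda>(t, x). f (x + t *\<^sub>R h) * \<psi> x) \<in> borel_measurable borel"
      unfolding borel_prod[symmetric] by measurable
    then show "(\<lambda>(t, x). f (x + t *\<^sub>R h) * \<psi> x) \<in> borel_measurable (unit_interval \<Otimes>\<^sub>M lborel)"
      by (rule measurable_unit_interval_pair)
    have "\<bar>f (x + t *\<^sub>R h)\<bar> * \<bar>\<psi> x\<bar> \<le> B * \<bar>f (x + t *\<^sub>R h)\<bar>" for t x
      using mult_left_mono[OF \<psi>(2)[of x], of "\<bar>f (x + t *\<^sub>R h)\<bar>"] by (simp add: mult.commute)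
    then show "AE p in unit_interval \<Otimes>\<^sub>M lborel. norm (case p of (t, x) \<Rightarrow> f (x + t *\<^sub>R h) * \<psi> x) \<le>
        norm (B * (case p of (t, x) \<Rightarrow> f (x + t *\<^sub>R h)))"
      using B by (intro AE_I2) (auto simp: abs_mult)
  qed
qed

lemma test_function_shift:
  assumes "test_function U \<psi>" "\<And>x. x \<in> U \<Longrightarrow> x + c \<in> \<Omega>"
  shows "test_function \<Omega> (\<lambda>x. \<psi> (x - c))" "partial_deriv i (\<lambda>x. \<psi> (x - c)) x = partial_deriv i \<psi> (x - c)"
proof -
  obtain K where K: "compact K" "K \<subseteq> U" "\<And>x. x \<notin> K \<Longrightarrow> \<psi> x = 0"
    using assms(1) unfolding test_function_def by blast
  have \<psi>: "(\<psi> has_derivative frechet_derivative \<psi> (at x)) (at x)" for x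
    using assms(1) by (simp add: test_function_def frechet_derivative_works)
  have D: "((\<lambda>x. \<psi> (x - c)) has_derivative frechet_derivative \<psi> (at (x - c))) (at x)" for x
  proof -
    have "((\<lambda>x. x - c) has_derivative (\<lambda>h. h)) (at x)" by (auto intro!: derivative_eq_intros)
    from has_derivative_compose[OF this \<psi>] show ?thesis .
  qed
  show pd: "partial_deriv i (\<lambda>x. \<psi> (x - c)) x = partial_deriv i \<psi> (x - c)" for i x
    unfolding partial_deriv_def using frechet_derivative_at[OF D] by metis
  show "test_function \<Omega> (\<lambda>x. \<psi> (x - c))"
  proof (rule test_functionI[OF D])
    show "continuous_on UNIV (\<lambda>x. frechet_derivative \<psi> (at (x - c)) (axis i 1))" for i
    proof -
      have "continuous_on UNIV (partial_deriv i \<psi>)" using assms(1) by (simp add: test_function_def)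
      then have "continuous_on UNIV (\<lambda>x. partial_deriv i \<psi> (x - c))"
        by (rule continuous_on_compose2) (auto intro!: continuous_intros)
      then show ?thesis by (simp add: partial_deriv_def)
    qed
    show "compact ((\<lambda>x. x + c) ` K)" using K(1) compact_translation[of K c] by (simp add: add.commute)
    show "(\<lambda>x. x + c) ` K \<subseteq> \<Omega>" using K(2) assms(2) by auto
    show "\<psi> (x - c) = 0" if "x \<notin> (\<lambda>x. x + c) ` K" for x
      using that K(3)[of "x - c"] by (metis diff_add_cancel image_eqI)
  qed
qed

lemma test_function_FTC:
  assumes "test_function U \<psi>"
  shows "(\<integral>t. (\<Sum>i\<in>UNIV. h$i * partial_deriv i \<psi> (y - t *\<^sub>R h)) \<partial>unit_interval) = \<psi> y - \<psi> (y - h)"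
proof -
  have \<psi>: "(\<psi> has_derivative frechet_derivative \<psi> (at x)) (at x)" for x
    using assms by (simp add: test_function_def frechet_derivative_works)
  have dir: "frechet_derivative \<psi> (at x) h = (\<Sum>i\<in>UNIV. h$i * partial_deriv i \<psi> x)" for x
  proof -
    have lin: "linear (frechet_derivative \<psi> (at x))" using \<psi> has_derivative_linear by blast
    have "frechet_derivative \<psi> (at x) h = frechet_derivative \<psi> (at x) (\<Sum>i\<in>UNIV. h$i *\<^sub>R axis i 1)"
      using basis_expansion[of h] by (simp add: scalar_mult_eq_scaleR)
    then show ?thesis using lin by (simp add: linear_sum linear_scale partial_deriv_def)
  qed
  \<comment> \<open>-\<psi>(y - t h) is an antiderivative of the integrand in t, and its values at 1
    and 0 differ by \<psi>(y) - \<psi>(y - h).\<close>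
  have DERIV: "((\<lambda>t. - \<psi> (y - t *\<^sub>R h)) has_real_derivative (\<Sum>i\<in>UNIV. h$i * partial_deriv i \<psi> (y - t *\<^sub>R h))) (at t)" for t
  proof -
    have "((\<lambda>t. y - t *\<^sub>R h) has_derivative (\<lambda>s. - (s *\<^sub>R h))) (at t)" by (auto intro!: derivative_eq_intros)
    from has_derivative_minus[OF has_derivative_compose[OF this \<psi>]]
    have "((\<lambda>t. - \<psi> (y - t *\<^sub>R h)) has_derivative (\<lambda>s. - frechet_derivative \<psi> (at (y - t *\<^sub>R h)) (- (s *\<^sub>R h)))) (at t)" .
    moreover have "- frechet_derivative \<psi> (at x) (- (s *\<^sub>R h)) = (\<Sum>i\<in>UNIV. h$i * partial_deriv i \<psi> x) * s" for x s
      using has_derivative_linear[OF \<psi>[of x]] dir[of x] by (simp add: linear_neg linear_scale)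
    ultimately show ?thesis by (simp add: has_field_derivative_def)
  qed
  have pc: "continuous_on UNIV (partial_deriv i \<psi>)" for i using assms by (simp add: test_function_def)
  have "isCont (\<lambda>t. \<Sum>i\<in>UNIV. h$i * partial_deriv i \<psi> (y - t *\<^sub>R h)) t" for t
  proof -
    have "continuous_on UNIV (\<lambda>t. \<Sum>i\<in>UNIV. h$i * partial_deriv i \<psi> (y - t *\<^sub>R h))"
      by (intro continuous_intros continuous_on_compose2[OF pc]) auto
    then show ?thesis by (simp add: continuous_on_eq_continuous_at)
  qed
  from integral_FTC_Icc_real[OF _ DERIV this, of 0 1]
  show ?thesis by (simp add: integral_restrict_space mult.commute)
qed

text \<open>Testing with \<open>\<psi>\<close> and shifting all translations onto the test function turns the identity
  into the fundamental theorem of calculus for \<open>\<psi>\<close>.\<close>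

lemma weak_derivative_translation:
  assumes \<Omega>: "open \<Omega>" "bounded \<Omega>" and f: "\<And>i. has_weak_partial \<Omega> i f (g i)"
    and U: "open U" "\<And>x t. x \<in> U \<Longrightarrow> 0 \<le> t \<Longrightarrow> t \<le> 1 \<Longrightarrow> x + t *\<^sub>R h \<in> \<Omega>"
  shows "AE x in lborel. x \<in> U \<longrightarrow> indicator \<Omega> (x + h) * f (x + h) - indicator \<Omega> x * f x =
    (\<integral>t. (\<Sum>i\<in>UNIV. h$i * (indicator \<Omega> (x + t *\<^sub>R h) * g i (x + t *\<^sub>R h))) \<partial>unit_interval)"
proof -
  interpret P: pair_sigma_finite unit_interval "lborel :: (real^2) measure" by (rule pair_sigma_finite_unit_interval)
  interpret fin: finite_measure "lborel_on \<Omega>" by (rule domain_finite[OF \<Omega>])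
  note meas\<Omega> = domain_measurable[OF \<Omega>]
  \<comment> \<open>Extension by zero turns all integrals into integrals over the plane, so that
    translations do not change the domain of integration.\<close>
  define F where "F x = indicator \<Omega> x * f x" for x
  define G where "G i x = indicator \<Omega> x * g i x" for i x
  define D where "D x = (\<Sum>i\<in>UNIV. h$i * G i x)" for x
  have si: "square_integrable (lborel_on \<Omega>) f" "square_integrable (lborel_on \<Omega>) (g i)" for i
    using f by (auto simp: has_weak_partial_iff[OF \<Omega>])
  have F: "integrable lborel F" and G: "integrable lborel (G i)" for i
    using fin.square_integrable_integrable_L1[OF si(1)] fin.square_integrable_integrable_L1[OF si(2)]
    unfolding F_def G_def by (auto simp: integrable_restrict_space meas\<Omega>)
  have D: "integrable lborel D" unfolding D_def using G by (intro Bochner_Integration.integrable_sum) auto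
  have [measurable]: "F \<in> borel_measurable borel" "D \<in> borel_measurable borel" "G i \<in> borel_measurable borel" for i
    using borel_measurable_integrable[OF F] borel_measurable_integrable[OF D] borel_measurable_integrable[OF G[of i]] by simp_all
  define I where "I x = (\<integral>t. D (x + t *\<^sub>R h) \<partial>unit_interval)" for x
  have Dt: "integrable (unit_interval \<Otimes>\<^sub>M lborel) (\<lambda>(t, x). D (x + t *\<^sub>R h) * \<psi> x)"
    if "\<psi> \<in> borel_measurable borel" "\<And>x. \<bar>\<psi> x\<bar> \<le> B" for \<psi> B
    by (rule integrable_along_translations[OF D that])
  have I: "integrable lborel I"
    using P.integrable_snd[OF Dt[of "\<lambda>_. 1" 1]] unfolding I_def by simp
  \<comment> \<open>The defect of the claimed identity. It is integrable over the plane, so it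
    vanishes almost everywhere on \<open>U\<close> once it is orthogonal to the test functions of
    \<open>U\<close>.\<close>
  define Q where "Q x = F (x + h) - F x - I x" for x
  have Q: "integrable lborel Q" unfolding Q_def
    by (intro Bochner_Integration.integrable_diff lborel_integrable_shift F I)
  have "AE x in lborel. x \<in> U \<longrightarrow> Q x = 0"
  proof (rule orthogonal_to_tests_imp_AE_0[OF Q U(1)])
    fix \<psi> assume \<psi>: "test_function U \<psi>"
    obtain K B where K: "compact K" "K \<subseteq> U" "B \<ge> 0" "\<And>x. x \<notin> K \<Longrightarrow> \<psi> x = 0"
      "\<And>x. \<bar>\<psi> x\<bar> \<le> B" "\<And>i x. \<bar>partial_deriv i \<psi> x\<bar> \<le> B"
      using test_function_props[OF \<psi>] by metis
    note [measurable] = test_function_measurable[OF \<psi>] test_function_partial_measurable[OF \<psi>]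
    have shifted: "(\<integral>x. u (x + c) * \<psi> x \<partial>lborel) = (\<integral>y. u y * \<psi> (y - c) \<partial>lborel)"
      if [measurable]: "u \<in> borel_measurable borel" for u c
      using lborel_integral_shift[of "\<lambda>y. u y * \<psi> (y - c)" c] by simp
    have IQ: "(\<integral>x. I x * \<psi> x \<partial>lborel) = - (\<integral>y. F y * (\<psi> y - \<psi> (y - h)) \<partial>lborel)"
    proof -
      have "(\<integral>x. I x * \<psi> x \<partial>lborel) = (\<integral>x. (\<integral>t. D (x + t *\<^sub>R h) * \<psi> x \<partial>unit_interval) \<partial>lborel)"
        by (simp add: I_def)
      also have "\<dots> = (\<integral>t. (\<integral>x. D (x + t *\<^sub>R h) * \<psi> x \<partial>lborel) \<partial>unit_interval)"
        by (rule P.Fubini_integral) (rule Dt; use K in measurable)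
      also have "\<dots> = (\<integral>t. - (\<integral>y. F y * (\<Sum>i\<in>UNIV. h$i * partial_deriv i \<psi> (y - t *\<^sub>R h)) \<partial>lborel) \<partial>unit_interval)"
      proof (rule Bochner_Integration.integral_cong[OF refl])
        fix t assume "t \<in> space unit_interval"
        then have t: "0 \<le> t" "t \<le> 1" by (auto simp: space_restrict_space)
        \<comment> \<open>The condition on \<open>U\<close> keeps the support of the shifted test
          function inside \<Omega>, so the definition of the weak derivative applies to it.\<close>
        note shift = test_function_shift[OF \<psi> U(2)[OF _ t]]
        have [measurable]: "(\<lambda>y. \<psi> (y - t *\<^sub>R h)) \<in> borel_measurable borel"
          "(\<lambda>y. partial_deriv i \<psi> (y - t *\<^sub>R h)) \<in> borel_measurable borel" for i by measurable
        have "(\<integral>x. D (x + t *\<^sub>R h) * \<psi> x \<partial>lborel) = (\<integral>y. D y * \<psi> (y - t *\<^sub>R h) \<partial>lborel)"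
          by (rule shifted) measurable
        also have "\<dots> = (\<integral>y. (\<Sum>i\<in>UNIV. h$i * (G i y * \<psi> (y - t *\<^sub>R h))) \<partial>lborel)"
          by (simp add: D_def sum_distrib_right mult.assoc)
        also have "\<dots> = (\<Sum>i\<in>UNIV. h$i * (\<integral>y. G i y * \<psi> (y - t *\<^sub>R h) \<partial>lborel))"
          using integrable_mult_bounded[OF G, of "\<lambda>y. \<psi> (y - t *\<^sub>R h)" B] K
          by (subst Bochner_Integration.integral_sum) auto
        also have "\<dots> = (\<Sum>i\<in>UNIV. h$i * - (\<integral>y. F y * partial_deriv i \<psi> (y - t *\<^sub>R h) \<partial>lborel))"
        proof (intro sum.cong refl arg_cong2[of _ _ _ _ "(*)"])
          fix i
          have "(\<integral>y. f y * partial_deriv i (\<lambda>y. \<psi> (y - t *\<^sub>R h)) y \<partial>lborel_on \<Omega>) =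
              - (\<integral>y. g i y * \<psi> (y - t *\<^sub>R h) \<partial>lborel_on \<Omega>)"
            using f[of i] shift(1) unfolding has_weak_partial_iff[OF \<Omega>] by blast
          then show "(\<integral>y. G i y * \<psi> (y - t *\<^sub>R h) \<partial>lborel) = - (\<integral>y. F y * partial_deriv i \<psi> (y - t *\<^sub>R h) \<partial>lborel)"
            using shift(2)[of i]
            by (simp add: integral_restrict_space meas\<Omega> F_def G_def mult.assoc)
        qed
        also have "\<dots> = - (\<Sum>i\<in>UNIV. \<integral>y. F y * (h$i * partial_deriv i \<psi> (y - t *\<^sub>R h)) \<partial>lborel)"
        proof -
          have "(\<integral>y. F y * (h$i * partial_deriv i \<psi> (y - t *\<^sub>R h)) \<partial>lborel) =
              h$i * (\<integral>y. F y * partial_deriv i \<psi> (y - t *\<^sub>R h) \<partial>lborel)" for i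
            unfolding integral_mult_right_zero[symmetric] by (simp add: ac_simps)
          then show ?thesis by (simp add: sum_negf)
        qed
        also have "\<dots> = - (\<integral>y. F y * (\<Sum>i\<in>UNIV. h$i * partial_deriv i \<psi> (y - t *\<^sub>R h)) \<partial>lborel)"
          unfolding sum_distrib_left
        proof (subst Bochner_Integration.integral_sum)
          fix i
          show "integrable lborel (\<lambda>y. F y * (h$i * partial_deriv i \<psi> (y - t *\<^sub>R h)))"
            by (rule integrable_mult_bounded[OF F, of _ "\<bar>h$i\<bar> * B"]) (use K in \<open>auto simp: abs_mult intro: mult_left_mono\<close>)
        qed simp
        finally show "(\<integral>x. D (x + t *\<^sub>R h) * \<psi> x \<partial>lborel) =
            - (\<integral>y. F y * (\<Sum>i\<in>UNIV. h$i * partial_deriv i \<psi> (y - t *\<^sub>R h)) \<partial>lborel)" .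
      qed
      also have "\<dots> = - (\<integral>t. (\<integral>y. F y * (\<Sum>i\<in>UNIV. h$i * partial_deriv i \<psi> (y - t *\<^sub>R h)) \<partial>lborel) \<partial>unit_interval)"
        by simp
      also have "\<dots> = - (\<integral>y. (\<integral>t. F y * (\<Sum>i\<in>UNIV. h$i * partial_deriv i \<psi> (y - t *\<^sub>R h)) \<partial>unit_interval) \<partial>lborel)"
      proof (subst P.Fubini_integral)
        \<comment> \<open>The directional derivative of \<psi> is bounded, so a constant multiple of
          F that does not depend on t dominates the integrand and justifies the second
          exchange.\<close>
        define \<Phi> where "\<Phi> x = (\<Sum>i\<in>UNIV. h$i * partial_deriv i \<psi> x)" for x
        have [measurable]: "\<Phi> \<in> borel_measurable borel" unfolding \<Phi>_def by measurable
        have bd: "\<bar>\<Phi> x\<bar> \<le> (\<Sum>i\<in>UNIV. \<bar>h$i\<bar> * B)" for x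
          unfolding \<Phi>_def using K(6) by (intro order_trans[OF sum_abs] sum_mono) (auto simp: abs_mult intro: mult_left_mono)
        define C where "C = (\<Sum>i\<in>UNIV. \<bar>h$i\<bar> * B)"
        interpret fm: finite_measure unit_interval by (rule finite_measure_unit_interval)
        have "integrable (unit_interval \<Otimes>\<^sub>M lborel) (\<lambda>(t, y). C * F y)"
        proof (rule P.Fubini_integrable)
          have "(\<lambda>(t::real, y). C * F y) \<in> borel_measurable borel"
            unfolding borel_prod[symmetric] by measurable
          then show "(\<lambda>(t, y). C * F y) \<in> borel_measurable (unit_interval \<Otimes>\<^sub>M lborel)"
            by (rule measurable_unit_interval_pair)
        qed (use F in auto)
        then show "integrable (unit_interval \<Otimes>\<^sub>M lborel)
            (\<lambda>(t, y). F y * (\<Sum>i\<in>UNIV. h$i * partial_deriv i \<psi> (y - t *\<^sub>R h)))"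
        proof (rule Bochner_Integration.integrable_bound)
          have "(\<lambda>(t::real, y). F y * \<Phi> (y - t *\<^sub>R h)) \<in> borel_measurable borel"
            unfolding borel_prod[symmetric] by measurable
          then show "(\<lambda>(t, y). F y * (\<Sum>i\<in>UNIV. h$i * partial_deriv i \<psi> (y - t *\<^sub>R h))) \<in>
              borel_measurable (unit_interval \<Otimes>\<^sub>M lborel)"
            unfolding \<Phi>_def by (rule measurable_unit_interval_pair)
          have "\<bar>F y\<bar> * \<bar>\<Phi> x\<bar> \<le> \<bar>C\<bar> * \<bar>F y\<bar>" for x y
            using mult_left_mono[OF bd[of x], of "\<bar>F y\<bar>"] abs_ge_self[of C] unfolding C_def[symmetric]
            by (smt (verit, best) mult.commute mult_right_mono abs_ge_zero)
          then show "AE p in unit_interval \<Otimes>\<^sub>M lborel. norm (case p of (t, y) \<Rightarrow>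
              F y * (\<Sum>i\<in>UNIV. h$i * partial_deriv i \<psi> (y - t *\<^sub>R h))) \<le> norm (case p of (t, y) \<Rightarrow> C * F y)"
            unfolding \<Phi>_def by (intro AE_I2) (auto simp: abs_mult)
        qed
      qed simp
      also have "\<dots> = - (\<integral>y. F y * (\<psi> y - \<psi> (y - h)) \<partial>lborel)"
        by (simp add: test_function_FTC[OF \<psi>])
      finally show ?thesis .
    qed
    have "(\<integral>x. Q x * \<psi> x \<partial>lborel) = (\<integral>x. F (x + h) * \<psi> x \<partial>lborel) - (\<integral>x. F x * \<psi> x \<partial>lborel) - (\<integral>x. I x * \<psi> x \<partial>lborel)"
      unfolding Q_def left_diff_distrib
      using integrable_mult_bounded[OF lborel_integrable_shift[OF F], of \<psi> B h] integrable_mult_bounded[OF F, of \<psi> B]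
        integrable_mult_bounded[OF I, of \<psi> B] K by simp
    also have "(\<integral>x. F (x + h) * \<psi> x \<partial>lborel) = (\<integral>y. F y * \<psi> (y - h) \<partial>lborel)" by (rule shifted) measurable
    also have "(\<integral>x. I x * \<psi> x \<partial>lborel) = (\<integral>y. F y * \<psi> (y - h) \<partial>lborel) - (\<integral>y. F y * \<psi> y \<partial>lborel)"
      unfolding IQ right_diff_distrib
      using integrable_mult_bounded[OF F, of "\<lambda>y. \<psi> (y - h)" B] integrable_mult_bounded[OF F, of \<psi> B] K by simp
    finally show "(\<integral>x. Q x * \<psi> x \<partial>lborel) = 0" by simp
  qed
  then show ?thesis
    unfolding Q_def I_def D_def G_def F_def by eventually_elim (auto simp: algebra_simps)
qed

text \<open>Integration by parts against Lipschitz functions: the translation identity gives the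
  difference quotients of \<open>F\<close> instead of its derivative, so no mollification is needed.\<close>

lemma weak_partial_test_Lipschitz:
  assumes \<Omega>: "open \<Omega>" "bounded \<Omega>" and f: "\<And>j. has_weak_partial \<Omega> j f (g j)"
    and K: "compact K" "K \<subseteq> \<Omega>" "\<And>x. x \<notin> K \<Longrightarrow> F x = 0"
    and F: "F \<in> borel_measurable borel" "\<And>x. \<bar>F x\<bar> \<le> B"
    and Lip: "\<delta> > 0" "\<And>x y. dist x y < \<delta> \<Longrightarrow> \<bar>F x - F y\<bar> \<le> L * dist x y"
    and G: "G \<in> borel_measurable (lborel_on \<Omega>)"
      "AE x in lborel_on \<Omega>. ((\<lambda>t. (F (x + t *\<^sub>R axis i 1) - F x) / t) \<longlongrightarrow> G x) (at 0)"
  shows "(\<integral>x. f x * G x \<partial>lborel_on \<Omega>) = - (\<integral>x. g i x * F x \<partial>lborel_on \<Omega>)"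
proof -
  interpret P: pair_sigma_finite unit_interval "lborel :: (real^2) measure" by (rule pair_sigma_finite_unit_interval)
  interpret UI: finite_measure unit_interval by (rule finite_measure_unit_interval)
  interpret fin: finite_measure "lborel_on \<Omega>" by (rule domain_finite[OF \<Omega>])
  note meas\<Omega> = domain_measurable[OF \<Omega>]
  define e :: "real^2" where "e = axis i 1"
  have e: "norm e = 1" by (simp add: e_def)
  define f0 where "f0 x = indicator \<Omega> x * f x" for x
  define g0 where "g0 x = indicator \<Omega> x * g i x" for x
  have si: "square_integrable (lborel_on \<Omega>) f" "square_integrable (lborel_on \<Omega>) (g i)"
    using f by (auto simp: has_weak_partial_iff[OF \<Omega>])
  have f0: "integrable lborel f0" and g0: "integrable lborel g0"
    using fin.square_integrable_integrable_L1[OF si(1)] fin.square_integrable_integrable_L1[OF si(2)]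
    unfolding f0_def g0_def by (auto simp: integrable_restrict_space meas\<Omega>)
  have [measurable]: "f0 \<in> borel_measurable borel" "g0 \<in> borel_measurable borel"
    using borel_measurable_integrable[OF f0] borel_measurable_integrable[OF g0] by simp_all
  note [measurable] = F(1)
  obtain \<rho> where \<rho>: "\<rho> > 0" "(\<Union>x\<in>K. ball x \<rho>) \<subseteq> \<Omega>"
    using compact_subset_open_imp_ball_epsilon_subset[OF K(1) \<Omega>(1) K(2)] by metis
  define U where "U = (\<Union>x\<in>K. ball x (\<rho> / 2))"
  have U: "open U" "K \<subseteq> U" using \<rho> by (auto simp: U_def)
  \<comment> \<open>Steps shorter than c stay within the range of the Lipschitz estimate and move
    points of \<open>U\<close> by less than \<rho>/2, so that they remain in \<Omega>.\<close>
  define c where "c = min \<delta> (\<rho> / 2)"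
  have c: "c > 0" "c \<le> \<delta>" "c \<le> \<rho> / 2" using Lip \<rho> by (auto simp: c_def)
  \<comment> \<open>The quotient has the step -t: after the substitution that moves x to x + t e,
    the numerator becomes f0 (x + t e) - f0 x, tested with F.\<close>
  define R where "R t = (\<integral>x. f0 x * ((F (x + (- t) *\<^sub>R e) - F x) / (- t)) \<partial>lborel)" for t
  have est: "\<bar>R t + (\<integral>y. g0 y * F y \<partial>lborel)\<bar> \<le> L * t * (\<integral>y. \<bar>g0 y\<bar> \<partial>lborel)" if t: "0 < t" "t < c" for t
  proof -
    define A where "A s = (\<integral>y. g0 y * F (y - (s * t) *\<^sub>R e) \<partial>lborel)" for s
    have bF: "integrable lborel (\<lambda>y. u y * F (y - a))" if "integrable lborel u" for u a
      by (rule integrable_mult_bounded[OF that, of _ B]) (use F in measurable)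
    have bF0: "integrable lborel (\<lambda>y. u y * F y)" if "integrable lborel u" for u
      using bF[OF that, of 0] by simp
    \<comment> \<open>The translation identity for the vector t e, in whose directional derivative
      only the component i survives.\<close>
    have TL: "AE x in lborel. x \<in> U \<longrightarrow> f0 (x + t *\<^sub>R e) - f0 x = (\<integral>s. t * g0 (x + (s * t) *\<^sub>R e) \<partial>unit_interval)"
    proof -
      have "x + s *\<^sub>R (t *\<^sub>R e) \<in> \<Omega>" if x: "x \<in> U" and s: "0 \<le> s" "s \<le> 1" for x s
      proof -
        obtain k where k: "k \<in> K" "dist k x < \<rho> / 2" using x by (auto simp: U_def)
        have "s * t \<le> 1 * t" by (rule mult_right_mono) (use s t in auto)
        moreover have "0 \<le> s * t" using s t by simp
        ultimately have "\<bar>s * t\<bar> < \<rho> / 2" using t c by linarith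
        then have "dist x (x + s *\<^sub>R (t *\<^sub>R e)) < \<rho> / 2" using e by (simp add: dist_norm)
        then have "dist k (x + s *\<^sub>R (t *\<^sub>R e)) < \<rho>"
          using k dist_triangle[of k "x + s *\<^sub>R (t *\<^sub>R e)" x] by linarith
        then have "x + s *\<^sub>R (t *\<^sub>R e) \<in> ball k \<rho>" by simp
        then show ?thesis using \<rho>(2) k(1) by blast
      qed
      from weak_derivative_translation[OF \<Omega> f U(1) this]
      have "AE x in lborel. x \<in> U \<longrightarrow> indicator \<Omega> (x + t *\<^sub>R e) * f (x + t *\<^sub>R e) - indicator \<Omega> x * f x =
        (\<integral>s. (\<Sum>j\<in>UNIV. (t *\<^sub>R e)$j * (indicator \<Omega> (x + s *\<^sub>R (t *\<^sub>R e)) * g j (x + s *\<^sub>R (t *\<^sub>R e)))) \<partial>unit_interval)"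
        by blast
      moreover have "(\<Sum>j\<in>UNIV. (t *\<^sub>R e)$j * w j) = t * w i" for w :: "2 \<Rightarrow> real"
      proof -
        have "(\<Sum>j\<in>UNIV. (t *\<^sub>R e)$j * w j) = (\<Sum>j\<in>UNIV. if j = i then t * w i else 0)"
          by (rule sum.cong) (auto simp: e_def axis_def)
        then show ?thesis by simp
      qed
      ultimately show ?thesis by (simp add: f0_def g0_def)
    qed
    have "R t * (- t) = (\<integral>x. f0 x * F (x - t *\<^sub>R e) \<partial>lborel) - (\<integral>x. f0 x * F x \<partial>lborel)"
    proof -
      have "R t * (- t) = (\<integral>x. f0 x * ((F (x + (- t) *\<^sub>R e) - F x) / (- t)) * (- t) \<partial>lborel)"
        unfolding R_def by simp
      also have "\<dots> = (\<integral>x. f0 x * F (x - t *\<^sub>R e) - f0 x * F x \<partial>lborel)"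
        using t by (intro Bochner_Integration.integral_cong) (auto simp: field_simps)
      finally show ?thesis using bF[OF f0] bF0[OF f0] by simp
    qed
    also have "(\<integral>x. f0 x * F (x - t *\<^sub>R e) \<partial>lborel) = (\<integral>x. f0 (x + t *\<^sub>R e) * F x \<partial>lborel)"
      using lborel_integral_shift[of "\<lambda>x. f0 x * F (x - t *\<^sub>R e)" "t *\<^sub>R e"] by simp
    also have "(\<integral>x. f0 (x + t *\<^sub>R e) * F x \<partial>lborel) - (\<integral>x. f0 x * F x \<partial>lborel) =
        (\<integral>x. (f0 (x + t *\<^sub>R e) - f0 x) * F x \<partial>lborel)"
      unfolding left_diff_distrib using bF0[OF lborel_integrable_shift[OF f0]] bF0[OF f0] by simp
    also have "\<dots> = (\<integral>x. (\<integral>s. t * (g0 (x + s *\<^sub>R (t *\<^sub>R e)) * F x) \<partial>unit_interval) \<partial>lborel)"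
    proof (rule integral_cong_AE)
      show "(\<lambda>x. (f0 (x + t *\<^sub>R e) - f0 x) * F x) \<in> borel_measurable lborel" by measurable
      have "integrable (unit_interval \<Otimes>\<^sub>M lborel) (\<lambda>(s, x). g0 (x + s *\<^sub>R (t *\<^sub>R e)) * F x)"
        by (rule integrable_along_translations[OF g0 F])
      from P.integrable_snd[OF this] 
      have "integrable lborel (\<lambda>x. t * (\<integral>s. g0 (x + s *\<^sub>R (t *\<^sub>R e)) * F x \<partial>unit_interval))" by simp
      then show "(\<lambda>x. \<integral>s. t * (g0 (x + s *\<^sub>R (t *\<^sub>R e)) * F x) \<partial>unit_interval) \<in> borel_measurable lborel"
        using borel_measurable_integrable by fastforce
      show "AE x in lborel. (f0 (x + t *\<^sub>R e) - f0 x) * F x = (\<integral>s. t * (g0 (x + s *\<^sub>R (t *\<^sub>R e)) * F x) \<partial>unit_interval)"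
        using TL
      proof eventually_elim
        case (elim x)
        \<comment> \<open>The translation identity is known on \<open>U\<close>, which contains K;
          off K the factor F vanishes.\<close>
        show ?case
        proof (cases "x \<in> K")
          case True
          then have "f0 (x + t *\<^sub>R e) - f0 x = (\<integral>s. t * g0 (x + (s * t) *\<^sub>R e) \<partial>unit_interval)" using elim U by blast
          then show ?thesis by (simp add: mult.assoc)
        qed (use K in simp)
      qed
    qed
    also have "\<dots> = (\<integral>s. (\<integral>x. t * (g0 (x + s *\<^sub>R (t *\<^sub>R e)) * F x) \<partial>lborel) \<partial>unit_interval)"
    proof (rule P.Fubini_integral)
      have "integrable (unit_interval \<Otimes>\<^sub>M lborel) (\<lambda>p. t * (case p of (s, x) \<Rightarrow> g0 (x + s *\<^sub>R (t *\<^sub>R e)) * F x))"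
        using integrable_along_translations[OF g0 F, of "t *\<^sub>R e"] by (rule integrable_mult_right)
      then show "integrable (unit_interval \<Otimes>\<^sub>M lborel) (\<lambda>(s, x). t * (g0 (x + s *\<^sub>R (t *\<^sub>R e)) * F x))"
        by (simp add: case_prod_unfold)
    qed
    also have "\<dots> = (\<integral>s. t * A s \<partial>unit_interval)"
    proof (intro Bochner_Integration.integral_cong refl)
      fix s
      have "(\<integral>x. g0 (x + s *\<^sub>R (t *\<^sub>R e)) * F x \<partial>lborel) = A s"
        using lborel_integral_shift[of "\<lambda>x. g0 x * F (x - (s * t) *\<^sub>R e)" "(s * t) *\<^sub>R e"] by (simp add: A_def)
      then show "(\<integral>x. t * (g0 (x + s *\<^sub>R (t *\<^sub>R e)) * F x) \<partial>lborel) = t * A s" by simp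
    qed
    finally have "t * (R t + (\<integral>s. A s \<partial>unit_interval)) = 0" by (simp add: algebra_simps)
    then have "R t = - (\<integral>s. A s \<partial>unit_interval)" using t by simp
    moreover have "\<bar>(\<integral>s. A s \<partial>unit_interval) - (\<integral>y. g0 y * F y \<partial>lborel)\<bar> \<le> L * t * (\<integral>y. \<bar>g0 y\<bar> \<partial>lborel)"
    proof -
      define J where "J = (\<integral>y. g0 y * F y \<partial>lborel)"
      have Abound: "\<bar>A s - J\<bar> \<le> L * t * (\<integral>y. \<bar>g0 y\<bar> \<partial>lborel)" if s: "s \<in> space unit_interval" for s
      proof -
        have s: "0 \<le> s" "s \<le> 1" using s by (auto simp: space_restrict_space)
        have st: "s * t \<le> 1 * t" "0 \<le> s * t" using s t by (auto intro: mult_right_mono)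
        have "L \<ge> 0"
        proof -
          have "0 \<le> \<bar>F e - F (e + (\<delta> / 2) *\<^sub>R e)\<bar>" by simp
          also have "\<dots> \<le> L * (\<delta> / 2)" using Lip(2)[of e "e + (\<delta> / 2) *\<^sub>R e"] Lip(1) e by (simp add: dist_norm)
          finally show ?thesis using Lip(1) by (simp add: zero_le_mult_iff)
        qed
        \<comment> \<open>Undoing the shift of F costs at most L t at every point, which is the
          error in \<open>est\<close>.\<close>
        have FF: "\<bar>F (y - (s * t) *\<^sub>R e) - F y\<bar> \<le> L * t" for y
        proof -
          have d: "dist (y - (s * t) *\<^sub>R e) y = s * t" using e s t by (simp add: dist_norm)
          have "s * t < \<delta>" using st t c by linarith
          then have "\<bar>F (y - (s * t) *\<^sub>R e) - F y\<bar> \<le> L * (s * t)"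
            using Lip(2)[of "y - (s * t) *\<^sub>R e" y] unfolding d by blast
          also have "\<dots> \<le> L * t" using st \<open>L \<ge> 0\<close> by (intro mult_left_mono) auto
          finally show ?thesis .
        qed
        have "A s - J = (\<integral>y. g0 y * (F (y - (s * t) *\<^sub>R e) - F y) \<partial>lborel)"
          unfolding A_def J_def right_diff_distrib using bF[OF g0] bF0[OF g0] by simp
        also have "\<bar>\<dots>\<bar> \<le> (\<integral>y. (L * t) * \<bar>g0 y\<bar> \<partial>lborel)"
        proof (rule order_trans[OF integral_abs_bound integral_mono])
          have "integrable lborel (\<lambda>y. g0 y * (F (y - (s * t) *\<^sub>R e) - F y))"
            unfolding right_diff_distrib using bF[OF g0] bF0[OF g0] by simp
          then show "integrable lborel (\<lambda>y. \<bar>g0 y * (F (y - (s * t) *\<^sub>R e) - F y)\<bar>)" by simp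
          show "integrable lborel (\<lambda>y. L * t * \<bar>g0 y\<bar>)" using g0 by simp
          show "\<bar>g0 y * (F (y - (s * t) *\<^sub>R e) - F y)\<bar> \<le> L * t * \<bar>g0 y\<bar>" for y
            using mult_left_mono[OF FF[of y], of "\<bar>g0 y\<bar>"] by (simp add: abs_mult mult.commute)
        qed
        finally show ?thesis by simp
      qed
      have "A = (\<lambda>s. \<integral>x. g0 (x + s *\<^sub>R (t *\<^sub>R e)) * F x \<partial>lborel)"
      proof
        show "A s = (\<integral>x. g0 (x + s *\<^sub>R (t *\<^sub>R e)) * F x \<partial>lborel)" for s
          using lborel_integral_shift[of "\<lambda>x. g0 x * F (x - (s * t) *\<^sub>R e)" "(s * t) *\<^sub>R e"] by (simp add: A_def)
      qed
      then have "integrable unit_interval A"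
        using P.integrable_fst[OF integrable_along_translations[OF g0 F, of "t *\<^sub>R e"]] by simp
      then have A: "integrable unit_interval (\<lambda>s. A s - J)" by simp
      have UI: "measure unit_interval (space unit_interval) = 1"
        by (simp add: measure_restrict_space space_restrict_space)
      have "(\<integral>s. A s \<partial>unit_interval) - J = (\<integral>s. A s - J \<partial>unit_interval)"
        using \<open>integrable unit_interval A\<close> UI by simp
      also have "\<bar>\<dots>\<bar> \<le> (\<integral>s. L * t * (\<integral>y. \<bar>g0 y\<bar> \<partial>lborel) \<partial>unit_interval)"
        using A Abound by (intro order_trans[OF integral_abs_bound integral_mono]) auto
      also have "\<dots> = L * t * (\<integral>y. \<bar>g0 y\<bar> \<partial>lborel)" using UI by simp
      finally show ?thesis unfolding J_def .
    qed
    ultimately show ?thesis by simp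
  qed
  define \<tau> where "\<tau> n = c / 2 * (1 / real (Suc n))" for n
  have \<tau>: "0 < \<tau> n" "\<tau> n < c" for n
  proof -
    show "0 < \<tau> n" using c by (simp add: \<tau>_def)
    have "\<tau> n \<le> c / 2 * 1" unfolding \<tau>_def using c by (intro mult_left_mono) auto
    then show "\<tau> n < c" using c by simp
  qed
  have \<tau>0: "\<tau> \<longlonglongrightarrow> 0"
  proof -
    have "(\<lambda>n. c / 2 * (1 / real (Suc n))) \<longlonglongrightarrow> c / 2 * 0"
      using LIMSEQ_inverse_real_of_nat by (intro tendsto_intros) (simp add: inverse_eq_divide)
    then show ?thesis unfolding \<tau>_def by simp
  qed
  \<comment> \<open>The integrals \<open>R (\<tau> n)\<close> have two limits. Moving the quotient
    to f gives minus the integral of g F by \<open>est\<close>; leaving it at F gives the integral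
    of f G by dominated convergence.\<close>
  have lim1: "(\<lambda>n. R (\<tau> n)) \<longlonglongrightarrow> - (\<integral>y. g0 y * F y \<partial>lborel)"
  proof -
    have "(\<lambda>n. \<bar>R (\<tau> n) + (\<integral>y. g0 y * F y \<partial>lborel)\<bar>) \<longlonglongrightarrow> 0"
    proof (rule tendsto_sandwich[OF _ _ tendsto_const])
      show "(\<lambda>n. L * \<tau> n * (\<integral>y. \<bar>g0 y\<bar> \<partial>lborel)) \<longlonglongrightarrow> 0"
        using tendsto_mult[OF tendsto_mult[OF tendsto_const[of L] \<tau>0] tendsto_const[of "\<integral>y. \<bar>g0 y\<bar> \<partial>lborel"]] by simp
    qed (use est \<tau> in auto)
    then have "(\<lambda>n. R (\<tau> n) - (- (\<integral>y. g0 y * F y \<partial>lborel))) \<longlonglongrightarrow> 0" by (simp add: tendsto_rabs_zero_iff)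
    then show ?thesis by (rule LIM_zero_cancel)
  qed
  have lim2: "(\<lambda>n. R (\<tau> n)) \<longlonglongrightarrow> (\<integral>x. f0 x * (indicator \<Omega> x *\<^sub>R G x) \<partial>lborel)"
    unfolding R_def
  proof (rule integral_dominated_convergence[where w = "\<lambda>x. L * \<bar>f0 x\<bar>"])
    have [measurable]: "(\<lambda>x. indicator \<Omega> x *\<^sub>R G x) \<in> borel_measurable borel"
      using G(1) by (simp add: borel_measurable_restrict_space_iff meas\<Omega>)
    show "(\<lambda>x. f0 x * (indicator \<Omega> x *\<^sub>R G x)) \<in> borel_measurable lborel" by measurable
    show "(\<lambda>x. f0 x * ((F (x + - \<tau> n *\<^sub>R e) - F x) / - \<tau> n)) \<in> borel_measurable lborel" for n by measurable
    show "integrable lborel (\<lambda>x. L * \<bar>f0 x\<bar>)" using f0 by simp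
    show "AE x in lborel. (\<lambda>n. f0 x * ((F (x + - \<tau> n *\<^sub>R e) - F x) / - \<tau> n)) \<longlonglongrightarrow> f0 x * (indicator \<Omega> x *\<^sub>R G x)"
      using G(2) unfolding AE_lborel_on[OF meas\<Omega>]
    proof eventually_elim
      case (elim x)
      show ?case
      proof (cases "x \<in> \<Omega>")
        case True
        have fl: "filterlim (\<lambda>n. - \<tau> n) (at 0) sequentially"
          using \<tau>(1) tendsto_minus[OF \<tau>0] by (auto simp: filterlim_at less_imp_neq[symmetric])
        have "((\<lambda>t. (F (x + t *\<^sub>R e) - F x) / t) \<longlongrightarrow> G x) (at 0)"
          using elim True unfolding e_def by blast
        from filterlim_compose[OF this fl]
        have "(\<lambda>n. (F (x + - \<tau> n *\<^sub>R e) - F x) / - \<tau> n) \<longlonglongrightarrow> G x" .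
        then show ?thesis using True by (intro tendsto_intros) simp
      qed (simp add: f0_def)
    qed
    show "AE x in lborel. norm (f0 x * ((F (x + - \<tau> n *\<^sub>R e) - F x) / - \<tau> n)) \<le> L * \<bar>f0 x\<bar>" for n
    proof (rule AE_I2)
      fix x
      have "dist (x + - \<tau> n *\<^sub>R e) x = \<tau> n" using e \<tau>(1)[of n] by (simp add: dist_norm)
      then have "\<bar>F (x + - \<tau> n *\<^sub>R e) - F x\<bar> \<le> L * \<tau> n"
        using Lip(2)[of "x + - \<tau> n *\<^sub>R e" x] \<tau>[of n] c by simp
      then have "\<bar>(F (x + - \<tau> n *\<^sub>R e) - F x) / - \<tau> n\<bar> \<le> L"
        using \<tau>(1)[of n] by (simp add: abs_divide divide_le_eq)
      from mult_right_mono[OF this, of "\<bar>f0 x\<bar>"]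
      show "norm (f0 x * ((F (x + - \<tau> n *\<^sub>R e) - F x) / - \<tau> n)) \<le> L * \<bar>f0 x\<bar>"
        unfolding real_norm_def abs_mult by (simp only: mult.commute)
    qed
  qed
  have "(\<integral>x. f x * G x \<partial>lborel_on \<Omega>) = (\<integral>x. f0 x * (indicator \<Omega> x *\<^sub>R G x) \<partial>lborel)"
    unfolding integral_restrict_space[of \<Omega> lborel, simplified, OF meas\<Omega>]
    by (intro Bochner_Integration.integral_cong) (auto simp: f0_def split: split_indicator)
  also have "\<dots> = - (\<integral>y. g0 y * F y \<partial>lborel)" using LIMSEQ_unique[OF lim2 lim1] .
  also have "(\<integral>y. g0 y * F y \<partial>lborel) = (\<integral>x. g i x * F x \<partial>lborel_on \<Omega>)"
    by (simp add: integral_restrict_space meas\<Omega> g0_def mult.assoc)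
  finally show ?thesis .
qed

text \<open>The gradient is integrated along the segment; the factor 2 counts the coordinates in the
  directional derivative.\<close>

lemma test_function_Lipschitz:
  assumes "test_function U \<psi>" "\<And>i x. \<bar>partial_deriv i \<psi> x\<bar> \<le> B"
  shows "\<bar>\<psi> x - \<psi> y\<bar> \<le> 2 * B * dist x y"
proof -
  interpret UI: finite_measure unit_interval by (rule finite_measure_unit_interval)
  have UI: "measure unit_interval (space unit_interval) = 1"
    by (simp add: measure_restrict_space space_restrict_space)
  have B: "B \<ge> 0" using assms(2)[of 1 0] by linarith
  have bound: "\<bar>\<Sum>i\<in>UNIV. (x - y)$i * partial_deriv i \<psi> z\<bar> \<le> 2 * B * dist x y" for z
  proof -
    have "\<bar>(x - y)$i * partial_deriv i \<psi> z\<bar> \<le> dist x y * B" for i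
      unfolding abs_mult dist_norm using component_le_norm_cart[of "x - y" i] assms(2)[of i z] by (intro mult_mono) auto
    then have "(\<Sum>i\<in>UNIV. \<bar>(x - y)$i * partial_deriv i \<psi> z\<bar>) \<le> (\<Sum>i\<in>(UNIV::2 set). dist x y * B)"
      by (intro sum_mono)
    from order_trans[OF sum_abs this] show ?thesis by (simp add: ac_simps)
  qed
  have "\<psi> x - \<psi> y = (\<integral>t. (\<Sum>i\<in>UNIV. (x - y)$i * partial_deriv i \<psi> (x - t *\<^sub>R (x - y))) \<partial>unit_interval)"
    using test_function_FTC[OF assms(1), of "x - y" x] by simp
  also have "\<bar>\<dots>\<bar> \<le> (\<integral>t. 2 * B * dist x y \<partial>unit_interval)"
  proof (rule order_trans[OF integral_abs_bound integral_mono'])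
    show "integrable unit_interval (\<lambda>t. 2 * B * dist x y)" by simp
  qed (use bound B in auto)
  finally show ?thesis using UI by simp
qed

text \<open>The product rule with a Lipschitz factor. The product of \<phi> and a test function is
  locally Lipschitz with uniform constants, compactly supported and differentiable in direction i
  almost everywhere, so \<open>weak_partial_test_Lipschitz\<close> applies to it. The bound on
  \<phi> is asked for along segments inside \<Omega> because \<Omega> need not be convex.\<close>

lemma has_weak_partial_Lipschitz_mult:
  assumes \<Omega>: "open \<Omega>" "bounded \<Omega>" and f: "\<And>j. has_weak_partial \<Omega> j f (g j)"
    and \<phi>: "\<phi> \<in> borel_measurable (lborel_on \<Omega>)" "\<And>x. x \<in> \<Omega> \<Longrightarrow> \<bar>\<phi> x\<bar> \<le> B"
      "\<And>x y. closed_segment x y \<subseteq> \<Omega> \<Longrightarrow> \<bar>\<phi> x - \<phi> y\<bar> \<le> L * dist x y"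
    and G: "G \<in> borel_measurable (lborel_on \<Omega>)" "\<And>x. x \<in> \<Omega> \<Longrightarrow> \<bar>G x\<bar> \<le> B'"
      "AE x in lborel_on \<Omega>. ((\<lambda>t. (\<phi> (x + t *\<^sub>R axis i 1) - \<phi> x) / t) \<longlongrightarrow> G x) (at 0)"
  shows "has_weak_partial \<Omega> i (\<lambda>x. \<phi> x * f x) (\<lambda>x. \<phi> x * g i x + G x * f x)"
  unfolding has_weak_partial_iff[OF \<Omega>]
proof (intro conjI allI impI)
  note meas\<Omega> = domain_measurable[OF \<Omega>]
  have si: "square_integrable (lborel_on \<Omega>) f" "square_integrable (lborel_on \<Omega>) (g i)"
    using f by (auto simp: has_weak_partial_iff[OF \<Omega>])
  have \<phi>f: "square_integrable (lborel_on \<Omega>) (\<lambda>x. \<phi> x * f x)"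
    using square_integrable_bounded_mult[OF si(1) \<phi>(1), of B] \<phi>(2) by (simp add: space_restrict_space)
  have \<phi>g: "square_integrable (lborel_on \<Omega>) (\<lambda>x. \<phi> x * g i x)"
    using square_integrable_bounded_mult[OF si(2) \<phi>(1), of B] \<phi>(2) by (simp add: space_restrict_space)
  have Gf: "square_integrable (lborel_on \<Omega>) (\<lambda>x. G x * f x)"
    using square_integrable_bounded_mult[OF si(1) G(1), of B'] G(2) by (simp add: space_restrict_space)
  show "square_integrable (lborel_on \<Omega>) (\<lambda>x. \<phi> x * f x)" by (rule \<phi>f)
  show "square_integrable (lborel_on \<Omega>) (\<lambda>x. \<phi> x * g i x + G x * f x)" by (rule square_integrable_add[OF \<phi>g Gf])
  fix \<psi> assume \<psi>: "test_function \<Omega> \<psi>"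
  obtain K C where K: "compact K" "K \<subseteq> \<Omega>" "C \<ge> 0" "\<And>x. x \<notin> K \<Longrightarrow> \<psi> x = 0"
    "\<And>x. \<bar>\<psi> x\<bar> \<le> C" "\<And>i x. \<bar>partial_deriv i \<psi> x\<bar> \<le> C"
    using test_function_props[OF \<psi>] by metis
  note \<psi>Lip = test_function_Lipschitz[OF \<psi> K(6)]
  define F where "F x = \<phi> x * \<psi> x" for x
  have F0: "F x = 0" if "x \<notin> K" for x using K that by (simp add: F_def)
  \<comment> \<open>Balls of radius \<delta> around points of K are convex and lie in \<Omega>, so
    the segment from a point of K to a nearby point stays in \<Omega> and the bound on \<phi> is
    available.\<close>
  obtain \<delta> where \<delta>: "\<delta> > 0" "(\<Union>x\<in>K. ball x \<delta>) \<subseteq> \<Omega>"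
    using compact_subset_open_imp_ball_epsilon_subset[OF K(1) \<Omega>(1) K(2)] by metis
  have Fm: "F \<in> borel_measurable borel"
  proof -
    have [measurable]: "(\<lambda>x. indicator \<Omega> x * \<phi> x) \<in> borel_measurable borel"
      using \<phi>(1) by (simp add: borel_measurable_restrict_space_iff meas\<Omega>)
    note [measurable] = test_function_measurable[OF \<psi>]
    have "F = (\<lambda>x. (indicator \<Omega> x * \<phi> x) * \<psi> x)"
      using K by (auto simp: F_def fun_eq_iff split: split_indicator)
    then show ?thesis by (simp only:) measurable
  qed
  define M where "M = \<bar>B\<bar>"
  have M: "M \<ge> 0" "\<And>x. x \<in> \<Omega> \<Longrightarrow> \<bar>\<phi> x\<bar> \<le> M" using order_trans[OF \<phi>(2) abs_ge_self] by (auto simp: M_def)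
  have Fb: "\<bar>F x\<bar> \<le> M * C" for x
  proof (cases "x \<in> K")
    case True
    then show ?thesis unfolding F_def abs_mult using M K by (intro mult_mono) auto
  qed (use F0 M K in auto)
  define L' where "L' = M * (2 * C) + C * \<bar>L\<bar>"
  have near: "\<bar>F x - F y\<bar> \<le> L' * dist x y" if d: "dist x y < \<delta>" and x: "x \<in> K" for x y
  proof -
    have seg: "closed_segment x y \<subseteq> \<Omega>"
    proof -
      have "closed_segment x y \<subseteq> ball x \<delta>"
        using d \<delta> by (intro closed_segment_subset) (auto simp: convex_ball)
      then show ?thesis using \<delta>(2) x by blast
    qed
    then have y: "y \<in> \<Omega>" "x \<in> \<Omega>" by auto
    have "F x - F y = \<phi> x * (\<psi> x - \<psi> y) + \<psi> y * (\<phi> x - \<phi> y)" by (simp add: F_def algebra_simps)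
    then have "\<bar>F x - F y\<bar> \<le> \<bar>\<phi> x\<bar> * \<bar>\<psi> x - \<psi> y\<bar> + \<bar>\<psi> y\<bar> * \<bar>\<phi> x - \<phi> y\<bar>"
      using abs_triangle_ineq[of "\<phi> x * (\<psi> x - \<psi> y)" "\<psi> y * (\<phi> x - \<phi> y)"] by (simp add: abs_mult)
    also have "\<dots> \<le> M * (2 * C * dist x y) + C * (\<bar>L\<bar> * dist x y)"
    proof (intro add_mono mult_mono)
      have "\<bar>\<phi> x - \<phi> y\<bar> \<le> L * dist x y" by (rule \<phi>(3)[OF seg])
      also have "\<dots> \<le> \<bar>L\<bar> * dist x y" by (intro mult_right_mono) auto
      finally show "\<bar>\<phi> x - \<phi> y\<bar> \<le> \<bar>L\<bar> * dist x y" .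
    qed (use M y K \<psi>Lip in auto)
    finally show ?thesis by (simp add: L'_def algebra_simps)
  qed
  have FL: "\<bar>F x - F y\<bar> \<le> L' * dist x y" if "dist x y < \<delta>" for x y
  proof -
    have "L' \<ge> 0" using M K by (simp add: L'_def)
    consider "x \<in> K" | "y \<in> K" | "x \<notin> K" "y \<notin> K" by blast
    then show ?thesis
    proof cases
      case 2
      then show ?thesis using near[of y x] that by (simp add: dist_commute abs_minus_commute)
    qed (use near[of x y] that F0[of x] F0[of y] \<open>L' \<ge> 0\<close> in auto)
  qed
  define D where "D x = \<phi> x * partial_deriv i \<psi> x + \<psi> x * G x" for x
  have Dm: "D \<in> borel_measurable (lborel_on \<Omega>)"
    unfolding D_def using \<phi>(1) G(1) borel_measurable_lborel_on[OF test_function_measurable[OF \<psi>]]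
      borel_measurable_lborel_on[OF test_function_partial_measurable[OF \<psi>]]
    by (intro borel_measurable_add borel_measurable_times)
  have DF: "AE x in lborel_on \<Omega>. ((\<lambda>t. (F (x + t *\<^sub>R axis i 1) - F x) / t) \<longlongrightarrow> D x) (at 0)"
    using G(3)
  proof eventually_elim
    case (elim x)
    let ?y = "\<lambda>t. x + t *\<^sub>R axis i (1::real)"
    have \<psi>x: "((\<lambda>t. (\<psi> (?y t) - \<psi> x) / t) \<longlongrightarrow> partial_deriv i \<psi> x) (at 0)"
    proof -
      have "(\<psi> has_derivative frechet_derivative \<psi> (at (?y 0))) (at (?y 0))"
        using \<psi> by (simp add: test_function_def frechet_derivative_works)
      moreover have "(?y has_derivative (\<lambda>t. t *\<^sub>R axis i 1)) (at 0)"
        by (auto intro!: derivative_eq_intros)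
      ultimately have "((\<lambda>t. \<psi> (?y t)) has_derivative (\<lambda>t. frechet_derivative \<psi> (at (?y 0)) (t *\<^sub>R axis i 1))) (at 0)"
        by (rule has_derivative_compose[rotated])
      moreover have "frechet_derivative \<psi> (at (?y 0)) (t *\<^sub>R axis i 1) = partial_deriv i \<psi> x * t" for t
        using linear_frechet_derivative[of \<psi> "at x"] \<psi>
        by (simp add: partial_deriv_def linear_scale test_function_def)
      ultimately have "((\<lambda>t. \<psi> (?y t)) has_real_derivative partial_deriv i \<psi> x) (at 0)"
        by (simp add: has_field_derivative_def)
      then show ?thesis by (simp add: DERIV_def)
    qed
    have "((\<lambda>t. \<psi> (?y t)) \<longlongrightarrow> \<psi> (?y 0)) (at 0)"
    proof -
      have "continuous_on UNIV (\<lambda>t. \<psi> (?y t))"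
        by (intro continuous_on_compose2[OF test_function_continuous[OF \<psi>]] continuous_intros) auto
      then have "isCont (\<lambda>t. \<psi> (?y t)) 0" by (simp add: continuous_on_eq_continuous_at)
      then show ?thesis by (simp only: isCont_def)
    qed
    then have "((\<lambda>t. (\<phi> (?y t) - \<phi> x) / t * \<psi> (?y t) + \<phi> x * ((\<psi> (?y t) - \<psi> x) / t)) \<longlongrightarrow>
        G x * \<psi> x + \<phi> x * partial_deriv i \<psi> x) (at 0)"
      by (intro tendsto_intros elim \<psi>x) simp
    moreover have "(\<phi> (?y t) - \<phi> x) / t * \<psi> (?y t) + \<phi> x * ((\<psi> (?y t) - \<psi> x) / t) = (F (?y t) - F x) / t" for t
      by (simp add: F_def diff_divide_distrib algebra_simps)
    ultimately show ?case by (simp add: D_def algebra_simps)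
  qed
  have key: "(\<integral>x. f x * D x \<partial>lborel_on \<Omega>) = - (\<integral>x. g i x * F x \<partial>lborel_on \<Omega>)"
    by (rule weak_partial_test_Lipschitz[OF \<Omega> f K(1,2) F0 Fm Fb \<delta>(1) FL Dm DF])
  note int = square_integrable_mult[OF \<phi>f square_integrable_test(2)[OF \<Omega> \<psi>, of i]]
    square_integrable_mult[OF Gf square_integrable_test(1)[OF \<Omega> \<psi>]]
    square_integrable_mult[OF \<phi>g square_integrable_test(1)[OF \<Omega> \<psi>]]
  have "(\<integral>x. f x * D x \<partial>lborel_on \<Omega>) = (\<integral>x. \<phi> x * f x * partial_deriv i \<psi> x + G x * f x * \<psi> x \<partial>lborel_on \<Omega>)"
    by (simp add: D_def algebra_simps)
  also have "\<dots> = (\<integral>x. \<phi> x * f x * partial_deriv i \<psi> x \<partial>lborel_on \<Omega>) + (\<integral>x. G x * f x * \<psi> x \<partial>lborel_on \<Omega>)"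
    using int by simp
  finally have "(\<integral>x. \<phi> x * f x * partial_deriv i \<psi> x \<partial>lborel_on \<Omega>) =
      - (\<integral>x. \<phi> x * g i x * \<psi> x \<partial>lborel_on \<Omega>) - (\<integral>x. G x * f x * \<psi> x \<partial>lborel_on \<Omega>)"
    using key by (simp add: F_def mult.commute mult.left_commute)
  also have "\<dots> = - (\<integral>x. (\<phi> x * g i x + G x * f x) * \<psi> x \<partial>lborel_on \<Omega>)"
    unfolding distrib_right using int by simp
  finally show "(\<integral>x. \<phi> x * f x * partial_deriv i \<psi> x \<partial>lborel_on \<Omega>) =
      - (\<integral>x. (\<phi> x * g i x + G x * f x) * \<psi> x \<partial>lborel_on \<Omega>)" .
qed

section \<open>Compactness\<close>

lemma lborel_nn_integral_affine:
  fixes f :: "'a::euclidean_space \<Rightarrow> ennreal"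
  assumes [measurable]: "f \<in> borel_measurable borel" and c: "c \<noteq> 0"
  shows "(\<integral>\<^sup>+x. f x \<partial>lborel) = ennreal (\<bar>c\<bar> ^ DIM('a)) * (\<integral>\<^sup>+x. f (t + c *\<^sub>R x) \<partial>lborel)"
  by (subst lborel_affine[OF c, of t])
     (simp add: nn_integral_density nn_integral_distr nn_integral_cmult)

text \<open>In the plane the substitution costs the factor 1/c^2, which is at most 4.\<close>

lemma nn_integral_scaled_le:
  fixes f :: "real^2 \<Rightarrow> ennreal"
  assumes f: "f \<in> borel_measurable borel" and c: "\<bar>c\<bar> \<ge> 1 / 2"
  shows "(\<integral>\<^sup>+h. f (a + c *\<^sub>R h) \<partial>lborel) \<le> 4 * (\<integral>\<^sup>+x. f x \<partial>lborel)"
proof -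
  let ?J = "\<integral>\<^sup>+h. f (a + c *\<^sub>R h) \<partial>lborel"
  have "(1/2)\<^sup>2 \<le> \<bar>c\<bar>\<^sup>2" using c by (intro power_mono) auto
  then have c2: "1 \<le> 4 * \<bar>c\<bar>\<^sup>2" by (simp add: power2_eq_square)
  have "?J = ennreal 1 * ?J" by simp
  also have "\<dots> \<le> ennreal (4 * \<bar>c\<bar>\<^sup>2) * ?J" using c2 by (intro mult_right_mono ennreal_leI) auto
  also have "\<dots> = 4 * (ennreal (\<bar>c\<bar>\<^sup>2) * ?J)" by (simp add: ennreal_mult mult.assoc)
  also have "ennreal (\<bar>c\<bar>\<^sup>2) * ?J = (\<integral>\<^sup>+x. f x \<partial>lborel)"
    using lborel_nn_integral_affine[OF f, of c a] c by simp
  finally show ?thesis .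
qed

text \<open>Jensen's inequality for a function that is merely measurable: if it is not integrable,
  its Bochner integral is 0 by convention.\<close>

lemma integral_sq_le_nn_integral:
  assumes "finite_measure M" "measure M (space M) \<le> 1" and w: "w \<in> borel_measurable M"
  shows "ennreal ((\<integral>t. w t \<partial>M)\<^sup>2) \<le> (\<integral>\<^sup>+t. ennreal ((w t)\<^sup>2) \<partial>M)"
proof (cases "integrable M w")
  case True
  interpret finite_measure M by fact
  have "ennreal ((\<integral>t. w t \<partial>M)\<^sup>2) = (ennreal (norm (\<integral>t. w t \<partial>M)))\<^sup>2"
    by (simp add: ennreal_power)
  also have "\<dots> \<le> (\<integral>\<^sup>+t. ennreal (norm (w t)) * 1 \<partial>M)\<^sup>2"
    using integral_norm_bound_ennreal[OF True] by (intro power_mono) auto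
  also have "\<dots> \<le> (\<integral>\<^sup>+t. (ennreal (norm (w t)))\<^sup>2 \<partial>M) * (\<integral>\<^sup>+t. 1\<^sup>2 \<partial>M)"
    using w by (intro Cauchy_Schwarz_nn_integral) auto
  also have "\<dots> \<le> (\<integral>\<^sup>+t. (ennreal (norm (w t)))\<^sup>2 \<partial>M) * 1"
  proof (rule mult_left_mono)
    show "(\<integral>\<^sup>+t. 1\<^sup>2 \<partial>M) \<le> 1" using assms(2) by (simp add: emeasure_eq_measure ennreal_le_1)
  qed simp
  finally show ?thesis by (simp add: ennreal_power)
qed (simp add: not_integrable_integral_eq)

text \<open>For \<open>t \<ge> 1/2\<close> the integral over \<open>h\<close> is transformed by \<open>z = x + t h\<close>; for
  \<open>t \<le> 1/2\<close> the roles of the end points \<open>x\<close> and \<open>x + h\<close> are exchanged.\<close>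

lemma nn_integral_chord_le:
  fixes \<gamma> :: "real^2 \<Rightarrow> ennreal"
  assumes P: "open P" "convex P" and [measurable]: "\<gamma> \<in> borel_measurable borel" and t: "0 \<le> t" "t \<le> 1"
  shows "(\<integral>\<^sup>+h. \<integral>\<^sup>+x. indicator P x * indicator P (x + h) * \<gamma> (x + t *\<^sub>R h) \<partial>lborel \<partial>lborel) \<le>
    4 * emeasure lborel P * (\<integral>\<^sup>+x. indicator P x * \<gamma> x \<partial>lborel)"
proof -
  have [measurable]: "P \<in> sets borel" using P by simp
  define \<gamma>P where "\<gamma>P x = indicator P x * \<gamma> x" for x
  have [measurable]: "\<gamma>P \<in> borel_measurable borel" unfolding \<gamma>P_def by measurable
  obtain c where c: "\<bar>c\<bar> \<ge> 1 / 2" and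
    le: "\<And>h. (\<integral>\<^sup>+x. indicator P x * indicator P (x + h) * \<gamma> (x + t *\<^sub>R h) \<partial>lborel) \<le>
      (\<integral>\<^sup>+x. indicator P x * \<gamma>P (x + c *\<^sub>R h) \<partial>lborel)"
  proof (cases "t \<ge> 1 / 2")
    case True
    have "x + t *\<^sub>R h \<in> P" if "x \<in> P" "x + h \<in> P" for x h
    proof -
      have "(1 - t) *\<^sub>R x + t *\<^sub>R (x + h) \<in> P" by (rule convexD[OF P(2)]) (use that t in auto)
      then show ?thesis by (simp add: algebra_simps)
    qed
    then have "(\<integral>\<^sup>+x. indicator P x * indicator P (x + h) * \<gamma> (x + t *\<^sub>R h) \<partial>lborel) \<le>
        (\<integral>\<^sup>+x. indicator P x * \<gamma>P (x + t *\<^sub>R h) \<partial>lborel)" for h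
      by (intro nn_integral_mono) (auto simp: \<gamma>P_def split: split_indicator)
    then show ?thesis using that[of t] True by simp
  next
    case False
    have mem: "y + (t - 1) *\<^sub>R h \<in> P" if "y \<in> P" "y - h \<in> P" for y h
    proof -
      have "t *\<^sub>R y + (1 - t) *\<^sub>R (y - h) \<in> P" by (rule convexD[OF P(2)]) (use that t in auto)
      then show ?thesis by (simp add: algebra_simps)
    qed
    have "(\<integral>\<^sup>+x. indicator P x * indicator P (x + h) * \<gamma> (x + t *\<^sub>R h) \<partial>lborel) \<le>
        (\<integral>\<^sup>+x. indicator P x * \<gamma>P (x + (t - 1) *\<^sub>R h) \<partial>lborel)" for h
    proof -
      let ?k = "\<lambda>y. indicator P (y - h) * indicator P y * \<gamma> (y + (t - 1) *\<^sub>R h)"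
      have "(\<integral>\<^sup>+x. indicator P x * indicator P (x + h) * \<gamma> (x + t *\<^sub>R h) \<partial>lborel) = (\<integral>\<^sup>+x. ?k (x + h) \<partial>lborel)"
        by (intro nn_integral_cong) (simp add: algebra_simps)
      also have "\<dots> = (\<integral>\<^sup>+y. ?k y \<partial>lborel)" by (rule lborel_nn_integral_shift) measurable
      also have "\<dots> \<le> (\<integral>\<^sup>+x. indicator P x * \<gamma>P (x + (t - 1) *\<^sub>R h) \<partial>lborel)"
        by (intro nn_integral_mono) (auto simp: \<gamma>P_def mem split: split_indicator)
      finally show ?thesis .
    qed
    then show ?thesis using that[of "t - 1"] False by simp
  qed
  have "(\<integral>\<^sup>+h. \<integral>\<^sup>+x. indicator P x * indicator P (x + h) * \<gamma> (x + t *\<^sub>R h) \<partial>lborel \<partial>lborel) \<le>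
      (\<integral>\<^sup>+h. \<integral>\<^sup>+x. indicator P x * \<gamma>P (x + c *\<^sub>R h) \<partial>lborel \<partial>lborel)"
    by (intro nn_integral_mono le)
  also have "\<dots> = (\<integral>\<^sup>+x. \<integral>\<^sup>+h. indicator P x * \<gamma>P (x + c *\<^sub>R h) \<partial>lborel \<partial>lborel)"
    by (rule lborel_pair.Fubini') measurable
  also have "\<dots> = (\<integral>\<^sup>+x. indicator P x * (\<integral>\<^sup>+h. \<gamma>P (x + c *\<^sub>R h) \<partial>lborel) \<partial>lborel)"
    by (intro nn_integral_cong nn_integral_cmult) measurable
  also have "\<dots> \<le> (\<integral>\<^sup>+x. indicator P x * (4 * (\<integral>\<^sup>+x. \<gamma>P x \<partial>lborel)) \<partial>lborel)"
    by (intro nn_integral_mono mult_left_mono nn_integral_scaled_le c) auto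
  also have "\<dots> = 4 * emeasure lborel P * (\<integral>\<^sup>+x. \<gamma>P x \<partial>lborel)"
    by (subst nn_integral_multc) (auto simp: ac_simps)
  finally show ?thesis unfolding \<gamma>P_def .
qed

text \<open>The substitution y = x + h makes the difference a translation, which
  \<open>weak_derivative_translation\<close> expresses as the mean of the directional derivative
  over a chord. Jensen's inequality and |h| <= d bound its square by d^2 times the mean of the
  squared gradient, and \<open>nn_integral_chord_le\<close> integrates this over x and h for each
  fixed t.\<close>

lemma Poincare_double_integral:
  assumes \<Omega>: "open \<Omega>" "bounded \<Omega>" and f: "\<And>i. has_weak_partial \<Omega> i f (g i)"
    and P: "open P" "convex P" "P \<subseteq> \<Omega>" and d: "\<And>x y. x \<in> P \<Longrightarrow> y \<in> P \<Longrightarrow> dist x y \<le> d"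
  defines "F \<equiv> \<lambda>x. indicator \<Omega> x * f x" and "\<gamma> \<equiv> \<lambda>x. indicator \<Omega> x * (\<Sum>i\<in>UNIV. (g i x)\<^sup>2)"
  shows "(\<integral>\<^sup>+x. \<integral>\<^sup>+y. indicator P x * indicator P y * ennreal ((F y - F x)\<^sup>2) \<partial>lborel \<partial>lborel) \<le>
    ennreal (d\<^sup>2) * (4 * emeasure lborel P * (\<integral>\<^sup>+x. indicator P x * ennreal (\<gamma> x) \<partial>lborel))"
proof -
  note meas\<Omega> = domain_measurable[OF \<Omega>]
  have [measurable]: "P \<in> sets borel" using P by simp
  have si: "square_integrable (lborel_on \<Omega>) f" "square_integrable (lborel_on \<Omega>) (g i)" for i
    using f by (auto simp: has_weak_partial_iff[OF \<Omega>])
  have [measurable]: "F \<in> borel_measurable borel"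
    using square_integrable_measurable[OF si(1)] unfolding F_def by (simp add: borel_measurable_restrict_space_iff meas\<Omega>)
  define G where "G i x = indicator \<Omega> x * g i x" for i x
  have [measurable]: "G i \<in> borel_measurable borel" for i
    using square_integrable_measurable[OF si(2)[of i]] unfolding G_def by (simp add: borel_measurable_restrict_space_iff meas\<Omega>)
  have \<gamma>G: "\<gamma> x = (\<Sum>i\<in>UNIV. (G i x)\<^sup>2)" for x unfolding \<gamma>_def G_def by (simp split: split_indicator)
  have [measurable]: "\<gamma> \<in> borel_measurable borel" unfolding \<gamma>G by measurable
  have \<gamma>0: "\<gamma> x \<ge> 0" for x unfolding \<gamma>G by (simp add: sum_nonneg)
  let ?I = "\<lambda>x h. indicator P x * indicator P (x + h) :: ennreal"
  let ?T = "\<lambda>t. indicator {0..1::real} t :: ennreal"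
  have pointwise: "AE x in lborel. ?I x h * ennreal ((F (x + h) - F x)\<^sup>2) \<le>
      ennreal (d\<^sup>2) * (\<integral>\<^sup>+t. ?T t * (?I x h * ennreal (\<gamma> (x + t *\<^sub>R h))) \<partial>lborel)" for h
  proof -
    \<comment> \<open>The admissible starting points for the shift h; convexity keeps the whole
      chord in \<open>P\<close>.\<close>
    define U where "U = P \<inter> (\<lambda>x. x - h) ` P"
    have U: "x \<in> U \<longleftrightarrow> x \<in> P \<and> x + h \<in> P" for x unfolding U_def by force
    have "open ((\<lambda>x. x - h) ` P)" using open_translation_subtract[OF P(1)] .
    then have openU: "open U" using P by (auto simp: U_def)
    have "x + t *\<^sub>R h \<in> \<Omega>" if "x \<in> U" "0 \<le> t" "t \<le> 1" for x t
    proof -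
      have "(1 - t) *\<^sub>R x + t *\<^sub>R (x + h) \<in> P" by (rule convexD[OF P(2)]) (use that U in auto)
      then show ?thesis using P(3) by (auto simp: algebra_simps)
    qed
    from weak_derivative_translation[OF \<Omega> f openU this]
    have "AE x in lborel. x \<in> U \<longrightarrow> F (x + h) - F x = (\<integral>t. (\<Sum>i\<in>UNIV. h$i * G i (x + t *\<^sub>R h)) \<partial>unit_interval)"
      unfolding F_def G_def by blast
    then show ?thesis
    proof eventually_elim
      case (elim x)
      show ?case
      proof (cases "x \<in> U")
        case True
        then have x: "x \<in> P" "x + h \<in> P" using U by auto
        let ?w = "\<lambda>t. \<Sum>i\<in>UNIV. h$i * G i (x + t *\<^sub>R h)"
        have "norm h \<le> d" using d[OF x] by (simp add: dist_norm)
        then have h2: "(norm h)\<^sup>2 \<le> d\<^sup>2" by (intro power_mono) auto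
        have "(\<lambda>t::real. ?w t) \<in> borel_measurable borel" by measurable
        then have wm: "?w \<in> borel_measurable unit_interval" by (rule borel_measurable_lborel_on)
        have wle: "(?w t)\<^sup>2 \<le> d\<^sup>2 * \<gamma> (x + t *\<^sub>R h)" for t
        proof -
          have "(?w t)\<^sup>2 \<le> (\<Sum>i\<in>UNIV. (h$i)\<^sup>2) * (\<Sum>i\<in>UNIV. (G i (x + t *\<^sub>R h))\<^sup>2)"
            by (rule Cauchy_Schwarz_ineq_sum)
          also have "(\<Sum>i\<in>UNIV. (h$i)\<^sup>2) = (norm h)\<^sup>2"
            unfolding power2_norm_eq_inner inner_vec_def by (simp add: power2_eq_square)
          also have "(norm h)\<^sup>2 * (\<Sum>i\<in>UNIV. (G i (x + t *\<^sub>R h))\<^sup>2) \<le> d\<^sup>2 * \<gamma> (x + t *\<^sub>R h)"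
            unfolding \<gamma>G using h2 by (intro mult_right_mono) (auto simp: sum_nonneg)
          finally show ?thesis .
        qed
        have "ennreal ((F (x + h) - F x)\<^sup>2) = ennreal ((\<integral>t. ?w t \<partial>unit_interval)\<^sup>2)" using elim True by simp
        also have "\<dots> \<le> (\<integral>\<^sup>+t. ennreal ((?w t)\<^sup>2) \<partial>unit_interval)"
          by (rule integral_sq_le_nn_integral[OF finite_measure_unit_interval _ wm])
             (simp add: measure_restrict_space space_restrict_space)
        also have "\<dots> \<le> (\<integral>\<^sup>+t. ennreal (d\<^sup>2 * \<gamma> (x + t *\<^sub>R h)) \<partial>unit_interval)"
          by (intro nn_integral_mono ennreal_leI wle)
        also have "\<dots> = (\<integral>\<^sup>+t. ennreal (d\<^sup>2) * (?T t * ennreal (\<gamma> (x + t *\<^sub>R h))) \<partial>lborel)"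
          using \<gamma>0 by (subst nn_integral_restrict_space) (auto simp: ennreal_mult ac_simps intro!: nn_integral_cong)
        also have "\<dots> = ennreal (d\<^sup>2) * (\<integral>\<^sup>+t. ?T t * ennreal (\<gamma> (x + t *\<^sub>R h)) \<partial>lborel)"
          by (rule nn_integral_cmult) measurable
        finally show ?thesis using x by simp
      qed (use U in \<open>auto split: split_indicator\<close>)
    qed
  qed
  \<comment> \<open>The integral over t is moved to the outside, so that the chord estimate can be
    used for each fixed t.\<close>
  have "(\<integral>\<^sup>+h. \<integral>\<^sup>+x. \<integral>\<^sup>+t. ?T t * (?I x h * ennreal (\<gamma> (x + t *\<^sub>R h))) \<partial>lborel \<partial>lborel \<partial>lborel) =
      (\<integral>\<^sup>+h. \<integral>\<^sup>+t. \<integral>\<^sup>+x. ?T t * (?I x h * ennreal (\<gamma> (x + t *\<^sub>R h))) \<partial>lborel \<partial>lborel \<partial>lborel)"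
    by (intro nn_integral_cong lborel_pair.Fubini') measurable
  also have "\<dots> = (\<integral>\<^sup>+t. \<integral>\<^sup>+h. \<integral>\<^sup>+x. ?T t * (?I x h * ennreal (\<gamma> (x + t *\<^sub>R h))) \<partial>lborel \<partial>lborel \<partial>lborel)"
    by (intro lborel_pair.Fubini') measurable
  also have "\<dots> \<le> (\<integral>\<^sup>+t. ?T t * (4 * emeasure lborel P * (\<integral>\<^sup>+x. indicator P x * ennreal (\<gamma> x) \<partial>lborel)) \<partial>lborel)"
  proof (rule nn_integral_mono)
    fix t :: real
    show "(\<integral>\<^sup>+h. \<integral>\<^sup>+x. ?T t * (?I x h * ennreal (\<gamma> (x + t *\<^sub>R h))) \<partial>lborel \<partial>lborel) \<le>
        ?T t * (4 * emeasure lborel P * (\<integral>\<^sup>+x. indicator P x * ennreal (\<gamma> x) \<partial>lborel))"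
      using nn_integral_chord_le[OF P(1,2), of "\<lambda>x. ennreal (\<gamma> x)" t]
      by (cases "t \<in> {0..1}") auto
  qed
  also have "\<dots> = 4 * emeasure lborel P * (\<integral>\<^sup>+x. indicator P x * ennreal (\<gamma> x) \<partial>lborel)"
    by (subst nn_integral_multc) auto
  finally have triple: "(\<integral>\<^sup>+h. \<integral>\<^sup>+x. \<integral>\<^sup>+t. ?T t * (?I x h * ennreal (\<gamma> (x + t *\<^sub>R h))) \<partial>lborel \<partial>lborel \<partial>lborel) \<le>
      4 * emeasure lborel P * (\<integral>\<^sup>+x. indicator P x * ennreal (\<gamma> x) \<partial>lborel)" .
  have "(\<integral>\<^sup>+x. \<integral>\<^sup>+y. indicator P x * indicator P y * ennreal ((F y - F x)\<^sup>2) \<partial>lborel \<partial>lborel) =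
      (\<integral>\<^sup>+x. \<integral>\<^sup>+h. ?I x h * ennreal ((F (x + h) - F x)\<^sup>2) \<partial>lborel \<partial>lborel)"
  proof (rule nn_integral_cong)
    fix x
    have "(\<integral>\<^sup>+h. indicator P x * indicator P (h + x) * ennreal ((F (h + x) - F x)\<^sup>2) \<partial>lborel) =
        (\<integral>\<^sup>+y. indicator P x * indicator P y * ennreal ((F y - F x)\<^sup>2) \<partial>lborel)"
      by (rule lborel_nn_integral_shift) measurable
    then show "(\<integral>\<^sup>+y. indicator P x * indicator P y * ennreal ((F y - F x)\<^sup>2) \<partial>lborel) =
        (\<integral>\<^sup>+h. ?I x h * ennreal ((F (x + h) - F x)\<^sup>2) \<partial>lborel)" by (simp add: add.commute)
  qed
  also have "\<dots> = (\<integral>\<^sup>+h. \<integral>\<^sup>+x. ?I x h * ennreal ((F (x + h) - F x)\<^sup>2) \<partial>lborel \<partial>lborel)"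
    by (rule lborel_pair.Fubini') measurable
  also have "\<dots> \<le> (\<integral>\<^sup>+h. \<integral>\<^sup>+x. ennreal (d\<^sup>2) * (\<integral>\<^sup>+t. ?T t * (?I x h * ennreal (\<gamma> (x + t *\<^sub>R h))) \<partial>lborel) \<partial>lborel \<partial>lborel)"
    by (intro nn_integral_mono nn_integral_mono_AE pointwise)
  also have "\<dots> = (\<integral>\<^sup>+h. ennreal (d\<^sup>2) * (\<integral>\<^sup>+x. \<integral>\<^sup>+t. ?T t * (?I x h * ennreal (\<gamma> (x + t *\<^sub>R h))) \<partial>lborel \<partial>lborel) \<partial>lborel)"
    by (intro nn_integral_cong nn_integral_cmult) measurable
  also have "\<dots> = ennreal (d\<^sup>2) * (\<integral>\<^sup>+h. \<integral>\<^sup>+x. \<integral>\<^sup>+t. ?T t * (?I x h * ennreal (\<gamma> (x + t *\<^sub>R h))) \<partial>lborel \<partial>lborel \<partial>lborel)"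
    by (intro nn_integral_cmult) measurable
  also have "\<dots> \<le> ennreal (d\<^sup>2) * (4 * emeasure lborel P * (\<integral>\<^sup>+x. indicator P x * ennreal (\<gamma> x) \<partial>lborel))"
    by (rule mult_left_mono[OF triple]) simp
  finally show ?thesis .
qed

text \<open>Expansion of the square. Up to a factor the double integral is the variance of f, which
  is how the mean value enters Poincare's inequality.\<close>

lemma (in finite_measure) double_integral_sq_diff:
  fixes f :: "'a \<Rightarrow> real"
  assumes f: "square_integrable M f"
  shows "(\<integral>\<^sup>+x. \<integral>\<^sup>+y. ennreal ((f y - f x)\<^sup>2) \<partial>M \<partial>M) =
    ennreal (2 * measure M (space M) * (\<integral>x. (f x)\<^sup>2 \<partial>M) - 2 * (\<integral>x. f x \<partial>M)\<^sup>2)"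
proof -
  let ?m = "measure M (space M)" and ?S = "\<integral>x. (f x)\<^sup>2 \<partial>M" and ?J = "\<integral>x. f x \<partial>M"
  have int: "integrable M f" "integrable M (\<lambda>x. (f x)\<^sup>2)"
    using square_integrable_integrable_L1[OF f] square_integrable_integrable[OF f] by auto
  have inner: "(\<integral>\<^sup>+y. ennreal ((f y - f x)\<^sup>2) \<partial>M) = ennreal (?S - 2 * f x * ?J + ?m * (f x)\<^sup>2)" for x
  proof -
    have "square_integrable M (\<lambda>y. f y - f x)" by (intro square_integrable_diff f square_integrable_const)
    then have i: "integrable M (\<lambda>y. (f y - f x)\<^sup>2)" using square_integrable_integrable by fastforce
    have "(\<integral>y. (f y - f x)\<^sup>2 \<partial>M) = (\<integral>y. (f y)\<^sup>2 - (2 * f x) * f y + (f x)\<^sup>2 \<partial>M)"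
      by (simp add: power2_diff algebra_simps)
    also have "\<dots> = ?S - 2 * f x * ?J + ?m * (f x)\<^sup>2" using int by simp
    finally show ?thesis using i by (simp add: nn_integral_eq_integral)
  qed
  have nonneg: "0 \<le> ?S - 2 * f x * ?J + ?m * (f x)\<^sup>2" for x
  proof -
    have "?J\<^sup>2 \<le> ?S * ?m"
      using integral_Cauchy_Schwarz[OF f square_integrable_const[of "1::real"]] by simp
    have "0 \<le> (\<integral>y. (f y - f x)\<^sup>2 \<partial>M)" by simp
    also have "\<dots> = (\<integral>y. (f y)\<^sup>2 - (2 * f x) * f y + (f x)\<^sup>2 \<partial>M)"
      by (simp add: power2_diff algebra_simps)
    also have "\<dots> = ?S - 2 * f x * ?J + ?m * (f x)\<^sup>2" using int by simp
    finally show ?thesis .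
  qed
  have i2: "integrable M (\<lambda>x. ?S - 2 * f x * ?J + ?m * (f x)\<^sup>2)" using int by simp
  have "(\<integral>\<^sup>+x. \<integral>\<^sup>+y. ennreal ((f y - f x)\<^sup>2) \<partial>M \<partial>M) = (\<integral>\<^sup>+x. ennreal (?S - 2 * f x * ?J + ?m * (f x)\<^sup>2) \<partial>M)"
    by (simp add: inner)
  also have "\<dots> = ennreal (\<integral>x. ?S - 2 * f x * ?J + ?m * (f x)\<^sup>2 \<partial>M)"
    using i2 nonneg by (intro nn_integral_eq_integral) auto
  also have "(\<integral>x. ?S - 2 * f x * ?J + ?m * (f x)\<^sup>2 \<partial>M) = 2 * ?m * ?S - 2 * ?J\<^sup>2"
    using int by (simp add: power2_eq_square)
  finally show ?thesis .
qed

lemma integrable_lborel_on_subset: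
  fixes w :: "'a::euclidean_space \<Rightarrow> real"
  assumes w: "integrable (lborel_on \<Omega>) w" and P: "P \<in> sets borel" "\<Omega> \<in> sets borel" "P \<subseteq> \<Omega>"
  shows "integrable (lborel_on P) w"
proof -
  have "integrable lborel (\<lambda>x. indicator \<Omega> x *\<^sub>R w x)"
    using w P by (simp add: integrable_restrict_space)
  then have "integrable lborel (\<lambda>x. indicator P x *\<^sub>R (indicator \<Omega> x *\<^sub>R w x))"
    using P by (intro integrable_mult_indicator[of P lborel]) simp_all
  moreover have "(\<lambda>x. indicator P x *\<^sub>R (indicator \<Omega> x *\<^sub>R w x)) = (\<lambda>x. indicator P x *\<^sub>R w x)"
    using P(3) by (auto simp: fun_eq_iff split: split_indicator)
  ultimately have "integrable lborel (\<lambda>x. indicator P x *\<^sub>R w x)" by (simp only:)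
  then show ?thesis using P by (simp add: integrable_restrict_space)
qed

lemma square_integrable_lborel_on_subset:
  fixes w :: "'a::euclidean_space \<Rightarrow> real"
  assumes w: "square_integrable (lborel_on \<Omega>) w" and P: "P \<in> sets borel" "\<Omega> \<in> sets borel" "P \<subseteq> \<Omega>"
  shows "square_integrable (lborel_on P) w"
proof -
  have "(\<lambda>x. indicator \<Omega> x *\<^sub>R w x) \<in> borel_measurable borel"
    using square_integrable_measurable[OF w] P by (simp add: borel_measurable_restrict_space_iff)
  then have "(\<lambda>x. indicator P x *\<^sub>R (indicator \<Omega> x *\<^sub>R w x)) \<in> borel_measurable borel"
    using P(1) by measurable
  moreover have "(\<lambda>x. indicator P x *\<^sub>R (indicator \<Omega> x *\<^sub>R w x)) = (\<lambda>x. indicator P x *\<^sub>R w x)"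
    using P(3) by (auto simp: fun_eq_iff split: split_indicator)
  ultimately have "(\<lambda>x. indicator P x *\<^sub>R w x) \<in> borel_measurable borel" by (simp only:)
  then have "w \<in> borel_measurable (lborel_on P)" using P by (simp add: borel_measurable_restrict_space_iff)
  then show ?thesis
    using integrable_lborel_on_subset[OF square_integrable_integrable[OF w] P] by (simp add: square_integrable_def)
qed

text \<open>Let m be the measure of P, S the integral of f^2 and J that of f. The double integral of
  the squared differences is 2 m S - 2 J^2, and it is at most 4 d^2 m times the gradient energy on
  P. Division by 2 m produces the constant 2 d^2.\<close>

theorem Poincare_inequality:
  assumes \<Omega>: "open \<Omega>" "bounded \<Omega>" and f: "\<And>i. has_weak_partial \<Omega> i f (g i)"
    and P: "open P" "convex P" "P \<subseteq> \<Omega>" and d: "\<And>x y. x \<in> P \<Longrightarrow> y \<in> P \<Longrightarrow> dist x y \<le> d"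
  shows "(\<integral>x. (f x)\<^sup>2 \<partial>lborel_on P) \<le> (\<integral>x. f x \<partial>lborel_on P)\<^sup>2 / measure lborel P +
    2 * d\<^sup>2 * (\<Sum>i\<in>UNIV. \<integral>x. (g i x)\<^sup>2 \<partial>lborel_on P)"
proof -
  have measP: "P \<in> sets borel" using P by simp
  note meas\<Omega> = domain_measurable[OF \<Omega>]
  interpret fin: finite_measure "lborel_on P"
    by (rule finite_measure_lborel_on[OF measP bounded_subset[OF \<Omega>(2) P(3)]])
  have si: "square_integrable (lborel_on P) f" "square_integrable (lborel_on P) (g i)" for i
    using f by (auto simp: has_weak_partial_iff[OF \<Omega>] intro: square_integrable_lborel_on_subset[OF _ measP meas\<Omega> P(3)])
  let ?m = "measure lborel P" and ?S = "\<integral>x. (f x)\<^sup>2 \<partial>lborel_on P" and ?J = "\<integral>x. f x \<partial>lborel_on P"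
  let ?E = "\<Sum>i\<in>UNIV. \<integral>x. (g i x)\<^sup>2 \<partial>lborel_on P"
  have m: "measure (lborel_on P) (space (lborel_on P)) = ?m"
    by (simp add: measure_restrict_space space_restrict_space measP)
  have em: "emeasure lborel P = ennreal ?m"
    using emeasure_bounded_finite[OF bounded_subset[OF \<Omega>(2) P(3)]] by (simp add: emeasure_eq_ennreal_measure)
  have E: "(\<integral>\<^sup>+x. indicator P x * ennreal (indicator \<Omega> x * (\<Sum>i\<in>UNIV. (g i x)\<^sup>2)) \<partial>lborel) = ennreal ?E"
  proof -
    have int: "integrable (lborel_on P) (\<lambda>x. (g i x)\<^sup>2)" for i using square_integrable_integrable[OF si(2)] by simp
    have "(\<integral>\<^sup>+x. indicator P x * ennreal (indicator \<Omega> x * (\<Sum>i\<in>UNIV. (g i x)\<^sup>2)) \<partial>lborel) =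
        (\<integral>\<^sup>+x. ennreal (\<Sum>i\<in>UNIV. (g i x)\<^sup>2) \<partial>lborel_on P)"
      using P(3) measP by (subst nn_integral_restrict_space) (auto intro!: nn_integral_cong split: split_indicator)
    also have "\<dots> = ennreal (\<integral>x. (\<Sum>i\<in>UNIV. (g i x)\<^sup>2) \<partial>lborel_on P)"
      using int by (intro nn_integral_eq_integral) (auto simp: sum_nonneg)
    also have "(\<integral>x. (\<Sum>i\<in>UNIV. (g i x)\<^sup>2) \<partial>lborel_on P) = ?E" using int by simp
    finally show ?thesis .
  qed
  have "ennreal (2 * ?m * ?S - 2 * ?J\<^sup>2) = (\<integral>\<^sup>+x. \<integral>\<^sup>+y. ennreal ((f y - f x)\<^sup>2) \<partial>lborel_on P \<partial>lborel_on P)"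
    using fin.double_integral_sq_diff[OF si(1)] m by simp
  also have "\<dots> = (\<integral>\<^sup>+x. \<integral>\<^sup>+y. indicator P x * indicator P y *
      ennreal ((indicator \<Omega> y * f y - indicator \<Omega> x * f x)\<^sup>2) \<partial>lborel \<partial>lborel)"
  proof (subst nn_integral_restrict_space)
    show "P \<inter> space lborel \<in> sets lborel" using measP by simp
    show "(\<integral>\<^sup>+x. (\<integral>\<^sup>+y. ennreal ((f y - f x)\<^sup>2) \<partial>lborel_on P) * indicator P x \<partial>lborel) =
      (\<integral>\<^sup>+x. \<integral>\<^sup>+y. indicator P x * indicator P y *
        ennreal ((indicator \<Omega> y * f y - indicator \<Omega> x * f x)\<^sup>2) \<partial>lborel \<partial>lborel)"
    proof (rule nn_integral_cong)
      fix x
      show "(\<integral>\<^sup>+y. ennreal ((f y - f x)\<^sup>2) \<partial>lborel_on P) * indicator P x =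
        (\<integral>\<^sup>+y. indicator P x * indicator P y * ennreal ((indicator \<Omega> y * f y - indicator \<Omega> x * f x)\<^sup>2) \<partial>lborel)"
      proof (cases "x \<in> P")
        case True
        then show ?thesis using P(3) measP
          by (subst nn_integral_restrict_space) (auto intro!: nn_integral_cong split: split_indicator)
      qed simp
    qed
  qed
  also have "\<dots> \<le> ennreal (d\<^sup>2) * (4 * ennreal ?m * ennreal ?E)"
    using Poincare_double_integral[OF \<Omega> f P d] unfolding E em .
  also have "\<dots> = ennreal (d\<^sup>2 * (4 * ?m * ?E))"
    by (simp add: ennreal_mult sum_nonneg)
  finally have main: "2 * ?m * ?S - 2 * ?J\<^sup>2 \<le> d\<^sup>2 * (4 * ?m * ?E)"
    by (subst (asm) ennreal_le_iff) (auto simp: sum_nonneg)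
  show ?thesis
  \<comment> \<open>On a null set the left side is 0, and the quotient by 0 is 0 as well.\<close>
  proof (cases "?m = 0")
    case True
    then have "AE x in lborel_on P. False"
      using measP em by (auto simp: AE_lborel_on intro!: AE_not_in null_setsI)
    then have "?S = 0" by (intro integral_eq_zero_AE) auto
    then show ?thesis using True by (simp add: sum_nonneg)
  next
    case False
    then have "?m > 0" by (simp add: less_le)
    then show ?thesis using main by (simp add: field_simps)
  qed
qed

section \<open>Hat functions\<close>

text \<open>Subtracting one point of S turns affine independence into linear independence, so a
  linear functional with the prescribed differences exists. The vector that represents it is
  \<open>adjoint g 1\<close>.\<close>

lemma affine_interpolation:
  fixes S :: "'a::euclidean_space set"
  assumes "\<not> affine_dependent S"
  shows "\<exists>l c. \<forall>y\<in>S. l \<bullet> y + c = f y"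
proof (cases "S = {}")
  case False
  then obtain a where a: "a \<in> S" by blast
  define B where "B = {x - a |x. x \<in> S - {a}}"
  have "independent B"
    using dependent_imp_affine_dependent[of a "S - {a}"] assms a by (auto simp: B_def insert_absorb)
  then obtain g where g: "linear g" "\<And>x. x \<in> B \<Longrightarrow> g x = f (x + a) - f a"
    using linear_independent_extend[of B "\<lambda>x. f (x + a) - f a"] by auto
  have "adjoint g 1 \<bullet> y + (f a - adjoint g 1 \<bullet> a) = f y" if "y \<in> S" for y
  proof -
    have "adjoint g 1 \<bullet> y - adjoint g 1 \<bullet> a = g (y - a)"
      using adjoint_works[OF g(1), of "y - a" 1] by (simp add: inner_commute inner_diff_right inner_diff_left)
    also have "\<dots> = f y - f a"
      using g(2)[of "y - a"] that linear_0[OF g(1)] by (cases "y = a") (auto simp: B_def)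
    finally show ?thesis by simp
  qed
  then show ?thesis by blast
qed auto

text \<open>The points at which two affine functions agree form a convex set.\<close>

lemma affine_eq_on_convex_hull:
  fixes S :: "'a::real_inner set"
  assumes "\<And>y. y \<in> S \<Longrightarrow> l \<bullet> y + c = l' \<bullet> y + c'" and x: "x \<in> convex hull S"
  shows "l \<bullet> x + c = l' \<bullet> x + c'"
proof -
  have "convex hull S \<subseteq> {x. (l - l') \<bullet> x = c' - c}"
    by (rule hull_minimal) (use assms(1) in \<open>fastforce simp: inner_diff_left\<close>, rule convex_hyperplane)
  then show ?thesis using x by (auto simp: inner_diff_left)
qed

text \<open>The condition inside the definite description of \<open>hat\<close>, named so that
  existence and uniqueness can be stated for it.\<close>

definition is_hat :: "(real^2) set set \<Rightarrow> real^2 \<Rightarrow> (real^2 \<Rightarrow> real) \<Rightarrow> bool" where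
  "is_hat \<T> z \<phi> \<longleftrightarrow>
     (\<forall>x. x \<notin> (\<Union>S\<in>\<T>. convex hull S) \<longrightarrow> \<phi> x = 0) \<and>
     continuous_on (\<Union>S\<in>\<T>. convex hull S) \<phi> \<and>
     (\<forall>S\<in>\<T>. \<exists>l c. \<forall>x\<in>convex hull S. \<phi> x = l \<bullet> x + c) \<and>
     (\<forall>y\<in>nodes \<T>. \<phi> y = (if y = z then 1 else 0))"

section \<open>Hat functions of a conforming triangulation\<close>

context
  fixes \<Omega> :: "(real^2) set" and \<T> :: "(real^2) set set"
  assumes \<T>: "conforming_triangulation \<Omega> \<T>"
begin

lemma triangulation_finite: "finite \<T>"
  and triangle_card: "S \<in> \<T> \<Longrightarrow> card S = 3"
  and triangle_independent: "S \<in> \<T> \<Longrightarrow> \<not> affine_dependent S"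
  and triangle_Int: "S \<in> \<T> \<Longrightarrow> S' \<in> \<T> \<Longrightarrow> convex hull S \<inter> convex hull S' = convex hull (S \<inter> S')"
  and triangle_Union: "(\<Union>S\<in>\<T>. convex hull S) = closure \<Omega>"
  using \<T> by (auto simp: conforming_triangulation_def)

lemma triangle_finite: "S \<in> \<T> \<Longrightarrow> finite S"
  using triangle_card[of S] card_ge_0_finite[of S] by simp

lemma nodes_finite: "finite (nodes \<T>)"
  using triangulation_finite triangle_finite by blast

lemma triangle_closed: "S \<in> \<T> \<Longrightarrow> closed (convex hull S)"
  using triangle_finite[of S] finite_imp_compact_convex_hull compact_imp_closed by blast

text \<open>On each triangle the function must be the affine interpolant of the nodal values. Two
  interpolants agree at the common vertices, hence on their convex hull, which by conformity is the
  whole intersection of the triangles. So they glue, and the result is continuous because the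
  triangles are finitely many closed sets.\<close>

lemma hat_exists_unique: "\<exists>!\<phi>. is_hat \<T> z \<phi>"
proof -
  have "\<forall>S\<in>\<T>. \<exists>l c. \<forall>y\<in>S. l \<bullet> y + c = (if y = z then 1 else 0)"
    by (intro ballI affine_interpolation[OF triangle_independent])
  then obtain l c where lc: "\<And>S y. S \<in> \<T> \<Longrightarrow> y \<in> S \<Longrightarrow> l S \<bullet> y + c S = (if y = z then 1 else 0)"
    by metis
  \<comment> \<open>An arbitrary triangle containing x; \<open>on\<close> shows that the value does
    not depend on the choice.\<close>
  define tri where "tri x = (SOME S. S \<in> \<T> \<and> x \<in> convex hull S)" for x
  define \<phi> where "\<phi> x = (if x \<in> (\<Union>S\<in>\<T>. convex hull S) then l (tri x) \<bullet> x + c (tri x) else 0)" for x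
  have on: "\<phi> x = l S \<bullet> x + c S" if S: "S \<in> \<T>" "x \<in> convex hull S" for S x
  proof -
    have tri: "tri x \<in> \<T>" "x \<in> convex hull (tri x)"
      using someI[of "\<lambda>S. S \<in> \<T> \<and> x \<in> convex hull S" S] S unfolding tri_def by auto
    then have x: "x \<in> convex hull (tri x \<inter> S)" using triangle_Int[OF tri(1) S(1)] S(2) by blast
    have "l (tri x) \<bullet> x + c (tri x) = l S \<bullet> x + c S"
      by (rule affine_eq_on_convex_hull[OF _ x]) (use lc tri(1) S(1) in auto)
    then show ?thesis using S by (auto simp: \<phi>_def)
  qed
  have "is_hat \<T> z \<phi>" unfolding is_hat_def
  proof (intro conjI ballI)
    show "\<forall>x. x \<notin> (\<Union>S\<in>\<T>. convex hull S) \<longrightarrow> \<phi> x = 0" by (simp add: \<phi>_def)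
    show "continuous_on (\<Union>S\<in>\<T>. convex hull S) \<phi>"
    proof (rule continuous_on_closed_Union[OF triangulation_finite])
      fix S assume S: "S \<in> \<T>"
      show "closed (convex hull S)" by (rule triangle_closed[OF S])
      have "continuous_on (convex hull S) (\<lambda>x. l S \<bullet> x + c S)" by (intro continuous_intros)
      then show "continuous_on (convex hull S) \<phi>" using on[OF S] by (simp cong: continuous_on_cong)
    qed
    show "\<exists>l c. \<forall>x\<in>convex hull S. \<phi> x = l \<bullet> x + c" if "S \<in> \<T>" for S using on[OF that] by blast
    show "\<phi> y = (if y = z then 1 else 0)" if y: "y \<in> nodes \<T>" for y
    proof -
      obtain S where S: "S \<in> \<T>" "y \<in> S" using y by blast
      then show ?thesis using on[OF S(1) hull_inc[OF S(2)]] lc[OF S] by simp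
    qed
  qed
  moreover have "\<psi> = \<phi>" if \<psi>: "is_hat \<T> z \<psi>" for \<psi>
  proof
    fix x
    show "\<psi> x = \<phi> x"
    proof (cases "x \<in> (\<Union>S\<in>\<T>. convex hull S)")
      case True
      then obtain S where S: "S \<in> \<T>" "x \<in> convex hull S" by blast
      obtain l' c' where l': "\<And>x. x \<in> convex hull S \<Longrightarrow> \<psi> x = l' \<bullet> x + c'"
        using \<psi> S(1) unfolding is_hat_def by meson
      have "l' \<bullet> x + c' = l S \<bullet> x + c S"
      proof (rule affine_eq_on_convex_hull[OF _ S(2)])
        fix y assume y: "y \<in> S"
        then have "\<psi> y = (if y = z then 1 else 0)" using \<psi> S(1) by (auto simp: is_hat_def)
        then show "l' \<bullet> y + c' = l S \<bullet> y + c S" using l'[OF hull_inc[OF y]] lc[OF S(1) y] by simp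
      qed
      then show ?thesis using l'[OF S(2)] on[OF S] by simp
    next
      case False
      then show ?thesis using \<psi> by (simp add: is_hat_def \<phi>_def)
    qed
  qed
  ultimately show ?thesis by blast
qed

lemma is_hat_hat: "is_hat \<T> z (hat \<T> z)"
  using theI'[OF hat_exists_unique[of z]] unfolding hat_def is_hat_def .

lemma hat_affine: "S \<in> \<T> \<Longrightarrow> \<exists>l c. \<forall>x\<in>convex hull S. hat \<T> z x = l \<bullet> x + c"
  using is_hat_hat by (auto simp: is_hat_def)

lemma hat_node: "y \<in> nodes \<T> \<Longrightarrow> hat \<T> z y = (if y = z then 1 else 0)"
  using is_hat_hat by (auto simp: is_hat_def)

lemma hat_continuous: "continuous_on (closure \<Omega>) (hat \<T> z)"
  using is_hat_hat[of z] triangle_Union by (simp add: is_hat_def)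

lemma hat_bounds:
  assumes "x \<in> closure \<Omega>"
  shows "0 \<le> hat \<T> z x" "hat \<T> z x \<le> 1"
proof -
  obtain S where S: "S \<in> \<T>" "x \<in> convex hull S" using assms triangle_Union by blast
  obtain l c where l: "\<And>x. x \<in> convex hull S \<Longrightarrow> hat \<T> z x = l \<bullet> x + c" using hat_affine[OF S(1)] by blast
  have "convex hull S \<subseteq> {x. l \<bullet> x \<ge> - c} \<inter> {x. l \<bullet> x \<le> 1 - c}"
  proof (rule hull_minimal)
    show "S \<subseteq> {x. l \<bullet> x \<ge> - c} \<inter> {x. l \<bullet> x \<le> 1 - c}"
    proof
      fix y assume y: "y \<in> S"
      have "y \<in> nodes \<T>" using S(1) y by blast
      then have "l \<bullet> y + c = (if y = z then 1 else 0)" using l[OF hull_inc[OF y]] hat_node[of y z] by simp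
      then show "y \<in> {x. l \<bullet> x \<ge> - c} \<inter> {x. l \<bullet> x \<le> 1 - c}" by (auto split: if_splits)
    qed
    show "convex ({x. l \<bullet> x \<ge> - c} \<inter> {x. l \<bullet> x \<le> 1 - c})"
      by (intro convex_Int convex_halfspace_le convex_halfspace_ge)
  qed
  then have "l \<bullet> x \<ge> - c" "l \<bullet> x \<le> 1 - c" using S(2) by auto
  then show "0 \<le> hat \<T> z x" "hat \<T> z x \<le> 1" using l[OF S(2)] by auto
qed

text \<open>On each triangle the sum is affine, and at the vertices it equals 1.\<close>

lemma hat_partition_of_unity:
  assumes "x \<in> closure \<Omega>"
  shows "(\<Sum>z\<in>nodes \<T>. hat \<T> z x) = 1"
proof -
  obtain S where S: "S \<in> \<T>" "x \<in> convex hull S" using assms triangle_Union by blast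
  obtain l c where l: "\<And>z x. x \<in> convex hull S \<Longrightarrow> hat \<T> z x = l z \<bullet> x + c z" using hat_affine[OF S(1)] by metis
  have sum: "(\<Sum>z\<in>nodes \<T>. hat \<T> z y) = (\<Sum>z\<in>nodes \<T>. l z) \<bullet> y + (\<Sum>z\<in>nodes \<T>. c z)" if "y \<in> convex hull S" for y
    using l[OF that] by (simp add: sum.distrib inner_sum_left)
  have "(\<Sum>z\<in>nodes \<T>. l z) \<bullet> x + (\<Sum>z\<in>nodes \<T>. c z) = 0 \<bullet> x + 1"
  proof (rule affine_eq_on_convex_hull[OF _ S(2)])
    fix y assume y: "y \<in> S"
    then have y': "y \<in> nodes \<T>" using S(1) by blast
    have "(\<Sum>z\<in>nodes \<T>. hat \<T> z y) = (\<Sum>z\<in>nodes \<T>. if z = y then 1 else 0)"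
      by (rule sum.cong) (auto simp: hat_node[OF y'])
    also have "\<dots> = 1" using y' nodes_finite by simp
    finally show "(\<Sum>z\<in>nodes \<T>. l z) \<bullet> y + (\<Sum>z\<in>nodes \<T>. c z) = 0 \<bullet> y + 1"
      using sum[OF hull_inc[OF y]] by simp
  qed
  then show ?thesis using sum[OF S(2)] by simp
qed

text \<open>The triangles cut the parameter interval of the segment into finitely many closed sets,
  on each of which the hat is affine. The sum of the norms of all gradients bounds every
  slope.\<close>

lemma hat_Lipschitz:
  "\<exists>L. \<forall>x y. closed_segment x y \<subseteq> \<Omega> \<longrightarrow> \<bar>hat \<T> z x - hat \<T> z y\<bar> \<le> L * dist x y"
proof -
  obtain l c where l: "\<And>S x. S \<in> \<T> \<Longrightarrow> x \<in> convex hull S \<Longrightarrow> hat \<T> z x = l S \<bullet> x + c S" using hat_affine[of _ z] by metis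
  define L where "L = (\<Sum>S\<in>\<T>. norm (l S))"
  have L: "norm (l S) \<le> L" if "S \<in> \<T>" for S
    unfolding L_def using that triangulation_finite by (intro member_le_sum) auto
  have L0: "L \<ge> 0" by (simp add: L_def sum_nonneg)
  have "\<bar>hat \<T> z x - hat \<T> z y\<bar> \<le> L * dist x y" if xy: "closed_segment x y \<subseteq> \<Omega>" for x y
  proof -
    let ?p = "linepath x y" and ?f = "\<lambda>s. hat \<T> z (linepath x y s)"
    have "(L * dist x y)-lipschitz_on {0..1} ?f"
    proof (rule lipschitz_on_closed_Union[where I = \<T> and U = "\<lambda>S. {0..1} \<inter> ?p -` (convex hull S)"])
      fix S assume S: "S \<in> \<T>"
      show "(L * dist x y)-lipschitz_on ({0..1} \<inter> ?p -` (convex hull S)) ?f"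
      proof (rule lipschitz_onI)
        fix s t assume s: "s \<in> {0..1} \<inter> ?p -` (convex hull S)" and t: "t \<in> {0..1} \<inter> ?p -` (convex hull S)"
        have "?f s - ?f t = l S \<bullet> (?p s - ?p t)" using s t l[OF S] by (simp add: inner_diff_right)
        also have "?p s - ?p t = (s - t) *\<^sub>R (y - x)" by (simp add: linepath_def algebra_simps)
        finally have "\<bar>?f s - ?f t\<bar> \<le> norm (l S) * norm ((s - t) *\<^sub>R (y - x))"
          using Cauchy_Schwarz_ineq2 by metis
        also have "\<dots> \<le> L * norm ((s - t) *\<^sub>R (y - x))" by (intro mult_right_mono L S) auto
        finally show "dist (?f s) (?f t) \<le> L * dist x y * dist s t"
          by (simp add: dist_norm norm_minus_commute mult_ac)
      qed (use L0 in simp)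
      show "closed ({0..1} \<inter> ?p -` (convex hull S))"
        by (rule continuous_closed_preimage) (auto intro: triangle_closed[OF S] continuous_on_linepath)
    next
      show "{0..1} \<subseteq> (\<Union>S\<in>\<T>. {0..1} \<inter> ?p -` (convex hull S))"
      proof
        fix s :: real assume s: "s \<in> {0..1}"
        then have "?p s \<in> closed_segment x y" by (metis linepath_image_01 imageI)
        then have "?p s \<in> closure \<Omega>" using xy closure_subset by blast
        then show "s \<in> (\<Union>S\<in>\<T>. {0..1} \<inter> ?p -` (convex hull S))" using triangle_Union s by auto
      qed
    qed (use triangulation_finite L0 in auto)
    from lipschitz_onD[OF this, of 0 1] show ?thesis by (simp add: dist_norm linepath_def)
  qed
  then show ?thesis by blast
qed

text \<open>Distinct triangles share at most two vertices, and the convex hull of these has empty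
  interior.\<close>

lemma interior_triangles_disjoint:
  assumes "S \<in> \<T>" "S' \<in> \<T>" "S \<noteq> S'"
  shows "interior (convex hull S) \<inter> interior (convex hull S') = {}"
proof -
  have "card (S \<inter> S') < 3"
  proof -
    have "\<not> S \<subseteq> S'"
      using card_subset_eq[OF triangle_finite[OF assms(2)], of S] triangle_card[OF assms(1)]
        triangle_card[OF assms(2)] assms(3) by auto
    then have "S \<inter> S' \<subset> S" by blast
    from psubset_card_mono[OF triangle_finite[OF assms(1)] this] show ?thesis
      using triangle_card[OF assms(1)] by simp
  qed
  then have "interior (convex hull (S \<inter> S')) = {}"
    using triangle_finite[OF assms(1)] by (intro empty_interior_convex_hull) auto
  then show ?thesis using triangle_Int[OF assms(1,2)] by (metis interior_Int)
qed

text \<open>Boundaries of convex sets are null sets.\<close>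

lemma AE_in_triangle_interior:
  "AE x in lborel. x \<in> \<Omega> \<longrightarrow> (\<exists>S\<in>\<T>. x \<in> interior (convex hull S))"
proof -
  have "AE x in lborel. \<forall>S\<in>\<T>. x \<notin> frontier (convex hull S)"
    unfolding AE_ball_countable[OF countable_finite[OF triangulation_finite]]
  proof
    fix S assume S: "S \<in> \<T>"
    have "negligible (frontier (convex hull S))" by (rule negligible_convex_frontier) simp
    then show "AE x in lborel. x \<notin> frontier (convex hull S)"
      by (intro AE_not_in) (auto simp: negligible_iff_null_sets null_sets_completion_iff)
  qed
  then show ?thesis
  proof eventually_elim
    case (elim x)
    show ?case
    proof
      assume "x \<in> \<Omega>"
      then obtain S where "S \<in> \<T>" "x \<in> convex hull S" using triangle_Union closure_subset by blast
      then show "\<exists>S\<in>\<T>. x \<in> interior (convex hull S)"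
        using elim triangle_closed[of S] by (auto simp: frontier_def)
    qed
  qed
qed

text \<open>The derivative is constant on the interior of each triangle. Writing it as a finite sum
  of indicators gives measurability and boundedness at once.\<close>

lemma hat_gradient:
  "\<exists>G B. G \<in> borel_measurable borel \<and> (\<forall>x. \<bar>G x\<bar> \<le> B) \<and>
     (AE x in lborel. x \<in> \<Omega> \<longrightarrow> ((\<lambda>t. (hat \<T> z (x + t *\<^sub>R axis i 1) - hat \<T> z x) / t) \<longlongrightarrow> G x) (at 0))"
proof -
  obtain l c where l: "\<And>S x. S \<in> \<T> \<Longrightarrow> x \<in> convex hull S \<Longrightarrow> hat \<T> z x = l S \<bullet> x + c S" using hat_affine[of _ z] by metis
  define G where "G x = (\<Sum>S\<in>\<T>. indicator (interior (convex hull S)) x * l S $ i)" for x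
  have "G \<in> borel_measurable borel" unfolding G_def by measurable
  moreover have "\<bar>G x\<bar> \<le> (\<Sum>S\<in>\<T>. \<bar>l S $ i\<bar>)" for x
    unfolding G_def by (rule order_trans[OF sum_abs sum_mono]) (auto simp: abs_mult split: split_indicator)
  moreover have "AE x in lborel. x \<in> \<Omega> \<longrightarrow> ((\<lambda>t. (hat \<T> z (x + t *\<^sub>R axis i 1) - hat \<T> z x) / t) \<longlongrightarrow> G x) (at 0)"
    using AE_in_triangle_interior
  proof eventually_elim
    case (elim x)
    show ?case
    proof
      assume "x \<in> \<Omega>"
      then obtain S where S: "S \<in> \<T>" "x \<in> interior (convex hull S)" using elim by blast
      have "G x = (\<Sum>S'\<in>\<T>. if S' = S then l S $ i else 0)"
        unfolding G_def using interior_triangles_disjoint[OF S(1)] S(2)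
        by (intro sum.cong) (auto split: split_indicator)
      then have G: "G x = l S $ i" using S(1) triangulation_finite by simp
      have "open ((\<lambda>t. x + t *\<^sub>R axis i 1) -` interior (convex hull S))"
        by (intro open_vimage continuous_intros) auto
      then have "eventually (\<lambda>t. t \<in> (\<lambda>t. x + t *\<^sub>R axis i 1) -` interior (convex hull S)) (at 0)"
        by (rule eventually_at_in_open') (use S(2) in simp)
      then have "eventually (\<lambda>t. l S $ i = (hat \<T> z (x + t *\<^sub>R axis i 1) - hat \<T> z x) / t) (at 0)"
        using eventually_neq_at_within[of 0 0 UNIV]
      proof eventually_elim
        case (elim t)
        then have "x + t *\<^sub>R axis i 1 \<in> convex hull S" "x \<in> convex hull S" using S interior_subset by auto
        then show ?case using l[OF S(1)] elim by (simp add: inner_add_right inner_axis)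
      qed
      then show "((\<lambda>t. (hat \<T> z (x + t *\<^sub>R axis i 1) - hat \<T> z x) / t) \<longlongrightarrow> G x) (at 0)"
        unfolding G by (rule Lim_transform_eventually[OF tendsto_const])
    qed
  qed
  ultimately show ?thesis by blast
qed

lemma hat_measurable:
  assumes "open \<Omega>"
  shows "hat \<T> z \<in> borel_measurable (lborel_on \<Omega>)"
proof -
  have "continuous_on \<Omega> (hat \<T> z)" 
    by (rule continuous_on_subset[OF hat_continuous closure_subset])
  then have "(\<lambda>x. indicator \<Omega> x *\<^sub>R hat \<T> z x) \<in> borel_measurable borel"
    using assms by (intro borel_measurable_continuous_on_indicator) auto
  then show ?thesis using assms by (simp add: borel_measurable_restrict_space_iff)
qed

text \<open>Makes the localized residual an evaluation of the residual at an H^1 function.\<close>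

lemma h1_space_hat_mult:
  assumes \<Omega>: "open \<Omega>" "bounded \<Omega>" and f: "h1_space \<Omega> f"
  shows "h1_space \<Omega> (\<lambda>x. hat \<T> z x * f x)"
proof -
  obtain L where L: "\<And>x y. closed_segment x y \<subseteq> \<Omega> \<Longrightarrow> \<bar>hat \<T> z x - hat \<T> z y\<bar> \<le> L * dist x y"
    using hat_Lipschitz by blast
  have "\<exists>g. has_weak_partial \<Omega> i (\<lambda>x. hat \<T> z x * f x) g" for i
  proof -
    obtain G B where G: "G \<in> borel_measurable borel" "\<And>x. \<bar>G x\<bar> \<le> B"
      "AE x in lborel. x \<in> \<Omega> \<longrightarrow> ((\<lambda>t. (hat \<T> z (x + t *\<^sub>R axis i 1) - hat \<T> z x) / t) \<longlongrightarrow> G x) (at 0)"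
      using hat_gradient[of z i] by blast
    have "has_weak_partial \<Omega> i (\<lambda>x. hat \<T> z x * f x) (\<lambda>x. hat \<T> z x * weak_partial \<Omega> i f x + G x * f x)"
    proof (rule has_weak_partial_Lipschitz_mult[OF \<Omega> _ hat_measurable[OF \<Omega>(1)] _ L borel_measurable_lborel_on[OF G(1)]])
      show "has_weak_partial \<Omega> j f (weak_partial \<Omega> j f)" for j
        by (rule has_weak_partial_weak_partial[OF \<Omega> f])
      show "\<bar>hat \<T> z x\<bar> \<le> 1" if "x \<in> \<Omega>" for x using hat_bounds[of x z] that closure_subset by fastforce
      show "AE x in lborel_on \<Omega>. ((\<lambda>t. (hat \<T> z (x + t *\<^sub>R axis i 1) - hat \<T> z x) / t) \<longlongrightarrow> G x) (at 0)"
        using G(3) by (simp add: AE_lborel_on domain_measurable[OF \<Omega>])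
    qed (use G in auto)
    then show ?thesis by blast
  qed
  then obtain g where "\<And>i. has_weak_partial \<Omega> i (\<lambda>x. hat \<T> z x * f x) (g i)" by metis
  then show ?thesis by (rule h1_spaceI[OF \<Omega>])
qed

end

section \<open>Rellich's compactness theorem\<close>

text \<open>Cantor's diagonal argument in the shape of Tychonoff's theorem: the rows lie in a
  countable product of compact intervals, which is compact and metrizable, and convergence there is
  coordinatewise.\<close>

lemma bounded_sequences_diagonal:
  fixes X :: "nat \<Rightarrow> nat \<Rightarrow> real"
  assumes "\<And>k m. \<bar>X k m\<bar> \<le> B"
  shows "\<exists>r :: nat \<Rightarrow> nat. strict_mono r \<and> (\<forall>m. Cauchy (\<lambda>k. X (r k) m))"
proof -
  let ?K = "PiE UNIV (\<lambda>_. {- B..B}) :: (nat \<Rightarrow> real) set"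
  have "compact ?K"
    using compactin_PiE[of "\<lambda>_::nat. euclideanreal" UNIV "\<lambda>_. {- B..B}"]
    by (simp add: euclidean_product_topology)
  then have "seq_compact ?K" by (simp add: compact_eq_seq_compact_metric)
  moreover have "X k \<in> ?K" for k using assms[of k] by (auto simp: abs_le_iff minus_le_iff)
  ultimately obtain l r where r: "strict_mono r" "(X \<circ> r) \<longlonglongrightarrow> l"
    unfolding seq_compact_def by metis
  have "Cauchy (\<lambda>k. X (r k) m)" for m
  proof -
    have "isCont (\<lambda>x::nat \<Rightarrow> real. x m) l"
    proof -
      have "continuous_on UNIV (\<lambda>x::nat \<Rightarrow> real. x m)" by (rule continuous_on_product_coordinates)
      then show ?thesis unfolding continuous_on_eq_continuous_at[OF open_UNIV] by blast
    qed
    from isCont_tendsto_compose[OF this r(2)] have "(\<lambda>k. X (r k) m) \<longlonglongrightarrow> l m" by (simp add: comp_def)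
    then show ?thesis using LIMSEQ_imp_Cauchy by blast
  qed
  then show ?thesis using r(1) by blast
qed

text \<open>The triangles cover the closure, so this is what puts their interiors into \<Omega>
  itself. Near a boundary point the set below the Lipschitz graph is open and misses \<Omega>, so no
  boundary point is interior to the closure.\<close>

lemma interior_closure_Lipschitz:
  assumes "open \<Omega>" "lipschitz_boundary \<Omega>"
  shows "interior (closure \<Omega>) = \<Omega>"
proof
  show "\<Omega> \<subseteq> interior (closure \<Omega>)" using assms(1) by (simp add: closure_subset interior_maximal)
  show "interior (closure \<Omega>) \<subseteq> \<Omega>"
  proof
    fix x assume x: "x \<in> interior (closure \<Omega>)"
    show "x \<in> \<Omega>"
    proof (rule ccontr)
      assume nx: "x \<notin> \<Omega>"
      have "x \<in> frontier \<Omega>" using x nx interior_subset assms(1) by (auto simp: frontier_def interior_open)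
      then obtain r e1 e2 L and \<gamma> :: "real \<Rightarrow> real" where r: "r > 0" "norm e1 = 1" "norm e2 = 1" "e1 \<bullet> e2 = 0"
        "L-lipschitz_on UNIV \<gamma>" "\<Omega> \<inter> ball x r = {y \<in> ball x r. y \<bullet> e2 > \<gamma> (y \<bullet> e1)}"
        using assms(2) unfolding lipschitz_boundary_def by meson
      have e2: "e2 \<bullet> e2 = 1" "e2 \<bullet> e1 = 0" using r by (auto simp: norm_eq_1 inner_commute)
      have le: "x \<bullet> e2 \<le> \<gamma> (x \<bullet> e1)" using nx r(1,6) by fastforce
      obtain d where d: "d > 0" "ball x d \<subseteq> closure \<Omega>"
        using x by (auto simp: mem_interior)
      define s where "s = min d r / 2"
      have s: "s > 0" "s < d" "s < r" using d r by (auto simp: s_def)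
      \<comment> \<open>A point strictly below the graph: x is on it or below it, and a step along
        -e2 leaves x \<bullet> e1 unchanged.\<close>
      define y where "y = x - s *\<^sub>R e2"
      have y: "y \<in> ball x r" "y \<in> ball x d" using s r by (auto simp: y_def dist_norm)
      have cont: "continuous_on UNIV \<gamma>" using lipschitz_on_continuous_on[OF r(5)] .
      define W where "W = ball x r \<inter> {y. y \<bullet> e2 < \<gamma> (y \<bullet> e1)}"
      have "open W" unfolding W_def
        by (intro open_Int open_ball open_Collect_less continuous_intros continuous_on_compose2[OF cont]) auto
      moreover have "y \<in> W" using y le s e2 by (simp add: W_def y_def inner_diff_left)
      moreover have "W \<inter> \<Omega> = {}"
      proof (rule ccontr)
        assume "W \<inter> \<Omega> \<noteq> {}"
        then obtain v where vW: "v \<in> W" "v \<in> \<Omega>" by blast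
        then have v: "v \<in> \<Omega> \<inter> ball x r" "v \<bullet> e2 < \<gamma> (v \<bullet> e1)" by (simp_all add: W_def)
        from v(1) have "v \<bullet> e2 > \<gamma> (v \<bullet> e1)" unfolding r(6) by simp
        then show False using v(2) by simp
      qed
      ultimately have "y \<notin> closure \<Omega>" using open_Int_closure_eq_empty by fastforce
      then show False using d y by blast
    qed
  qed
qed

text \<open>On each piece of a fine partition a function is close to its mean value, by
  Poincare's inequality; the mean values are controlled by a diagonal sequence.\<close>

lemma Rellich_of_partitions:
  assumes \<Omega>: "open \<Omega>" "bounded \<Omega>"
    and fin: "\<And>n. finite (\<P> n)" and P: "\<And>n P. P \<in> \<P> n \<Longrightarrow> open P \<and> convex P \<and> P \<subseteq> \<Omega>"
    and diam: "\<And>n P x y. P \<in> \<P> n \<Longrightarrow> x \<in> P \<Longrightarrow> y \<in> P \<Longrightarrow> dist x y \<le> d n" and d: "d \<longlonglongrightarrow> 0"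
    and cover: "\<And>n::nat. AE x in lborel. x \<in> \<Omega> \<longrightarrow> (\<exists>P\<in>\<P> n. x \<in> P)"
    and overlap: "\<And>n x. (\<Sum>P\<in>\<P> n. indicator P x) \<le> (c::real)"
    and f: "\<And>k::nat. h1_space \<Omega> (f k)" "\<And>k. (h1_norm \<Omega> (f k))\<^sup>2 \<le> C"
  shows "\<exists>r :: nat \<Rightarrow> nat. strict_mono r \<and>
    (\<forall>\<epsilon>>0. \<exists>N. \<forall>i\<ge>N. \<forall>k\<ge>N. (\<integral>x. (f (r i) x - f (r k) x)\<^sup>2 \<partial>lborel_on \<Omega>) < \<epsilon>)"
proof -
  note meas\<Omega> = domain_measurable[OF \<Omega>]
  interpret fm: finite_measure "lborel_on \<Omega>" by (rule domain_finite[OF \<Omega>])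
  have integrable_piece: "integrable lborel (\<lambda>x. indicator P x *\<^sub>R w x)" 
    "integral\<^sup>L (lborel_on P) w = (\<integral>x. indicator P x *\<^sub>R w x \<partial>lborel)"
    if "P \<in> \<P> n" "integrable (lborel_on \<Omega>) w" for P n and w :: "real^2 \<Rightarrow> real"
  proof -
    have PP: "P \<in> sets borel" "P \<subseteq> \<Omega>" using P[OF that(1)] by auto
    show "integrable lborel (\<lambda>x. indicator P x *\<^sub>R w x)"
      using integrable_lborel_on_subset[OF that(2) PP(1) meas\<Omega> PP(2)] PP by (simp add: integrable_restrict_space)
    show "integral\<^sup>L (lborel_on P) w = (\<integral>x. indicator P x *\<^sub>R w x \<partial>lborel)"
      using PP by (simp add: integral_restrict_space)
  qed
  \<comment> \<open>The pieces cover \<Omega> up to a null set and overlap at most c times, so sums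
    over the pieces and integrals over \<Omega> control each other.\<close>
  have pieces_lower: "(\<integral>x. w x \<partial>lborel_on \<Omega>) \<le> (\<Sum>P\<in>\<P> n. \<integral>x. w x \<partial>lborel_on P)"
    and pieces_upper: "(\<Sum>P\<in>\<P> n. \<integral>x. w x \<partial>lborel_on P) \<le> c * (\<integral>x. w x \<partial>lborel_on \<Omega>)"
    if w: "integrable (lborel_on \<Omega>) w" "\<And>x. w x \<ge> 0" for w :: "real^2 \<Rightarrow> real" and n
  proof -
    have int\<Omega>: "integrable lborel (\<lambda>x. indicator \<Omega> x *\<^sub>R w x)"
      using w(1) by (simp add: integrable_restrict_space meas\<Omega>)
    have sum: "(\<Sum>P\<in>\<P> n. \<integral>x. w x \<partial>lborel_on P) = (\<integral>x. (\<Sum>P\<in>\<P> n. indicator P x *\<^sub>R w x) \<partial>lborel)"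
      using integrable_piece[OF _ w(1)] by (subst Bochner_Integration.integral_sum) (auto intro!: sum.cong)
    have intS: "integrable lborel (\<lambda>x. \<Sum>P\<in>\<P> n. indicator P x *\<^sub>R w x)"
      using integrable_piece[OF _ w(1)] by (intro Bochner_Integration.integrable_sum) auto
    have \<Omega>_eq: "(\<integral>x. w x \<partial>lborel_on \<Omega>) = (\<integral>x. indicator \<Omega> x *\<^sub>R w x \<partial>lborel)"
      by (simp add: integral_restrict_space meas\<Omega>)
    show "(\<integral>x. w x \<partial>lborel_on \<Omega>) \<le> (\<Sum>P\<in>\<P> n. \<integral>x. w x \<partial>lborel_on P)"
      unfolding sum \<Omega>_eq
    proof (rule integral_mono_AE[OF int\<Omega> intS])
      show "AE x in lborel. indicator \<Omega> x *\<^sub>R w x \<le> (\<Sum>P\<in>\<P> n. indicator P x *\<^sub>R w x)"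
        using cover[of n]
      proof eventually_elim
        case (elim x)
        show ?case
        proof (cases "x \<in> \<Omega>")
          case True
          then obtain P where "P \<in> \<P> n" "x \<in> P" using elim by blast
          then have "w x \<le> (\<Sum>P\<in>\<P> n. indicator P x *\<^sub>R w x)"
            using member_le_sum[of P "\<P> n" "\<lambda>P. indicator P x *\<^sub>R w x"] fin w(2) by simp
          then show ?thesis using True by simp
        qed (simp add: sum_nonneg w(2))
      qed
    qed
    show "(\<Sum>P\<in>\<P> n. \<integral>x. w x \<partial>lborel_on P) \<le> c * (\<integral>x. w x \<partial>lborel_on \<Omega>)"
      unfolding sum \<Omega>_eq integral_mult_right_zero[symmetric]
    proof (rule integral_mono[OF intS])
      show "integrable lborel (\<lambda>x. c * indicator \<Omega> x *\<^sub>R w x)" using int\<Omega> by simp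
      show "(\<Sum>P\<in>\<P> n. indicator P x *\<^sub>R w x) \<le> c * indicator \<Omega> x *\<^sub>R w x" for x
      proof (cases "x \<in> \<Omega>")
        case True
        have "(\<Sum>P\<in>\<P> n. indicator P x *\<^sub>R w x) = (\<Sum>P\<in>\<P> n. indicator P x) * w x"
          by (simp add: sum_distrib_right)
        also have "\<dots> \<le> c * w x" by (intro mult_right_mono overlap w(2))
        finally show ?thesis using True by simp
      next
        case False
        then have "x \<notin> P" if "P \<in> \<P> n" for P using P[OF that] by blast
        then show ?thesis using False by simp
      qed
    qed
  qed
  have c: "c \<ge> 0" using overlap[of 0 0] by (meson order_trans sum_nonneg indicator_pos_le)
  \<comment> \<open>By |f| <= f^2 + 1 the integrals are bounded uniformly in the function, the level
    and the piece, as the diagonal argument requires.\<close>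
  have mean_bound: "\<bar>\<integral>x. f k x \<partial>lborel_on P\<bar> \<le> C + measure lborel \<Omega>" if PP: "P \<in> \<P> n" for k P n
  proof -
    have si: "square_integrable (lborel_on \<Omega>) (f k)" by (rule h1_square_integrable(1)[OF \<Omega> f(1)])
    have i1: "integrable (lborel_on \<Omega>) (f k)" by (rule fm.square_integrable_integrable_L1[OF si])
    have i2: "integrable (lborel_on \<Omega>) (\<lambda>x. (f k x)\<^sup>2)" using square_integrable_integrable[OF si] by simp
    have "\<bar>\<integral>x. f k x \<partial>lborel_on P\<bar> \<le> (\<integral>x. \<bar>indicator P x *\<^sub>R f k x\<bar> \<partial>lborel)"
      unfolding integrable_piece(2)[OF PP i1] by (rule integral_abs_bound)
    also have "\<dots> \<le> (\<integral>x. indicator \<Omega> x *\<^sub>R ((f k x)\<^sup>2 + 1) \<partial>lborel)"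
    proof (rule integral_mono)
      show "integrable lborel (\<lambda>x. \<bar>indicator P x *\<^sub>R f k x\<bar>)" using integrable_piece(1)[OF PP i1] by simp
      have "integrable (lborel_on \<Omega>) (\<lambda>x. (f k x)\<^sup>2 + 1)" using i2 by simp
      then show "integrable lborel (\<lambda>x. indicator \<Omega> x *\<^sub>R ((f k x)\<^sup>2 + 1))"
        by (simp add: integrable_restrict_space meas\<Omega>)
      show "\<bar>indicator P x *\<^sub>R f k x\<bar> \<le> indicator \<Omega> x *\<^sub>R ((f k x)\<^sup>2 + 1)" for x
      proof -
        have "\<bar>f k x\<bar> \<le> (f k x)\<^sup>2 + 1"
          using sum_squares_bound[of "\<bar>f k x\<bar>" 1] by simp
        then show ?thesis using P[OF PP] by (auto split: split_indicator)
      qed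
    qed
    also have "\<dots> = (\<integral>x. (f k x)\<^sup>2 + 1 \<partial>lborel_on \<Omega>)" by (simp add: integral_restrict_space meas\<Omega>)
    also have "\<dots> = (\<integral>x. (f k x)\<^sup>2 \<partial>lborel_on \<Omega>) + measure lborel \<Omega>"
      using i2 meas\<Omega> by (simp add: measure_restrict_space space_restrict_space)
    also have "(\<integral>x. (f k x)\<^sup>2 \<partial>lborel_on \<Omega>) \<le> C"
      using f(2)[of k] unfolding h1_norm_sq[OF \<Omega>]
      by (smt (verit) sum_nonneg integral_nonneg_AE AE_I2 zero_le_power2)
    finally show ?thesis by simp
  qed
  \<comment> \<open>The pieces of all levels are enumerated together, so that a single subsequence
    serves every level.\<close>
  define \<Q> where "\<Q> = (\<Union>n. \<P> n)"
  have Qc: "countable \<Q>" unfolding \<Q>_def using fin by (intro countable_UN) (auto intro: countable_finite)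
  \<comment> \<open>The default 0 covers an empty \<open>\<Q>\<close>, for which
    \<open>from_nat_into\<close> gives no member.\<close>
  define X where "X k m = (if from_nat_into \<Q> m \<in> \<Q> then \<integral>x. f k x \<partial>lborel_on (from_nat_into \<Q> m) else 0)" for k m
  have "\<bar>X k m\<bar> \<le> \<bar>C\<bar> + measure lborel \<Omega>" for k m
  proof (cases "from_nat_into \<Q> m \<in> \<Q>")
    case True
    then obtain n where "from_nat_into \<Q> m \<in> \<P> n" by (auto simp: \<Q>_def)
    then have "\<bar>X k m\<bar> \<le> C + measure lborel \<Omega>" using mean_bound True by (simp add: X_def)
    then show ?thesis by linarith
  qed (simp add: X_def)
  then obtain r where r: "strict_mono r" "\<And>m. Cauchy (\<lambda>k. X (r k) m)"
    using bounded_sequences_diagonal[of X] by blast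
  have mean_Cauchy: "Cauchy (\<lambda>k. \<integral>x. f (r k) x \<partial>lborel_on P)" if "P \<in> \<P> n" for P n
  proof -
    have PQ: "P \<in> \<Q>" using that by (auto simp: \<Q>_def)
    from from_nat_into_surj[OF Qc this] obtain m where "from_nat_into \<Q> m = P" by blast
    then show ?thesis using r(2)[of m] PQ by (simp add: X_def)
  qed
  \<comment> \<open>Poincare's inequality contributes 2 d^2, the overlap c, and the gradient of a
    difference of two of the functions 4 C; the product is 8 c C d^2.\<close>
  have diff_bound: "(\<integral>x. (f i x - f k x)\<^sup>2 \<partial>lborel_on \<Omega>) \<le>
      (\<Sum>P\<in>\<P> n. ((\<integral>x. f i x \<partial>lborel_on P) - (\<integral>x. f k x \<partial>lborel_on P))\<^sup>2 / measure lborel P) + 8 * c * C * (d n)\<^sup>2" for i k n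
  proof -
    let ?f = "\<lambda>x. f i x - f k x" and ?g = "\<lambda>j x. weak_partial \<Omega> j (f i) x - weak_partial \<Omega> j (f k) x"
    have hwp: "has_weak_partial \<Omega> j ?f (?g j)" for j
      using has_weak_partial_comb[OF \<Omega> has_weak_partial_weak_partial[OF \<Omega> f(1)[of i]]
        has_weak_partial_weak_partial[OF \<Omega> f(1)[of k]], of j "-1"] by simp
    have si: "square_integrable (lborel_on \<Omega>) (f l)" "square_integrable (lborel_on \<Omega>) (weak_partial \<Omega> j (f l))" for l j
      using h1_square_integrable[OF \<Omega> f(1)] by auto
    have i2: "integrable (lborel_on \<Omega>) (\<lambda>x. (?f x)\<^sup>2)" "integrable (lborel_on \<Omega>) (\<lambda>x. (?g j x)\<^sup>2)" for j
      using square_integrable_integrable[OF square_integrable_diff[OF si(1) si(1)]]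
        square_integrable_integrable[OF square_integrable_diff[OF si(2) si(2)]] by simp_all
    have mean: "(\<integral>x. ?f x \<partial>lborel_on P) = (\<integral>x. f i x \<partial>lborel_on P) - (\<integral>x. f k x \<partial>lborel_on P)" if PP: "P \<in> \<P> n" for P
    proof -
      have i1: "integrable (lborel_on \<Omega>) (f l)" for l by (rule fm.square_integrable_integrable_L1[OF si(1)])
      have "integrable (lborel_on P) (f l)" for l
        using integrable_piece(1)[OF PP i1[of l]] P[OF PP] by (simp add: integrable_restrict_space)
      then show ?thesis by simp
    qed
    have grad: "(\<Sum>j\<in>UNIV. \<integral>x. (?g j x)\<^sup>2 \<partial>lborel_on \<Omega>) \<le> 4 * C"
    proof -
      have "(\<integral>x. (?g j x)\<^sup>2 \<partial>lborel_on \<Omega>) \<le> 2 * (\<integral>x. (weak_partial \<Omega> j (f i) x)\<^sup>2 \<partial>lborel_on \<Omega>) +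
          2 * (\<integral>x. (weak_partial \<Omega> j (f k) x)\<^sup>2 \<partial>lborel_on \<Omega>)" for j
        using integral_norm_sq_add_le[OF si(2)[of j i] square_integrable_scaleR[OF si(2)[of j k], of "-1"]] by simp
      then have "(\<Sum>j\<in>UNIV. \<integral>x. (?g j x)\<^sup>2 \<partial>lborel_on \<Omega>) \<le> (\<Sum>j\<in>UNIV. 2 * (\<integral>x. (weak_partial \<Omega> j (f i) x)\<^sup>2 \<partial>lborel_on \<Omega>) +
          2 * (\<integral>x. (weak_partial \<Omega> j (f k) x)\<^sup>2 \<partial>lborel_on \<Omega>))" by (intro sum_mono)
      also have "\<dots> = 2 * (\<Sum>j\<in>UNIV. \<integral>x. (weak_partial \<Omega> j (f i) x)\<^sup>2 \<partial>lborel_on \<Omega>) +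
          2 * (\<Sum>j\<in>UNIV. \<integral>x. (weak_partial \<Omega> j (f k) x)\<^sup>2 \<partial>lborel_on \<Omega>)"
        by (simp add: sum.distrib sum_distrib_left)
      also have "\<dots> \<le> 2 * C + 2 * C"
      proof -
        have "(\<Sum>j\<in>UNIV. \<integral>x. (weak_partial \<Omega> j (f l) x)\<^sup>2 \<partial>lborel_on \<Omega>) \<le> C" for l
        proof -
          have "0 \<le> (\<integral>x. (f l x)\<^sup>2 \<partial>lborel_on \<Omega>)" by simp
          then show ?thesis using f(2)[of l] unfolding h1_norm_sq[OF \<Omega>] by linarith
        qed
        from this[of i] this[of k] show ?thesis by simp
      qed
      finally show ?thesis by simp
    qed
    have "(\<integral>x. (?f x)\<^sup>2 \<partial>lborel_on \<Omega>) \<le> (\<Sum>P\<in>\<P> n. \<integral>x. (?f x)\<^sup>2 \<partial>lborel_on P)"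
      by (rule pieces_lower[OF i2(1)]) simp
    also have "\<dots> \<le> (\<Sum>P\<in>\<P> n. (\<integral>x. ?f x \<partial>lborel_on P)\<^sup>2 / measure lborel P +
        2 * (d n)\<^sup>2 * (\<Sum>j\<in>UNIV. \<integral>x. (?g j x)\<^sup>2 \<partial>lborel_on P))"
    proof (rule sum_mono)
      fix P assume PP: "P \<in> \<P> n"
      show "(\<integral>x. (?f x)\<^sup>2 \<partial>lborel_on P) \<le> (\<integral>x. ?f x \<partial>lborel_on P)\<^sup>2 / measure lborel P +
        2 * (d n)\<^sup>2 * (\<Sum>j\<in>UNIV. \<integral>x. (?g j x)\<^sup>2 \<partial>lborel_on P)"
        by (rule Poincare_inequality[OF \<Omega> hwp]) (use P[OF PP] diam[OF PP] in auto)
    qed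
    also have "\<dots> = (\<Sum>P\<in>\<P> n. ((\<integral>x. f i x \<partial>lborel_on P) - (\<integral>x. f k x \<partial>lborel_on P))\<^sup>2 / measure lborel P) +
        2 * (d n)\<^sup>2 * (\<Sum>j\<in>UNIV. \<Sum>P\<in>\<P> n. \<integral>x. (?g j x)\<^sup>2 \<partial>lborel_on P)"
    proof -
      have "(\<Sum>P\<in>\<P> n. \<Sum>j\<in>UNIV. \<integral>x. (?g j x)\<^sup>2 \<partial>lborel_on P) =
          (\<Sum>j\<in>UNIV. \<Sum>P\<in>\<P> n. \<integral>x. (?g j x)\<^sup>2 \<partial>lborel_on P)" by (rule sum.swap)
      then show ?thesis unfolding sum.distrib sum_distrib_left[symmetric] using mean by simp
    qed
    also have "\<dots> \<le> (\<Sum>P\<in>\<P> n. ((\<integral>x. f i x \<partial>lborel_on P) - (\<integral>x. f k x \<partial>lborel_on P))\<^sup>2 / measure lborel P) +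
        2 * (d n)\<^sup>2 * (c * (4 * C))"
    proof (intro add_left_mono mult_left_mono)
      have "(\<Sum>j\<in>UNIV. \<Sum>P\<in>\<P> n. \<integral>x. (?g j x)\<^sup>2 \<partial>lborel_on P) \<le> (\<Sum>j\<in>UNIV. c * (\<integral>x. (?g j x)\<^sup>2 \<partial>lborel_on \<Omega>))"
        by (intro sum_mono pieces_upper[OF i2(2)]) simp
      also have "\<dots> = c * (\<Sum>j\<in>UNIV. \<integral>x. (?g j x)\<^sup>2 \<partial>lborel_on \<Omega>)" by (simp add: sum_distrib_left)
      also have "\<dots> \<le> c * (4 * C)" by (intro mult_left_mono grad c)
      finally show "(\<Sum>j\<in>UNIV. \<Sum>P\<in>\<P> n. \<integral>x. (?g j x)\<^sup>2 \<partial>lborel_on P) \<le> c * (4 * C)" .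
    qed simp
    finally show ?thesis by (simp add: algebra_simps)
  qed
  have "\<exists>N. \<forall>i\<ge>N. \<forall>k\<ge>N. (\<integral>x. (f (r i) x - f (r k) x)\<^sup>2 \<partial>lborel_on \<Omega>) < \<epsilon>" if \<epsilon>: "\<epsilon> > 0" for \<epsilon>
  proof -
    \<comment> \<open>The level n is fixed first, to make the gradient term small. Only the finitely
      many integrals over pieces of this level remain, and they are Cauchy.\<close>
    have "(\<lambda>n. 8 * c * C * (d n)\<^sup>2) \<longlonglongrightarrow> 8 * c * C * 0\<^sup>2" by (intro tendsto_intros d)
    then have "eventually (\<lambda>n. 8 * c * C * (d n)\<^sup>2 < \<epsilon> / 2) sequentially"
      using \<epsilon> by (intro order_tendstoD(2)) auto
    then obtain n where n: "8 * c * C * (d n)\<^sup>2 < \<epsilon> / 2" by (auto simp: eventually_sequentially)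
    define M where "M P k = (\<integral>x. f (r k) x \<partial>lborel_on P)" for P k
    have "\<exists>N. \<forall>i\<ge>N. \<forall>k\<ge>N. (M P i - M P k)\<^sup>2 / measure lborel P < \<epsilon> / (2 * (1 + card (\<P> n)))" if PP: "P \<in> \<P> n" for P
    proof -
      define m where "m = measure lborel P"
      show ?thesis
      proof (cases "m = 0")
        case True
        then show ?thesis using \<epsilon> by (auto simp: m_def)
      next
        case False
        then have m: "m > 0" by (simp add: m_def less_le)
        define \<delta> where "\<delta> = sqrt (\<epsilon> / (2 * (1 + card (\<P> n))) * m)"
        have "\<epsilon> / (2 * (1 + card (\<P> n))) * m > 0" using \<epsilon> m by (intro mult_pos_pos divide_pos_pos) auto
        then have \<delta>: "\<delta> > 0" "\<delta>\<^sup>2 = \<epsilon> / (2 * (1 + card (\<P> n))) * m" by (auto simp: \<delta>_def)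
        have "Cauchy (M P)" unfolding M_def by (rule mean_Cauchy[OF PP])
        from CauchyD[OF this \<delta>(1)]
        obtain N where N: "\<And>i k. i \<ge> N \<Longrightarrow> k \<ge> N \<Longrightarrow> \<bar>M P i - M P k\<bar> < \<delta>"
          unfolding real_norm_def by blast
        have "(M P i - M P k)\<^sup>2 / m < \<epsilon> / (2 * (1 + card (\<P> n)))" if "i \<ge> N" "k \<ge> N" for i k
        proof -
          have "\<bar>M P i - M P k\<bar>\<^sup>2 < \<delta>\<^sup>2" using N[OF that] by (intro power_strict_mono) auto
          then show ?thesis unfolding \<delta>(2) using m by (simp add: pos_divide_less_eq)
        qed
        then show ?thesis unfolding m_def by blast
      qed
    qed
    then obtain N where N: "\<And>P i k. P \<in> \<P> n \<Longrightarrow> i \<ge> N P \<Longrightarrow> k \<ge> N P \<Longrightarrow>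
        (M P i - M P k)\<^sup>2 / measure lborel P < \<epsilon> / (2 * (1 + card (\<P> n)))" by metis
    show ?thesis
    proof (intro exI[of _ "\<Sum>P\<in>\<P> n. N P"] allI impI)
      fix i k assume ik: "(\<Sum>P\<in>\<P> n. N P) \<le> i" "(\<Sum>P\<in>\<P> n. N P) \<le> k"
      have le: "N P \<le> i" "N P \<le> k" if "P \<in> \<P> n" for P
        using member_le_sum[of P "\<P> n" N] that fin ik by auto
      have "(\<Sum>P\<in>\<P> n. (M P i - M P k)\<^sup>2 / measure lborel P) \<le> (\<Sum>P\<in>\<P> n. \<epsilon> / (2 * (1 + card (\<P> n))))"
        using N le by (intro sum_mono) (simp add: less_imp_le)
      also have "\<dots> \<le> \<epsilon> / 2" using \<epsilon> by (simp add: field_simps)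
      finally show "(\<integral>x. (f (r i) x - f (r k) x)\<^sup>2 \<partial>lborel_on \<Omega>) < \<epsilon>"
        using diff_bound[of "r i" "r k" n] n unfolding M_def by linarith
    qed
  qed
  note Cauchy_L2 = this
  show ?thesis by (intro exI[of _ r] conjI r(1) allI impI Cauchy_L2)
qed

text \<open>Open cells of side 1/(n + 1). Scaling the coordinates instead of the bounds lets
  \<open>floor\<close> recover the indices from any point of the cell.\<close>

definition grid_box :: "nat \<Rightarrow> int \<Rightarrow> int \<Rightarrow> (real^2) set" where
  "grid_box n p q = {x. of_int p < real (Suc n) * x$1 \<and> real (Suc n) * x$1 < of_int p + 1 \<and>
     of_int q < real (Suc n) * x$2 \<and> real (Suc n) * x$2 < of_int q + 1}"

lemma grid_box_floor: "x \<in> grid_box n p q \<Longrightarrow> p = \<lfloor>real (Suc n) * x$1\<rfloor> \<and> q = \<lfloor>real (Suc n) * x$2\<rfloor>"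
  unfolding grid_box_def by (auto intro!: floor_unique[symmetric])

lemma open_grid_box: "open (grid_box n p q)"
  unfolding grid_box_def
  by (intro open_Collect_conj open_Collect_less continuous_intros)

lemma convex_grid_box: "convex (grid_box n p q)"
proof -
  have eq: "grid_box n p q = box (vector [of_int p / real (Suc n), of_int q / real (Suc n)])
      (vector [(of_int p + 1) / real (Suc n), (of_int q + 1) / real (Suc n)])"
    by (auto simp: grid_box_def mem_box_cart forall_2 field_simps)
  show ?thesis unfolding eq by (rule convex_box)
qed

lemma diameter_grid_box:
  assumes "x \<in> grid_box n p q" "y \<in> grid_box n p q"
  shows "dist x y \<le> 2 / real (Suc n)"
proof -
  have "\<bar>x$i - y$i\<bar> \<le> 1 / real (Suc n)" for i
  proof -
    have "\<bar>real (Suc n) * x$i - real (Suc n) * y$i\<bar> \<le> 1"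
      using assms exhaust_2[of i] unfolding grid_box_def by auto
    then have "real (Suc n) * \<bar>x$i - y$i\<bar> \<le> 1" by (simp add: right_diff_distrib[symmetric] abs_mult)
    then show ?thesis by (simp add: field_simps)
  qed
  then have "(\<Sum>i\<in>UNIV. \<bar>(x - y)$i\<bar>) \<le> (\<Sum>i\<in>(UNIV :: 2 set). 1 / real (Suc n))" by (intro sum_mono) simp
  then show ?thesis using norm_le_l1_cart[of "x - y"] by (simp add: dist_norm)
qed

text \<open>Only countably many grid lines are missed.\<close>

lemma AE_in_grid_box: "AE x in lborel. \<exists>p q. x \<in> grid_box n p q"
proof -
  have "AE x in lborel. \<forall>a::int. \<forall>i::2. x$i \<noteq> of_int a / real (Suc n)"
    unfolding AE_all_countable
  proof (intro allI)
    fix a :: int and i :: 2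
    have "negligible {x::real^2. x$i = of_int a / real (Suc n)}" 
      using negligible_standard_hyperplane[of "axis i 1 :: real^2" "of_int a / real (Suc n)"]
      by (simp add: inner_axis axis_in_Basis_iff)
    then have "AE x in lborel. x \<notin> {x::real^2. x$i = of_int a / real (Suc n)}"
      by (intro AE_not_in) (auto simp: negligible_iff_null_sets null_sets_completion_iff intro!: borel_closed closed_Collect_eq continuous_intros)
    then show "AE x in lborel. x$i \<noteq> of_int a / real (Suc n)" by simp
  qed
  then show ?thesis
  proof eventually_elim
    case (elim x)
    have "of_int \<lfloor>real (Suc n) * x$i\<rfloor> < real (Suc n) * x$i" for i
    proof -
      have "of_int \<lfloor>real (Suc n) * x$i\<rfloor> \<noteq> real (Suc n) * x$i"
      proof
        define k where "k = \<lfloor>real (Suc n) * x$i\<rfloor>"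
        assume "of_int \<lfloor>real (Suc n) * x$i\<rfloor> = real (Suc n) * x$i"
        then have "of_int k = real (Suc n) * x$i" by (simp only: k_def)
        then have "x$i = of_int k / real (Suc n)" by (simp add: eq_divide_eq mult.commute)
        then show False using elim by blast
      qed
      then show ?thesis using of_int_floor_le[of "real (Suc n) * x$i"] by linarith
    qed
    moreover have "real (Suc n) * x$i < of_int \<lfloor>real (Suc n) * x$i\<rfloor> + 1" for i
      by (rule real_of_int_floor_add_one_gt)
    ultimately have "x \<in> grid_box n \<lfloor>real (Suc n) * x$1\<rfloor> \<lfloor>real (Suc n) * x$2\<rfloor>"
      unfolding grid_box_def mem_Collect_eq by (intro conjI)
    then show ?case by blast
  qed
qed

text \<open>The pieces are grid cells intersected with open triangles; they are convex, small and
  inside \<Omega>. A point determines its grid cell, so at most one piece for each triangle contains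
  it, and the overlap is bounded independently of n.\<close>

theorem Rellich:
  assumes \<Omega>: "open \<Omega>" "bounded \<Omega>" "lipschitz_boundary \<Omega>" and \<T>: "conforming_triangulation \<Omega> \<T>"
    and f: "\<And>k::nat. h1_space \<Omega> (f k)" "\<And>k. (h1_norm \<Omega> (f k))\<^sup>2 \<le> C"
  shows "\<exists>r :: nat \<Rightarrow> nat. strict_mono r \<and>
    (\<forall>\<epsilon>>0. \<exists>N. \<forall>i\<ge>N. \<forall>k\<ge>N. (\<integral>x. (f (r i) x - f (r k) x)\<^sup>2 \<partial>lborel_on \<Omega>) < \<epsilon>)"
proof -
  obtain B where B: "\<And>x. x \<in> \<Omega> \<Longrightarrow> norm x \<le> B" using \<Omega>(2) by (auto simp: bounded_iff)
  \<comment> \<open>A finite range that contains the index of every cell met by \<Omega>, whose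
    points have coordinates of modulus at most |B|.\<close>
  define R where "R n = {- \<lceil>real (Suc n) * \<bar>B\<bar>\<rceil> - 1..\<lceil>real (Suc n) * \<bar>B\<bar>\<rceil>}" for n
  define piece where "piece n = (\<lambda>(S, p, q). interior (convex hull S) \<inter> grid_box n p q)" for n
  define \<P> where "\<P> n = piece n ` (\<T> \<times> R n \<times> R n)" for n
  have fin: "finite (\<P> n)" for n using triangulation_finite[OF \<T>] by (auto simp: \<P>_def R_def)
  show ?thesis
  proof (rule Rellich_of_partitions[OF \<Omega>(1,2) fin])
    show "open P \<and> convex P \<and> P \<subseteq> \<Omega>" if PP: "P \<in> \<P> n" for n P
    proof -
      obtain S p q where S: "S \<in> \<T>" "P = interior (convex hull S) \<inter> grid_box n p q"
        using PP by (auto simp: \<P>_def piece_def)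
      have "interior (convex hull S) \<subseteq> interior (closure \<Omega>)"
        using S(1) triangle_Union[OF \<T>] by (intro interior_mono) auto
      then show ?thesis
        using S(2) interior_closure_Lipschitz[OF \<Omega>(1,3)] open_grid_box convex_grid_box
        by (auto intro!: convex_Int)
    qed
    show "dist x y \<le> 2 / real (Suc n)" if "P \<in> \<P> n" "x \<in> P" "y \<in> P" for n P x y
      using that diameter_grid_box by (auto simp: \<P>_def piece_def)
    show "(\<lambda>n. 2 / real (Suc n)) \<longlonglongrightarrow> 0"
      using tendsto_mult[OF tendsto_const[of 2] LIMSEQ_inverse_real_of_nat] by (simp add: divide_inverse)
    show "AE x in lborel. x \<in> \<Omega> \<longrightarrow> (\<exists>P\<in>\<P> n. x \<in> P)" for n
      using AE_in_triangle_interior[OF \<T>] AE_in_grid_box[of n]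
    proof eventually_elim
      case (elim x)
      show ?case
      proof
        assume x: "x \<in> \<Omega>"
        obtain S p q where S: "S \<in> \<T>" "x \<in> interior (convex hull S)" and pq: "x \<in> grid_box n p q"
          using elim x by blast
        have coord: "\<lfloor>real (Suc n) * x$i\<rfloor> \<in> R n" for i
        proof -
          have "\<bar>x$i\<bar> \<le> \<bar>B\<bar>" using component_le_norm_cart[of x i] B[OF x] by linarith
          then have "\<bar>real (Suc n) * x$i\<bar> \<le> real (Suc n) * \<bar>B\<bar>" by (simp add: abs_mult)
          then show ?thesis unfolding R_def atLeastAtMost_iff by linarith
        qed
        have "p \<in> R n" "q \<in> R n" using grid_box_floor[OF pq] coord by auto
        then have "piece n (S, p, q) \<in> \<P> n" using S by (auto simp: \<P>_def)
        then show "\<exists>P\<in>\<P> n. x \<in> P" using S pq by (intro bexI[of _ "piece n (S, p, q)"]) (auto simp: piece_def)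
      qed
    qed
    show "(\<Sum>P\<in>\<P> n. indicator P x) \<le> real (card \<T>)" for n x
    proof -
      have "{P \<in> \<P> n. x \<in> P} \<subseteq> (\<lambda>S. piece n (S, \<lfloor>real (Suc n) * x$1\<rfloor>, \<lfloor>real (Suc n) * x$2\<rfloor>)) ` \<T>"
      proof
        fix P assume "P \<in> {P \<in> \<P> n. x \<in> P}"
        then obtain S p q where S: "S \<in> \<T>" "P = piece n (S, p, q)" "x \<in> P" by (auto simp: \<P>_def)
        then have "p = \<lfloor>real (Suc n) * x$1\<rfloor> \<and> q = \<lfloor>real (Suc n) * x$2\<rfloor>"
          by (intro grid_box_floor) (simp add: piece_def)
        then show "P \<in> (\<lambda>S. piece n (S, \<lfloor>real (Suc n) * x$1\<rfloor>, \<lfloor>real (Suc n) * x$2\<rfloor>)) ` \<T>"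
          using S by blast
      qed
      then have "card {P \<in> \<P> n. x \<in> P} \<le> card \<T>"
        by (rule surj_card_le[OF triangulation_finite[OF \<T>]])
      moreover have "(\<Sum>P\<in>\<P> n. indicator P x) = real (card {P \<in> \<P> n. x \<in> P})"
        using fin[of n] by (simp add: indicator_def sum.If_cases Int_def)
      ultimately show ?thesis by simp
    qed
  qed (use f in auto)
qed

section \<open>The energy space\<close>

lemma square_integrable_vec:
  fixes f :: "'a \<Rightarrow> ('b::euclidean_space)^'n"
  assumes "\<And>i. square_integrable M (\<lambda>x. f x $ i)"
  shows "square_integrable M f"
proof -
  have "square_integrable M (\<lambda>x. \<Sum>i\<in>UNIV. axis i (f x $ i))"
  proof (intro square_integrable_sum square_integrable_linear[OF assms])
    show "linear (\<lambda>y. axis i y :: 'b^'n)" for i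
      by (auto simp: linear_iff axis_def vec_eq_iff)
  qed
  moreover have "(\<Sum>i\<in>UNIV. axis i (y $ i)) = y" for y :: "'b^'n"
  proof -
    have "(\<Sum>i\<in>UNIV. axis i (y $ i) $ j) = (\<Sum>i\<in>UNIV. if i = j then y $ j else 0)" for j
      by (rule sum.cong) (auto simp: axis_def)
    then show ?thesis by (simp add: vec_eq_iff)
  qed
  ultimately show ?thesis by simp
qed

text \<open>The ambient space without boundary conditions. All forms are semi-inner products on it,
  and it is closed under multiplication by hats.\<close>

definition H1_vec :: "(real^2) set \<Rightarrow> (real^2 \<Rightarrow> real^2) set" where
  "H1_vec \<Omega> = {v. \<forall>i. h1_space \<Omega> (\<lambda>x. v x $ i)}"

definition symmetric_part :: "real^2^2 \<Rightarrow> real^2^2" where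
  "symmetric_part A = (1/2) *\<^sub>R (A + transpose A)"

lemma linear_symmetric_part: "linear symmetric_part"
  by (auto simp: linear_iff symmetric_part_def vec_eq_iff transpose_def algebra_simps)

lemma transpose_symmetric_part: "transpose (symmetric_part A) = symmetric_part A"
  by (simp add: symmetric_part_def vec_eq_iff transpose_def)

text \<open>One family for three forms: the Dirichlet form has weight 1 and identities, the energy
  form has R = \<CC> after the symmetric part and S = the symmetric part, and the weighted patch
  norm has a hat as its weight.\<close>

definition gradient_form ::
  "(real^2) set \<Rightarrow> (real^2 \<Rightarrow> real) \<Rightarrow> (real^2^2 \<Rightarrow> real^2^2) \<Rightarrow> (real^2^2 \<Rightarrow> real^2^2) \<Rightarrow>
     (real^2 \<Rightarrow> real^2) \<Rightarrow> (real^2 \<Rightarrow> real^2) \<Rightarrow> real" where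
  "gradient_form \<Omega> \<phi> R S u v =
     (\<integral>x. \<phi> x * (R (weak_jacobian \<Omega> u x) \<bullet> S (weak_jacobian \<Omega> v x)) \<partial>lborel_on \<Omega>)"

abbreviation Dirichlet_form :: "(real^2) set \<Rightarrow> (real^2 \<Rightarrow> real^2) \<Rightarrow> (real^2 \<Rightarrow> real^2) \<Rightarrow> real" where
  "Dirichlet_form \<Omega> \<equiv> gradient_form \<Omega> (\<lambda>_. 1) (\<lambda>A. A) (\<lambda>A. A)"

text \<open>Stated as an equality of predicates in g: the choice made by \<open>weak_partial\<close>
  is then literally the same for both functions.\<close>

lemma has_weak_partial_cong:
  assumes "\<Omega> \<in> sets borel" "\<And>x. x \<in> \<Omega> \<Longrightarrow> f x = f' x"
  shows "has_weak_partial \<Omega> i f = has_weak_partial \<Omega> i f'"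
proof
  fix g
  have l2: "l2_space \<Omega> f \<longleftrightarrow> l2_space \<Omega> f'"
  proof -
    have "(\<lambda>x. indicator \<Omega> x *\<^sub>R f x) = (\<lambda>x. indicator \<Omega> x *\<^sub>R f' x)"
      "(\<lambda>x. indicator \<Omega> x *\<^sub>R (f x)\<^sup>2) = (\<lambda>x. indicator \<Omega> x *\<^sub>R (f' x)\<^sup>2)"
      using assms(2) by (auto simp: fun_eq_iff split: split_indicator)
    then show ?thesis unfolding l2_space_def set_borel_measurable_def set_integrable_def by (simp only:)
  qed
  have "(LINT x:\<Omega>|lborel. f x * w x) = (LINT x:\<Omega>|lborel. f' x * w x)" for w
    unfolding set_lebesgue_integral_def using assms(2)
    by (intro Bochner_Integration.integral_cong) (auto split: split_indicator)
  then show "has_weak_partial \<Omega> i f g = has_weak_partial \<Omega> i f' g"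
    unfolding has_weak_partial_def l2 by simp
qed

lemma weak_jacobian_cong:
  assumes "\<Omega> \<in> sets borel" "\<And>x. x \<in> \<Omega> \<Longrightarrow> u x = v x"
  shows "weak_jacobian \<Omega> u = weak_jacobian \<Omega> v"
proof -
  have "weak_partial \<Omega> j (\<lambda>x. u x $ i) = weak_partial \<Omega> j (\<lambda>x. v x $ i)" for i j
    unfolding weak_partial_def
    using has_weak_partial_cong[OF assms(1), of "\<lambda>x. u x $ i" "\<lambda>x. v x $ i" j] assms(2) by simp
  then show ?thesis by (simp add: weak_jacobian_def fun_eq_iff)
qed

section \<open>Semi-inner products on H^1 vector fields\<close>

context
  fixes \<Omega> :: "(real^2) set"
  assumes open_\<Omega>: "open \<Omega>" and bounded_\<Omega>: "bounded \<Omega>"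
begin

lemma h1_space_zero: "h1_space \<Omega> (\<lambda>x. 0)"
proof (rule h1_spaceI[OF open_\<Omega> bounded_\<Omega>])
  show "has_weak_partial \<Omega> i (\<lambda>x. 0) (\<lambda>x. 0)" for i
    by (simp add: has_weak_partial_iff[OF open_\<Omega> bounded_\<Omega>] square_integrable_zero)
qed

lemma H1_vec_subspace: "linear_subspace (H1_vec \<Omega>)"
  unfolding linear_subspace_def
proof (intro conjI ballI allI)
  have "(\<lambda>x. 0) \<in> H1_vec \<Omega>" by (simp add: H1_vec_def h1_space_zero)
  then show "H1_vec \<Omega> \<noteq> {}" by blast
  show "(\<lambda>x. u x + c *\<^sub>R v x) \<in> H1_vec \<Omega>" if "u \<in> H1_vec \<Omega>" "v \<in> H1_vec \<Omega>" for u v c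
    using that h1_space_comb[OF open_\<Omega> bounded_\<Omega>] by (simp add: H1_vec_def)
qed

lemma H1_vec_square_integrable: "v \<in> H1_vec \<Omega> \<Longrightarrow> square_integrable (lborel_on \<Omega>) v"
  using h1_square_integrable(1)[OF open_\<Omega> bounded_\<Omega>]
  by (intro square_integrable_vec) (auto simp: H1_vec_def)

lemma jacobian_square_integrable:
  assumes "v \<in> H1_vec \<Omega>"
  shows "square_integrable (lborel_on \<Omega>) (weak_jacobian \<Omega> v)"
proof (intro square_integrable_vec)
  fix i j
  have "h1_space \<Omega> (\<lambda>x. v x $ i)" using assms by (simp add: H1_vec_def)
  from h1_square_integrable(2)[OF open_\<Omega> bounded_\<Omega> this, of j]
  show "square_integrable (lborel_on \<Omega>) (\<lambda>x. weak_jacobian \<Omega> v x $ i $ j)"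
    by (simp add: weak_jacobian_def)
qed

text \<open>Holds only almost everywhere, because \<open>weak_partial\<close> chooses its
  representatives for each function separately.\<close>

lemma jacobian_comb:
  assumes "u \<in> H1_vec \<Omega>" "v \<in> H1_vec \<Omega>"
  shows "AE x in lborel_on \<Omega>. weak_jacobian \<Omega> (\<lambda>x. u x + c *\<^sub>R v x) x =
    weak_jacobian \<Omega> u x + c *\<^sub>R weak_jacobian \<Omega> v x"
proof -
  have h1: "h1_space \<Omega> (\<lambda>x. u x $ i)" "h1_space \<Omega> (\<lambda>x. v x $ i)" for i
    using assms by (auto simp: H1_vec_def)
  have "AE x in lborel_on \<Omega>. \<forall>i j. weak_partial \<Omega> j (\<lambda>x. u x $ i + c * v x $ i) x =
      weak_partial \<Omega> j (\<lambda>x. u x $ i) x + c * weak_partial \<Omega> j (\<lambda>x. v x $ i) x"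
    unfolding AE_all_countable using weak_partial_comb[OF open_\<Omega> bounded_\<Omega> h1] by blast
  then show ?thesis
    by eventually_elim (simp add: weak_jacobian_def vec_eq_iff)
qed

lemma gradient_form_integrable:
  fixes R S :: "real^2^2 \<Rightarrow> real^2^2"
  assumes "u \<in> H1_vec \<Omega>" "v \<in> H1_vec \<Omega>" and RS: "linear R" "linear S"
    and \<phi>: "\<phi> \<in> borel_measurable (lborel_on \<Omega>)" "\<And>x. x \<in> \<Omega> \<Longrightarrow> 0 \<le> \<phi> x \<and> \<phi> x \<le> C"
  shows "integrable (lborel_on \<Omega>) (\<lambda>x. \<phi> x * (R (weak_jacobian \<Omega> u x) \<bullet> S (weak_jacobian \<Omega> v x)))"
proof -
  have "square_integrable (lborel_on \<Omega>) (\<lambda>x. \<phi> x *\<^sub>R R (weak_jacobian \<Omega> u x))"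
    using square_integrable_bounded_mult[OF square_integrable_linear[OF jacobian_square_integrable[OF assms(1)] RS(1)] \<phi>(1), of C] \<phi>(2)
    by (simp add: space_restrict_space)
  from square_integrable_inner[OF this square_integrable_linear[OF jacobian_square_integrable[OF assms(2)] RS(2)]]
  show ?thesis by simp
qed

lemma gradient_form_semi_inner:
  assumes RS: "linear R" "linear S" "\<And>A B. R A \<bullet> S B = R B \<bullet> S A" "\<And>A. R A \<bullet> S A \<ge> 0"
    and \<phi>: "\<phi> \<in> borel_measurable (lborel_on \<Omega>)" "\<And>x. x \<in> \<Omega> \<Longrightarrow> 0 \<le> \<phi> x \<and> \<phi> x \<le> C"
  shows "semi_inner (H1_vec \<Omega>) (gradient_form \<Omega> \<phi> R S)"
  unfolding semi_inner_def
proof (intro conjI ballI allI)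
  fix u v assume u: "u \<in> H1_vec \<Omega>"
  show "gradient_form \<Omega> \<phi> R S u u \<ge> 0"
    unfolding gradient_form_def
    using \<phi>(2) RS(4) by (intro integral_nonneg_AE AE_I2 mult_nonneg_nonneg) (auto simp: space_restrict_space)
  assume v: "v \<in> H1_vec \<Omega>"
  show "gradient_form \<Omega> \<phi> R S u v = gradient_form \<Omega> \<phi> R S v u"
    unfolding gradient_form_def using RS(3) by metis
  fix w c assume w: "w \<in> H1_vec \<Omega>"
  note int = gradient_form_integrable[OF _ _ RS(1,2) \<phi>]
  have "gradient_form \<Omega> \<phi> R S (\<lambda>x. u x + c *\<^sub>R v x) w =
      (\<integral>x. \<phi> x * (R (weak_jacobian \<Omega> u x) \<bullet> S (weak_jacobian \<Omega> w x)) +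
         c * (\<phi> x * (R (weak_jacobian \<Omega> v x) \<bullet> S (weak_jacobian \<Omega> w x))) \<partial>lborel_on \<Omega>)"
    unfolding gradient_form_def
  proof (rule integral_cong_AE)
    show "AE x in lborel_on \<Omega>. \<phi> x * (R (weak_jacobian \<Omega> (\<lambda>x. u x + c *\<^sub>R v x) x) \<bullet> S (weak_jacobian \<Omega> w x)) =
      \<phi> x * (R (weak_jacobian \<Omega> u x) \<bullet> S (weak_jacobian \<Omega> w x)) +
         c * (\<phi> x * (R (weak_jacobian \<Omega> v x) \<bullet> S (weak_jacobian \<Omega> w x)))"
      using jacobian_comb[OF u v, of c]
      by eventually_elim (simp add: linear_add[OF RS(1)] linear_scale[OF RS(1)] inner_add_left algebra_simps)
  qed (use int[OF u w] int[OF v w] int[OF subspace_comb[OF H1_vec_subspace u v] w, of c] in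
      \<open>auto dest!: borel_measurable_integrable intro!: borel_measurable_add borel_measurable_times\<close>)
  also have "\<dots> = gradient_form \<Omega> \<phi> R S u w + c * gradient_form \<Omega> \<phi> R S v w"
    unfolding gradient_form_def using int[OF u w] int[OF v w] by simp
  finally show "gradient_form \<Omega> \<phi> R S (\<lambda>x. u x + c *\<^sub>R v x) w =
      gradient_form \<Omega> \<phi> R S u w + c * gradient_form \<Omega> \<phi> R S v w" .
qed

lemma Dirichlet_form_semi_inner: "semi_inner (H1_vec \<Omega>) (Dirichlet_form \<Omega>)"
  by (rule gradient_form_semi_inner[where C = 1]) (auto simp: linear_iff inner_commute)

lemma Dirichlet_form_eq: "Dirichlet_form \<Omega> v v = (l2_norm \<Omega> (weak_jacobian \<Omega> v))\<^sup>2"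
  unfolding l2_norm_sq[OF domain_measurable[OF open_\<Omega> bounded_\<Omega>]] gradient_form_def
  by (simp add: power2_norm_eq_inner)

lemma a_form_eq:
  "a_form \<Omega> \<CC> = gradient_form \<Omega> (\<lambda>_. 1) (\<lambda>A. \<CC> (symmetric_part A)) symmetric_part"
  by (simp add: fun_eq_iff a_form_def gradient_form_def strain_def symmetric_part_def
      set_integral_lborel_on[OF domain_measurable[OF open_\<Omega> bounded_\<Omega>]])

lemma a_form_semi_inner:
  assumes \<CC>: "elasticity_tensor \<CC>"
  shows "semi_inner (H1_vec \<Omega>) (a_form \<Omega> \<CC>)"
  unfolding a_form_eq
proof (rule gradient_form_semi_inner[where C = 1])
  have lin: "linear \<CC>" using \<CC> by (simp add: elasticity_tensor_def)
  then show "linear (\<lambda>A. \<CC> (symmetric_part A))"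
    using linear_compose[OF linear_symmetric_part lin] by (simp add: comp_def)
  \<comment> \<open>Symmetry and definiteness of \<CC> are available on symmetric matrices, where
    \<open>symmetric_part\<close> takes its values.\<close>
  show "\<CC> (symmetric_part A) \<bullet> symmetric_part B = \<CC> (symmetric_part B) \<bullet> symmetric_part A" for A B
    using \<CC> transpose_symmetric_part unfolding elasticity_tensor_def by (metis inner_commute)
  show "\<CC> (symmetric_part A) \<bullet> symmetric_part A \<ge> 0" for A
    using \<CC> transpose_symmetric_part[of A] linear_0[OF lin] unfolding elasticity_tensor_def
    by (cases "symmetric_part A = 0") (auto intro: less_imp_le)
qed (auto simp: linear_symmetric_part)

text \<open>Continuity of the energy with respect to the gradient; it turns an H^1 limit into a
  limit in energy.\<close>

lemma a_form_le_Dirichlet: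
  assumes \<CC>: "elasticity_tensor \<CC>"
  shows "\<exists>C\<ge>0. \<forall>v\<in>H1_vec \<Omega>. a_form \<Omega> \<CC> v v \<le> C * Dirichlet_form \<Omega> v v"
proof -
  have lin: "linear \<CC>" using \<CC> by (simp add: elasticity_tensor_def)
  have linC: "linear (\<lambda>A. \<CC> (symmetric_part A))"
    using linear_compose[OF linear_symmetric_part lin] by (simp add: comp_def)
  obtain C1 where C1: "C1 > 0" "\<And>A. norm (\<CC> (symmetric_part A)) \<le> C1 * norm A"
    using linear_bounded_pos[OF linC] by blast
  obtain C2 where C2: "C2 > 0" "\<And>A. norm (symmetric_part A) \<le> C2 * norm A"
    using linear_bounded_pos[OF linear_symmetric_part] by blast
  have "a_form \<Omega> \<CC> v v \<le> (C1 * C2) * Dirichlet_form \<Omega> v v" if v: "v \<in> H1_vec \<Omega>" for v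
  proof -
    let ?J = "weak_jacobian \<Omega> v"
    have ids: "linear (\<lambda>A::real^2^2. A)" by (simp add: linear_iff)
    have "a_form \<Omega> \<CC> v v \<le> (\<integral>x. (C1 * C2) * (1 * (?J x \<bullet> ?J x)) \<partial>lborel_on \<Omega>)"
      unfolding a_form_eq gradient_form_def
    proof (rule integral_mono)
      show "integrable (lborel_on \<Omega>) (\<lambda>x. 1 * (\<CC> (symmetric_part (?J x)) \<bullet> symmetric_part (?J x)))"
        by (rule gradient_form_integrable[OF v v linC linear_symmetric_part, where C = 1]) auto
      have "integrable (lborel_on \<Omega>) (\<lambda>x. 1 * (?J x \<bullet> ?J x))"
        by (rule gradient_form_integrable[OF v v ids ids, where C = 1]) auto
      then show "integrable (lborel_on \<Omega>) (\<lambda>x. C1 * C2 * (1 * (?J x \<bullet> ?J x)))" by (rule integrable_mult_right)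
      fix x
      have "\<CC> (symmetric_part (?J x)) \<bullet> symmetric_part (?J x) \<le>
          norm (\<CC> (symmetric_part (?J x))) * norm (symmetric_part (?J x))" by (rule norm_cauchy_schwarz)
      also have "\<dots> \<le> (C1 * norm (?J x)) * (C2 * norm (?J x))"
        using C1 C2 by (intro mult_mono) auto
      also have "\<dots> = C1 * C2 * (?J x \<bullet> ?J x)" by (simp add: power2_norm_eq_inner[symmetric] power2_eq_square)
      finally show "1 * (\<CC> (symmetric_part (?J x)) \<bullet> symmetric_part (?J x)) \<le> C1 * C2 * (1 * (?J x \<bullet> ?J x))" by simp
    qed
    also have "\<dots> = C1 * C2 * Dirichlet_form \<Omega> v v" unfolding gradient_form_def by simp
    finally show ?thesis .
  qed
  then show ?thesis using C1(1) C2(1) by (intro exI[of _ "C1 * C2"]) auto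
qed

lemma l2_inner_eq: "l2_inner \<Omega> u v = (\<integral>x. u x \<bullet> v x \<partial>lborel_on \<Omega>)" for u v :: "real^2 \<Rightarrow> real^2"
  by (simp add: l2_inner_def set_integral_lborel_on[OF domain_measurable[OF open_\<Omega> bounded_\<Omega>]])

lemma l2_inner_semi_inner: "semi_inner (H1_vec \<Omega>) (l2_inner \<Omega>)"
  unfolding semi_inner_def l2_inner_eq
proof (intro conjI ballI allI)
  fix u v w c assume uvw: "u \<in> H1_vec \<Omega>" "v \<in> H1_vec \<Omega>" "w \<in> H1_vec \<Omega>"
  show "(\<integral>x. (u x + c *\<^sub>R v x) \<bullet> w x \<partial>lborel_on \<Omega>) =
      (\<integral>x. u x \<bullet> w x \<partial>lborel_on \<Omega>) + c * (\<integral>x. v x \<bullet> w x \<partial>lborel_on \<Omega>)"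
    using square_integrable_inner[OF H1_vec_square_integrable[OF uvw(1)] H1_vec_square_integrable[OF uvw(3)]]
      square_integrable_inner[OF H1_vec_square_integrable[OF uvw(2)] H1_vec_square_integrable[OF uvw(3)]]
    by (simp add: inner_add_left)
qed (auto simp: inner_commute)

lemma l2_inner_self: "l2_inner \<Omega> v v = (l2_norm \<Omega> v)\<^sup>2" for v :: "real^2 \<Rightarrow> real^2"
  unfolding l2_inner_eq l2_norm_sq[OF domain_measurable[OF open_\<Omega> bounded_\<Omega>]] by (simp add: power2_norm_eq_inner)

lemma l2_inner_components:
  assumes "v \<in> H1_vec \<Omega>"
  shows "l2_inner \<Omega> v v = (\<Sum>i\<in>UNIV. \<integral>x. (v x $ i)\<^sup>2 \<partial>lborel_on \<Omega>)"
proof -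
  have "integrable (lborel_on \<Omega>) (\<lambda>x. (v x $ i)\<^sup>2)" for i
    using assms square_integrable_integrable[OF h1_square_integrable(1)[OF open_\<Omega> bounded_\<Omega>]]
    by (force simp: H1_vec_def)
  then show ?thesis unfolding l2_inner_eq
    by (simp add: inner_vec_def power2_eq_square[symmetric])
qed

lemma Dirichlet_form_components:
  assumes "v \<in> H1_vec \<Omega>"
  shows "Dirichlet_form \<Omega> v v = (\<Sum>i\<in>UNIV. \<Sum>j\<in>UNIV. \<integral>x. (weak_partial \<Omega> j (\<lambda>x. v x $ i) x)\<^sup>2 \<partial>lborel_on \<Omega>)"
proof -
  have "integrable (lborel_on \<Omega>) (\<lambda>x. (weak_partial \<Omega> j (\<lambda>x. v x $ i) x)\<^sup>2)" for i j
    using assms square_integrable_integrable[OF h1_square_integrable(2)[OF open_\<Omega> bounded_\<Omega>]]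
    by (force simp: H1_vec_def)
  then show ?thesis unfolding gradient_form_def
    by (simp add: inner_vec_def weak_jacobian_def power2_eq_square[symmetric])
qed

lemma h1_norm_components:
  assumes "v \<in> H1_vec \<Omega>"
  shows "(h1_norm \<Omega> (\<lambda>x. v x $ i))\<^sup>2 \<le> l2_inner \<Omega> v v + Dirichlet_form \<Omega> v v"
proof -
  have "(\<integral>x. (v x $ i)\<^sup>2 \<partial>lborel_on \<Omega>) \<le> l2_inner \<Omega> v v"
    unfolding l2_inner_components[OF assms] by (rule member_le_sum) auto
  moreover have "(\<Sum>j\<in>UNIV. \<integral>x. (weak_partial \<Omega> j (\<lambda>x. v x $ i) x)\<^sup>2 \<partial>lborel_on \<Omega>) \<le> Dirichlet_form \<Omega> v v"
    unfolding Dirichlet_form_components[OF assms]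
    by (rule member_le_sum[of i UNIV "\<lambda>i. \<Sum>j\<in>UNIV. \<integral>x. (weak_partial \<Omega> j (\<lambda>x. v x $ i) x)\<^sup>2 \<partial>lborel_on \<Omega>"])
       (auto intro: sum_nonneg)
  ultimately show ?thesis unfolding h1_norm_sq[OF open_\<Omega> bounded_\<Omega>] by simp
qed

end

section \<open>Zero traces and the boundary conditions\<close>

lemma tendsto_zero_of_sq_le:
  fixes x y :: "nat \<Rightarrow> real"
  assumes "y \<longlonglongrightarrow> 0" "\<And>n. (x n)\<^sup>2 \<le> y n"
  shows "x \<longlonglongrightarrow> 0"
proof -
  have "(\<lambda>n. (x n)\<^sup>2) \<longlonglongrightarrow> 0"
    by (rule tendsto_sandwich[OF _ _ tendsto_const assms(1)]) (use assms(2) in auto)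
  from tendsto_real_sqrt[OF this] have "(\<lambda>n. \<bar>x n\<bar>) \<longlonglongrightarrow> 0" by simp
  then show ?thesis by (simp add: tendsto_rabs_zero_iff)
qed

lemma continuous_square_integrable_unit:
  fixes w :: "real^2 \<Rightarrow> real"
  assumes "continuous_on S w" "closed_segment a b \<subseteq> S"
  shows "square_integrable (lborel_on {0..1}) (\<lambda>t. w (linepath a b t))"
proof -
  interpret UI: finite_measure unit_interval by (rule finite_measure_unit_interval)
  have cont: "continuous_on {0..1} (\<lambda>t. w (linepath a b t))"
    by (rule continuous_on_compose2[OF assms(1) continuous_on_linepath])
       (use assms(2) in \<open>auto simp: linepath_image_01 image_subset_iff[symmetric]\<close>)
  then have "compact ((\<lambda>t. w (linepath a b t)) ` {0..1})" by (intro compact_continuous_image) auto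
  then obtain B where B: "\<forall>t\<in>{0..1}. \<bar>w (linepath a b t)\<bar> \<le> B"
    using compact_imp_bounded bounded_iff by (metis image_eqI real_norm_def)
  have "(\<lambda>t. indicator {0..1} t *\<^sub>R w (linepath a b t)) \<in> borel_measurable borel"
    by (rule borel_measurable_continuous_on_indicator[OF _ cont]) simp
  then have "(\<lambda>t. w (linepath a b t)) \<in> borel_measurable unit_interval"
    by (simp add: borel_measurable_restrict_space_iff)
  then show ?thesis
    using B by (intro square_integrable_bound[OF UI.square_integrable_const[of "1::real"], of _ B])
               (auto simp: space_restrict_space)
qed

lemma has_trace_zero_iff:
  "has_trace \<Omega> a b f (\<lambda>_. 0) \<longleftrightarrow>
     (\<exists>w. (\<forall>n. h1_space \<Omega> (w n) \<and> continuous_on (closure \<Omega>) (w n)) \<and>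
        (\<lambda>n. h1_norm \<Omega> (\<lambda>x. w n x - f x)) \<longlonglongrightarrow> 0 \<and>
        (\<lambda>n. l2_norm {0..1} (\<lambda>t. w n (linepath a b t))) \<longlonglongrightarrow> 0)"
  by (simp add: has_trace_def l2_space_iff square_integrable_zero)

context
  fixes \<Omega> :: "(real^2) set"
  assumes open_\<Omega>: "open \<Omega>" and bounded_\<Omega>: "bounded \<Omega>"
begin

lemma h1_norm_scale:
  assumes f: "h1_space \<Omega> f"
  shows "h1_space \<Omega> (\<lambda>x. c * f x)" "(h1_norm \<Omega> (\<lambda>x. c * f x))\<^sup>2 = c\<^sup>2 * (h1_norm \<Omega> f)\<^sup>2"
proof -
  note zero = h1_space_zero[OF open_\<Omega> bounded_\<Omega>]
  have hwp: "has_weak_partial \<Omega> i (\<lambda>x. c * f x) (\<lambda>x. c * weak_partial \<Omega> i f x)" for i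
  proof -
    have "has_weak_partial \<Omega> i (\<lambda>x. 0) (\<lambda>x. 0)"
      by (simp add: has_weak_partial_iff[OF open_\<Omega> bounded_\<Omega>] square_integrable_zero)
    from has_weak_partial_comb[OF open_\<Omega> bounded_\<Omega> this has_weak_partial_weak_partial[OF open_\<Omega> bounded_\<Omega> f], of c]
    show ?thesis by simp
  qed
  show cf: "h1_space \<Omega> (\<lambda>x. c * f x)" by (rule h1_spaceI[OF open_\<Omega> bounded_\<Omega> hwp])
  have "(\<integral>x. (weak_partial \<Omega> i (\<lambda>x. c * f x) x)\<^sup>2 \<partial>lborel_on \<Omega>) = c\<^sup>2 * (\<integral>x. (weak_partial \<Omega> i f x)\<^sup>2 \<partial>lborel_on \<Omega>)" for i
  proof -
    have "(\<integral>x. (weak_partial \<Omega> i (\<lambda>x. c * f x) x)\<^sup>2 \<partial>lborel_on \<Omega>) =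
        (\<integral>x. c\<^sup>2 * (weak_partial \<Omega> i f x)\<^sup>2 \<partial>lborel_on \<Omega>)"
    proof (rule integral_cong_AE)
      show "AE x in lborel_on \<Omega>. (weak_partial \<Omega> i (\<lambda>x. c * f x) x)\<^sup>2 = c\<^sup>2 * (weak_partial \<Omega> i f x)\<^sup>2"
        using weak_partial_AE_eq[OF open_\<Omega> bounded_\<Omega> hwp[of i]] by eventually_elim (simp add: power_mult_distrib)
    qed (use h1_square_integrable(2)[OF open_\<Omega> bounded_\<Omega> cf, of i] h1_square_integrable(2)[OF open_\<Omega> bounded_\<Omega> f, of i]
        in \<open>auto dest!: square_integrable_measurable\<close>)
    then show ?thesis by simp
  qed
  then show "(h1_norm \<Omega> (\<lambda>x. c * f x))\<^sup>2 = c\<^sup>2 * (h1_norm \<Omega> f)\<^sup>2"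
    unfolding h1_norm_sq[OF open_\<Omega> bounded_\<Omega>]
    by (simp add: power_mult_distrib sum_distrib_left algebra_simps)
qed

lemma h1_space_add: "h1_space \<Omega> f \<Longrightarrow> h1_space \<Omega> g \<Longrightarrow> h1_space \<Omega> (\<lambda>x. f x + g x)"
  using h1_space_comb[OF open_\<Omega> bounded_\<Omega>, of f g 1] by simp

lemma h1_space_diff: "h1_space \<Omega> f \<Longrightarrow> h1_space \<Omega> g \<Longrightarrow> h1_space \<Omega> (\<lambda>x. f x - g x)"
  using h1_space_comb[OF open_\<Omega> bounded_\<Omega>, of f g "-1"] by simp

text \<open>The approximating sequences are combined. They are continuous up to the boundary, so
  their restrictions to the segment are square integrable and the bound for squares of sums
  applies.\<close>

lemma has_trace_zero_comb:
  assumes f: "h1_space \<Omega> f" "has_trace \<Omega> a b f (\<lambda>_. 0)" and g: "h1_space \<Omega> g" "has_trace \<Omega> a b g (\<lambda>_. 0)"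
    and seg: "closed_segment a b \<subseteq> closure \<Omega>"
  shows "has_trace \<Omega> a b (\<lambda>x. f x + c * g x) (\<lambda>_. 0)"
proof -
  obtain w where w: "\<And>n. h1_space \<Omega> (w n)" "\<And>n. continuous_on (closure \<Omega>) (w n)"
      "(\<lambda>n. h1_norm \<Omega> (\<lambda>x. w n x - f x)) \<longlonglongrightarrow> 0" "(\<lambda>n. l2_norm {0..1} (\<lambda>t. w n (linepath a b t))) \<longlonglongrightarrow> 0"
    using f(2) unfolding has_trace_zero_iff by blast
  obtain y where y: "\<And>n. h1_space \<Omega> (y n)" "\<And>n. continuous_on (closure \<Omega>) (y n)"
      "(\<lambda>n. h1_norm \<Omega> (\<lambda>x. y n x - g x)) \<longlonglongrightarrow> 0" "(\<lambda>n. l2_norm {0..1} (\<lambda>t. y n (linepath a b t))) \<longlonglongrightarrow> 0"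
    using g(2) unfolding has_trace_zero_iff by blast
  show ?thesis unfolding has_trace_zero_iff
  proof (intro exI[of _ "\<lambda>n x. w n x + c * y n x"] conjI allI)
    show "h1_space \<Omega> (\<lambda>x. w n x + c * y n x)" for n by (rule h1_space_comb[OF open_\<Omega> bounded_\<Omega> w(1) y(1)])
    show "continuous_on (closure \<Omega>) (\<lambda>x. w n x + c * y n x)" for n by (intro continuous_intros w(2) y(2))
    show "(\<lambda>n. h1_norm \<Omega> (\<lambda>x. w n x + c * y n x - (f x + c * g x))) \<longlonglongrightarrow> 0"
    proof (rule tendsto_zero_of_sq_le)
      have "(\<lambda>n. 2 * (h1_norm \<Omega> (\<lambda>x. w n x - f x))\<^sup>2 + 2 * (c\<^sup>2 * (h1_norm \<Omega> (\<lambda>x. y n x - g x))\<^sup>2)) \<longlonglongrightarrow>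
          2 * 0\<^sup>2 + 2 * (c\<^sup>2 * 0\<^sup>2)" by (intro tendsto_intros w(3) y(3))
      then show "(\<lambda>n. 2 * (h1_norm \<Omega> (\<lambda>x. w n x - f x))\<^sup>2 + 2 * (c\<^sup>2 * (h1_norm \<Omega> (\<lambda>x. y n x - g x))\<^sup>2)) \<longlonglongrightarrow> 0"
        by simp
      fix n
      have eq: "w n x + c * y n x - (f x + c * g x) = (w n x - f x) + c * (y n x - g x)" for x
        by (simp add: algebra_simps)
      have d: "h1_space \<Omega> (\<lambda>x. w n x - f x)" "h1_space \<Omega> (\<lambda>x. y n x - g x)"
        using h1_space_diff w(1) y(1) f(1) g(1) by auto
      show "(h1_norm \<Omega> (\<lambda>x. w n x + c * y n x - (f x + c * g x)))\<^sup>2 \<le>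
          2 * (h1_norm \<Omega> (\<lambda>x. w n x - f x))\<^sup>2 + 2 * (c\<^sup>2 * (h1_norm \<Omega> (\<lambda>x. y n x - g x))\<^sup>2)"
        unfolding eq using h1_norm_add_le[OF open_\<Omega> bounded_\<Omega> d(1) h1_norm_scale(1)[OF d(2), of c]]
          h1_norm_scale(2)[OF d(2), of c] by simp
    qed
    show "(\<lambda>n. l2_norm {0..1} (\<lambda>t. w n (linepath a b t) + c * y n (linepath a b t))) \<longlonglongrightarrow> 0"
    proof (rule tendsto_zero_of_sq_le)
      have "(\<lambda>n. 2 * (l2_norm {0..1} (\<lambda>t. w n (linepath a b t)))\<^sup>2 + 2 * (c\<^sup>2 * (l2_norm {0..1} (\<lambda>t. y n (linepath a b t)))\<^sup>2)) \<longlonglongrightarrow>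
          2 * 0\<^sup>2 + 2 * (c\<^sup>2 * 0\<^sup>2)" by (intro tendsto_intros w(4) y(4))
      then show "(\<lambda>n. 2 * (l2_norm {0..1} (\<lambda>t. w n (linepath a b t)))\<^sup>2 + 2 * (c\<^sup>2 * (l2_norm {0..1} (\<lambda>t. y n (linepath a b t)))\<^sup>2)) \<longlonglongrightarrow> 0"
        by simp
      fix n
      have si: "square_integrable unit_interval (\<lambda>t. w n (linepath a b t))"
        "square_integrable unit_interval (\<lambda>t. y n (linepath a b t))"
        using continuous_square_integrable_unit[OF w(2) seg] continuous_square_integrable_unit[OF y(2) seg] by auto
      show "(l2_norm {0..1} (\<lambda>t. w n (linepath a b t) + c * y n (linepath a b t)))\<^sup>2 \<le>
          2 * (l2_norm {0..1} (\<lambda>t. w n (linepath a b t)))\<^sup>2 + 2 * (c\<^sup>2 * (l2_norm {0..1} (\<lambda>t. y n (linepath a b t)))\<^sup>2)"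
        using integral_norm_sq_add_le[OF si(1) square_integrable_scaleR[OF si(2), of c]]
        by (simp add: l2_norm_sq power_mult_distrib)
    qed
  qed
qed

text \<open>A diagonal choice: for each n an approximant of \<open>f n\<close> is taken whose H^1
  distance to \<open>f n\<close> and whose norm on the segment are both below 1/(n + 1).\<close>

lemma has_trace_zero_limit:
  assumes f: "\<And>n. h1_space \<Omega> (f n)" "\<And>n. has_trace \<Omega> a b (f n) (\<lambda>_. 0)" and g: "h1_space \<Omega> g"
    and lim: "(\<lambda>n. h1_norm \<Omega> (\<lambda>x. f n x - g x)) \<longlonglongrightarrow> 0"
  shows "has_trace \<Omega> a b g (\<lambda>_. 0)"
proof -
  have "\<exists>w. h1_space \<Omega> w \<and> continuous_on (closure \<Omega>) w \<and>
      h1_norm \<Omega> (\<lambda>x. w x - f n x) < 1 / real (Suc n) \<and> l2_norm {0..1} (\<lambda>t. w (linepath a b t)) < 1 / real (Suc n)" for n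
  proof -
    obtain w where w: "\<And>k. h1_space \<Omega> (w k)" "\<And>k. continuous_on (closure \<Omega>) (w k)"
      "(\<lambda>k. h1_norm \<Omega> (\<lambda>x. w k x - f n x)) \<longlonglongrightarrow> 0" "(\<lambda>k. l2_norm {0..1} (\<lambda>t. w k (linepath a b t))) \<longlonglongrightarrow> 0"
      using f(2)[of n] unfolding has_trace_zero_iff by blast
    have pos: "0 < 1 / real (Suc n)" by simp
    have "eventually (\<lambda>k. h1_norm \<Omega> (\<lambda>x. w k x - f n x) < 1 / real (Suc n) \<and>
        l2_norm {0..1} (\<lambda>t. w k (linepath a b t)) < 1 / real (Suc n)) sequentially"
      using order_tendstoD(2)[OF w(3) pos] order_tendstoD(2)[OF w(4) pos] by eventually_elim simp
    then obtain k where "h1_norm \<Omega> (\<lambda>x. w k x - f n x) < 1 / real (Suc n)"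
        "l2_norm {0..1} (\<lambda>t. w k (linepath a b t)) < 1 / real (Suc n)"
      unfolding eventually_sequentially by blast
    then show ?thesis using w by blast
  qed
  then obtain w where w: "\<And>n. h1_space \<Omega> (w n)" "\<And>n. continuous_on (closure \<Omega>) (w n)"
      "\<And>n. h1_norm \<Omega> (\<lambda>x. w n x - f n x) < 1 / real (Suc n)"
      "\<And>n. l2_norm {0..1} (\<lambda>t. w n (linepath a b t)) < 1 / real (Suc n)"
    by metis
  have inv: "(\<lambda>n. 1 / real (Suc n)) \<longlonglongrightarrow> 0" using LIMSEQ_inverse_real_of_nat by (simp add: inverse_eq_divide)
  show ?thesis unfolding has_trace_zero_iff
  proof (intro exI[of _ w] conjI allI w(1,2))
    show "(\<lambda>n. l2_norm {0..1} (\<lambda>t. w n (linepath a b t))) \<longlonglongrightarrow> 0"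
    proof (rule tendsto_sandwich[OF _ _ tendsto_const inv])
      show "\<forall>\<^sub>F n in sequentially. 0 \<le> l2_norm {0..1} (\<lambda>t. w n (linepath a b t))"
        by (simp add: l2_norm_eq)
    qed (use w(4) in \<open>auto simp: less_imp_le\<close>)
    have lim1: "(\<lambda>n. h1_norm \<Omega> (\<lambda>x. w n x - f n x)) \<longlonglongrightarrow> 0"
    proof (rule tendsto_sandwich[OF _ _ tendsto_const inv])
      show "\<forall>\<^sub>F n in sequentially. 0 \<le> h1_norm \<Omega> (\<lambda>x. w n x - f n x)"
        using h1_norm_nonneg[OF open_\<Omega> bounded_\<Omega>] by simp
    qed (use w(3) in \<open>auto simp: less_imp_le\<close>)
    show "(\<lambda>n. h1_norm \<Omega> (\<lambda>x. w n x - g x)) \<longlonglongrightarrow> 0"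
    proof (rule tendsto_zero_of_sq_le)
      have "(\<lambda>n. 2 * (h1_norm \<Omega> (\<lambda>x. w n x - f n x))\<^sup>2 + 2 * (h1_norm \<Omega> (\<lambda>x. f n x - g x))\<^sup>2) \<longlonglongrightarrow> 2 * 0\<^sup>2 + 2 * 0\<^sup>2"
        by (intro tendsto_intros lim1 lim)
      then show "(\<lambda>n. 2 * (h1_norm \<Omega> (\<lambda>x. w n x - f n x))\<^sup>2 + 2 * (h1_norm \<Omega> (\<lambda>x. f n x - g x))\<^sup>2) \<longlonglongrightarrow> 0" by simp
      show "(h1_norm \<Omega> (\<lambda>x. w n x - g x))\<^sup>2 \<le>
          2 * (h1_norm \<Omega> (\<lambda>x. w n x - f n x))\<^sup>2 + 2 * (h1_norm \<Omega> (\<lambda>x. f n x - g x))\<^sup>2" for n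
        using h1_norm_add_le[OF open_\<Omega> bounded_\<Omega> h1_space_diff[OF w(1) f(1)] h1_space_diff[OF f(1) g], of n n n] by simp
    qed
  qed
qed

lemma h1_space_inner:
  assumes "v \<in> H1_vec \<Omega>"
  shows "h1_space \<Omega> (\<lambda>x. v x \<bullet> \<nu>)"
    "(h1_norm \<Omega> (\<lambda>x. v x \<bullet> \<nu>))\<^sup>2 \<le> 2 * ((\<nu>$1)\<^sup>2 + (\<nu>$2)\<^sup>2) * (l2_inner \<Omega> v v + Dirichlet_form \<Omega> v v)"
proof -
  have h1: "h1_space \<Omega> (\<lambda>x. v x $ i)" for i using assms by (simp add: H1_vec_def)
  have eq: "v x \<bullet> \<nu> = \<nu>$1 * v x $ 1 + \<nu>$2 * v x $ 2" for x by (simp add: inner_vec_def sum_2 mult.commute)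
  note s = h1_norm_scale[OF h1]
  show "h1_space \<Omega> (\<lambda>x. v x \<bullet> \<nu>)" unfolding eq by (intro h1_space_add s(1))
  have "(h1_norm \<Omega> (\<lambda>x. v x \<bullet> \<nu>))\<^sup>2 \<le> 2 * ((\<nu>$1)\<^sup>2 * (h1_norm \<Omega> (\<lambda>x. v x $ 1))\<^sup>2) + 2 * ((\<nu>$2)\<^sup>2 * (h1_norm \<Omega> (\<lambda>x. v x $ 2))\<^sup>2)"
    unfolding eq using h1_norm_add_le[OF open_\<Omega> bounded_\<Omega> s(1) s(1), of "\<nu>$1" 1 "\<nu>$2" 2] by (simp add: s(2))
  also have "\<dots> \<le> 2 * ((\<nu>$1)\<^sup>2 * (l2_inner \<Omega> v v + Dirichlet_form \<Omega> v v)) + 2 * ((\<nu>$2)\<^sup>2 * (l2_inner \<Omega> v v + Dirichlet_form \<Omega> v v))"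
    by (intro add_mono mult_left_mono h1_norm_components[OF open_\<Omega> bounded_\<Omega> assms]) auto
  finally show "(h1_norm \<Omega> (\<lambda>x. v x \<bullet> \<nu>))\<^sup>2 \<le> 2 * ((\<nu>$1)\<^sup>2 + (\<nu>$2)\<^sup>2) * (l2_inner \<Omega> v v + Dirichlet_form \<Omega> v v)"
    by (simp add: algebra_simps)
qed

lemma H_space_subset_H1: "H_space \<Omega> \<Gamma>D \<Gamma>g \<subseteq> H1_vec \<Omega>"
  by (auto simp: H_space_def H1_vec_def)

text \<open>Nonemptiness is a hypothesis because the eigenfunction u provides a member.\<close>

lemma H_space_subspace:
  assumes "\<Gamma>D \<subseteq> frontier \<Omega>" "\<Gamma>g \<subseteq> frontier \<Omega>" "H_space \<Omega> \<Gamma>D \<Gamma>g \<noteq> {}"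
  shows "linear_subspace (H_space \<Omega> \<Gamma>D \<Gamma>g)"
  unfolding linear_subspace_def
proof (intro conjI ballI allI assms(3))
  fix u v c assume u: "u \<in> H_space \<Omega> \<Gamma>D \<Gamma>g" and v: "v \<in> H_space \<Omega> \<Gamma>D \<Gamma>g"
  have fr: "frontier \<Omega> \<subseteq> closure \<Omega>" by (simp add: frontier_def)
  have H1: "u \<in> H1_vec \<Omega>" "v \<in> H1_vec \<Omega>" using u v H_space_subset_H1 by auto
  then have h1: "h1_space \<Omega> (\<lambda>x. u x $ i)" "h1_space \<Omega> (\<lambda>x. v x $ i)" for i by (auto simp: H1_vec_def)
  show "(\<lambda>x. u x + c *\<^sub>R v x) \<in> H_space \<Omega> \<Gamma>D \<Gamma>g"
    unfolding H_space_def mem_Collect_eq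
  proof (intro conjI allI impI)
    show "h1_space \<Omega> (\<lambda>x. (u x + c *\<^sub>R v x) $ i)" for i
      using h1_space_comb[OF open_\<Omega> bounded_\<Omega> h1] by simp
    show "has_trace \<Omega> a b (\<lambda>x. (u x + c *\<^sub>R v x) $ i) (\<lambda>_. 0)"
      if ab: "a \<noteq> b \<and> closed_segment a b \<subseteq> \<Gamma>D" for a b i
    proof -
      have "has_trace \<Omega> a b (\<lambda>x. u x $ i) (\<lambda>_. 0)" "has_trace \<Omega> a b (\<lambda>x. v x $ i) (\<lambda>_. 0)"
        using u v ab by (auto simp: H_space_def)
      moreover have "closed_segment a b \<subseteq> closure \<Omega>" using ab assms(1) fr by blast
      ultimately show ?thesis using has_trace_zero_comb[OF h1(1) _ h1(2)] by simp
    qed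
    show "has_trace \<Omega> a b (\<lambda>x. (u x + c *\<^sub>R v x) \<bullet> \<nu>) (\<lambda>_. 0)"
      if ab: "a \<noteq> b \<and> closed_segment a b \<subseteq> \<Gamma>g \<and> (\<forall>x\<in>open_segment a b. outer_unit_normal \<Omega> x \<nu>)" for a b \<nu>
    proof -
      have "has_trace \<Omega> a b (\<lambda>x. u x \<bullet> \<nu>) (\<lambda>_. 0)" "has_trace \<Omega> a b (\<lambda>x. v x \<bullet> \<nu>) (\<lambda>_. 0)"
        using u v ab unfolding H_space_def by blast+
      moreover have "closed_segment a b \<subseteq> closure \<Omega>" using ab assms(2) fr by blast
      ultimately show ?thesis
        using has_trace_zero_comb[OF h1_space_inner(1)[OF H1(1)] _ h1_space_inner(1)[OF H1(2)]]
        by (simp add: inner_add_left)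
    qed
  qed
qed

text \<open>H^1 convergence of the components entails that of v \<bullet> \<nu>, so both kinds of
  boundary condition pass to the limit by \<open>has_trace_zero_limit\<close>.\<close>

lemma H_space_closed:
  assumes v: "\<And>n. v n \<in> H_space \<Omega> \<Gamma>D \<Gamma>g" and u: "u \<in> H1_vec \<Omega>"
    and lim: "form_converges (l2_inner \<Omega>) v u" "form_converges (Dirichlet_form \<Omega>) v u"
  shows "u \<in> H_space \<Omega> \<Gamma>D \<Gamma>g"
proof -
  have vH1: "v n \<in> H1_vec \<Omega>" for n using v H_space_subset_H1 by blast
  then have h1: "h1_space \<Omega> (\<lambda>x. v n x $ i)" "h1_space \<Omega> (\<lambda>x. u x $ i)" for n i using u by (auto simp: H1_vec_def)
  have d: "(\<lambda>x. v n x - u x) \<in> H1_vec \<Omega>" for n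
    by (rule subspace_diff[OF H1_vec_subspace[OF open_\<Omega> bounded_\<Omega>] vH1 u])
  define q where "q n = l2_inner \<Omega> (\<lambda>x. v n x - u x) (\<lambda>x. v n x - u x) + Dirichlet_form \<Omega> (\<lambda>x. v n x - u x) (\<lambda>x. v n x - u x)" for n
  have q: "q \<longlonglongrightarrow> 0" using tendsto_add[OF lim[unfolded form_converges_def]] unfolding q_def by simp
  have comp: "(\<lambda>n. h1_norm \<Omega> (\<lambda>x. v n x $ i - u x $ i)) \<longlonglongrightarrow> 0" for i
    by (rule tendsto_zero_of_sq_le[OF q]) (use h1_norm_components[OF open_\<Omega> bounded_\<Omega> d] in \<open>simp add: q_def\<close>)
  have normal: "(\<lambda>n. h1_norm \<Omega> (\<lambda>x. v n x \<bullet> \<nu> - u x \<bullet> \<nu>)) \<longlonglongrightarrow> 0" for \<nu>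
  proof (rule tendsto_zero_of_sq_le)
    show "(\<lambda>n. 2 * ((\<nu>$1)\<^sup>2 + (\<nu>$2)\<^sup>2) * q n) \<longlonglongrightarrow> 0"
      using tendsto_mult[OF tendsto_const q, of "2 * ((\<nu>$1)\<^sup>2 + (\<nu>$2)\<^sup>2)"] by simp
    show "(h1_norm \<Omega> (\<lambda>x. v n x \<bullet> \<nu> - u x \<bullet> \<nu>))\<^sup>2 \<le> 2 * ((\<nu>$1)\<^sup>2 + (\<nu>$2)\<^sup>2) * q n" for n
      using h1_space_inner(2)[OF d, of n \<nu>] by (simp add: q_def inner_diff_left)
  qed
  show ?thesis unfolding H_space_def mem_Collect_eq
  proof (intro conjI allI impI)
    show "h1_space \<Omega> (\<lambda>x. u x $ i)" for i by (rule h1)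
    show "has_trace \<Omega> a b (\<lambda>x. u x $ i) (\<lambda>_. 0)" if ab: "a \<noteq> b \<and> closed_segment a b \<subseteq> \<Gamma>D" for a b i
      by (rule has_trace_zero_limit[OF h1(1) _ h1(2) comp]) (use v ab in \<open>auto simp: H_space_def\<close>)
    show "has_trace \<Omega> a b (\<lambda>x. u x \<bullet> \<nu>) (\<lambda>_. 0)"
      if ab: "a \<noteq> b \<and> closed_segment a b \<subseteq> \<Gamma>g \<and> (\<forall>x\<in>open_segment a b. outer_unit_normal \<Omega> x \<nu>)" for a b \<nu>
    proof (rule has_trace_zero_limit[OF h1_space_inner(1)[OF vH1] _ h1_space_inner(1)[OF u] normal])
      show "has_trace \<Omega> a b (\<lambda>x. v n x \<bullet> \<nu>) (\<lambda>_. 0)" for n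
        using v[of n] ab unfolding H_space_def by blast
    qed
  qed
qed

text \<open>The components and their weak derivatives converge separately in L^2;
  \<open>has_weak_partial_limit\<close> identifies the limits of the derivatives as derivatives of
  the limits.\<close>

lemma H1_vec_complete:
  assumes v: "\<And>n. v n \<in> H1_vec \<Omega>" and Cauchy: "form_Cauchy (l2_inner \<Omega>) v" "form_Cauchy (Dirichlet_form \<Omega>) v"
  shows "\<exists>u\<in>H1_vec \<Omega>. form_converges (l2_inner \<Omega>) v u \<and> form_converges (Dirichlet_form \<Omega>) v u"
proof -
  interpret fm: finite_measure "lborel_on \<Omega>" by (rule domain_finite[OF open_\<Omega> bounded_\<Omega>])
  have h1: "h1_space \<Omega> (\<lambda>x. v n x $ i)" for n i using v by (auto simp: H1_vec_def)
  have d: "(\<lambda>x. v n x - u x) \<in> H1_vec \<Omega>" if "u \<in> H1_vec \<Omega>" for n u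
    by (rule subspace_diff[OF H1_vec_subspace[OF open_\<Omega> bounded_\<Omega>] v that])
  \<comment> \<open>The representative chosen for the difference agrees with the difference of the
    derivatives only almost everywhere, so the identity is stated under the integral.\<close>
  have wp_diff: "(\<integral>x. (weak_partial \<Omega> j (\<lambda>x. f x - g x) x)\<^sup>2 \<partial>lborel_on \<Omega>) =
      (\<integral>x. (weak_partial \<Omega> j f x - h x)\<^sup>2 \<partial>lborel_on \<Omega>)"
    if f: "h1_space \<Omega> f" and g: "has_weak_partial \<Omega> j g h" for f g h j
  proof (rule integral_cong_AE)
    have hwp: "has_weak_partial \<Omega> j (\<lambda>x. f x - g x) (\<lambda>x. weak_partial \<Omega> j f x - h x)"
      using has_weak_partial_comb[OF open_\<Omega> bounded_\<Omega> has_weak_partial_weak_partial[OF open_\<Omega> bounded_\<Omega> f] g, of "-1"]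
      by simp
    show "AE x in lborel_on \<Omega>. (weak_partial \<Omega> j (\<lambda>x. f x - g x) x)\<^sup>2 = (weak_partial \<Omega> j f x - h x)\<^sup>2"
      using weak_partial_AE_eq[OF open_\<Omega> bounded_\<Omega> hwp] by eventually_elim simp
    have "has_weak_partial \<Omega> j (\<lambda>x. f x - g x) (weak_partial \<Omega> j (\<lambda>x. f x - g x))"
      unfolding weak_partial_def using someI[of "has_weak_partial \<Omega> j (\<lambda>x. f x - g x)", OF hwp] .
    then have "square_integrable (lborel_on \<Omega>) (weak_partial \<Omega> j (\<lambda>x. f x - g x))"
      by (simp add: has_weak_partial_iff[OF open_\<Omega> bounded_\<Omega>])
    then show "(\<lambda>x. (weak_partial \<Omega> j (\<lambda>x. f x - g x) x)\<^sup>2) \<in> borel_measurable (lborel_on \<Omega>)"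
      by (auto dest: square_integrable_measurable)
    have "square_integrable (lborel_on \<Omega>) (\<lambda>x. weak_partial \<Omega> j f x - h x)"
      using hwp by (simp add: has_weak_partial_iff[OF open_\<Omega> bounded_\<Omega>])
    then show "(\<lambda>x. (weak_partial \<Omega> j f x - h x)\<^sup>2) \<in> borel_measurable (lborel_on \<Omega>)"
      by (auto dest: square_integrable_measurable)
  qed
  have "\<exists>f0. square_integrable (lborel_on \<Omega>) f0 \<and> (\<lambda>n. \<integral>x. (v n x $ i - f0 x)\<^sup>2 \<partial>lborel_on \<Omega>) \<longlonglongrightarrow> 0" for i
  proof (rule fm.L2_complete)
    show "square_integrable (lborel_on \<Omega>) (\<lambda>x. v n x $ i)" for n
      by (rule h1_square_integrable(1)[OF open_\<Omega> bounded_\<Omega> h1])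
    fix \<epsilon> :: real assume "\<epsilon> > 0"
    then obtain N where N: "\<And>n k. n \<ge> N \<Longrightarrow> k \<ge> N \<Longrightarrow> l2_inner \<Omega> (\<lambda>x. v n x - v k x) (\<lambda>x. v n x - v k x) < \<epsilon>"
      using Cauchy(1) unfolding form_Cauchy_def by meson
    have le: "(\<integral>x. (v n x $ i - v k x $ i)\<^sup>2 \<partial>lborel_on \<Omega>) \<le> l2_inner \<Omega> (\<lambda>x. v n x - v k x) (\<lambda>x. v n x - v k x)" for n k
      unfolding l2_inner_components[OF open_\<Omega> bounded_\<Omega> d[OF v]] 
      using member_le_sum[of i UNIV "\<lambda>i. \<integral>x. ((v n x - v k x) $ i)\<^sup>2 \<partial>lborel_on \<Omega>"] by simp
    show "\<exists>N. \<forall>n\<ge>N. \<forall>k\<ge>N. (\<integral>x. (v n x $ i - v k x $ i)\<^sup>2 \<partial>lborel_on \<Omega>) < \<epsilon>"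
      by (intro exI[of _ N] allI impI) (rule le_less_trans[OF le N])
  qed
  then have "\<exists>f0. \<forall>i. square_integrable (lborel_on \<Omega>) (f0 i) \<and>
      (\<lambda>n. \<integral>x. (v n x $ i - f0 i x)\<^sup>2 \<partial>lborel_on \<Omega>) \<longlonglongrightarrow> 0"
    by (intro choice allI)
  then obtain f0 where f0: "\<And>i. square_integrable (lborel_on \<Omega>) (f0 i)"
      "\<And>i. (\<lambda>n. \<integral>x. (v n x $ i - f0 i x)\<^sup>2 \<partial>lborel_on \<Omega>) \<longlonglongrightarrow> 0" by blast
  have "\<exists>g0. square_integrable (lborel_on \<Omega>) g0 \<and>
      (\<lambda>n. \<integral>x. (weak_partial \<Omega> j (\<lambda>x. v n x $ i) x - g0 x)\<^sup>2 \<partial>lborel_on \<Omega>) \<longlonglongrightarrow> 0" for i j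
  proof (rule fm.L2_complete)
    show "square_integrable (lborel_on \<Omega>) (weak_partial \<Omega> j (\<lambda>x. v n x $ i))" for n
      by (rule h1_square_integrable(2)[OF open_\<Omega> bounded_\<Omega> h1])
    fix \<epsilon> :: real assume "\<epsilon> > 0"
    then obtain N where N: "\<And>n k. n \<ge> N \<Longrightarrow> k \<ge> N \<Longrightarrow> Dirichlet_form \<Omega> (\<lambda>x. v n x - v k x) (\<lambda>x. v n x - v k x) < \<epsilon>"
      using Cauchy(2) unfolding form_Cauchy_def by meson
    have le: "(\<integral>x. (weak_partial \<Omega> j (\<lambda>x. v n x $ i) x - weak_partial \<Omega> j (\<lambda>x. v k x $ i) x)\<^sup>2 \<partial>lborel_on \<Omega>) \<le>
        Dirichlet_form \<Omega> (\<lambda>x. v n x - v k x) (\<lambda>x. v n x - v k x)" for n k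
    proof -
      let ?I = "\<lambda>i j. \<integral>x. (weak_partial \<Omega> j (\<lambda>x. (v n x - v k x) $ i) x)\<^sup>2 \<partial>lborel_on \<Omega>"
      have "?I i j \<le> (\<Sum>j\<in>UNIV. ?I i j)" by (rule member_le_sum) auto
      also have "\<dots> \<le> (\<Sum>i\<in>UNIV. \<Sum>j\<in>UNIV. ?I i j)"
        by (rule member_le_sum[of i UNIV "\<lambda>i. \<Sum>j\<in>UNIV. ?I i j"]) (auto intro: sum_nonneg)
      also have "?I i j = (\<integral>x. (weak_partial \<Omega> j (\<lambda>x. v n x $ i) x - weak_partial \<Omega> j (\<lambda>x. v k x $ i) x)\<^sup>2 \<partial>lborel_on \<Omega>)"
        using wp_diff[OF h1 has_weak_partial_weak_partial[OF open_\<Omega> bounded_\<Omega> h1], of j n i k i] by simp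
      finally show ?thesis unfolding Dirichlet_form_components[OF open_\<Omega> bounded_\<Omega> d[OF v]] .
    qed
    show "\<exists>N. \<forall>n\<ge>N. \<forall>k\<ge>N. (\<integral>x. (weak_partial \<Omega> j (\<lambda>x. v n x $ i) x - weak_partial \<Omega> j (\<lambda>x. v k x $ i) x)\<^sup>2 \<partial>lborel_on \<Omega>) < \<epsilon>"
      by (intro exI[of _ N] allI impI) (rule le_less_trans[OF le N])
  qed
  then have "\<exists>g0. \<forall>i j. square_integrable (lborel_on \<Omega>) (g0 i j) \<and>
      (\<lambda>n. \<integral>x. (weak_partial \<Omega> j (\<lambda>x. v n x $ i) x - g0 i j x)\<^sup>2 \<partial>lborel_on \<Omega>) \<longlonglongrightarrow> 0"
    by (intro choice allI)
  then obtain g0 where g0: "\<And>i j. square_integrable (lborel_on \<Omega>) (g0 i j)"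
      "\<And>i j. (\<lambda>n. \<integral>x. (weak_partial \<Omega> j (\<lambda>x. v n x $ i) x - g0 i j x)\<^sup>2 \<partial>lborel_on \<Omega>) \<longlonglongrightarrow> 0" by blast
  define u :: "real^2 \<Rightarrow> real^2" where "u x = (\<chi> i. f0 i x)" for x
  have hwp: "has_weak_partial \<Omega> j (f0 i) (g0 i j)" for i j
    by (rule has_weak_partial_limit[OF open_\<Omega> bounded_\<Omega> has_weak_partial_weak_partial[OF open_\<Omega> bounded_\<Omega> h1] f0(1) g0(1) f0(2) g0(2)])
  have ui: "(\<lambda>x. u x $ i) = f0 i" for i by (simp add: u_def)
  have u: "u \<in> H1_vec \<Omega>" unfolding H1_vec_def mem_Collect_eq ui using h1_spaceI[OF open_\<Omega> bounded_\<Omega> hwp] by blast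
  have "form_converges (l2_inner \<Omega>) v u" unfolding form_converges_def l2_inner_components[OF open_\<Omega> bounded_\<Omega> d[OF u]]
  proof (rule tendsto_null_sum)
    show "(\<lambda>n. \<integral>x. ((v n x - u x) $ i)\<^sup>2 \<partial>lborel_on \<Omega>) \<longlonglongrightarrow> 0" for i using f0(2)[of i] by (simp add: u_def)
  qed
  moreover have "form_converges (Dirichlet_form \<Omega>) v u"
    unfolding form_converges_def Dirichlet_form_components[OF open_\<Omega> bounded_\<Omega> d[OF u]]
  proof (intro tendsto_null_sum)
    fix i j
    have "(\<integral>x. (weak_partial \<Omega> j (\<lambda>x. (v n x - u x) $ i) x)\<^sup>2 \<partial>lborel_on \<Omega>) =
        (\<integral>x. (weak_partial \<Omega> j (\<lambda>x. v n x $ i) x - g0 i j x)\<^sup>2 \<partial>lborel_on \<Omega>)" for n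
      using wp_diff[OF h1 hwp, of j n i i] by (simp add: u_def)
    then show "(\<lambda>n. \<integral>x. (weak_partial \<Omega> j (\<lambda>x. (v n x - u x) $ i) x)\<^sup>2 \<partial>lborel_on \<Omega>) \<longlonglongrightarrow> 0" using g0(2)[where i = i and j = j] by simp
  qed
  ultimately show ?thesis using u by blast
qed

end

text \<open>Rellich's theorem for the first component, then for the second along the subsequence
  obtained.\<close>

lemma H1_vec_compact:
  assumes \<Omega>: "open \<Omega>" "bounded \<Omega>" "lipschitz_boundary \<Omega>" and \<T>: "conforming_triangulation \<Omega> \<T>"
    and v: "\<And>n::nat. v n \<in> H1_vec \<Omega>" "\<And>n. l2_inner \<Omega> (v n) (v n) + Dirichlet_form \<Omega> (v n) (v n) \<le> C"
  shows "\<exists>r. strict_mono r \<and> form_Cauchy (l2_inner \<Omega>) (\<lambda>n. v (r n))"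
proof -
  have h1: "h1_space \<Omega> (\<lambda>x. v n x $ i)" for n i using v by (auto simp: H1_vec_def)
  have bound: "(h1_norm \<Omega> (\<lambda>x. v n x $ i))\<^sup>2 \<le> C" for n i
    using h1_norm_components[OF \<Omega>(1,2) v(1)[of n], of i] v(2)[of n] by linarith
  obtain r1 where r1: "strict_mono (r1 :: nat \<Rightarrow> nat)"
    "\<And>\<epsilon>. \<epsilon> > 0 \<Longrightarrow> \<exists>N. \<forall>i\<ge>N. \<forall>k\<ge>N. (\<integral>x. (v (r1 i) x $ 1 - v (r1 k) x $ 1)\<^sup>2 \<partial>lborel_on \<Omega>) < \<epsilon>"
    using Rellich[OF \<Omega> \<T>, of "\<lambda>n x. v n x $ 1" C] h1 bound by blast
  obtain r2 where r2: "strict_mono (r2 :: nat \<Rightarrow> nat)"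
    "\<And>\<epsilon>. \<epsilon> > 0 \<Longrightarrow> \<exists>N. \<forall>i\<ge>N. \<forall>k\<ge>N. (\<integral>x. (v (r1 (r2 i)) x $ 2 - v (r1 (r2 k)) x $ 2)\<^sup>2 \<partial>lborel_on \<Omega>) < \<epsilon>"
    using Rellich[OF \<Omega> \<T>, of "\<lambda>n x. v (r1 n) x $ 2" C] h1 bound by blast
  have "form_Cauchy (l2_inner \<Omega>) (\<lambda>n. v (r1 (r2 n)))" unfolding form_Cauchy_def
  proof (intro allI impI)
    fix \<epsilon> :: real assume "\<epsilon> > 0"
    then have e: "\<epsilon> / 2 > 0" by simp
    obtain N1 where N1: "\<And>i k. i \<ge> N1 \<Longrightarrow> k \<ge> N1 \<Longrightarrow> (\<integral>x. (v (r1 i) x $ 1 - v (r1 k) x $ 1)\<^sup>2 \<partial>lborel_on \<Omega>) < \<epsilon> / 2"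
      using r1(2)[OF e] by blast
    obtain N2 where N2: "\<And>i k. i \<ge> N2 \<Longrightarrow> k \<ge> N2 \<Longrightarrow> (\<integral>x. (v (r1 (r2 i)) x $ 2 - v (r1 (r2 k)) x $ 2)\<^sup>2 \<partial>lborel_on \<Omega>) < \<epsilon> / 2"
      using r2(2)[OF e] by blast
    show "\<exists>N. \<forall>i\<ge>N. \<forall>k\<ge>N. l2_inner \<Omega> (\<lambda>x. v (r1 (r2 i)) x - v (r1 (r2 k)) x) (\<lambda>x. v (r1 (r2 i)) x - v (r1 (r2 k)) x) < \<epsilon>"
    proof (intro exI[of _ "max N1 N2"] allI impI)
      fix i k assume ik: "max N1 N2 \<le> i" "max N1 N2 \<le> k"
      have "r2 i \<ge> i" "r2 k \<ge> k" using seq_suble[OF r2(1)] by auto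
      then have "r2 i \<ge> N1" "r2 k \<ge> N1" using ik by auto
      note a = N1[OF this]
      have b: "(\<integral>x. (v (r1 (r2 i)) x $ 2 - v (r1 (r2 k)) x $ 2)\<^sup>2 \<partial>lborel_on \<Omega>) < \<epsilon> / 2" using N2 ik by simp
      have "(\<lambda>x. v (r1 (r2 i)) x - v (r1 (r2 k)) x) \<in> H1_vec \<Omega>"
        by (rule subspace_diff[OF H1_vec_subspace[OF \<Omega>(1,2)] v(1) v(1)])
      from l2_inner_components[OF \<Omega>(1,2) this] a b
      show "l2_inner \<Omega> (\<lambda>x. v (r1 (r2 i)) x - v (r1 (r2 k)) x) (\<lambda>x. v (r1 (r2 i)) x - v (r1 (r2 k)) x) < \<epsilon>"
        by (simp add: sum_2)
    qed
  qed
  moreover have "strict_mono (\<lambda>n. r1 (r2 n))" using r1(1) r2(1) by (simp add: strict_mono_def)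
  ultimately show ?thesis by blast
qed

section \<open>Eigenvalues and the estimator\<close>

lemma semi_inner_subset: "semi_inner V B \<Longrightarrow> W \<subseteq> V \<Longrightarrow> semi_inner W B"
  unfolding semi_inner_def by (meson subsetD)

text \<open>Lets t tend to 0 in the two perturbation arguments, \<open>Korn_Dirichlet\<close> and
  \<open>residual_le_estimator\<close>.\<close>

lemma le_zero_of_scaled_bounds:
  fixes r E :: real
  assumes "\<And>t. t > 0 \<Longrightarrow> r \<le> t * E"
  shows "r \<le> 0"
proof (rule ccontr)
  assume "\<not> r \<le> 0"
  then have r: "r > 0" by simp
  then have E: "E > 0" using assms[of 1] by simp
  have "r \<le> r / (2 * E) * E" using r E by (intro assms) simp
  then show False using r E by simp
qed

text \<open>Lets the expansion in \<open>eigenvalue_number\<close>, which holds almost everywhere,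
  be used in inner products.\<close>

lemma l2_inner_AE_cong:
  fixes u u' v :: "real^2 \<Rightarrow> real^2"
  assumes \<Omega>: "open \<Omega>" "bounded \<Omega>" and H1: "u \<in> H1_vec \<Omega>" "u' \<in> H1_vec \<Omega>" "v \<in> H1_vec \<Omega>"
    and eq: "AE x in lborel. x \<in> \<Omega> \<longrightarrow> u x = u' x"
  shows "l2_inner \<Omega> u v = l2_inner \<Omega> u' v"
  unfolding l2_inner_eq[OF \<Omega>]
proof (rule integral_cong_AE)
  have si: "square_integrable (lborel_on \<Omega>) u" "square_integrable (lborel_on \<Omega>) u'" "square_integrable (lborel_on \<Omega>) v"
    using H1 H1_vec_square_integrable[OF \<Omega>] by auto
  show "(\<lambda>x. u x \<bullet> v x) \<in> borel_measurable (lborel_on \<Omega>)" "(\<lambda>x. u' x \<bullet> v x) \<in> borel_measurable (lborel_on \<Omega>)"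
    using square_integrable_inner[OF si(1,3)] square_integrable_inner[OF si(2,3)]
    by (auto dest: borel_measurable_integrable)
  have "AE x in lborel_on \<Omega>. u x = u' x" using eq by (simp add: AE_lborel_on domain_measurable[OF \<Omega>])
  then show "AE x in lborel_on \<Omega>. u x \<bullet> v x = u' x \<bullet> v x" by eventually_elim simp
qed

text \<open>\<open>korn_constant\<close> speaks about nonzero energy. A v of zero energy is
  energy-orthogonal to u by Cauchy-Schwarz, so v + t u has the energy t^2 a(u, u) > 0; Korn's
  inequality for it forces the Dirichlet form of v to vanish as t tends to 0.\<close>

lemma Korn_Dirichlet:
  assumes \<Omega>: "open \<Omega>" "bounded \<Omega>" and \<CC>: "elasticity_tensor \<CC>"
    and H: "linear_subspace H" "H \<subseteq> H1_vec \<Omega>" and K: "korn_constant \<Omega> \<CC> H K"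
    and u: "u \<in> H" "a_form \<Omega> \<CC> u u > 0" and v: "v \<in> H"
  shows "Dirichlet_form \<Omega> v v \<le> K\<^sup>2 * a_form \<Omega> \<CC> v v"
proof -
  note a = semi_inner_subset[OF a_form_semi_inner[OF \<Omega> \<CC>] H(2)]
  note D = semi_inner_subset[OF Dirichlet_form_semi_inner[OF \<Omega>] H(2)]
  have regular: "Dirichlet_form \<Omega> w w \<le> K\<^sup>2 * a_form \<Omega> \<CC> w w" if w: "w \<in> H" "a_form \<Omega> \<CC> w w > 0" for w
  proof -
    have "energy_norm \<Omega> \<CC> w \<noteq> 0" using w(2) by (simp add: energy_norm_def)
    then have "l2_norm \<Omega> (weak_jacobian \<Omega> w) \<le> K * energy_norm \<Omega> \<CC> w"
      using K w(1) by (simp add: korn_constant_def)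
    then have "(l2_norm \<Omega> (weak_jacobian \<Omega> w))\<^sup>2 \<le> (K * energy_norm \<Omega> \<CC> w)\<^sup>2"
      by (intro power_mono) (simp_all add: l2_norm_eq domain_measurable[OF \<Omega>])
    then show ?thesis using w(2) by (simp add: Dirichlet_form_eq[OF \<Omega>] energy_norm_def power_mult_distrib)
  qed
  show ?thesis
  proof (cases "a_form \<Omega> \<CC> v v = 0")
    case False
    then show ?thesis using regular[OF v] form_nonneg[OF H(1) a v] by simp
  next
    case True
    have "(a_form \<Omega> \<CC> v u)\<^sup>2 \<le> 0" using form_Cauchy_Schwarz[OF H(1) a v u(1)] True by simp
    then have cross: "a_form \<Omega> \<CC> v u = 0" by simp
    let ?w = "\<lambda>t x. v x + t *\<^sub>R u x"
    have aw: "a_form \<Omega> \<CC> (?w t) (?w t) = t\<^sup>2 * a_form \<Omega> \<CC> u u" for t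
      using form_expand[OF H(1) a v u(1), of t] True cross by simp
    have bound: "Dirichlet_form \<Omega> v v + 2 * t * Dirichlet_form \<Omega> v u + t\<^sup>2 * Dirichlet_form \<Omega> u u \<le>
        K\<^sup>2 * (t\<^sup>2 * a_form \<Omega> \<CC> u u)" if "t \<noteq> 0" for t
      using regular[OF subspace_comb[OF H(1) v u(1)], of t] form_expand[OF H(1) D v u(1), of t] aw[of t] u(2) that
      by simp
    have "Dirichlet_form \<Omega> v v \<le> 0"
    proof (rule le_zero_of_scaled_bounds)
      fix s :: real assume s: "s > 0"
      \<comment> \<open>Adding the bounds for t and -t removes the cross term and leaves a multiple
        of t^2 = s.\<close>
      define t where "t = sqrt s"
      have t: "t \<noteq> 0" "t\<^sup>2 = s" using s by (auto simp: t_def)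
      show "Dirichlet_form \<Omega> v v \<le> s * (K\<^sup>2 * a_form \<Omega> \<CC> u u - Dirichlet_form \<Omega> u u)"
        using bound[of t] bound[of "- t"] t by (simp add: algebra_simps)
    qed
    then show ?thesis using True by simp
  qed
qed

text \<open>Korn's inequality makes a bound on the energy a bound on the full gradient.\<close>

lemma H_space_compactly_embedded:
  assumes \<Omega>: "open \<Omega>" "bounded \<Omega>" "lipschitz_boundary \<Omega>" and \<T>: "conforming_triangulation \<Omega> \<T>"
    and Korn: "\<And>v. v \<in> H \<Longrightarrow> Dirichlet_form \<Omega> v v \<le> K * a v v" and K: "K \<ge> 0" and H: "H \<subseteq> H1_vec \<Omega>"
  shows "compactly_embedded H a (l2_inner \<Omega>)"
  unfolding compactly_embedded_def
proof (intro allI impI)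
  fix v :: "nat \<Rightarrow> real^2 \<Rightarrow> real^2" and C :: real
  assume v: "\<forall>n. v n \<in> H \<and> a (v n) (v n) \<le> C \<and> l2_inner \<Omega> (v n) (v n) \<le> C"
  have "l2_inner \<Omega> (v n) (v n) + Dirichlet_form \<Omega> (v n) (v n) \<le> C + K * C" for n
  proof -
    have "v n \<in> H" "a (v n) (v n) \<le> C" "l2_inner \<Omega> (v n) (v n) \<le> C" using v by auto
    with Korn[of "v n"] mult_left_mono[OF _ K, of "a (v n) (v n)" C] show ?thesis by simp
  qed
  then show "\<exists>r. strict_mono r \<and> form_Cauchy (l2_inner \<Omega>) (\<lambda>n. v (r n))"
    using v H by (intro H1_vec_compact[OF \<Omega> \<T>, where C = "C + K * C"]) auto
qed

text \<open>By Korn's inequality a Cauchy sequence in energy is Cauchy for the full gradient. Its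
  H^1 limit keeps the boundary conditions by \<open>H_space_closed\<close> and is a limit in energy
  by \<open>a_form_le_Dirichlet\<close>.\<close>

lemma H_space_complete:
  assumes \<Omega>: "open \<Omega>" "bounded \<Omega>" and \<CC>: "elasticity_tensor \<CC>"
    and H: "H = H_space \<Omega> \<Gamma>D \<Gamma>g" "linear_subspace H"
    and Korn: "\<And>v. v \<in> H \<Longrightarrow> Dirichlet_form \<Omega> v v \<le> K * a_form \<Omega> \<CC> v v" and K: "K \<ge> 0"
  shows "complete_in_forms H (a_form \<Omega> \<CC>) (l2_inner \<Omega>)"
  unfolding complete_in_forms_def
proof (intro allI impI)
  fix v :: "nat \<Rightarrow> real^2 \<Rightarrow> real^2"
  assume v: "(\<forall>n. v n \<in> H) \<and> form_Cauchy (a_form \<Omega> \<CC>) v \<and> form_Cauchy (l2_inner \<Omega>) v"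
  have HH1: "H \<subseteq> H1_vec \<Omega>" unfolding H(1) by (rule H_space_subset_H1[OF \<Omega>])
  have vH: "v n \<in> H" "v n \<in> H1_vec \<Omega>" for n using v HH1 by auto
  have d: "(\<lambda>x. v i x - v k x) \<in> H" for i k by (rule subspace_diff[OF H(2) vH(1) vH(1)])
  have "form_Cauchy (Dirichlet_form \<Omega>) v" unfolding form_Cauchy_def
  proof (intro allI impI)
    fix \<epsilon> :: real assume \<epsilon>: "\<epsilon> > 0"
    then have "\<epsilon> / (K + 1) > 0" using K by simp
    then obtain N where N: "\<And>i k. i \<ge> N \<Longrightarrow> k \<ge> N \<Longrightarrow> a_form \<Omega> \<CC> (\<lambda>x. v i x - v k x) (\<lambda>x. v i x - v k x) < \<epsilon> / (K + 1)"
      using v unfolding form_Cauchy_def by meson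
    have "Dirichlet_form \<Omega> (\<lambda>x. v i x - v k x) (\<lambda>x. v i x - v k x) < \<epsilon>" if "i \<ge> N" "k \<ge> N" for i k
    proof -
      have "Dirichlet_form \<Omega> (\<lambda>x. v i x - v k x) (\<lambda>x. v i x - v k x) \<le> K * a_form \<Omega> \<CC> (\<lambda>x. v i x - v k x) (\<lambda>x. v i x - v k x)"
        by (rule Korn[OF d])
      also have "\<dots> \<le> K * (\<epsilon> / (K + 1))" using N[OF that] K by (intro mult_left_mono) auto
      also have "\<dots> < \<epsilon>" using K \<epsilon> by (simp add: field_simps)
      finally show ?thesis .
    qed
    then show "\<exists>N. \<forall>i\<ge>N. \<forall>k\<ge>N. Dirichlet_form \<Omega> (\<lambda>x. v i x - v k x) (\<lambda>x. v i x - v k x) < \<epsilon>" by blast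
  qed
  then obtain u where u: "u \<in> H1_vec \<Omega>" "form_converges (l2_inner \<Omega>) v u" "form_converges (Dirichlet_form \<Omega>) v u"
    using H1_vec_complete[of \<Omega> v, OF \<Omega> vH(2)] v by blast
  have uH: "u \<in> H" unfolding H(1)
    by (rule H_space_closed[OF \<Omega> _ u]) (use vH(1) H(1) in simp)
  obtain C where C: "C \<ge> 0" "\<And>v. v \<in> H1_vec \<Omega> \<Longrightarrow> a_form \<Omega> \<CC> v v \<le> C * Dirichlet_form \<Omega> v v"
    using a_form_le_Dirichlet[OF \<Omega> \<CC>] by blast
  have dH1: "(\<lambda>x. v n x - u x) \<in> H1_vec \<Omega>" for n by (rule subspace_diff[OF H1_vec_subspace[OF \<Omega>] vH(2) u(1)])
  have "form_converges (a_form \<Omega> \<CC>) v u" unfolding form_converges_def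
  proof (rule tendsto_sandwich[OF _ _ tendsto_const])
    show "\<forall>\<^sub>F n in sequentially. 0 \<le> a_form \<Omega> \<CC> (\<lambda>x. v n x - u x) (\<lambda>x. v n x - u x)"
      using form_nonneg[OF H1_vec_subspace[OF \<Omega>] a_form_semi_inner[OF \<Omega> \<CC>] dH1] by simp
    show "\<forall>\<^sub>F n in sequentially. a_form \<Omega> \<CC> (\<lambda>x. v n x - u x) (\<lambda>x. v n x - u x) \<le>
        C * Dirichlet_form \<Omega> (\<lambda>x. v n x - u x) (\<lambda>x. v n x - u x)" using C(2)[OF dH1] by simp
    show "(\<lambda>n. C * Dirichlet_form \<Omega> (\<lambda>x. v n x - u x) (\<lambda>x. v n x - u x)) \<longlonglongrightarrow> 0"
      using tendsto_mult[OF tendsto_const u(3)[unfolded form_converges_def], of C] by simp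
  qed
  then show "\<exists>u\<in>H. form_converges (a_form \<Omega> \<CC>) v u \<and> form_converges (l2_inner \<Omega>) v u" using uH u(2) by blast
qed

lemma eigenpair_normalized:
  assumes "open \<Omega>" "bounded \<Omega>" "eigenpair \<Omega> \<CC> V \<kappa> u"
  shows "\<kappa> \<ge> 0" "u \<in> V" "l2_inner \<Omega> u u = 1" "v \<in> V \<Longrightarrow> a_form \<Omega> \<CC> u v = \<kappa> * l2_inner \<Omega> u v"
  using assms(3) l2_inner_self[OF assms(1,2), of u] by (auto simp: eigenpair_def)

text \<open>The first j eigenfunctions in W are the trial vectors of
  \<open>minmax_principle\<close>. They lie in H, their equation makes them orthogonal in the energy
  as well, and their energies are at most the last eigenvalue \<kappa>'.\<close>

lemma eigenvalue_number_mono: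
  assumes \<Omega>: "open \<Omega>" "bounded \<Omega>" and \<CC>: "elasticity_tensor \<CC>"
    and H: "linear_subspace H" "H \<subseteq> H1_vec \<Omega>" and W: "W \<subseteq> H"
    and compact: "compactly_embedded H (a_form \<Omega> \<CC>) (l2_inner \<Omega>)"
    and complete: "complete_in_forms H (a_form \<Omega> \<CC>) (l2_inner \<Omega>)"
    and \<kappa>: "eigenvalue_number \<Omega> \<CC> H j \<kappa>" and \<kappa>': "eigenvalue_number \<Omega> \<CC> W j \<kappa>'"
  shows "\<kappa> \<le> \<kappa>'"
proof -
  note a = semi_inner_subset[OF a_form_semi_inner[OF \<Omega> \<CC>] H(2)]
  note m = semi_inner_subset[OF l2_inner_semi_inner[OF \<Omega>] H(2)]
  note normalized = eigenpair_normalized[OF \<Omega>]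
  obtain \<mu> w where w: "\<mu> j = \<kappa>" "\<forall>i\<in>{1..j}. eigenpair \<Omega> \<CC> H (\<mu> i) (w i)"
      "\<forall>i\<in>{1..j}. \<forall>l\<in>{1..j}. i < l \<longrightarrow> \<mu> i \<le> \<mu> l \<and> l2_inner \<Omega> (w i) (w l) = 0"
      "\<forall>\<theta> v. eigenpair \<Omega> \<CC> H \<theta> v \<and> \<theta> < \<kappa> \<longrightarrow>
        (\<exists>c. AE x in lborel. x \<in> \<Omega> \<longrightarrow> v x = (\<Sum>i | i \<in> {1..j} \<and> \<mu> i = \<theta>. c i *\<^sub>R w i x))"
    using \<kappa> unfolding eigenvalue_number_def by (elim conjE exE) (rule that; assumption)
  obtain \<nu> z where z: "\<nu> j = \<kappa>'" "\<forall>i\<in>{1..j}. eigenpair \<Omega> \<CC> W (\<nu> i) (z i)"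
      "\<forall>i\<in>{1..j}. \<forall>l\<in>{1..j}. i < l \<longrightarrow> \<nu> i \<le> \<nu> l \<and> l2_inner \<Omega> (z i) (z l) = 0"
    using \<kappa>' unfolding eigenvalue_number_def by (elim conjE exE) (rule that; assumption)
  have j: "j \<ge> 1" using \<kappa> by (simp add: eigenvalue_number_def)
  note w_pair = w(2)[rule_format] and w_orth = w(3)[rule_format, THEN conjunct2]
  note z_pair = z(2)[rule_format] and z_incr = z(3)[rule_format, THEN conjunct1]
    and z_orth_less = z(3)[rule_format, THEN conjunct2]
  have wH: "w i \<in> H" if "i \<in> {1..j}" for i using normalized(2)[OF w_pair[OF that]] .
  have zW: "z i \<in> W" "z i \<in> H" if "i \<in> {1..j}" for i using normalized(2)[OF z_pair[OF that]] W by auto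
  have z_orth: "l2_inner \<Omega> (z i) (z l) = 0" if "i \<in> {1..j}" "l \<in> {1..j}" "i \<noteq> l" for i l
    using z_orth_less[of i l] z_orth_less[of l i] form_sym[OF H(1) m zW(2)[OF that(1)] zW(2)[OF that(2)]] that
    by (cases "i < l") auto
  show ?thesis
  proof (rule minmax_principle[OF H(1) a m compact complete, of j w \<mu> \<kappa> z])
    show "w i \<in> H \<and> l2_inner \<Omega> (w i) (w i) = 1 \<and> (\<forall>x\<in>H. a_form \<Omega> \<CC> (w i) x = \<mu> i * l2_inner \<Omega> (w i) x)"
      if "i \<in> {1..j}" for i using normalized(2-4)[OF w_pair[OF that]] by blast
    show "l2_inner \<Omega> (w i) (w l) = 0" if "i \<in> {1..j}" "l \<in> {1..j}" "i \<noteq> l" for i l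
      using w_orth[of i l] w_orth[of l i] form_sym[OF H(1) m wH[OF that(1)] wH[OF that(2)]] that
      by (cases "i < l") auto
    show "\<exists>c. \<forall>x\<in>H. l2_inner \<Omega> v x = (\<Sum>i | i \<in> {1..j} \<and> \<mu> i = \<theta>. c i * l2_inner \<Omega> (w i) x)"
      if v: "0 \<le> \<theta>" "\<theta> < \<kappa>" "v \<in> H" "l2_inner \<Omega> v v = 1" "\<forall>x\<in>H. a_form \<Omega> \<CC> v x = \<theta> * l2_inner \<Omega> v x" for \<theta> v
    proof -
      have "(l2_norm \<Omega> v)\<^sup>2 = 1" using v(4) l2_inner_self[OF \<Omega>, of v] by simp
      moreover have "l2_norm \<Omega> v \<ge> 0" by (simp add: l2_norm_eq domain_measurable[OF \<Omega>])
      ultimately have "l2_norm \<Omega> v = 1" unfolding power2_eq_1_iff by linarith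
      then have "eigenpair \<Omega> \<CC> H \<theta> v" using v by (simp add: eigenpair_def)
      then have "\<exists>c. AE x in lborel. x \<in> \<Omega> \<longrightarrow> v x = (\<Sum>i | i \<in> {1..j} \<and> \<mu> i = \<theta>. c i *\<^sub>R w i x)"
        using w(4)[rule_format, OF conjI[OF _ v(2)]] by simp
      then obtain c where
        c: "AE x in lborel. x \<in> \<Omega> \<longrightarrow> v x = (\<Sum>i | i \<in> {1..j} \<and> \<mu> i = \<theta>. c i *\<^sub>R w i x)" by blast
      let ?s = "\<lambda>x. \<Sum>i | i \<in> {1..j} \<and> \<mu> i = \<theta>. c i *\<^sub>R w i x"
      have s: "?s \<in> H" by (rule subspace_sum[OF H(1)]) (use wH in auto)
      \<comment> \<open>\<open>minmax_principle\<close> uses the expansion of v only through its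
        inner products with members of H.\<close>
      have "l2_inner \<Omega> v x = (\<Sum>i | i \<in> {1..j} \<and> \<mu> i = \<theta>. c i * l2_inner \<Omega> (w i) x)" if x: "x \<in> H" for x
      proof -
        have "l2_inner \<Omega> v x = l2_inner \<Omega> ?s x"
          by (rule l2_inner_AE_cong[OF \<Omega> _ _ _ c]) (use v(3) s x H(2) in auto)
        also have "\<dots> = (\<Sum>i | i \<in> {1..j} \<and> \<mu> i = \<theta>. c i * l2_inner \<Omega> (w i) x)"
          by (rule form_sum_left[OF H(1) m _ x]) (use wH in auto)
        finally show ?thesis .
      qed
      then show ?thesis by blast
    qed
    show "z i \<in> H \<and> l2_inner \<Omega> (z i) (z i) = 1 \<and> a_form \<Omega> \<CC> (z i) (z i) \<le> \<kappa>'" if i: "i \<in> {1..j}" for i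
    proof -
      have "\<nu> i \<le> \<kappa>'" using z(1) z_incr[of i j] i j by (cases "i = j") auto
      then show ?thesis using normalized(3)[OF z_pair[OF i]] normalized(4)[OF z_pair[OF i] zW(1)[OF i]] zW(2)[OF i] by simp
    qed
    show "l2_inner \<Omega> (z i) (z l) = 0 \<and> a_form \<Omega> \<CC> (z i) (z l) = 0" if "i \<in> {1..j}" "l \<in> {1..j}" "i \<noteq> l" for i l
      using z_orth[OF that] normalized(4)[OF z_pair[OF that(1)] zW(1)[OF that(2)]] by simp
  qed (use w(1) j in auto)
qed

section \<open>From local estimators to the residual\<close>

text \<open>A local supremum may be infinite with either sign. Both signs square to \<infinity> and
  make the sum infinite, so outside this case the computation is one with real numbers.\<close>

lemma ereal_sqrt_sum_sq_cases:
  fixes f :: "'a \<Rightarrow> ereal"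
  assumes "finite A"
  shows "ereal_sqrt (\<Sum>z\<in>A. (f z)\<^sup>2) = \<infinity> \<or>
    (\<exists>r. (\<forall>z\<in>A. f z = ereal (r z)) \<and> ereal_sqrt (\<Sum>z\<in>A. (f z)\<^sup>2) = ereal (sqrt (\<Sum>z\<in>A. (r z)\<^sup>2)))"
proof (cases "\<exists>z\<in>A. \<bar>f z\<bar> = \<infinity>")
  case True
  then obtain z where z: "z \<in> A" "\<bar>f z\<bar> = \<infinity>" by (rule bexE)
  have inf: "x * x = \<infinity>" if "\<bar>x\<bar> = \<infinity>" for x :: ereal using that by (cases x) simp_all
  have "(\<Sum>z\<in>A. (f z)\<^sup>2) = \<infinity>"
    unfolding sum_Pinfty power2_eq_square using assms z(1) inf[OF z(2)] by (intro conjI bexI)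
  then show ?thesis by (simp add: ereal_sqrt_def)
next
  case False
  define r where "r z = real_of_ereal (f z)" for z
  have r: "f z = ereal (r z)" if "z \<in> A" for z using False that by (auto simp: r_def ereal_real)
  then have "(\<Sum>z\<in>A. (f z)\<^sup>2) = (\<Sum>z\<in>A. ereal ((r z)\<^sup>2))" by (intro sum.cong) (auto simp: power2_eq_square)
  then have "(\<Sum>z\<in>A. (f z)\<^sup>2) = ereal (\<Sum>z\<in>A. (r z)\<^sup>2)" by simp
  then show ?thesis using r by (auto simp: ereal_sqrt_def)
qed

text \<open>The hat vanishes on \<Omega> outside its patch, so the integral may run over \<Omega>;
  there its square is the quadratic form of a semi-inner product.\<close>

lemma weighted_patch_norm_eq:
  assumes \<Omega>: "open \<Omega>" "bounded \<Omega>" and \<T>: "conforming_triangulation \<Omega> \<T>"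
  shows "weighted_patch_norm \<Omega> \<T> z v = sqrt (gradient_form \<Omega> (hat \<T> z) (\<lambda>A. A) (\<lambda>A. A) v v)"
proof -
  have "indicator (patch \<Omega> \<T> z) x *\<^sub>R (norm (sqrt (hat \<T> z x) *\<^sub>R weak_jacobian \<Omega> v x))\<^sup>2 =
      indicator \<Omega> x *\<^sub>R (hat \<T> z x * (weak_jacobian \<Omega> v x \<bullet> weak_jacobian \<Omega> v x))" for x
  proof (cases "x \<in> \<Omega>")
    case True
    then have "hat \<T> z x \<ge> 0" using hat_bounds(1)[OF \<T>] closure_subset by blast
    then show ?thesis using True
      by (simp add: patch_def power_mult_distrib power2_norm_eq_inner split: split_indicator)
  qed (simp add: patch_def)
  then show ?thesis
    by (simp add: weighted_patch_norm_def l2_norm_def set_lebesgue_integral_def gradient_form_def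
        integral_restrict_space domain_measurable[OF \<Omega>])
qed

text \<open>If the weighted norm of \<open>v\<close> on a patch vanishes, the supremum says nothing about \<open>v\<close>
  directly. It is then applied to \<open>v + t y\<close> for a \<open>y\<close> with nonvanishing weighted norm and
  \<open>t\<close> tends to \<open>0\<close>. If there is no such \<open>y\<close>, the supremum is \<open>-\<infinity>\<close>, whose square is
  \<open>\<infinity>\<close>.\<close>

lemma residual_le_estimator:
  assumes \<Omega>: "open \<Omega>" "bounded \<Omega>" and \<T>: "conforming_triangulation \<Omega> \<T>" and \<CC>: "elasticity_tensor \<CC>"
    and H: "linear_subspace H" "H \<subseteq> H1_vec \<Omega>" and uh: "u\<^sub>h \<in> H1_vec \<Omega>"
    and Res: "Res = residual \<Omega> \<CC> \<kappa>\<^sub>h u\<^sub>h"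
  shows "estimator \<Omega> H \<T> Res = \<infinity> \<or>
    (\<exists>h\<ge>0. estimator \<Omega> H \<T> Res = ereal h \<and> (\<forall>v\<in>H. Res v \<le> h * l2_norm \<Omega> (weak_jacobian \<Omega> v)))"
proof -
  note V = H1_vec_subspace[OF \<Omega>]
  note a = a_form_semi_inner[OF \<Omega> \<CC>] and m = l2_inner_semi_inner[OF \<Omega>]
  note meas\<Omega> = domain_measurable[OF \<Omega>]
  let ?N = "weighted_patch_norm \<Omega> \<T>" and ?w = "\<lambda>z. gradient_form \<Omega> (hat \<T> z) (\<lambda>A. A) (\<lambda>A. A)"
  note norm_eq = weighted_patch_norm_eq[OF \<Omega> \<T>]
  have hat01: "0 \<le> hat \<T> z x \<and> hat \<T> z x \<le> 1" if "x \<in> \<Omega>" for z x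
    using hat_bounds[OF \<T>, of x z] that closure_subset by blast
  have w: "semi_inner (H1_vec \<Omega>) (?w z)" for z
    by (rule gradient_form_semi_inner[OF \<Omega> _ _ _ _ hat_measurable[OF \<T> \<Omega>(1)] hat01])
       (auto simp: linear_iff inner_commute)
  have HV: "v \<in> H1_vec \<Omega>" if "v \<in> H" for v using that H(2) by blast
  have hatV: "(\<lambda>x. hat \<T> z x *\<^sub>R v x) \<in> H1_vec \<Omega>" if "v \<in> H1_vec \<Omega>" for z v
    using that h1_space_hat_mult[OF \<T> \<Omega>] by (simp add: H1_vec_def)
  have Res_comb: "Res (\<lambda>x. v x + t *\<^sub>R y x) = Res v + t * Res y" if "v \<in> H1_vec \<Omega>" "y \<in> H1_vec \<Omega>" for v y t
    unfolding Res residual_def form_comb_right[OF V a that uh] form_comb_right[OF V m that uh]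
    by (simp add: algebra_simps)
  have Res_partition: "Res v = (\<Sum>z\<in>nodes \<T>. Res (\<lambda>x. hat \<T> z x *\<^sub>R v x))" if v: "v \<in> H1_vec \<Omega>" for v
  proof -
    define s where "s = (\<lambda>x. \<Sum>z\<in>nodes \<T>. 1 *\<^sub>R (hat \<T> z x *\<^sub>R v x))"
    have sV: "s \<in> H1_vec \<Omega>" unfolding s_def by (rule subspace_sum[OF V hatV[OF v]])
    \<comment> \<open>The hats sum to 1 on \<Omega> but vanish off its closure, so s and v need not
      agree there. The congruence lemmas below transfer both forms from v to s.\<close>
    have sv: "s x = v x" if "x \<in> \<Omega>" for x
    proof -
      have "x \<in> closure \<Omega>" using that closure_subset by blast
      from hat_partition_of_unity[OF \<T> this] show ?thesis
        unfolding s_def scaleR_one scaleR_sum_left[symmetric] by simp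
    qed
    have B: "B u\<^sub>h s = (\<Sum>z\<in>nodes \<T>. B u\<^sub>h (\<lambda>x. hat \<T> z x *\<^sub>R v x))" if "semi_inner (H1_vec \<Omega>) B" for B
    proof -
      have "B u\<^sub>h s = B s u\<^sub>h" by (rule form_sym[OF V that uh sV])
      also have "\<dots> = (\<Sum>z\<in>nodes \<T>. 1 * B (\<lambda>x. hat \<T> z x *\<^sub>R v x) u\<^sub>h)"
        unfolding s_def by (rule form_sum_left[OF V that hatV[OF v] uh])
      also have "\<dots> = (\<Sum>z\<in>nodes \<T>. B u\<^sub>h (\<lambda>x. hat \<T> z x *\<^sub>R v x))"
        using form_sym[OF V that uh hatV[OF v]] by simp
      finally show ?thesis .
    qed
    have "l2_inner \<Omega> u\<^sub>h v = l2_inner \<Omega> u\<^sub>h s"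
      using l2_inner_AE_cong[OF \<Omega> v sV uh] sv form_sym[OF V m uh v] form_sym[OF V m uh sV] by simp
    moreover have "a_form \<Omega> \<CC> u\<^sub>h v = a_form \<Omega> \<CC> u\<^sub>h s"
      unfolding a_form_def strain_def using weak_jacobian_cong[OF meas\<Omega> sv] by simp
    ultimately show ?thesis
      unfolding Res residual_def using B[OF a] B[OF m] by (simp add: sum_subtractf sum_distrib_left)
  qed
  have weights: "(\<Sum>z\<in>nodes \<T>. (?N z v)\<^sup>2) = (l2_norm \<Omega> (weak_jacobian \<Omega> v))\<^sup>2" if v: "v \<in> H1_vec \<Omega>" for v
  proof -
    let ?J = "weak_jacobian \<Omega> v"
    have ids: "linear (\<lambda>A::real^2^2. A)" by (simp add: linear_iff)
    have int: "integrable (lborel_on \<Omega>) (\<lambda>x. hat \<T> z x * (?J x \<bullet> ?J x))" for z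
      by (rule gradient_form_integrable[OF \<Omega> v v ids ids hat_measurable[OF \<T> \<Omega>(1)] hat01])
    have "(\<Sum>z\<in>nodes \<T>. (?N z v)\<^sup>2) = (\<Sum>z\<in>nodes \<T>. \<integral>x. hat \<T> z x * (?J x \<bullet> ?J x) \<partial>lborel_on \<Omega>)"
      using form_nonneg[OF V w v] unfolding norm_eq by (simp add: gradient_form_def)
    also have "\<dots> = (\<integral>x. (\<Sum>z\<in>nodes \<T>. hat \<T> z x) * (?J x \<bullet> ?J x) \<partial>lborel_on \<Omega>)"
      using int by (simp add: sum_distrib_right)
    also have "\<dots> = (\<integral>x. (norm (?J x))\<^sup>2 \<partial>lborel_on \<Omega>)"
    proof (rule Bochner_Integration.integral_cong[OF refl])
      fix x assume "x \<in> space (lborel_on \<Omega>)"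
      then have "x \<in> closure \<Omega>" using closure_subset by (auto simp: space_restrict_space)
      then show "(\<Sum>z\<in>nodes \<T>. hat \<T> z x) * (?J x \<bullet> ?J x) = (norm (?J x))\<^sup>2"
        by (simp add: hat_partition_of_unity[OF \<T>] power2_norm_eq_inner)
    qed
    also have "\<dots> = (l2_norm \<Omega> ?J)\<^sup>2" by (simp add: l2_norm_sq meas\<Omega>)
    finally show ?thesis .
  qed
  consider "estimator \<Omega> H \<T> Res = \<infinity>" |
    \<rho> where "\<And>z. z \<in> nodes \<T> \<Longrightarrow> local_estimator \<Omega> H \<T> Res z = ereal (\<rho> z)"
      "estimator \<Omega> H \<T> Res = ereal (sqrt (\<Sum>z\<in>nodes \<T>. (\<rho> z)\<^sup>2))"
    using ereal_sqrt_sum_sq_cases[OF nodes_finite[OF \<T>], of "local_estimator \<Omega> H \<T> Res"]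
    unfolding estimator_def by blast
  then show ?thesis
  proof cases
    case 2
    have regular: "Res (\<lambda>x. hat \<T> z x *\<^sub>R v x) \<le> \<rho> z * ?N z v" if z: "z \<in> nodes \<T>" and v: "v \<in> H" "?N z v \<noteq> 0" for z v
    proof -
      have "ereal (Res (\<lambda>x. hat \<T> z x *\<^sub>R v x) / ?N z v) \<le> local_estimator \<Omega> H \<T> Res z"
        unfolding local_estimator_def by (rule SUP_upper) (use v in simp)
      then have le: "Res (\<lambda>x. hat \<T> z x *\<^sub>R v x) / ?N z v \<le> \<rho> z" using 2(1)[OF z] by simp
      have "?N z v > 0" using v(2) form_nonneg[OF V w HV[OF v(1)], of z] unfolding norm_eq by simp
      then show ?thesis using le by (simp add: pos_divide_le_eq)
    qed
    have local: "Res (\<lambda>x. hat \<T> z x *\<^sub>R v x) \<le> \<rho> z * ?N z v" if z: "z \<in> nodes \<T>" and v: "v \<in> H" for z v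
    proof (cases "?N z v = 0")
      case False
      then show ?thesis using regular[OF z v] by simp
    next
      case True
      have "{v \<in> H. ?N z v \<noteq> 0} \<noteq> {}"
      proof
        assume empty: "{v \<in> H. ?N z v \<noteq> 0} = {}"
        have "local_estimator \<Omega> H \<T> Res z = - \<infinity>"
          unfolding local_estimator_def empty by (simp add: bot_ereal_def)
        then show False using 2(1)[OF z] by simp
      qed
      then obtain y where y: "y \<in> H" "?N z y \<noteq> 0" by blast
      have wv: "?w z v v = 0" using True form_nonneg[OF V w HV[OF v], of z] unfolding norm_eq by simp
      have "(?w z v y)\<^sup>2 \<le> 0" using form_Cauchy_Schwarz[OF V w HV[OF v] HV[OF y(1)], of z] wv by simp
      then have cross: "?w z v y = 0" by simp
      have "Res (\<lambda>x. hat \<T> z x *\<^sub>R v x) \<le> 0"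
      proof (rule le_zero_of_scaled_bounds)
        fix t :: real assume t: "t > 0"
        let ?v = "\<lambda>x. v x + t *\<^sub>R y x"
        have "?N z ?v = t * ?N z y"
          using t unfolding norm_eq form_expand[OF V w HV[OF v] HV[OF y(1)]] wv cross
          by (simp add: real_sqrt_mult)
        then have "Res (\<lambda>x. hat \<T> z x *\<^sub>R ?v x) \<le> \<rho> z * (t * ?N z y)"
          using regular[OF z subspace_comb[OF H(1) v y(1)], of t] y(2) t by simp
        moreover have "(\<lambda>x. hat \<T> z x *\<^sub>R ?v x) = (\<lambda>x. hat \<T> z x *\<^sub>R v x + t *\<^sub>R (hat \<T> z x *\<^sub>R y x))"
          by (simp add: fun_eq_iff scaleR_add_right mult.commute)
        ultimately show "Res (\<lambda>x. hat \<T> z x *\<^sub>R v x) \<le> t * (\<rho> z * ?N z y - Res (\<lambda>x. hat \<T> z x *\<^sub>R y x))"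
          using Res_comb[OF hatV[OF HV[OF v]] hatV[OF HV[OF y(1)]], of z t z] by (simp add: algebra_simps)
      qed
      then show ?thesis using True by simp
    qed
    have "Res v \<le> sqrt (\<Sum>z\<in>nodes \<T>. (\<rho> z)\<^sup>2) * l2_norm \<Omega> (weak_jacobian \<Omega> v)" if v: "v \<in> H" for v
    proof -
      have "Res v \<le> (\<Sum>z\<in>nodes \<T>. \<rho> z * ?N z v)"
        unfolding Res_partition[OF HV[OF v]] by (intro sum_mono local v)
      also have "\<dots> \<le> sqrt ((\<Sum>z\<in>nodes \<T>. (\<rho> z)\<^sup>2) * (\<Sum>z\<in>nodes \<T>. (?N z v)\<^sup>2))"
        by (intro real_le_rsqrt Cauchy_Schwarz_ineq_sum)
      also have "\<dots> = sqrt (\<Sum>z\<in>nodes \<T>. (\<rho> z)\<^sup>2) * l2_norm \<Omega> (weak_jacobian \<Omega> v)"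
        unfolding weights[OF HV[OF v]] by (simp add: real_sqrt_mult l2_norm_eq meas\<Omega>)
      finally show ?thesis .
    qed
    then show ?thesis using 2(2) by (intro disjI2 exI[of _ "sqrt (\<Sum>z\<in>nodes \<T>. (\<rho> z)\<^sup>2)"]) (auto simp: sum_nonneg)
  qed simp
qed

theorem theorem3p4:
  fixes \<Omega> \<Gamma>D \<Gamma>g :: "(real^2) set"
    and \<CC> :: "real^2^2 \<Rightarrow> real^2^2"
    and \<T> :: "(real^2) set set"
    and H H\<^sub>h :: "(real^2 \<Rightarrow> real^2) set"
    and \<sigma> \<rho> \<kappa> \<kappa>\<^sub>h :: real
    and j k :: nat
    and u u\<^sub>h e :: "real^2 \<Rightarrow> real^2"
    and Res :: "(real^2 \<Rightarrow> real^2) \<Rightarrow> real"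
    and \<eta> :: ereal
  assumes "polygonal_lipschitz_domain \<Omega>"
    and "boundary_parts \<Omega> \<Gamma>D \<Gamma>g"
    and "elasticity_tensor \<CC>"
    and "conforming_triangulation \<Omega> \<T>"
    and "resolves_boundary \<Omega> \<Gamma>D \<Gamma>g \<T>"
    and "shape_regular \<sigma> \<T>"
    and "quasi_uniform \<rho> \<T>"
    and "k \<ge> 1"
    and "H = H_space \<Omega> \<Gamma>D \<Gamma>g"
    and "H\<^sub>h = H_discrete \<Omega> \<Gamma>D \<Gamma>g \<T> k"
    and "eigenpair \<Omega> \<CC> H \<kappa> u"
    and "eigenpair \<Omega> \<CC> H\<^sub>h \<kappa>\<^sub>h u\<^sub>h"
    and "eigenvalue_number \<Omega> \<CC> H j \<kappa>"
    and "eigenvalue_number \<Omega> \<CC> H\<^sub>h j \<kappa>\<^sub>h"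
    and "simple_eigenvalue \<Omega> \<CC> H \<kappa>"
    and "\<kappa> > 0"
    and "Res = residual \<Omega> \<CC> \<kappa>\<^sub>h u\<^sub>h"
    and "\<eta> = estimator \<Omega> H \<T> Res"
    and "e = (\<lambda>x. u x - u\<^sub>h x)"
  shows "dual_gradient_norm \<Omega> H Res \<le> ereal (sqrt 3) * \<eta> \<and>
    (\<forall>C_Korn. korn_constant \<Omega> \<CC> H C_Korn \<longrightarrow>
       dual_energy_norm \<Omega> \<CC> H Res \<le> ereal (sqrt 3 * C_Korn) * \<eta> \<and>
       ereal (energy_norm \<Omega> \<CC> e)
         \<le> ereal (sqrt 3 * C_Korn) * \<eta>
           + ereal ((\<kappa> + \<kappa>\<^sub>h) / (2 * sqrt \<kappa>) * l2_norm \<Omega> e))"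
proof -
  have \<Omega>: "open \<Omega>" "bounded \<Omega>" "lipschitz_boundary \<Omega>"
    using \<open>polygonal_lipschitz_domain \<Omega>\<close> by (auto simp: polygonal_lipschitz_domain_def)
  have \<Gamma>: "\<Gamma>D \<subseteq> frontier \<Omega>" "\<Gamma>g \<subseteq> frontier \<Omega>"
    using \<open>boundary_parts \<Omega> \<Gamma>D \<Gamma>g\<close> by (auto simp: boundary_parts_def)
  note \<CC> = \<open>elasticity_tensor \<CC>\<close> and \<T> = \<open>conforming_triangulation \<Omega> \<T>\<close> and H_def = \<open>H = H_space \<Omega> \<Gamma>D \<Gamma>g\<close>
  note u = eigenpair_normalized[OF \<Omega>(1,2) \<open>eigenpair \<Omega> \<CC> H \<kappa> u\<close>]
  note uh = eigenpair_normalized[OF \<Omega>(1,2) \<open>eigenpair \<Omega> \<CC> H\<^sub>h \<kappa>\<^sub>h u\<^sub>h\<close>]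
  have HV: "H \<subseteq> H1_vec \<Omega>" unfolding H_def by (rule H_space_subset_H1[OF \<Omega>(1,2)])
  have HhH: "H\<^sub>h \<subseteq> H" using \<open>H\<^sub>h = H_discrete \<Omega> \<Gamma>D \<Gamma>g \<T> k\<close> H_def by (auto simp: H_discrete_def)
  have H: "linear_subspace H"
    unfolding H_def by (rule H_space_subspace[OF \<Omega>(1,2) \<Gamma>]) (use u(2) H_def in auto)
  have uhH: "u\<^sub>h \<in> H" using uh(2) HhH by blast
  note a = semi_inner_subset[OF a_form_semi_inner[OF \<Omega>(1,2) \<CC>] HV]
  note m = semi_inner_subset[OF l2_inner_semi_inner[OF \<Omega>(1,2)] HV]
  have s3: "1 \<le> sqrt 3" by simp
  consider "\<eta> = \<infinity>" | h where "h \<ge> 0" "\<eta> = ereal h" "\<And>v. v \<in> H \<Longrightarrow> Res v \<le> h * l2_norm \<Omega> (weak_jacobian \<Omega> v)"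
    using residual_le_estimator[OF \<Omega>(1,2) \<T> \<CC> H HV _ \<open>Res = residual \<Omega> \<CC> \<kappa>\<^sub>h u\<^sub>h\<close>] uhH HV
      \<open>\<eta> = estimator \<Omega> H \<T> Res\<close> by blast
  then show ?thesis
  proof cases
    case 1
    \<comment> \<open>\<open>korn_constant_def\<close> supplies a positive factor, so the products
      with \<infinity> on the right are \<infinity>.\<close>
    then show ?thesis by (auto simp: korn_constant_def)
  next
    case 2
    \<comment> \<open>The sharper bound with the constant 1 is relaxed to the claimed one
      here.\<close>
    have sh: "h \<le> sqrt 3 * h" using mult_right_mono[OF s3 2(1)] by simp
    have D0: "0 \<le> l2_norm \<Omega> (weak_jacobian \<Omega> v)" for v by (simp add: l2_norm_eq domain_measurable[OF \<Omega>(1,2)])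
    have "dual_gradient_norm \<Omega> H Res \<le> ereal (sqrt 3 * h)"
      unfolding dual_gradient_norm_def
    proof (rule SUP_least)
      fix v assume v: "v \<in> {v \<in> H. l2_norm \<Omega> (weak_jacobian \<Omega> v) \<noteq> 0}"
      then have pos: "l2_norm \<Omega> (weak_jacobian \<Omega> v) > 0" using D0[of v] by simp
      then have "Res v / l2_norm \<Omega> (weak_jacobian \<Omega> v) \<le> h" using 2(3)[of v] v by (simp add: pos_divide_le_eq)
      then show "ereal (Res v / l2_norm \<Omega> (weak_jacobian \<Omega> v)) \<le> ereal (sqrt 3 * h)" using sh by simp
    qed
    moreover have "dual_energy_norm \<Omega> \<CC> H Res \<le> ereal (sqrt 3 * K * h) \<and>
        energy_norm \<Omega> \<CC> e \<le> sqrt 3 * K * h + (\<kappa> + \<kappa>\<^sub>h) / (2 * sqrt \<kappa>) * l2_norm \<Omega> e"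
      if K: "korn_constant \<Omega> \<CC> H K" for K
    proof -
      have K0: "K > 0" using K by (simp add: korn_constant_def)
      \<comment> \<open>This positive energy qualifies u as the perturbing vector of
        \<open>Korn_Dirichlet\<close>.\<close>
      have au: "a_form \<Omega> \<CC> u u = \<kappa>" using u(3) u(4)[OF u(2)] by simp
      have Korn: "Dirichlet_form \<Omega> v v \<le> K\<^sup>2 * a_form \<Omega> \<CC> v v" if "v \<in> H" for v
        by (rule Korn_Dirichlet[OF \<Omega>(1,2) \<CC> H HV K u(2) _ that]) (use au \<open>\<kappa> > 0\<close> in simp)
      have compact: "compactly_embedded H (a_form \<Omega> \<CC>) (l2_inner \<Omega>)"
        by (rule H_space_compactly_embedded[where K = "K\<^sup>2", OF \<Omega> \<T> _ _ HV]) (use Korn in auto)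
      have complete: "complete_in_forms H (a_form \<Omega> \<CC>) (l2_inner \<Omega>)"
        by (rule H_space_complete[where K = "K\<^sup>2", OF \<Omega>(1,2) \<CC> H_def H]) (use Korn in auto)
      have "\<kappa> \<le> \<kappa>\<^sub>h"
        by (rule eigenvalue_number_mono[OF \<Omega>(1,2) \<CC> H HV HhH compact complete
              \<open>eigenvalue_number \<Omega> \<CC> H j \<kappa>\<close> \<open>eigenvalue_number \<Omega> \<CC> H\<^sub>h j \<kappa>\<^sub>h\<close>])
      have bound: "Res v \<le> sqrt 3 * K * h * energy_norm \<Omega> \<CC> v" if v: "v \<in> H" for v
      proof -
        have "(l2_norm \<Omega> (weak_jacobian \<Omega> v))\<^sup>2 \<le> (K * energy_norm \<Omega> \<CC> v)\<^sup>2"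
          using Korn[OF v] form_nonneg[OF H a v]
          by (simp add: Dirichlet_form_eq[OF \<Omega>(1,2)] energy_norm_def power_mult_distrib)
        then have le: "l2_norm \<Omega> (weak_jacobian \<Omega> v) \<le> K * energy_norm \<Omega> \<CC> v"
          by (rule power2_le_imp_le) (use K0 form_nonneg[OF H a v] in \<open>simp add: energy_norm_def\<close>)
        have "Res v \<le> h * l2_norm \<Omega> (weak_jacobian \<Omega> v)" by (rule 2(3)[OF v])
        also have "\<dots> \<le> sqrt 3 * h * l2_norm \<Omega> (weak_jacobian \<Omega> v)" by (intro mult_right_mono sh D0)
        also have "\<dots> \<le> sqrt 3 * h * (K * energy_norm \<Omega> \<CC> v)" using 2(1) by (intro mult_left_mono le) auto
        finally show ?thesis by (simp add: mult_ac)
      qed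
      have "dual_energy_norm \<Omega> \<CC> H Res \<le> ereal (sqrt 3 * K * h)"
        unfolding dual_energy_norm_def
      proof (rule SUP_least)
        fix v assume v: "v \<in> {v \<in> H. energy_norm \<Omega> \<CC> v \<noteq> 0}"
        then have "energy_norm \<Omega> \<CC> v > 0" using form_nonneg[OF H a, of v] by (simp add: energy_norm_def)
        then show "ereal (Res v / energy_norm \<Omega> \<CC> v) \<le> ereal (sqrt 3 * K * h)"
          using bound[of v] v by (simp add: pos_divide_le_eq)
      qed
      moreover have "energy_norm \<Omega> \<CC> e \<le> sqrt 3 * K * h + (\<kappa> + \<kappa>\<^sub>h) / (2 * sqrt \<kappa>) * l2_norm \<Omega> e"
      proof -
        \<comment> \<open>The eigenvalue equations and the normalization make both squared norms of
          e and its residual affine functions of this single number.\<close>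
        define s where "s = l2_inner \<Omega> u u\<^sub>h"
        define E where "E = energy_norm \<Omega> \<CC> e"
        define n where "n = l2_norm \<Omega> e"
        have e: "e \<in> H" unfolding \<open>e = (\<lambda>x. u x - u\<^sub>h x)\<close> by (rule subspace_diff[OF H u(2) uhH])
        have E0: "E \<ge> 0" "E\<^sup>2 = a_form \<Omega> \<CC> e e"
          using form_nonneg[OF H a e] by (auto simp: E_def energy_norm_def)
        have n0: "n \<ge> 0" "n\<^sup>2 = l2_inner \<Omega> e e"
          unfolding n_def l2_inner_self[OF \<Omega>(1,2)] by (simp_all add: l2_norm_eq domain_measurable[OF \<Omega>(1,2)])
        have auh: "a_form \<Omega> \<CC> u\<^sub>h u\<^sub>h = \<kappa>\<^sub>h" using uh(3) uh(4)[OF uh(2)] by simp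
        have auuh: "a_form \<Omega> \<CC> u u\<^sub>h = \<kappa> * s" using u(4)[OF uhH] by (simp add: s_def)
        have mee: "n\<^sup>2 = 2 - 2 * s"
          unfolding n0 \<open>e = (\<lambda>x. u x - u\<^sub>h x)\<close> form_diff[OF H m u(2) uhH] s_def using u(3) uh(3) by simp
        have aee: "E\<^sup>2 = \<kappa> + \<kappa>\<^sub>h - 2 * \<kappa> * s"
          unfolding E0 \<open>e = (\<lambda>x. u x - u\<^sub>h x)\<close> form_diff[OF H a u(2) uhH] auuh au auh by simp
        have right: "B u\<^sub>h e = B u u\<^sub>h - B u\<^sub>h u\<^sub>h" if B: "semi_inner H B" for B
          using form_comb_right[OF H B u(2) uhH uhH, of "-1"] form_sym[OF H B u(2) uhH]
          unfolding \<open>e = (\<lambda>x. u x - u\<^sub>h x)\<close> by simp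
        \<comment> \<open>Two equations are combined: the continuous one for u tested with
          \<open>u\<^sub>h\<close>, and the discrete one for \<open>u\<^sub>h\<close> tested with
          itself.\<close>
        have "Res e = (\<kappa>\<^sub>h - \<kappa>) * s"
          unfolding \<open>Res = residual \<Omega> \<CC> \<kappa>\<^sub>h u\<^sub>h\<close> residual_def right[OF a] right[OF m] auuh auh uh(3) s_def
          by (simp add: algebra_simps)
        then have split: "E\<^sup>2 = Res e + (\<kappa> + \<kappa>\<^sub>h) / 2 * n\<^sup>2" unfolding aee mee by (simp add: field_simps)
        have "\<kappa> * n\<^sup>2 \<le> E\<^sup>2" unfolding aee mee using \<open>\<kappa> \<le> \<kappa>\<^sub>h\<close> by (simp add: algebra_simps)
        then have "sqrt (\<kappa> * n\<^sup>2) \<le> sqrt (E\<^sup>2)" by (rule real_sqrt_le_mono)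
        then have nE: "sqrt \<kappa> * n \<le> E" using E0(1) n0(1) by (simp add: real_sqrt_mult)
        \<comment> \<open>The second term of the claimed bound. The product of n with itself is
          split so that \<open>nE\<close> can replace one factor by E.\<close>
        define c where "c = (\<kappa> + \<kappa>\<^sub>h) / (2 * sqrt \<kappa>) * n"
        have c0: "c \<ge> 0" using \<open>\<kappa> > 0\<close> uh(1) n0(1) by (simp add: c_def)
        have "(\<kappa> + \<kappa>\<^sub>h) / 2 * n\<^sup>2 = c * (sqrt \<kappa> * n)"
          using \<open>\<kappa> > 0\<close> by (simp add: c_def field_simps power2_eq_square)
        also have "\<dots> \<le> c * E" by (rule mult_left_mono[OF nE c0])
        finally have "E\<^sup>2 \<le> (sqrt 3 * K * h + c) * E"
          using split bound[OF e] unfolding E_def[symmetric] distrib_right by linarith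
        then have "E * E \<le> (sqrt 3 * K * h + c) * E" by (simp add: power2_eq_square)
        moreover have "0 \<le> sqrt 3 * K * h + c" using K0 2(1) c0 by simp
        \<comment> \<open>For E = 0 the bound is the nonnegativity just shown; otherwise E
          cancels.\<close>
        ultimately have "E \<le> sqrt 3 * K * h + c"
          using E0(1) by (cases "E = 0") (auto simp: mult_le_cancel_right)
        then show ?thesis by (simp add: E_def n_def c_def)
      qed
      ultimately show ?thesis by blast
    qed
    ultimately show ?thesis using 2(2) by simp
  qed
qed

end
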